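(* Let $F$ be a finite extension of $\mathbb{Q}_2$ and $W_F$ its Weil group. Let $\rho_1$ be an irreducible, primitive, two-dimensional continuous representation of $W_F$, and $\rho_2$ an irreducible three-dimensional continuous representation of $W_F$ with $\rho_2\cong\mathrm{Ind}_{L/F}(\theta)$ for a noncyclic cubic extension $L/F$ and a quasicharacter $\theta$ of $W_L$, and with $\rho_2\not\cong\chi\otimes\rho_2$ for every unramified quasicharacter $\chi\ne1$ of $W_F$. Let $\rho=\rho_1\otimes\rho_2$. Then: (1) $\rho$ is reducible if and only if there is a quasicharacter $\chi$ of $W_F$ such that $\rho_2\cong\chi\otimes\mathrm{Ad}^0(\rho_1)$; (2) when this holds, $\rho\cong(\chi\otimes\rho_1)\oplus(\chi\otimes\rho_1\otimes\lambda)$, where $\lambda$ is the unique irreducible two-dimensional representation of $\mathrm{Gal}(K/F)\cong S_3$, $K$ being the normal closure of $L/F$.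
   Context: $\rho_1$ primitive means it is not induced from a quasicharacter of the Weil group of a quadratic extension. $\mathrm{Ad}^0$ is the adjoint action of $\mathrm{GL}_2(\mathbb{C})$ on the Lie algebra of $\mathrm{SL}_2(\mathbb{C})$, so that $\tau\otimes\check\tau=1\oplus\mathrm{Ad}^0(\tau)$ for a two-dimensional representation $\tau$. *)

theory Defs
  imports
    "HOL-Analysis.Analysis"
    "HOL-Algebra.Algebra"
    "HOL-Algebra.Algebraic_Closure_Type"
    "HOL-Computational_Algebra.Fraction_Field"
begin

unbundle no fps_syntax

section \<open>The field of 2-adic numbers and its algebraic closure\<close>

text \<open>The 2-adic integers are the inverse limit of the rings of integers modulo \<open>2 ^ n\<close>; the
  \<open>n\<close>-th component is stored as its least nonnegative representative.\<close>

typedef zadic2 =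
  "{f :: nat \<Rightarrow> int. (\<forall>n. f n mod 2 ^ n = f n) \<and> (\<forall>n. f (Suc n) mod 2 ^ n = f n)}"
  by (rule exI[of _ "\<lambda>_. 0"]) simp

setup_lifting type_definition_zadic2

lemma mod_pow2_Suc: "(a mod 2 ^ Suc n) mod 2 ^ n = a mod (2 ^ n :: int)"
  by (rule mod_mod_cancel) (simp add: le_imp_power_dvd)

instantiation zadic2 :: comm_ring_1
begin

lift_definition zero_zadic2 :: zadic2 is "\<lambda>_. 0" by simp

lift_definition one_zadic2 :: zadic2 is "\<lambda>n. 1 mod 2 ^ n"
  by (simp only: mod_pow2_Suc mod_mod_trivial simp_thms)

lift_definition plus_zadic2 :: "zadic2 \<Rightarrow> zadic2 \<Rightarrow> zadic2" is "\<lambda>f g n. (f n + g n) mod 2 ^ n"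
  by (simp only: mod_pow2_Suc mod_mod_trivial simp_thms) (metis mod_add_eq)

lift_definition minus_zadic2 :: "zadic2 \<Rightarrow> zadic2 \<Rightarrow> zadic2" is "\<lambda>f g n. (f n - g n) mod 2 ^ n"
  by (simp only: mod_pow2_Suc mod_mod_trivial simp_thms) (metis mod_diff_eq)

lift_definition uminus_zadic2 :: "zadic2 \<Rightarrow> zadic2" is "\<lambda>f n. (- f n) mod 2 ^ n"
  by (simp only: mod_pow2_Suc mod_mod_trivial simp_thms) (metis mod_minus_eq)

lift_definition times_zadic2 :: "zadic2 \<Rightarrow> zadic2 \<Rightarrow> zadic2" is "\<lambda>f g n. (f n * g n) mod 2 ^ n"
  by (simp only: mod_pow2_Suc mod_mod_trivial simp_thms) (metis mod_mult_eq)

instance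
proof
  fix a b c :: zadic2
  show "a * b * c = a * (b * c)"
    by transfer (simp add: mod_simps mult.assoc)
  show "a * b = b * a"
    by transfer (simp add: mult.commute)
  show "1 * a = a"
    by transfer (simp only: mod_mult_left_eq mult_1_left simp_thms)
  show "a + b + c = a + (b + c)"
    by transfer (simp add: mod_simps add.assoc)
  show "a + b = b + a"
    by transfer (simp add: add.commute)
  show "0 + a = a"
    by transfer simp
  show "- a + a = 0"
    by transfer (simp add: mod_simps)
  show "a - b = a + - b"
    by transfer (simp add: mod_simps)
  show "(a + b) * c = a * c + b * c"
    by transfer (simp add: mod_simps distrib_right)
  have "(\<lambda>_. 0) \<noteq> (\<lambda>n. 1 mod (2 :: int) ^ n)"
    by (auto simp: fun_eq_iff intro!: exI[of _ "1 :: nat"])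
  then show "(0 :: zadic2) \<noteq> 1"
    by transfer
qed

end

lemma zadic2_component_mod:
  assumes "\<And>n. f (Suc n) mod 2 ^ n = (f n :: int)"
  shows "f (n + k) mod 2 ^ n = f n mod 2 ^ n"
proof (induction k)
  case (Suc k)
  have "f (n + Suc k) mod 2 ^ n = f (Suc (n + k)) mod 2 ^ (n + k) mod 2 ^ n"
    by (simp add: mod_mod_cancel le_imp_power_dvd)
  with Suc show ?case
    by (simp add: assms)
qed simp

lemma pow2_dvd_mult_split:
  assumes "(2 :: int) ^ (m + n) dvd a * b"
  shows "2 ^ m dvd a \<or> 2 ^ n dvd b"
proof (cases "a = 0 \<or> b = 0")
  case False
  have "prime_elem (2 :: int)"
    by simp
  then have "multiplicity 2 (a * b) = multiplicity 2 a + multiplicity 2 b"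
    using False by (intro prime_elem_multiplicity_mult_distrib) auto
  moreover have "m + n \<le> multiplicity 2 (a * b)"
    using assms False by (subst (asm) power_dvd_iff_le_multiplicity) auto
  ultimately have "m \<le> multiplicity 2 a \<or> n \<le> multiplicity 2 b"
    by linarith
  then show ?thesis
    by (auto intro: multiplicity_dvd')
qed auto

instance zadic2 :: idom
proof
  fix a b :: zadic2
  assume "a \<noteq> 0" "b \<noteq> 0"
  then show "a * b \<noteq> 0"
  proof transfer
    fix f g :: "nat \<Rightarrow> int"
    assume f: "(\<forall>n. f n mod 2 ^ n = f n) \<and> (\<forall>n. f (Suc n) mod 2 ^ n = f n)"
      and g: "(\<forall>n. g n mod 2 ^ n = g n) \<and> (\<forall>n. g (Suc n) mod 2 ^ n = g n)"
      and "f \<noteq> (\<lambda>_. 0)" "g \<noteq> (\<lambda>_. 0)"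
    then obtain k m where km: "f k \<noteq> 0" "g m \<noteq> 0"
      by blast
    have "f (k + m) mod 2 ^ k = f k"
      using zadic2_component_mod[of f k m] f by simp
    moreover have "g (k + m) mod 2 ^ m = g m"
      using zadic2_component_mod[of g m k] g by (simp add: add.commute)
    ultimately have "\<not> 2 ^ k dvd f (k + m)" "\<not> 2 ^ m dvd g (k + m)"
      using km by (auto simp: dvd_eq_mod_eq_0)
    then have "(f (k + m) * g (k + m)) mod 2 ^ (k + m) \<noteq> 0"
      using pow2_dvd_mult_split by (auto simp: dvd_eq_mod_eq_0[symmetric])
    then show "(\<lambda>n. (f n * g n) mod 2 ^ n) \<noteq> (\<lambda>_. 0)"
      by (auto simp: fun_eq_iff)
  qed
qed

type_synonym qadic2 = "zadic2 fract"
type_synonym qbar = "qadic2 alg_closure"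

definition QBar :: "qbar ring" where
  "QBar = ring_of_type_algebra"

definition Q2 :: "qbar set" where
  "Q2 = range to_ac"

definition of_zadic2 :: "zadic2 \<Rightarrow> qbar" where
  "of_zadic2 z = to_ac (Fract z 1)"

section \<open>Extensions inside the algebraic closure\<close>

definition extension_of_degree :: "nat \<Rightarrow> qbar set \<Rightarrow> qbar set \<Rightarrow> bool" where
  "extension_of_degree n F E \<longleftrightarrow>
     subfield F QBar \<and> subfield E QBar \<and> F \<subseteq> E \<and> ring.dimension QBar n F E"

definition finite_extension :: "qbar set \<Rightarrow> qbar set \<Rightarrow> bool" where
  "finite_extension F E \<longleftrightarrow> (\<exists>n. extension_of_degree n F E)"

text \<open>Automorphisms of \<open>E\<close> over \<open>F\<close>; the functions are extensional on \<open>E\<close>, so that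
  \<open>galois_group UNIV F\<close> is the absolute Galois group of \<open>F\<close>.\<close>

definition galois_group :: "qbar set \<Rightarrow> qbar set \<Rightarrow> (qbar \<Rightarrow> qbar) monoid" where
  "galois_group E F =
     \<lparr>carrier = {\<sigma> \<in> extensional E. bij_betw \<sigma> E E \<and>
        (\<forall>x\<in>E. \<forall>y\<in>E. \<sigma> (x + y) = \<sigma> x + \<sigma> y \<and> \<sigma> (x * y) = \<sigma> x * \<sigma> y) \<and>
        (\<forall>x\<in>F. \<sigma> x = x)},
      mult = compose E,
      one = (\<lambda>x\<in>E. x)\<rparr>"

definition normal_extension :: "qbar set \<Rightarrow> qbar set \<Rightarrow> bool" where
  "normal_extension F E \<longleftrightarrow>
     subfield F QBar \<and> subfield E QBar \<and> F \<subseteq> E \<and>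
     (\<forall>\<sigma> \<in> carrier (galois_group UNIV F). \<sigma> ` E = E)"

definition normal_closure :: "qbar set \<Rightarrow> qbar set \<Rightarrow> qbar set" where
  "normal_closure F L = \<Inter>{M. normal_extension F M \<and> L \<subseteq> M}"

text \<open>In characteristic 0 a normal algebraic extension is Galois.\<close>

definition cyclic_extension :: "qbar set \<Rightarrow> qbar set \<Rightarrow> bool" where
  "cyclic_extension F E \<longleftrightarrow> normal_extension F E \<and> cyclic_group (galois_group E F)"

section \<open>The Weil group\<close>

text \<open>The valuation ring of the algebraic closure is the integral closure of the 2-adic integers.\<close>

definition integers :: "qbar set" where
  "integers = {x. \<exists>p :: zadic2 poly.
     Polynomial.lead_coeff p = 1 \<and> poly (map_poly of_zadic2 p) x = 0}"

definition max_ideal :: "qbar set" where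
  "max_ideal = {x \<in> integers. \<not> (\<exists>y\<in>integers. x * y = 1)}"

definition residue_card :: "qbar set \<Rightarrow> nat" where
  "residue_card F =
     card ((integers \<inter> F) // {(x, y). x \<in> integers \<inter> F \<and> y \<in> integers \<inter> F \<and> x - y \<in> max_ideal})"

definition inertia :: "qbar set \<Rightarrow> (qbar \<Rightarrow> qbar) set" where
  "inertia F =
     {\<sigma> \<in> carrier (galois_group UNIV F). \<forall>x\<in>integers. \<sigma> x - x \<in> max_ideal}"

text \<open>The Weil group consists of the \<open>\<sigma>\<close> acting on the residue field of the algebraic closure as
  the \<open>n\<close>-th power (first alternative) or the \<open>-n\<close>-th power (second alternative) of the Frobenius
  \<open>x \<mapsto> x ^ q\<close>, for some natural number \<open>n\<close>.\<close>

definition weil_group :: "qbar set \<Rightarrow> (qbar \<Rightarrow> qbar) monoid" where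
  "weil_group F = (galois_group UNIV F)
     \<lparr>carrier := {\<sigma> \<in> carrier (galois_group UNIV F). \<exists>n.
        (\<forall>x\<in>integers. \<sigma> x - x ^ (residue_card F ^ n) \<in> max_ideal) \<or>
        (\<forall>x\<in>integers. \<sigma> x ^ (residue_card F ^ n) - x \<in> max_ideal)}\<rparr>"

text \<open>The inertia group, with its Krull topology, is an open subgroup of the Weil group: the cosets
  of the subgroups of inertia fixing a finite extension of \<open>F\<close> form a basis.\<close>

definition weil_topology :: "qbar set \<Rightarrow> (qbar \<Rightarrow> qbar) topology" where
  "weil_topology F = topology_generated_by
     {U. \<exists>\<sigma> E. \<sigma> \<in> carrier (weil_group F) \<and> finite_extension F E \<and>
        U = {\<sigma> \<otimes>\<^bsub>weil_group F\<^esub> \<tau> | \<tau>. \<tau> \<in> inertia F \<and> (\<forall>x\<in>E. \<tau> x = x)}}"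

section \<open>Representations\<close>

definition GL :: "(complex ^ 'n ^ 'n) monoid" where
  "GL = \<lparr>carrier = {A. invertible A}, mult = (**), one = mat 1\<rparr>"

definition irreducible_rep :: "'g monoid \<Rightarrow> ('g \<Rightarrow> complex ^ 'n ^ 'n) \<Rightarrow> bool" where
  "irreducible_rep G \<rho> \<longleftrightarrow> \<rho> \<in> hom G GL \<and>
     (\<forall>S. vec.subspace S \<and> (\<forall>g \<in> carrier G. \<forall>v \<in> S. \<rho> g *v v \<in> S) \<longrightarrow> S = {0} \<or> S = UNIV)"

text \<open>A representation on the nonzero space \<open>complex ^ 'n\<close> is reducible if it is not irreducible.\<close>

definition reducible_rep :: "'g monoid \<Rightarrow> ('g \<Rightarrow> complex ^ 'n ^ 'n) \<Rightarrow> bool" where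
  "reducible_rep G \<rho> \<longleftrightarrow> \<rho> \<in> hom G GL \<and> \<not> irreducible_rep G \<rho>"

definition rep_iso ::
    "'g monoid \<Rightarrow> ('g \<Rightarrow> complex ^ 'm ^ 'm) \<Rightarrow> ('g \<Rightarrow> complex ^ 'n ^ 'n) \<Rightarrow> bool" where
  "rep_iso G \<rho> \<rho>' \<longleftrightarrow>
     (\<exists>(P :: complex ^ 'm ^ 'n) (Q :: complex ^ 'n ^ 'm). P ** Q = mat 1 \<and> Q ** P = mat 1 \<and>
        (\<forall>g \<in> carrier G. P ** \<rho> g = \<rho>' g ** P))"

definition twist :: "('g \<Rightarrow> complex) \<Rightarrow> ('g \<Rightarrow> complex ^ 'n ^ 'n) \<Rightarrow> 'g \<Rightarrow> complex ^ 'n ^ 'n" where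
  "twist \<eta> \<rho> g = (\<chi> i j. \<eta> g * \<rho> g $ i $ j)"

definition tensor_rep ::
    "('g \<Rightarrow> complex ^ 'm ^ 'm) \<Rightarrow> ('g \<Rightarrow> complex ^ 'n ^ 'n) \<Rightarrow> 'g \<Rightarrow> complex ^ ('m \<times> 'n) ^ ('m \<times> 'n)" where
  "tensor_rep \<rho> \<rho>' g = (\<chi> i j. \<rho> g $ fst i $ fst j * \<rho>' g $ snd i $ snd j)"

definition sum_rep ::
    "('g \<Rightarrow> complex ^ 'm ^ 'm) \<Rightarrow> ('g \<Rightarrow> complex ^ 'n ^ 'n) \<Rightarrow> 'g \<Rightarrow> complex ^ ('m + 'n) ^ ('m + 'n)" where
  "sum_rep \<rho> \<rho>' g = (\<chi> i j. case (i, j) of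
       (Inl a, Inl b) \<Rightarrow> \<rho> g $ a $ b
     | (Inr a, Inr b) \<Rightarrow> \<rho>' g $ a $ b
     | _ \<Rightarrow> 0)"

text \<open>Coordinates on the Lie algebra of \<open>SL\<^sub>2\<close>, the traceless matrices.\<close>

definition sl2_matrix :: "complex ^ 3 \<Rightarrow> complex ^ 2 ^ 2" where
  "sl2_matrix v = vector [vector [v $ 1, v $ 2], vector [v $ 3, - v $ 1]]"

definition sl2_coords :: "complex ^ 2 ^ 2 \<Rightarrow> complex ^ 3" where
  "sl2_coords A = vector [A $ 1 $ 1, A $ 1 $ 2, A $ 2 $ 1]"

lemma trace_sl2_matrix: "trace (sl2_matrix v) = 0"
  by (simp add: trace_def sl2_matrix_def sum_2)

lemma sl2_coords_matrix: "sl2_coords (sl2_matrix v) = v"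
  by (simp add: vec_eq_iff forall_3 sl2_coords_def sl2_matrix_def)

lemma sl2_matrix_coords: "trace A = 0 \<Longrightarrow> sl2_matrix (sl2_coords A) = A"
  by (simp add: vec_eq_iff forall_2 sl2_coords_def sl2_matrix_def trace_def sum_2
      add_eq_0_iff)

definition Ad0 :: "('g \<Rightarrow> complex ^ 2 ^ 2) \<Rightarrow> 'g \<Rightarrow> complex ^ 3 ^ 3" where
  "Ad0 \<rho> g = matrix (\<lambda>v. sl2_coords (\<rho> g ** sl2_matrix v ** matrix_inv (\<rho> g)))"

text \<open>The space of the representation of \<open>G\<close> induced from the character \<open>\<theta>\<close> of the subgroup \<open>H\<close>;
  \<open>G\<close> acts by right translation. Functions vanish outside \<open>G\<close>. No smoothness condition
  is imposed: when \<open>H\<close> is open in \<open>G\<close> and \<open>\<theta>\<close> is continuous, it holds automatically.\<close>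

definition induced_space :: "'g monoid \<Rightarrow> 'g monoid \<Rightarrow> ('g \<Rightarrow> complex) \<Rightarrow> ('g \<Rightarrow> complex) set" where
  "induced_space G H \<theta> = {f. (\<forall>g. g \<notin> carrier G \<longrightarrow> f g = 0) \<and>
     (\<forall>h \<in> carrier H. \<forall>g \<in> carrier G. f (h \<otimes>\<^bsub>G\<^esub> g) = \<theta> h * f g)}"

definition iso_to_induced ::
    "'g monoid \<Rightarrow> 'g monoid \<Rightarrow> ('g \<Rightarrow> complex) \<Rightarrow> ('g \<Rightarrow> complex ^ 'n ^ 'n) \<Rightarrow> bool" where
  "iso_to_induced G H \<theta> \<rho> \<longleftrightarrow>
     (\<exists>T :: complex ^ 'n \<Rightarrow> 'g \<Rightarrow> complex.
        bij_betw T UNIV (induced_space G H \<theta>) \<and>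
        (\<forall>v w g. T (v + w) g = T v g + T w g) \<and>
        (\<forall>c v g. T (c *s v) g = c * T v g) \<and>
        (\<forall>s \<in> carrier G. \<forall>v. \<forall>g \<in> carrier G. T (\<rho> s *v v) g = T v (g \<otimes>\<^bsub>G\<^esub> s)))"

section \<open>Representations of the Weil group\<close>

definition weil_rep :: "qbar set \<Rightarrow> ((qbar \<Rightarrow> qbar) \<Rightarrow> complex ^ 'n ^ 'n) \<Rightarrow> bool" where
  "weil_rep F \<rho> \<longleftrightarrow>
     \<rho> \<in> hom (weil_group F) GL \<and> continuous_map (weil_topology F) euclidean \<rho>"

definition quasicharacter :: "qbar set \<Rightarrow> ((qbar \<Rightarrow> qbar) \<Rightarrow> complex) \<Rightarrow> bool" where
  "quasicharacter F \<eta> \<longleftrightarrow>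
     \<eta> \<in> hom (weil_group F) (units_of ring_of_type_algebra) \<and>
     continuous_map (weil_topology F) euclidean \<eta>"

definition unramified :: "qbar set \<Rightarrow> ((qbar \<Rightarrow> qbar) \<Rightarrow> complex) \<Rightarrow> bool" where
  "unramified F \<eta> \<longleftrightarrow> (\<forall>\<sigma> \<in> inertia F. \<eta> \<sigma> = 1)"

definition primitive_rep :: "qbar set \<Rightarrow> ((qbar \<Rightarrow> qbar) \<Rightarrow> complex ^ 2 ^ 2) \<Rightarrow> bool" where
  "primitive_rep F \<rho> \<longleftrightarrow>
     \<not> (\<exists>E \<theta>. extension_of_degree 2 F E \<and> quasicharacter E \<theta> \<and>
            iso_to_induced (weil_group F) (weil_group E) \<theta> \<rho>)"

text \<open>A representation of \<open>galois_group K F\<close>, for \<open>K\<close> normal over \<open>F\<close>, viewed as one of the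
  Weil group of \<open>F\<close>.\<close>

definition inflate ::
    "qbar set \<Rightarrow> ((qbar \<Rightarrow> qbar) \<Rightarrow> complex ^ 'n ^ 'n) \<Rightarrow> (qbar \<Rightarrow> qbar) \<Rightarrow> complex ^ 'n ^ 'n" where
  "inflate K \<phi> \<sigma> = \<phi> (restrict \<sigma> K)"

end

theory Submission
  imports Defs "HOL-Number_Theory.Cong"
begin

text \<open>Let \<open>\<alpha>\<close> generate \<open>L\<close> over \<open>F\<close>. The Weil group acts on the three conjugates of \<open>\<alpha>\<close>, and
  \<open>\<rho>2\<close> is monomial over this action. Since \<open>\<rho>1\<close> is primitive, it stays irreducible on the elements acting
  by even permutations (Clifford theory for the quadratic extension generated by the square root of the
  discriminant), and then also on those fixing all conjugates. A proper stable
  subspace \<open>Y\<close> of \<open>\<rho>1 \<otimes> \<rho>2\<close> therefore projects isomorphically or trivially to each of three copies of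
  \<open>\<rho>1\<close>; up to passing to a quotient, \<open>Y\<close> is two-dimensional and \<open>\<rho>2\<close> embeds into \<open>Hom(\<rho>1, Y)\<close>. The
  determinant is a quadratic form on this space that is invariant up to scalars, so the complement of
  \<open>\<rho>2\<close> is a stable line. It identifies \<open>Y\<close> with a twist of \<open>\<rho>1\<close> and \<open>\<rho>2\<close> with the
  corresponding twist of \<open>Ad0 \<rho>1\<close>.

  Conversely, if \<open>\<rho>2\<close> is a twist of \<open>Ad0 \<rho>1\<close>, then the lines of \<open>\<rho>2\<close> are spanned by traceless
  matrices \<open>a i\<close> that conjugation by \<open>\<rho>1\<close> permutes up to scalars, and \<open>v \<otimes> a i \<mapsto> (a i v) \<otimes> e i\<close>
  turns \<open>\<rho>1 \<otimes> Ad0 \<rho>1\<close> into \<open>\<rho>1\<close> tensored with the permutation representation of the symmetric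
  group, which is \<open>1 \<oplus> \<lambda>\<close>.\<close>

section \<open>Integral elements over the 2-adic integers\<close>

text \<open>The Weil group is defined by its action on the residue field of the algebraic closure,
  so the integral closure of the 2-adic integers must first be shown to be a local ring. No
  valuation is at hand; non-units are recognized instead as the elements that are nilpotent modulo
  2. The consequence that matters is that the Weil group of an intermediate field \<open>E\<close>
  is exactly the subgroup of the Weil group of \<open>F\<close> fixing \<open>E\<close> pointwise.
  This is what allows cosets of the Weil group of \<open>L\<close> to be read as conjugates of
  \<alpha>. On the side of representations the stable subspace \<open>Y\<close> has dimension two or
  four. In dimension four the quotient is a plane and \<rho>2 maps to Hom from \<rho>1 to it
  directly. In dimension two, contraction with functionals produces the dual of \<rho>2 instead, and
  the self-duality of \<open>Ad0\<close> leads back to \<rho>2. In both cases the twisting factor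
  appears as a bare function; a trace formula through \<rho>1 and \<rho>2 shows that it is
  continuous.\<close>

lemma Rep_zadic2_2 [simp]: "Rep_zadic2 2 n = 2 mod 2 ^ n"
proof -
  have "Rep_zadic2 2 n = (1 mod 2 ^ n + 1 mod 2 ^ n) mod 2 ^ n"
    unfolding one_add_one[symmetric] plus_zadic2.rep_eq one_zadic2.rep_eq ..
  then show ?thesis by (simp add: mod_simps)
qed

text \<open>The ring is local with uniformizer 2, and component 1 decides. An odd \<open>z\<close>
  is invertible in every component, and uniqueness of inverses modulo \<open>2 ^ n\<close> makes
  them compatible.\<close>

lemma zadic2_even_cases:
  fixes z :: zadic2
  shows "2 dvd z \<or> z dvd 1"
proof (cases "Rep_zadic2 z 1 = 0")
  case True
  then have "\<exists>w. z = 2 * w"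
  proof (transfer, unfold one_add_one[symmetric], transfer)
    fix z :: "nat \<Rightarrow> int"
    assume z: "(\<forall>n. z n mod 2 ^ n = z n) \<and> (\<forall>n. z (Suc n) mod 2 ^ n = z n)" and z1: "z 1 = 0"
    have even: "even (z (Suc n))" for n
      using zadic2_component_mod[of z 1 n] z z1 by (auto simp: dvd_eq_mod_eq_0)
    \<comment> \<open>Halving costs one binary digit, so component \<open>n\<close> of the quotient
      is read off component \<open>Suc n\<close>.\<close>
    define w where "w n = z (Suc n) div 2" for n
    have w2: "z (Suc n) = 2 * w n" for n
      using even[of n] by (simp add: w_def)
    have "w n mod 2 ^ n = w n" for n
      using z[THEN conjunct1, rule_format, of "Suc n"] w2[of n] by simp
    moreover have "w (Suc n) mod 2 ^ n = w n" for n
      using z[THEN conjunct2, rule_format, of "Suc n"] w2[of n] w2[of "Suc n"] by simp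
    moreover have "z n = (((1 mod 2 ^ n + 1 mod 2 ^ n) mod 2 ^ n) * w n) mod 2 ^ n" for n
    proof -
      have "z n = (2 * w n) mod 2 ^ n"
        using z w2[of n] by metis
      then show ?thesis by (simp only: mod_simps one_add_one)
    qed
    ultimately show "\<exists>w\<in>{f. (\<forall>n. f n mod 2 ^ n = f n) \<and> (\<forall>n. f (Suc n) mod 2 ^ n = f n)}.
       z = (\<lambda>n. (((1 mod 2 ^ n + 1 mod 2 ^ n) mod 2 ^ n) * w n) mod 2 ^ n)"
      by (intro bexI[of _ w]) auto
  qed
  then show ?thesis by auto
next
  case False
  then have "\<exists>w. z * w = 1"
  proof transfer
    fix z :: "nat \<Rightarrow> int"
    assume z: "(\<forall>n. z n mod 2 ^ n = z n) \<and> (\<forall>n. z (Suc n) mod 2 ^ n = z n)" and z1: "z 1 \<noteq> 0"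
    have "z 1 mod 2 = z 1"
      using z[THEN conjunct1, rule_format, of 1] by simp
    then have "odd (z 1)"
      using z1 by (metis even_iff_mod_2_eq_zero)
    then have odd: "odd (z (Suc n))" for n
      using zadic2_component_mod[of z 1 n] z by (auto simp: dvd_eq_mod_eq_0)
    have copr: "coprime (z n) (2 ^ n)" for n
      by (cases n) (use odd in auto)
    have ex: "\<exists>u. (z n * u) mod 2 ^ n = 1 mod 2 ^ n" for n
      using cong_solve_coprime_int[OF copr[of n]] unfolding cong_def .
    then obtain u where u: "\<And>n. (z n * u n) mod 2 ^ n = 1 mod 2 ^ n"
      by metis
    define w where "w n = u n mod 2 ^ n" for n
    have w: "(z n * w n) mod 2 ^ n = 1 mod 2 ^ n" for n
      using u[of n] by (simp add: w_def mod_simps)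
    have "w (Suc n) mod 2 ^ n = w n" for n
    proof -
      have "(z n * w (Suc n)) mod 2 ^ n = ((z (Suc n) mod 2 ^ n) * w (Suc n)) mod 2 ^ n"
        using z by simp
      also have "\<dots> = (z (Suc n) * w (Suc n)) mod 2 ^ Suc n mod 2 ^ n"
        by (simp only: mod_pow2_Suc mod_mult_left_eq)
      also have "\<dots> = (z n * w n) mod 2 ^ n"
        by (simp only: w mod_pow2_Suc)
      finally have "[z n * w (Suc n) = z n * w n] (mod 2 ^ n)"
        by (simp add: cong_def)
      then have "[w (Suc n) = w n] (mod 2 ^ n)"
        using copr[of n] by (simp add: cong_mult_lcancel)
      then show ?thesis
        by (simp add: cong_def w_def)
    qed
    moreover have "w n mod 2 ^ n = w n" for n
      by (simp add: w_def)
    ultimately show "\<exists>w\<in>{f. (\<forall>n. f n mod 2 ^ n = f n) \<and> (\<forall>n. f (Suc n) mod 2 ^ n = f n)}.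
       (\<lambda>n. (z n * w n) mod 2 ^ n) = (\<lambda>n. 1 mod 2 ^ n)"
      using w by (intro bexI[of _ w]) auto
  qed
  then show ?thesis by (metis dvd_triv_left)
qed

lemma two_not_dvd_one_zadic2: "\<not> (2 :: zadic2) dvd 1"
proof
  assume "(2 :: zadic2) dvd 1"
  then obtain w :: zadic2 where "1 = 2 * w" by auto
  then have "Rep_zadic2 1 1 = Rep_zadic2 (2 * w) 1" by simp
  then show False
    by (simp add: one_zadic2.rep_eq times_zadic2.rep_eq)
qed

text \<open>Induction on the index of a nonzero component: halving an even element lowers that index
  by one, and component 0 is always 0, so the process stops at a unit.\<close>

lemma zadic2_two_power_unit:
  fixes z :: zadic2
  assumes "z \<noteq> 0"
  obtains k w where "z = 2 ^ k * w" "w dvd 1"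
proof -
  obtain n where n: "Rep_zadic2 z n \<noteq> 0"
    using assms by transfer auto
  then have "\<exists>k w. z = 2 ^ k * w \<and> w dvd 1"
  proof (induction n arbitrary: z)
    case 0
    have "Rep_zadic2 z 0 mod 2 ^ 0 = Rep_zadic2 z 0"
      using Rep_zadic2[of z] by blast
    with 0 show ?case by simp
  next
    case (Suc n)
    show ?case
    proof (cases "2 dvd z")
      case True
      then obtain w where w: "z = 2 * w" by auto
      have "Rep_zadic2 w n \<noteq> 0"
      proof
        assume *: "Rep_zadic2 w n = 0"
        have "Rep_zadic2 w (Suc n) mod 2 ^ n = Rep_zadic2 w n"
          using Rep_zadic2[of w] by auto
        with * have "2 ^ n dvd Rep_zadic2 w (Suc n)"
          by (simp add: dvd_eq_mod_eq_0)
        then have "2 ^ Suc n dvd 2 * Rep_zadic2 w (Suc n)"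
          by simp
        then have "Rep_zadic2 z (Suc n) = 0"
          unfolding w by (simp add: times_zadic2.rep_eq mod_simps)
        with Suc.prems show False by simp
      qed
      then obtain k v where kv: "w = 2 ^ k * v" "v dvd 1"
        using Suc.IH by blast
      then show ?thesis
        by (intro exI[of _ "Suc k"] exI[of _ v]) (auto simp: w)
    next
      case False
      then have "z dvd 1" using zadic2_even_cases by blast
      then show ?thesis
        by (intro exI[of _ 0] exI[of _ z]) auto
    qed
  qed
  then show ?thesis using that by blast
qed

text \<open>The sum of the convergent series with terms \<open>2 ^ j * d j\<close>: modulo
  \<open>2 ^ n\<close> only the terms with \<open>j < n\<close> survive, so every component is a
  finite sum. Completeness is used in this form.\<close>

lift_definition zadic2_series :: "(nat \<Rightarrow> zadic2) \<Rightarrow> zadic2"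
  is "\<lambda>d n. (\<Sum>j<n. 2 ^ j * d j n) mod 2 ^ n"
proof -
  fix d :: "nat \<Rightarrow> nat \<Rightarrow> int"
  assume d: "\<And>j. (\<forall>n. d j n mod 2 ^ n = d j n) \<and> (\<forall>n. d j (Suc n) mod 2 ^ n = d j n)"
  have "(\<Sum>j<Suc n. 2 ^ j * d j (Suc n)) mod 2 ^ n = (\<Sum>j<n. 2 ^ j * d j n) mod 2 ^ n" for n
  proof -
    have "(\<Sum>j<n. 2 ^ j * d j (Suc n)) mod 2 ^ n = (\<Sum>j<n. (2 ^ j * (d j (Suc n) mod 2 ^ n)) mod 2 ^ n) mod 2 ^ n"
      by (simp add: mod_simps mod_sum_eq)
    also have "\<dots> = (\<Sum>j<n. 2 ^ j * d j n) mod 2 ^ n"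
      using d by (simp add: mod_sum_eq)
    finally show ?thesis
      by (simp add: mod_simps)
  qed
  then show "(\<forall>n. (\<Sum>j<n. 2 ^ j * d j n) mod 2 ^ n mod 2 ^ n = (\<Sum>j<n. 2 ^ j * d j n) mod 2 ^ n) \<and>
    (\<forall>n. (\<Sum>j<Suc n. 2 ^ j * d j (Suc n)) mod 2 ^ Suc n mod 2 ^ n = (\<Sum>j<n. 2 ^ j * d j n) mod 2 ^ n)"
    by (simp only: mod_pow2_Suc mod_mod_trivial simp_thms)
qed

lemma zadic2_series_unfold: "zadic2_series d = d 0 + 2 * zadic2_series (\<lambda>j. d (Suc j))"
proof (unfold one_add_one[symmetric], transfer, rule ext)
  fix d :: "nat \<Rightarrow> nat \<Rightarrow> int" and n
  have "(d 0 n + 2 * (\<Sum>j<n. 2 ^ j * d (Suc j) n)) = (\<Sum>j<Suc n. 2 ^ j * d j n)"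
    by (subst sum.lessThan_Suc_shift) (simp add: sum_distrib_left mult.assoc)
  then have "(d 0 n + 2 * (\<Sum>j<n. 2 ^ j * d (Suc j) n)) mod 2 ^ n = (\<Sum>j<n. 2 ^ j * d j n) mod 2 ^ n"
    by (simp add: mod_simps)
  then show "(\<Sum>j<n. 2 ^ j * d j n) mod 2 ^ n =
    (d 0 n + (1 mod 2 ^ n + 1 mod 2 ^ n) mod 2 ^ n * ((\<Sum>j<n. 2 ^ j * d (Suc j) n) mod 2 ^ n) mod 2 ^ n) mod 2 ^ n"
    by (simp add: mod_simps)
qed

lemma zadic2_series_tail:
  "zadic2_series d = (\<Sum>j<k. 2 ^ j * d j) + 2 ^ k * zadic2_series (\<lambda>j. d (j + k))"
proof (induction k arbitrary: d)
  case (Suc k)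
  have "zadic2_series d = d 0 + 2 * zadic2_series (\<lambda>j. d (Suc j))"
    by (rule zadic2_series_unfold)
  also have "\<dots> = d 0 + 2 * ((\<Sum>j<k. 2 ^ j * d (Suc j)) + 2 ^ k * zadic2_series (\<lambda>j. d (Suc (j + k))))"
    by (subst Suc.IH) simp
  also have "\<dots> = (\<Sum>j<Suc k. 2 ^ j * d j) + 2 ^ Suc k * zadic2_series (\<lambda>j. d (j + Suc k))"
    by (subst sum.lessThan_Suc_shift) (simp add: sum_distrib_left algebra_simps)
  finally show ?case .
qed simp

lemma of_zadic2_simps [simp]:
  "of_zadic2 0 = 0" "of_zadic2 1 = 1"
  "of_zadic2 (a + b) = of_zadic2 a + of_zadic2 b"
  "of_zadic2 (a * b) = of_zadic2 a * of_zadic2 b"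
  "of_zadic2 (- a) = - of_zadic2 a"
  "of_zadic2 (a - b) = of_zadic2 a - of_zadic2 b"
  by (simp_all add: of_zadic2_def flip: Zero_fract_def One_fract_def to_ac_add to_ac_mult to_ac_minus to_ac_diff)

lemma of_zadic2_power [simp]: "of_zadic2 (a ^ n) = of_zadic2 a ^ n"
  by (induction n) auto

lemma of_zadic2_2 [simp]: "of_zadic2 2 = 2"
  unfolding one_add_one[symmetric] of_zadic2_simps ..

lemma of_zadic2_sum: "of_zadic2 (sum f A) = (\<Sum>x\<in>A. of_zadic2 (f x))"
  by (induction A rule: infinite_finite_induct) auto

lemma of_zadic2_eq_iff [simp]: "of_zadic2 a = of_zadic2 b \<longleftrightarrow> a = b"
  by (simp add: of_zadic2_def eq_fract)

lemma of_zadic2_eq_0_iff [simp]: "of_zadic2 a = 0 \<longleftrightarrow> a = 0"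
  using of_zadic2_eq_iff[of a 0] by simp

text \<open>Characteristic 0 passes to the fraction field and its closure, where it makes minimal
  polynomials separable.\<close>

instance zadic2 :: ring_char_0
proof
  have *: "of_nat n \<noteq> (0 :: zadic2)" if "n > 0" for n
  proof -
    have "Rep_zadic2 (of_nat n) k = int n mod 2 ^ k" for n k
      by (induction n) (simp_all add: zero_zadic2.rep_eq one_zadic2.rep_eq plus_zadic2.rep_eq mod_simps)
    \<comment> \<open>Component \<open>n\<close> of \<open>of_nat n\<close> is \<open>n\<close>
      itself because \<open>n < 2 ^ n\<close>.\<close>
    then have "Rep_zadic2 (of_nat n) n = int n mod 2 ^ n" .
    also have "\<dots> = int n"
      by (simp add: mod_pos_pos_trivial of_nat_less_two_power)
    finally show ?thesis
      using that by (auto simp: zero_zadic2.rep_eq)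
  qed
  show "inj (of_nat :: nat \<Rightarrow> zadic2)"
  proof (rule injI)
    fix m n assume "of_nat m = (of_nat n :: zadic2)"
    then show "m = n"
      using *[of "m - n"] *[of "n - m"] by (cases m n rule: linorder_cases) (auto simp: of_nat_diff)
  qed
qed

instance fract :: ("{idom, ring_char_0}") field_char_0
proof
  show "inj (of_nat :: nat \<Rightarrow> 'a fract)"
    by (auto intro!: injI simp: of_nat_fract eq_fract)
qed

text \<open>Integrality is tested through finitely generated submodules over the 2-adic integers;
  the interpretation supplies \<open>span\<close> and \<open>subspace\<close> for them.\<close>

interpretation Z2: Modules.module "\<lambda>(c :: zadic2) (x :: qbar). of_zadic2 c * x"
  by standard (auto simp: algebra_simps)

lemma Z2_span_image_lessThan:
  "Z2.span (v ` {..<n :: nat}) = range (\<lambda>c. \<Sum>i<n. of_zadic2 (c i) * v i)"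
proof (induction n)
  case (Suc n)
  have "x \<in> Z2.span (v ` {..<Suc n}) \<longleftrightarrow> (\<exists>c. x = (\<Sum>i<Suc n. of_zadic2 (c i) * v i))" for x
  proof
    assume "x \<in> Z2.span (v ` {..<Suc n})"
    then obtain k c where "x - of_zadic2 k * v n = (\<Sum>i<n. of_zadic2 (c i) * v i)"
      by (auto simp: lessThan_Suc Z2.span_insert Suc.IH)
    then have "x = (\<Sum>i<Suc n. of_zadic2 ((c(n := k)) i) * v i)"
      by (simp add: algebra_simps)
    then show "\<exists>c. x = (\<Sum>i<Suc n. of_zadic2 (c i) * v i)" by blast
  next
    assume "\<exists>c. x = (\<Sum>i<Suc n. of_zadic2 (c i) * v i)"
    then show "x \<in> Z2.span (v ` {..<Suc n})"
      by (auto intro!: Z2.span_add[OF Z2.span_sum] Z2.span_scale intro: Z2.span_base)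
  qed
  then show ?case by auto
qed auto

text \<open>Every nonzero element is a power of 2 times a unit, so the least power of 2 that ever
  occurs divides all elements of the chain. Once it has entered, nothing new can appear.\<close>

lemma zadic2_chain_stabilizes:
  fixes I :: "nat \<Rightarrow> zadic2 set"
  assumes ideal: "\<And>k a b. a \<in> I k \<Longrightarrow> a * b \<in> I k" and mono: "\<And>k. I k \<subseteq> I (Suc k)"
  shows "\<exists>K. \<forall>k\<ge>K. I k = I K"
proof (cases "\<exists>k a. a \<in> I k \<and> a \<noteq> 0")
  case True
  have up: "2 ^ m \<in> I k" if "a \<in> I k" "a = 2 ^ m * w" "w dvd 1" for a k m w
  proof -
    obtain v where "1 = w * v" using \<open>w dvd 1\<close> by auto
    then have "2 ^ m = a * v" using that by (simp add: mult.assoc)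
    then show ?thesis using ideal that by metis
  qed
  have "\<exists>m k. 2 ^ m \<in> I k"
    using True up by (metis zadic2_two_power_unit)
  define m where "m = (LEAST m. \<exists>k. 2 ^ m \<in> I k)"
  obtain K where K: "2 ^ m \<in> I K"
    using LeastI_ex[OF \<open>\<exists>m k. 2 ^ m \<in> I k\<close>] unfolding m_def by blast
  have "I k \<subseteq> I K" for k
  proof
    fix a assume a: "a \<in> I k"
    show "a \<in> I K"
    proof (cases "a = 0")
      case True then show ?thesis using ideal[OF K, of 0] by simp
    next
      case False
      then obtain n w where nw: "a = 2 ^ n * w" "w dvd 1" by (rule zadic2_two_power_unit)
      then have "m \<le> n" using up[OF a] unfolding m_def by (intro Least_le) blast
      then have "a = 2 ^ m * (2 ^ (n - m) * w)"
        using nw by (simp flip: power_add mult.assoc)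
      then show ?thesis using ideal[OF K] by metis
    qed
  qed
  moreover have "I K \<subseteq> I k" if "k \<ge> K" for k
    using lift_Suc_mono_le[of I, OF mono that] .
  ultimately show ?thesis by blast
next
  case False
  then have z: "I k \<subseteq> {0}" for k by auto
  \<comment> \<open>Closure under multiples does not put 0 into \<open>I k\<close>, so an initial
    stretch of empty sets has to be allowed for.\<close>
  show ?thesis
  proof (cases "\<exists>K. 0 \<in> I K")
    case True
    then obtain K where "0 \<in> I K" by blast
    then have "0 \<in> I k" if "k \<ge> K" for k
      using lift_Suc_mono_le[of I, OF mono that] by auto
    then show ?thesis using z by (metis order_refl subset_singletonD empty_iff)
  next
    case False
    then show ?thesis using z by (metis subset_singletonD singletonI)
  qed
qed

text \<open>Noetherianity, by induction on the generators: a submodule is controlled by its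
  intersection with the span of the remaining generators and by the ideal of coefficients that its
  elements have at \<open>v\<close>. Both chains stabilize.\<close>

lemma Z2_chain_stabilizes:
  fixes N :: "nat \<Rightarrow> qbar set"
  assumes "finite S"
  assumes "\<And>k. Z2.subspace (N k)" "\<And>k. N k \<subseteq> N (Suc k)" "\<And>k. N k \<subseteq> Z2.span S"
  shows "\<exists>K. \<forall>k\<ge>K. N k = N K"
  using assms
proof (induction S arbitrary: N rule: finite_induct)
  case empty
  then have "N k = {0}" for k
    using Z2.subspace_0[OF empty(1)[of k]] empty(3)[of k] unfolding Z2.span_empty by blast
  then show ?case by simp
next
  case (insert v S)
  note mono = lift_Suc_mono_le[of N, OF insert.prems(2)]
  have "\<exists>K. \<forall>k\<ge>K. N k \<inter> Z2.span S = N K \<inter> Z2.span S"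
    using insert.prems by (intro insert.IH) (auto intro: Z2.subspace_inter)
  then obtain K1 where K1: "\<And>k. k \<ge> K1 \<Longrightarrow> N k \<inter> Z2.span S = N K1 \<inter> Z2.span S" by blast
  define I where "I k = {c. \<exists>x\<in>N k. x - of_zadic2 c * v \<in> Z2.span S}" for k
  have "\<exists>K. \<forall>k\<ge>K. I k = I K"
  proof (rule zadic2_chain_stabilizes)
    fix k a b assume "a \<in> I k"
    then obtain x where x: "x \<in> N k" "x - of_zadic2 a * v \<in> Z2.span S" unfolding I_def by blast
    have "of_zadic2 b * x - of_zadic2 (a * b) * v = of_zadic2 b * (x - of_zadic2 a * v)"
      by (simp add: algebra_simps)
    then have "of_zadic2 b * x - of_zadic2 (a * b) * v \<in> Z2.span S"
      using Z2.span_scale[OF x(2), of b] by simp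
    then show "a * b \<in> I k"
      using Z2.subspace_scale[OF insert.prems(1) x(1), of b] unfolding I_def by blast
  next
    show "I k \<subseteq> I (Suc k)" for k
      using insert.prems(2)[of k] unfolding I_def by blast
  qed
  then obtain K2 where K2: "\<And>k. k \<ge> K2 \<Longrightarrow> I k = I K2" by blast
  define K where "K = max K1 K2"
  have "N k \<subseteq> N K" if "k \<ge> K" for k
  proof
    fix x assume x: "x \<in> N k"
    then obtain c where c: "x - of_zadic2 c * v \<in> Z2.span S"
      using insert.prems(3)[of k] by (auto simp: Z2.span_insert)
    then have "c \<in> I k" using x unfolding I_def by blast
    then have "c \<in> I K" using K2[of k] K2[of K] that by (auto simp: K_def)
    then obtain y where y: "y \<in> N K" "y - of_zadic2 c * v \<in> Z2.span S" unfolding I_def by blast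
    \<comment> \<open>\<open>x\<close> and \<open>y\<close> share a coefficient at \<open>v\<close>,
      so their difference falls into the part that is already stable.\<close>
    have "x - y \<in> N k"
      using x y(1) mono[OF that] insert.prems(1) by (auto intro: Z2.subspace_diff)
    moreover have "x - y \<in> Z2.span S"
      using Z2.span_diff[OF c y(2)] by simp
    ultimately have "x - y \<in> N K"
      using K1[of k] K1[of K] that by (auto simp: K_def)
    then have "(x - y) + y \<in> N K"
      using y(1) insert.prems(1) by (blast intro: Z2.subspace_add)
    then show "x \<in> N K" by simp
  qed
  then show ?case using mono by blast
qed

section \<open>The ring of integers of the algebraic closure\<close>

lemma poly_map_of_zadic2: "poly (map_poly of_zadic2 p) x = (\<Sum>i\<le>Polynomial.degree p. of_zadic2 (Polynomial.coeff p i) * x ^ i)"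
  by (simp add: poly_altdef degree_map_poly coeff_map_poly)

text \<open>The monic equation rewrites \<open>x ^ n\<close> in lower powers, so the span of the
  first \<open>n\<close> powers is stable under multiplication by \<open>x\<close>.\<close>

lemma integers_powers_in_span:
  assumes "x \<in> integers"
  obtains n where "\<And>k. x ^ k \<in> Z2.span ((\<lambda>i. x ^ i) ` {..<n :: nat})"
proof -
  obtain p where p: "Polynomial.lead_coeff p = 1" "poly (map_poly of_zadic2 p) x = 0"
    using assms unfolding integers_def by blast
  define n where "n = Polynomial.degree p"
  define S where "S = (\<lambda>i. x ^ i) ` {..<n}"
  have xn: "x ^ n \<in> Z2.span S"
  proof -
    have "(\<Sum>i<n. of_zadic2 (Polynomial.coeff p i) * x ^ i) + x ^ n = 0"
      using p unfolding poly_map_of_zadic2 n_def[symmetric]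
      by (simp add: lessThan_Suc_atMost[symmetric] add.commute)
    then have "x ^ n = (\<Sum>i<n. of_zadic2 (- Polynomial.coeff p i) * x ^ i)"
      by (simp add: sum_negf eq_neg_iff_add_eq_0 add.commute)
    then show ?thesis
      unfolding S_def Z2_span_image_lessThan by (rule range_eqI[where x = "\<lambda>i. - Polynomial.coeff p i"])
  qed
  have step: "x * y \<in> Z2.span S" if "y \<in> Z2.span S" for y
    using that
  proof (induction rule: Z2.span_induct_alt)
    case (step c b y)
    then obtain i where i: "b = x ^ i" "i < n" unfolding S_def by auto
    have "x * b \<in> Z2.span S"
    proof (cases "Suc i = n")
      case True
      then show ?thesis using i xn by auto
    next
      case False
      then have "x ^ Suc i \<in> S" using i unfolding S_def by (intro imageI) auto
      then show ?thesis using i by (auto intro: Z2.span_base)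
    qed
    then have "of_zadic2 c * (x * b) + x * y \<in> Z2.span S"
      using step by (auto intro: Z2.span_add Z2.span_scale)
    then show ?case by (simp add: algebra_simps)
  qed (simp add: Z2.span_zero)
  have "x ^ k \<in> Z2.span S" for k
  proof (induction k)
    case 0
    show ?case
    proof (cases "n = 0")
      case True then show ?thesis using xn by simp
    next
      case False
      then have "x ^ 0 \<in> S" unfolding S_def by (intro imageI) auto
      then show ?thesis by (rule Z2.span_base)
    qed
  qed (simp add: step)
  then show ?thesis using that unfolding S_def by blast
qed

text \<open>The converse criterion: the spans of the first \<open>k\<close> powers form an ascending
  chain inside a finitely generated module. Where it stops, \<open>x ^ K\<close> is a combination of
  lower powers, which is a monic equation.\<close>

lemma integersI_powers:
  assumes "finite S" "\<And>k. x ^ k \<in> Z2.span S"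
  shows "x \<in> integers"
proof -
  define N where "N k = Z2.span ((\<lambda>i. x ^ i) ` {..<k :: nat})" for k
  have "\<exists>K. \<forall>k\<ge>K. N k = N K"
  proof (rule Z2_chain_stabilizes[OF assms(1)])
    show "N k \<subseteq> Z2.span S" for k
      unfolding N_def using assms(2) by (intro Z2.span_minimal) auto
    show "N k \<subseteq> N (Suc k)" for k
      unfolding N_def by (intro Z2.span_mono) auto
  qed (auto simp: N_def)
  then obtain K where K: "N (Suc K) = N K" by (metis le_Suc_eq order_refl)
  have "x ^ K \<in> N (Suc K)" unfolding N_def by (intro Z2.span_base) auto
  then obtain c where c: "x ^ K = (\<Sum>i<K. of_zadic2 (c i) * x ^ i)"
    unfolding K unfolding N_def Z2_span_image_lessThan by blast
  define q where "q = (\<Sum>i<K. Polynomial.monom (c i) i)"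
  define p where "p = Polynomial.monom 1 K - q"
  have cq: "Polynomial.coeff q j = (if j < K then c j else 0)" for j
    by (simp add: q_def coeff_sum sum.delta' if_distrib cong: if_cong)
  have cp: "Polynomial.coeff p j = (if j = K then 1 else if j < K then - c j else 0)" for j
    by (auto simp: p_def cq)
  have deg: "Polynomial.degree p = K"
    by (rule antisym) (auto intro!: degree_le le_degree simp: cp)
  have "poly (map_poly of_zadic2 p) x = 0"
  proof -
    have "(\<Sum>i<K. of_zadic2 (Polynomial.coeff p i) * x ^ i) = (\<Sum>i<K. - (of_zadic2 (c i) * x ^ i))"
      by (intro sum.cong) (auto simp: cp)
    then show ?thesis
      using c by (simp add: poly_map_of_zadic2 deg lessThan_Suc_atMost[symmetric] sum_negf) (simp add: cp)
  qed
  moreover have "Polynomial.lead_coeff p = 1"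
    by (simp only: deg cp simp_thms if_True)
  ultimately show ?thesis
    unfolding integers_def by blast
qed

lemma Z2_span_mult:
  assumes "x \<in> Z2.span A" "y \<in> Z2.span B"
  shows "x * y \<in> Z2.span ((\<lambda>(a, b). a * b) ` (A \<times> B))"
  using assms(1)
proof (induction rule: Z2.span_induct_alt)
  case (step c a z)
  have "a * y \<in> Z2.span ((\<lambda>(a, b). a * b) ` (A \<times> B))"
    using assms(2)
  proof (induction rule: Z2.span_induct_alt)
    case (step d b w)
    have "of_zadic2 d * (a * b) + a * w \<in> Z2.span ((\<lambda>(a, b). a * b) ` (A \<times> B))"
      using step \<open>a \<in> A\<close> by (intro Z2.span_add Z2.span_scale[OF Z2.span_base]) auto
    then show ?case by (simp add: algebra_simps)
  qed (simp add: Z2.span_zero)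
  then have "of_zadic2 c * (a * y) + z * y \<in> Z2.span ((\<lambda>(a, b). a * b) ` (A \<times> B))"
    using step by (intro Z2.span_add Z2.span_scale)
  then show ?case by (simp add: algebra_simps)
qed (simp add: Z2.span_zero)

text \<open>The products of finitely many powers of \<open>x\<close> and of \<open>y\<close> span a
  module that contains all powers of \<open>x + y\<close> and of \<open>x * y\<close>.\<close>

lemma integers_add_mult:
  assumes "x \<in> integers" "y \<in> integers"
  shows "x + y \<in> integers" "x * y \<in> integers"
proof -
  obtain m where m: "\<And>k. x ^ k \<in> Z2.span ((\<lambda>i. x ^ i) ` {..<m :: nat})"
    using integers_powers_in_span[OF assms(1)] by blast
  obtain n where n: "\<And>k. y ^ k \<in> Z2.span ((\<lambda>i. y ^ i) ` {..<n :: nat})"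
    using integers_powers_in_span[OF assms(2)] by blast
  define S where "S = (\<lambda>(a, b). a * b) ` (((\<lambda>i. x ^ i) ` {..<m}) \<times> ((\<lambda>i. y ^ i) ` {..<n}))"
  have fin: "finite S" unfolding S_def by auto
  have xy: "x ^ i * y ^ j \<in> Z2.span S" for i j
    unfolding S_def using m n by (rule Z2_span_mult)
  show "x * y \<in> integers"
    by (rule integersI_powers[OF fin]) (simp add: power_mult_distrib xy)
  show "x + y \<in> integers"
  proof (rule integersI_powers[OF fin])
    fix k
    have "of_zadic2 (of_nat (k choose i)) * (x ^ i * y ^ (k - i)) \<in> Z2.span S" for i
      using xy by (rule Z2.span_scale)
    moreover have "of_zadic2 (of_nat n) = of_nat n" for n by (induction n) auto
    ultimately show "(x + y) ^ k \<in> Z2.span S"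
      by (auto simp: binomial_ring mult.assoc intro: Z2.span_sum)
  qed
qed

lemma of_zadic2_in_integers: "of_zadic2 a \<in> integers"
  by (rule integersI_powers[of "{1}"]) (auto simp: Z2.span_singleton intro: range_eqI[of _ _ "a ^ _"])

lemma integers_0 [simp]: "0 \<in> integers" and integers_1 [simp]: "1 \<in> integers"
  using of_zadic2_in_integers[of 0] of_zadic2_in_integers[of 1] by simp_all

lemma integers_uminus: "x \<in> integers \<Longrightarrow> - x \<in> integers"
  using integers_add_mult(2)[OF of_zadic2_in_integers[of "-1"]] by simp

lemma integers_diff: "x \<in> integers \<Longrightarrow> y \<in> integers \<Longrightarrow> x - y \<in> integers"
  using integers_add_mult(1)[of x "- y"] integers_uminus by simp

lemma integers_power: "x \<in> integers \<Longrightarrow> x ^ n \<in> integers"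
  by (induction n) (auto intro: integers_add_mult)

text \<open>Multiplying a monic equation of degree \<open>n\<close> by \<open>2 ^ n\<close> and
  using \<open>2 * x = 1\<close> leaves 1 plus an even 2-adic integer equal to 0. This keeps
  elements nilpotent modulo 2 from being units.\<close>

lemma half_not_integer:
  assumes "x \<in> integers"
  shows "2 * x \<noteq> 1"
proof
  assume x: "2 * x = 1"
  obtain p where p: "Polynomial.lead_coeff p = 1" "poly (map_poly of_zadic2 p) x = 0"
    using assms unfolding integers_def by blast
  define n where "n = Polynomial.degree p"
  have "0 = 2 ^ n * (\<Sum>i\<le>n. of_zadic2 (Polynomial.coeff p i) * x ^ i)"
    using p(2) by (simp add: poly_map_of_zadic2 n_def)
  also have "\<dots> = (\<Sum>i\<le>n. of_zadic2 (Polynomial.coeff p i * 2 ^ (n - i)))"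
  proof (unfold sum_distrib_left, rule sum.cong[OF refl])
    fix i assume "i \<in> {..n}"
    then have "(2 :: qbar) ^ n = 2 ^ (n - i) * 2 ^ i" by (simp flip: power_add)
    then have "2 ^ n * (of_zadic2 (Polynomial.coeff p i) * x ^ i) = 2 ^ (n - i) * of_zadic2 (Polynomial.coeff p i) * (2 * x) ^ i"
      by (simp only: power_mult_distrib mult_ac)
    then show "2 ^ n * (of_zadic2 (Polynomial.coeff p i) * x ^ i) = of_zadic2 (Polynomial.coeff p i * 2 ^ (n - i))"
      by (simp only: x) (simp add: mult_ac)
  qed
  also have "\<dots> = of_zadic2 (\<Sum>i\<le>n. Polynomial.coeff p i * 2 ^ (n - i))"
    by (simp add: of_zadic2_sum)
  finally have "(\<Sum>i\<le>n. Polynomial.coeff p i * 2 ^ (n - i)) = 0"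
    by (metis of_zadic2_eq_0_iff)
  then have "1 + (\<Sum>i<n. Polynomial.coeff p i * 2 ^ (n - i)) = 0"
    using p(1) by (simp add: n_def lessThan_Suc_atMost[symmetric] add.commute)
  moreover have "2 dvd (\<Sum>i<n. Polynomial.coeff p i * 2 ^ (n - i))"
    by (intro dvd_sum) (auto intro!: dvd_mult dvd_power)
  ultimately have "(2 :: zadic2) dvd 1"
    by (metis dvd_0_right dvd_add_left_iff)
  then show False using two_not_dvd_one_zadic2 by blast
qed

section \<open>Completeness and the local structure of the integers\<close>

lemmas integers_add = integers_add_mult(1) and integers_mult = integers_add_mult(2)

text \<open>Convergence is coordinatewise: for each increment some coefficients are chosen, and they
  are summed by \<open>zadic2_series\<close>. The generators may be dependent.\<close>

lemma Z2_span_complete: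
  assumes y: "\<And>k. \<exists>d\<in>Z2.span (v ` {..<n :: nat}). y (Suc k) - y k = 2 ^ k * d"
  obtains z where "\<And>k. \<exists>d\<in>Z2.span (v ` {..<n :: nat}). z - y k = 2 ^ k * d"
proof -
  have "\<exists>c. y (Suc k) - y k = 2 ^ k * (\<Sum>i<n. of_zadic2 (c i) * v i)" for k
    using y[of k] unfolding Z2_span_image_lessThan by blast
  then obtain c where c: "\<And>k. y (Suc k) - y k = 2 ^ k * (\<Sum>i<n. of_zadic2 (c k i) * v i)"
    by metis
  define z where "z = y 0 + (\<Sum>i<n. of_zadic2 (zadic2_series (\<lambda>k. c k i)) * v i)"
  have yk: "y k = y 0 + (\<Sum>i<n. of_zadic2 (\<Sum>j<k. 2 ^ j * c j i) * v i)" for k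
  proof (induction k)
    case (Suc k)
    have "y (Suc k) = y k + 2 ^ k * (\<Sum>i<n. of_zadic2 (c k i) * v i)"
      using c[of k] by (simp add: algebra_simps)
    also have "\<dots> = y 0 + (\<Sum>i<n. of_zadic2 (\<Sum>j<Suc k. 2 ^ j * c j i) * v i)"
      unfolding Suc by (simp add: sum_distrib_left algebra_simps sum.distrib)
    finally show ?case .
  qed simp
  have "z - y k = 2 ^ k * (\<Sum>i<n. of_zadic2 (zadic2_series (\<lambda>j. c (j + k) i)) * v i)" for k
  proof -
    have tail: "of_zadic2 (zadic2_series (\<lambda>k. c k i)) * v i = of_zadic2 (\<Sum>j<k. 2 ^ j * c j i) * v i +
        2 ^ k * (of_zadic2 (zadic2_series (\<lambda>j. c (j + k) i)) * v i)" for i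
      using arg_cong[OF zadic2_series_tail[of "\<lambda>k. c k i" k], of "\<lambda>a. of_zadic2 a * v i"]
      by (simp add: distrib_right mult.assoc)
    show ?thesis
      unfolding z_def yk[of k] tail sum.distrib sum_distrib_left[symmetric]
      by (simp only: add_diff_cancel_left add_diff_cancel_left')
  qed
  moreover have "(\<Sum>i<n. of_zadic2 (c i) * v i) \<in> Z2.span (v ` {..<n})" for c
    unfolding Z2_span_image_lessThan by (rule range_eqI[where x = c]) simp
  ultimately show ?thesis
    by (intro that bexI)
qed

lemma coeff_sum_monom_lessThan:
  "Polynomial.coeff (\<Sum>i<n. Polynomial.monom (a i) i) j = (if j < n then a j else 0)"
  by (simp add: coeff_sum)

text \<open>Once denominators are cleared, the leading coefficient \<open>c n\<close> times
  \<open>x\<close> is integral.\<close>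

lemma algebraic_multiple_integer:
  obtains a where "a \<noteq> 0" "of_zadic2 a * x \<in> integers"
proof -
  obtain p where p: "p \<noteq> 0" "poly (map_poly to_ac p) x = 0"
    by (rule alg_closure_algebraic)
  have "\<exists>b. b \<noteq> 0 \<and> (\<forall>i\<in>I. \<exists>c. of_zadic2 c = of_zadic2 b * to_ac (Polynomial.coeff p i))" if "finite I" for I :: "nat set"
    using that
  proof (induction I rule: finite_induct)
    case (insert i I)
    then obtain b where b: "b \<noteq> 0" "\<And>i. i \<in> I \<Longrightarrow> \<exists>c. of_zadic2 c = of_zadic2 b * to_ac (Polynomial.coeff p i)"
      by blast
    obtain s t where st: "Polynomial.coeff p i = Fract s t" "t \<noteq> 0"
      by (cases "Polynomial.coeff p i")
    have "of_zadic2 t * to_ac (Polynomial.coeff p i) = of_zadic2 s"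
      using st by (simp add: of_zadic2_def eq_fract flip: to_ac_mult)
    then have 1: "\<exists>c. of_zadic2 c = of_zadic2 (b * t) * to_ac (Polynomial.coeff p i)"
      by (intro exI[of _ "b * s"]) (simp add: mult.assoc)
    have 2: "\<exists>c. of_zadic2 c = of_zadic2 (b * t) * to_ac (Polynomial.coeff p j)" if "j \<in> I" for j
    proof -
      obtain c where "of_zadic2 c = of_zadic2 b * to_ac (Polynomial.coeff p j)"
        using b(2)[OF \<open>j \<in> I\<close>] by auto
      then have "of_zadic2 (c * t) = of_zadic2 (b * t) * to_ac (Polynomial.coeff p j)"
        by simp
      then show ?thesis by blast
    qed
    show ?case
      using 1 2 b(1) st(2) by (intro exI[of _ "b * t"]) (auto simp del: of_zadic2_simps)
  qed (auto intro: exI[of _ 1])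
  note ex_b = this
  from ex_b[of "{..Polynomial.degree p}"] obtain b where b: "b \<noteq> 0"
    "\<And>i. i \<le> Polynomial.degree p \<Longrightarrow> \<exists>c. of_zadic2 c = of_zadic2 b * to_ac (Polynomial.coeff p i)" by auto
  define n where "n = Polynomial.degree p"
  obtain c where c: "\<And>i. i \<le> n \<Longrightarrow> of_zadic2 (c i) = of_zadic2 b * to_ac (Polynomial.coeff p i)"
    using b(2) unfolding n_def by metis
  have cn: "c n \<noteq> 0"
    using c[of n] b(1) p(1) by (auto simp: n_def)
  have npos: "n > 0"
  proof (rule ccontr)
    assume "\<not> n > 0"
    then obtain a where "p = [:a:]" by (auto simp: n_def elim: degree_eq_zeroE)
    then show False using p by (simp add: map_poly_pCons)
  qed
  define u where "u = of_zadic2 (c n) * x"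
  have eq0: "(\<Sum>i\<le>n. of_zadic2 (c i) * x ^ i) = 0"
  proof -
    have "(\<Sum>i\<le>n. of_zadic2 (c i) * x ^ i) = of_zadic2 b * (\<Sum>i\<le>n. to_ac (Polynomial.coeff p i) * x ^ i)"
      using c by (simp add: sum_distrib_left mult.assoc)
    also have "(\<Sum>i\<le>n. to_ac (Polynomial.coeff p i) * x ^ i) = poly (map_poly to_ac p) x"
      by (simp add: poly_altdef degree_map_poly coeff_map_poly n_def)
    finally show ?thesis using p by simp
  qed
  \<comment> \<open>The equation times \<open>c n ^ (n - 1)\<close>, rewritten in \<open>u\<close>:
    the power \<open>x ^ i\<close> absorbs \<open>c n ^ i\<close>, which leaves
    \<open>c i * c n ^ (n - 1 - i)\<close> below the leading coefficient 1.\<close>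
  define q where "q = Polynomial.monom 1 n + (\<Sum>i<n. Polynomial.monom (c i * c n ^ (n - 1 - i)) i)"
  have cq: "Polynomial.coeff q j = (if j = n then 1 else if j < n then c j * c n ^ (n - 1 - j) else 0)" for j
    by (simp add: q_def coeff_sum_monom_lessThan)
  have deg: "Polynomial.degree q = n"
    by (rule antisym) (auto intro!: degree_le le_degree simp: cq)
  have "poly (map_poly of_zadic2 q) u = (\<Sum>i\<le>n. of_zadic2 (c n) ^ (n - 1) * (of_zadic2 (c i) * x ^ i))"
    unfolding poly_map_of_zadic2 deg
  proof (intro sum.cong refl)
    fix i assume "i \<in> {..n}"
    show "of_zadic2 (Polynomial.coeff q i) * u ^ i = of_zadic2 (c n) ^ (n - 1) * (of_zadic2 (c i) * x ^ i)"
    proof (cases "i = n")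
      case True
      have "of_zadic2 (c n) ^ n = of_zadic2 (c n) ^ (n - 1) * of_zadic2 (c n)"
        using npos by (metis Suc_diff_1 power_Suc2)
      with True show ?thesis by (simp add: cq u_def power_mult_distrib mult_ac)
    next
      case False
      with \<open>i \<in> {..n}\<close> have "of_zadic2 (c n) ^ (n - 1) = of_zadic2 (c n) ^ (n - 1 - i) * of_zadic2 (c n) ^ i"
        by (simp flip: power_add)
      with False \<open>i \<in> {..n}\<close> show ?thesis by (simp add: cq u_def power_mult_distrib mult_ac)
    qed
  qed
  also have "\<dots> = 0" using eq0 by (simp flip: sum_distrib_left)
  finally have "u \<in> integers"
    unfolding integers_def using deg by (intro CollectI exI[of _ q]) (simp add: cq)
  then show ?thesis using that cn unfolding u_def by blast
qed

text \<open>A nonzero \<open>z\<close> that is infinitely 2-divisible in the integers would make \<open>1 / 2\<close> integral.\<close>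

lemma infinitely_2_divisible_0:
  assumes "\<And>k. \<exists>d\<in>integers. z = 2 ^ k * d"
  shows "z = 0"
proof (rule ccontr)
  assume z: "z \<noteq> 0"
  obtain a where a: "a \<noteq> 0" "of_zadic2 a * inverse z \<in> integers"
    by (rule algebraic_multiple_integer)
  obtain j w where jw: "a = 2 ^ j * w" "w dvd 1"
    using a(1) by (rule zadic2_two_power_unit)
  obtain w' where w': "1 = w * w'" using jw(2) by auto
  \<comment> \<open>One factor of 2 more than \<open>a\<close> contains, so that \<open>d\<close>
    times \<open>a / z\<close> times \<open>w'\<close> comes out as one half.\<close>
  obtain d where d: "d \<in> integers" "z = 2 ^ Suc j * d" using assms by blast
  have ww: "of_zadic2 w * of_zadic2 w' = 1"
    using w' by (simp flip: of_zadic2_simps)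
  have "d * (of_zadic2 a * inverse z) * of_zadic2 w' \<in> integers"
    using integers_add_mult(2)[OF integers_add_mult(2)[OF d(1) a(2)] of_zadic2_in_integers] .
  moreover have "2 * (d * (of_zadic2 a * inverse z) * of_zadic2 w') = (2 ^ Suc j * d) * inverse z * (of_zadic2 w * of_zadic2 w')"
    by (simp only: jw(1) of_zadic2_simps of_zadic2_power of_zadic2_2 power_Suc mult_ac)
  then have "2 * (d * (of_zadic2 a * inverse z) * of_zadic2 w') = 1"
    unfolding d(2)[symmetric] ww using z by simp
  ultimately show False using half_not_integer by blast
qed

text \<open>For an integer \<open>x\<close> this span is the ring generated by \<open>x\<close> over
  the 2-adic integers: closed under multiplication and, as a finite module, complete by
  \<open>Z2_span_complete\<close>.\<close>

lemma Z2_span_powers: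
  assumes "x \<in> integers"
  obtains n where
    "\<And>k. x ^ k \<in> Z2.span ((\<lambda>i. x ^ i) ` {..<n :: nat})"
    "\<And>a b. a \<in> Z2.span ((\<lambda>i. x ^ i) ` {..<n}) \<Longrightarrow> b \<in> Z2.span ((\<lambda>i. x ^ i) ` {..<n}) \<Longrightarrow>
       a * b \<in> Z2.span ((\<lambda>i. x ^ i) ` {..<n})"
    "Z2.span ((\<lambda>i. x ^ i) ` {..<n}) \<subseteq> integers"
proof -
  obtain n where n: "\<And>k. x ^ k \<in> Z2.span ((\<lambda>i. x ^ i) ` {..<n :: nat})" (is "\<And>k. _ \<in> Z2.span ?S")
    using integers_powers_in_span[OF assms] by blast
  have "a * b \<in> Z2.span ?S" if "a \<in> Z2.span ?S" "b \<in> Z2.span ?S" for a b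
  proof -
    have "Z2.span ((\<lambda>(a, b). a * b) ` (?S \<times> ?S)) \<subseteq> Z2.span ?S"
      by (rule Z2.span_minimal) (auto simp flip: power_add intro: n)
    then show ?thesis using Z2_span_mult[OF that] by blast
  qed
  moreover have "Z2.span ?S \<subseteq> integers"
  proof
    fix a assume "a \<in> Z2.span ?S"
    then show "a \<in> integers"
      by (induction rule: Z2.span_induct_alt)
         (auto intro!: integers_add_mult of_zadic2_in_integers integers_power assms)
  qed
  ultimately show ?thesis using that n by blast
qed

text \<open>The cofactor \<open>a + b\<close> equals \<open>2 * b + 2 ^ k * d\<close> and is even,
  so squaring gains one factor of 2.\<close>

lemma two_dvd_power_two_power:
  fixes a b d :: "'a :: comm_ring_1"
  assumes "a - b = 2 ^ k * d" "k > 0"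
  shows "a\<^sup>2 - b\<^sup>2 = 2 ^ Suc k * (d * (b + 2 ^ (k - 1) * d))"
proof -
  have a: "a = b + 2 ^ k * d" using assms(1) by (simp add: algebra_simps)
  have "2 ^ k = 2 * (2 :: 'a) ^ (k - 1)" using assms(2) by (metis Suc_diff_1 power_Suc)
  then show ?thesis unfolding a by (simp add: power2_eq_square algebra_simps)
qed

lemma zadic2_mod_2:
  fixes z :: zadic2
  shows "\<exists>e\<in>{0, 1}. \<exists>f. z = e + 2 * f"
proof (cases "2 dvd z")
  case False
  have *: "Rep_zadic2 a 1 = 1" if "\<not> 2 dvd a" for a
  proof -
    have "a dvd 1" using zadic2_even_cases[of a] that by blast
    then obtain v where "1 = a * v" by (rule dvdE)
    then have "Rep_zadic2 1 1 = Rep_zadic2 (a * v) 1" by simp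
    then have "(Rep_zadic2 a 1 * Rep_zadic2 v 1) mod 2 = 1"
      by (simp add: one_zadic2.rep_eq times_zadic2.rep_eq)
    then have "odd (Rep_zadic2 a 1)" by auto
    moreover have "Rep_zadic2 a 1 mod 2 = Rep_zadic2 a 1"
      using Rep_zadic2[of a] by (auto dest: spec[of _ 1])
    ultimately show ?thesis by presburger
  qed
  have "2 dvd z - 1"
  proof (rule ccontr)
    assume "\<not> 2 dvd z - 1"
    moreover have "Rep_zadic2 (z - 1) 1 = (Rep_zadic2 z 1 - 1) mod 2"
      by (simp add: minus_zadic2.rep_eq one_zadic2.rep_eq mod_simps)
    ultimately show False using *[OF False] *[of "z - 1"] by simp
  qed
  then obtain f where "z - 1 = 2 * f" by (elim dvdE)
  then have "z = 1 + 2 * f" by (simp add: algebra_simps)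
  then show ?thesis by blast
qed (auto elim!: dvdE)

text \<open>Modulo 2, some power of \<open>x\<close> is idempotent. It lifts to an idempotent of the 2-adically
  complete domain generated by \<open>x\<close>, that is, to 0 or 1.\<close>

lemma integers_power_cases:
  assumes "x \<in> integers"
  shows "(\<exists>m>0. \<exists>d\<in>integers. x ^ m = 2 * d) \<or> (\<exists>y\<in>integers. x * y = 1)"
proof -
  obtain n where n: "\<And>k. x ^ k \<in> Z2.span ((\<lambda>i. x ^ i) ` {..<n :: nat})"
    "\<And>a b. a \<in> Z2.span ((\<lambda>i. x ^ i) ` {..<n}) \<Longrightarrow> b \<in> Z2.span ((\<lambda>i. x ^ i) ` {..<n}) \<Longrightarrow>
       a * b \<in> Z2.span ((\<lambda>i. x ^ i) ` {..<n})"
    "Z2.span ((\<lambda>i. x ^ i) ` {..<n}) \<subseteq> integers"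
    using Z2_span_powers[OF assms] by metis
  define M where "M = Z2.span ((\<lambda>i. x ^ i) ` {..<n})"
  have M: "a * b \<in> M" "a + b \<in> M" "a - b \<in> M" "a \<in> integers" if "a \<in> M" "b \<in> M" for a b
    using that n unfolding M_def by (auto intro: Z2.span_add Z2.span_diff)
  have M1: "x ^ k \<in> M" for k using n unfolding M_def by blast
  have M2: "of_zadic2 a * b \<in> M" if "b \<in> M" for a b
    using that unfolding M_def by (rule Z2.span_scale)
  have Mpow: "2 ^ k * b \<in> M" if "b \<in> M" for b k
    using M2[OF that, of "2 ^ k"] by simp
  have Mp: "b ^ k \<in> M" if "b \<in> M" for b k
    by (induction k) (use M1[of 0] M(1) that in auto)
  have "\<exists>m>0. \<exists>d\<in>M. (x ^ m)\<^sup>2 - x ^ m = 2 * d"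
  proof -
    define r where "r c = (\<Sum>i<n. of_zadic2 (c i) * x ^ i)" for c
    have red: "\<exists>c\<in>{..<n} \<rightarrow>\<^sub>E {0, 1}. \<exists>d\<in>M. y = r c + 2 * d" if "y \<in> M" for y
    proof -
      have "y \<in> range r"
        using that unfolding M_def Z2_span_image_lessThan r_def .
      then obtain c where c: "y = r c" by blast
      have "\<exists>e. (\<exists>f. c i = e + 2 * f) \<and> e \<in> {0, 1}" for i
        using zadic2_mod_2[of "c i"] by blast
      then obtain e f where ef: "\<And>i. c i = e i + 2 * f i" "\<And>i. e i \<in> {0, 1}" by metis
      have "y = r (restrict e {..<n}) + 2 * r f"
        unfolding c r_def by (simp add: ef(1) sum.distrib sum_distrib_left algebra_simps)
      moreover have "r f \<in> M" unfolding M_def Z2_span_image_lessThan r_def by (rule range_eqI[where x = f]) simp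
      moreover have "restrict e {..<n} \<in> {..<n} \<rightarrow>\<^sub>E {0, 1}" using ef(2) by auto
      ultimately show ?thesis by blast
    qed
    obtain c d where cd: "\<And>k. c k \<in> {..<n} \<rightarrow>\<^sub>E {0, 1}" "\<And>k. d k \<in> M" "\<And>k. x ^ k = r (c k) + 2 * d k"
      using red[OF M1] by metis
    \<comment> \<open>Modulo 2 the coefficients can be taken from 0 and 1, so two different powers
      of \<open>x\<close> agree modulo 2.\<close>
    have "finite (range c)"
      by (rule finite_subset[of _ "{..<n} \<rightarrow>\<^sub>E {0, 1}"]) (use cd(1) in \<open>auto intro: finite_PiE\<close>)
    then have "\<not> inj c" using finite_imageD infinite_UNIV_nat by blast
    then obtain i j where ij: "i < j" "c i = c j"
      by (metis injI linorder_cases)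
    have period: "\<exists>e\<in>M. x ^ (i + s + t * (j - i)) - x ^ (i + s) = 2 * e" for s t
    proof (induction t)
      case 0
      have "x ^ (i + s + 0 * (j - i)) - x ^ (i + s) = 2 * 0" by simp
      moreover have "0 \<in> M" unfolding M_def by (rule Z2.span_zero)
      ultimately show ?case by blast
    next
      case (Suc t)
      then obtain e where e: "e \<in> M" "x ^ (i + s + t * (j - i)) - x ^ (i + s) = 2 * e" by blast
      have ji: "x ^ j - x ^ i = 2 * (d j - d i)" using cd(3) ij(2) by (simp add: algebra_simps)
      have "x ^ (i + s + Suc t * (j - i)) = x ^ (s + t * (j - i)) * x ^ j"
      proof -
        have "i + s + Suc t * (j - i) = (s + t * (j - i)) + j" using ij(1) by simp
        then show ?thesis by (simp only: power_add)
      qed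
      moreover have "x ^ (i + s + t * (j - i)) = x ^ (s + t * (j - i)) * x ^ i"
      proof -
        have "i + s + t * (j - i) = (s + t * (j - i)) + i" by simp
        then show ?thesis by (simp only: power_add)
      qed
      ultimately have "x ^ (i + s + Suc t * (j - i)) - x ^ (i + s + t * (j - i)) = x ^ (s + t * (j - i)) * (x ^ j - x ^ i)"
        by (simp add: algebra_simps)
      also have "\<dots> = 2 * (x ^ (s + t * (j - i)) * (d j - d i))" unfolding ji by simp
      finally have "x ^ (i + s + Suc t * (j - i)) - x ^ (i + s) = 2 * (x ^ (s + t * (j - i)) * (d j - d i) + e)"
        using e(2) by (simp add: algebra_simps)
      moreover have "x ^ (s + t * (j - i)) * (d j - d i) + e \<in> M"
        by (intro M(1-3) M1 cd(2) e(1))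
      ultimately show ?case by (rule bexI)
    qed
    \<comment> \<open>A multiple of the period \<open>j - i\<close> that is at least the preperiod
      \<open>i\<close>: then \<open>x ^ (m + m)\<close> and \<open>x ^ m\<close> agree modulo
      2.\<close>
    define m where "m = Suc i * (j - i)"
    have "Suc i * 1 \<le> m" unfolding m_def using ij(1) by (intro mult_le_mono) auto
    then have m: "m > 0" "m \<ge> i" by auto
    have "m + m = i + (m - i) + Suc i * (j - i)" using m by (simp add: m_def)
    moreover have "m = i + (m - i)" using m by simp
    ultimately obtain e where "e \<in> M" "x ^ (m + m) - x ^ m = 2 * e"
      using period[of "m - i" "Suc i"] by metis
    then show ?thesis using m(1) by (auto simp: power2_eq_square power_add)
  qed
  then obtain m d where m: "m > 0" "d \<in> M" "(x ^ m)\<^sup>2 - x ^ m = 2 * d" by blast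
  have y1: "(x ^ m) ^ (2 ^ 1) = x ^ (m * 2)" by (simp only: power_mult power_one_right)
  \<comment> \<open>Repeated squaring of an idempotent modulo 2; the limit \<open>z\<close> is an
    exact idempotent.\<close>
  define y where "y k = (x ^ m) ^ (2 ^ k)" for k :: nat
  have ySuc: "y (Suc k) = (y k)\<^sup>2" for k
    unfolding y_def power_Suc2 power_mult ..
  have yM: "y k \<in> M" for k unfolding y_def by (intro Mp M1)
  have step: "\<exists>d\<in>M. y (Suc k) - y k = 2 ^ Suc k * d" for k
  proof (induction k)
    case 0
    then show ?case using m by (auto simp: y_def)
  next
    case (Suc k)
    then obtain d where d: "d \<in> M" "y (Suc k) - y k = 2 ^ Suc k * d" by blast
    have "y (Suc (Suc k)) - y (Suc k) = (y (Suc k))\<^sup>2 - (y k)\<^sup>2"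
      by (simp only: ySuc)
    also have "\<dots> = 2 ^ Suc (Suc k) * (d * (y k + 2 ^ (Suc k - 1) * d))"
      using d(2) by (rule two_dvd_power_two_power) simp
    finally have "y (Suc (Suc k)) - y (Suc k) = 2 ^ Suc (Suc k) * (d * (y k + 2 ^ (Suc k - 1) * d))" .
    moreover have "d * (y k + 2 ^ (Suc k - 1) * d) \<in> M"
      by (intro M(1-3) Mpow d(1) yM)
    ultimately show ?case by (rule bexI)
  qed
  have "\<exists>d\<in>M. y (Suc k) - y k = 2 ^ k * d" for k
  proof -
    obtain d where "d \<in> M" "y (Suc k) - y k = 2 ^ Suc k * d" using step by blast
    then show ?thesis using Mpow[of d 1] by (intro bexI[of _ "2 * d"]) auto
  qed
  then obtain z where z: "\<And>k. \<exists>d\<in>M. z - y k = 2 ^ k * d"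
    unfolding M_def using Z2_span_complete[where y = y and v = "\<lambda>i. x ^ i" and n = n] by blast
  have zM: "z \<in> M" using z[of 0] yM[of 0] M(2) by (metis diff_add_cancel mult_1 power_0)
  have "z\<^sup>2 - z = 0"
  proof (rule infinitely_2_divisible_0)
    fix k
    obtain d where d: "d \<in> M" "z - y k = 2 ^ k * d" using z by blast
    obtain e where e: "e \<in> M" "y (Suc k) - y k = 2 ^ Suc k * e" using step by blast
    have "z\<^sup>2 - z = (z - y k) * (z + y k) + (y (Suc k) - y k) - (z - y k)"
      unfolding ySuc by (simp add: algebra_simps power2_eq_square)
    also have "\<dots> = 2 ^ k * (d * (z + y k) + 2 * e - d)"
      unfolding d e by (simp add: algebra_simps)
    finally have "z\<^sup>2 - z = 2 ^ k * (d * (z + y k) + 2 * e - d)" .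
    moreover have 2: "2 * e \<in> M"
      using Mpow[of e 1] e by simp
    have "d * (z + y k) + 2 * e - d \<in> M"
      using M(3)[OF M(2)[OF M(1)[OF d(1) M(2)[OF zM yM]] 2] d(1)] .
    then have "d * (z + y k) + 2 * e - d \<in> integers"
      using M(4) by blast
    ultimately show "\<exists>d\<in>integers. z\<^sup>2 - z = 2 ^ k * d" by (rule bexI)
  qed
  then have "z * (z - 1) = 0" by (simp add: power2_eq_square algebra_simps)
  then have "z = 0 \<or> z = 1" by simp
  \<comment> \<open>Index 1 is the first at which \<open>z\<close> and \<open>y k\<close> are known
    to agree modulo 2.\<close>
  moreover obtain d where d: "d \<in> M" "z - y 1 = 2 * d" using z[of 1] power_one_right by metis
  then have "y 1 = z + 2 * (- d)"
    by (simp add: algebra_simps)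
  ultimately consider "y 1 = 2 * (- d)" | "y 1 = 1 + 2 * (- d)"
    by fastforce
  then show ?thesis
  proof cases
    case 1
    then have "x ^ (m * 2) = 2 * (- d)" unfolding y_def y1 .
    then show ?thesis using m(1) M(4)[OF d(1) d(1)] integers_uminus by (intro disjI1 exI[of _ "m * 2"]) auto
  next
    case 2
    text \<open>\<open>y 1 = 1 - 2 * d\<close> is inverted by a geometric series.\<close>
    define w where "w k = (\<Sum>j<k. (2 * d) ^ j)" for k :: nat
    have dM: "d ^ k \<in> M" for k by (rule Mp[OF d(1)])
    have wstep: "\<exists>e\<in>M. w (Suc k) - w k = 2 ^ k * e" for k
      using dM[of k] by (intro bexI[of _ "d ^ k"]) (auto simp: w_def power_mult_distrib)
    then obtain u where u: "\<And>k. \<exists>e\<in>M. u - w k = 2 ^ k * e"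
      unfolding M_def using Z2_span_complete[where y = w and v = "\<lambda>i. x ^ i" and n = n] by blast
    have uM: "u \<in> M" using u[of 0] by (auto simp: w_def)
    have "y 1 * u - 1 = 0"
    proof (rule infinitely_2_divisible_0)
      fix k
      obtain e where e: "e \<in> M" "u - w k = 2 ^ k * e" using u by blast
      have "(1 - 2 * d) * w k = 1 - (2 * d) ^ k"
        unfolding w_def by (rule one_diff_power_eq[symmetric])
      moreover have "y 1 = 1 - 2 * d" using 2 by simp
      ultimately have "y 1 * w k = 1 - 2 ^ k * d ^ k" by (simp only: power_mult_distrib)
      then have "y 1 * w k - 1 = 2 ^ k * (- (d ^ k))" by simp
      moreover have "y 1 * u - 1 = y 1 * (u - w k) + (y 1 * w k - 1)" by (simp add: algebra_simps)
      ultimately have "y 1 * u - 1 = 2 ^ k * (y 1 * e - d ^ k)"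
        unfolding e(2) by (simp add: algebra_simps)
      moreover have "y 1 * e - d ^ k \<in> M" by (intro M(1-3) e(1) yM dM)
      then have "y 1 * e - d ^ k \<in> integers" using M(4) by blast
      ultimately show "\<exists>d\<in>integers. y 1 * u - 1 = 2 ^ k * d" by (rule bexI)
    qed
    moreover have "y 1 = x * x ^ (m * 2 - 1)"
      using m(1) unfolding y_def y1 by (metis Suc_diff_1 mult_pos_pos pos2 power_Suc)
    ultimately have "x * (x ^ (m * 2 - 1) * u) = 1" by (simp add: mult_ac)
    moreover have "x ^ (m * 2 - 1) * u \<in> integers" using M(4)[OF M(1)[OF M1 uM] uM] .
    ultimately show ?thesis by blast
  qed
qed

text \<open>Non-units are the nilpotents modulo 2. In this form, unlike in the definition, closure
  under sums is accessible.\<close>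

lemma max_ideal_eq: "max_ideal = {x \<in> integers. \<exists>m>0. \<exists>d\<in>integers. x ^ m = 2 * d}"
proof -
  have False if x: "x \<in> integers" "m > 0" "d \<in> integers" "x ^ m = 2 * d" "y \<in> integers" "x * y = 1" for x m d y
  proof -
    have "2 * (d * y ^ m) = (x * y) ^ m" using x(4) by (simp only: power_mult_distrib mult.assoc)
    then have "2 * (d * y ^ m) = 1" using x(6) by simp
    then show False using half_not_integer integers_mult[OF x(3) integers_power[OF x(5)]] by blast
  qed
  then show ?thesis unfolding max_ideal_def using integers_power_cases by blast
qed

lemma max_ideal_0: "0 \<in> max_ideal"
  by (simp add: max_ideal_def)

lemma max_ideal_2: "2 \<in> max_ideal"
proof -
  have "(2 :: qbar) \<in> integers" using of_zadic2_in_integers[of 2] by simp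
  then show ?thesis using half_not_integer by (auto simp: max_ideal_def)
qed

lemma one_notin_max_ideal: "1 \<notin> max_ideal"
  by (auto simp: max_ideal_def intro: bexI[of _ 1])

lemma max_ideal_subset: "max_ideal \<subseteq> integers"
  by (auto simp: max_ideal_def)

lemma max_ideal_mult:
  assumes "x \<in> max_ideal" "y \<in> integers"
  shows "x * y \<in> max_ideal"
proof -
  obtain m d where "m > 0" "d \<in> integers" "x ^ m = 2 * d"
    using assms(1) by (auto simp: max_ideal_eq)
  then have "m > 0" "d * y ^ m \<in> integers" "(x * y) ^ m = 2 * (d * y ^ m)"
    using assms by (auto simp: power_mult_distrib intro: integers_mult integers_power)
  moreover have "x * y \<in> integers" using assms max_ideal_subset by (intro integers_mult) auto
  ultimately show ?thesis
    unfolding max_ideal_eq by blast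
qed

lemma max_ideal_uminus: "x \<in> max_ideal \<Longrightarrow> - x \<in> max_ideal"
  using max_ideal_mult[of x "- 1"] integers_uminus[of 1] by simp

text \<open>Every term of the binomial expansion with exponent \<open>m + n\<close> contains
  \<open>x ^ m\<close> or \<open>y ^ n\<close>, hence a factor 2.\<close>

lemma max_ideal_add:
  assumes "x \<in> max_ideal" "y \<in> max_ideal"
  shows "x + y \<in> max_ideal"
proof -
  have I: "x \<in> integers" "y \<in> integers" using assms max_ideal_subset by auto
  obtain m d where m: "m > 0" "d \<in> integers" "x ^ m = 2 * d"
    using assms(1) by (auto simp: max_ideal_eq)
  obtain n e where n: "n > 0" "e \<in> integers" "y ^ n = 2 * e"
    using assms(2) by (auto simp: max_ideal_eq)
  have *: "\<exists>f\<in>integers. x ^ i * y ^ (m + n - i) = 2 * f" if "i \<le> m + n" for i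
  proof (cases "m \<le> i")
    case True
    then have "x ^ i = 2 * d * x ^ (i - m)" by (metis m(3) power_add le_add_diff_inverse)
    then have "x ^ i * y ^ (m + n - i) = 2 * (d * x ^ (i - m) * y ^ (m + n - i))" by simp
    then show ?thesis
      by (rule bexI) (intro integers_mult integers_power m I)
  next
    case False
    then have "m + n - i = n + (m - i)" by simp
    then have "y ^ (m + n - i) = 2 * e * y ^ (m - i)" by (simp only: n(3) power_add)
    then have "x ^ i * y ^ (m + n - i) = 2 * (e * x ^ i * y ^ (m - i))" by simp
    then show ?thesis
      by (rule bexI) (intro integers_mult integers_power n I)
  qed
  then obtain f where f: "\<And>i. i \<le> m + n \<Longrightarrow> f i \<in> integers" "\<And>i. i \<le> m + n \<Longrightarrow> x ^ i * y ^ (m + n - i) = 2 * f i"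
    by metis
  have nat: "of_nat k \<in> integers" for k
    by (induction k) (auto intro: integers_add)
  have "(x + y) ^ (m + n) = 2 * (\<Sum>i\<le>m + n. of_nat (m + n choose i) * f i)"
    unfolding binomial_ring sum_distrib_left by (intro sum.cong) (auto simp: f mult_ac)
  moreover have "(\<Sum>i\<in>A. of_nat (m + n choose i) * f i) \<in> integers" if "A \<subseteq> {..m + n}" for A
    using finite_subset[OF that] that
    by (induction A rule: finite_induct) (auto intro!: integers_add integers_mult nat f)
  ultimately show ?thesis
    using m I integers_add unfolding max_ideal_eq by (intro CollectI conjI exI[of _ "m + n"]) auto
qed

lemma max_ideal_diff: "x \<in> max_ideal \<Longrightarrow> y \<in> max_ideal \<Longrightarrow> x - y \<in> max_ideal"
  using max_ideal_add[of x "- y"] max_ideal_uminus by simp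

section \<open>Residue fields\<close>

lemma subfield_QBar_iff:
  "subfield E QBar \<longleftrightarrow> 0 \<in> E \<and> 1 \<in> E \<and> (\<forall>x\<in>E. \<forall>y\<in>E. x + y \<in> E \<and> x * y \<in> E) \<and>
     (\<forall>x\<in>E. - x \<in> E \<and> inverse x \<in> E)"
proof -
  interpret Q: Ring.field QBar unfolding QBar_def by (rule field_from_type_algebra)
  have Units: "Units QBar = - {0}"
    using Q.field_Units by (auto simp: QBar_def ring_of_type_algebra_def)
  have inv: "inv\<^bsub>QBar\<^esub> x = inverse x" if "x \<noteq> 0" for x
    using that by (intro Q.comm_inv_char) (auto simp: QBar_def ring_of_type_algebra_def)
  have ainv: "\<ominus>\<^bsub>QBar\<^esub> x = - x" for x
    by (rule Q.minus_equality) (auto simp: QBar_def ring_of_type_algebra_def)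
  have simps: "carrier QBar = UNIV" "\<zero>\<^bsub>QBar\<^esub> = 0" "\<one>\<^bsub>QBar\<^esub> = 1"
    "x \<oplus>\<^bsub>QBar\<^esub> y = x + y" "x \<otimes>\<^bsub>QBar\<^esub> y = x * y" for x y
    by (auto simp: QBar_def ring_of_type_algebra_def)
  show ?thesis
  proof (intro iffI)
    assume E: "subfield E QBar"
    have "inverse x \<in> E" if "x \<in> E" for x
      using Q.subfield_m_inv(1)[OF E, of x] inv[of x] that subringE(2)[OF subfieldE(1)[OF E]]
      by (cases "x = 0") (auto simp: simps)
    then show "0 \<in> E \<and> 1 \<in> E \<and> (\<forall>x\<in>E. \<forall>y\<in>E. x + y \<in> E \<and> x * y \<in> E) \<and>
     (\<forall>x\<in>E. - x \<in> E \<and> inverse x \<in> E)"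
      using subringE[OF subfieldE(1)[OF E]] by (auto simp: simps ainv)
  next
    assume *: "0 \<in> E \<and> 1 \<in> E \<and> (\<forall>x\<in>E. \<forall>y\<in>E. x + y \<in> E \<and> x * y \<in> E) \<and>
     (\<forall>x\<in>E. - x \<in> E \<and> inverse x \<in> E)"
    then have "subring E QBar"
      by (intro Q.subringI) (auto simp: simps ainv)
    then show "subfield E QBar"
      using * by (intro Q.subfieldI') (auto simp: Units simps inv)
  qed
qed

\<comment> \<open>The residue field of the algebraic closure as a type: congruences modulo the
  maximal ideal become equations, and the Frobenius conditions in the Weil group become identities
  between powers. The relation is partial because the integers are only a subset of
  \<open>qbar\<close>.\<close>
quotient_type residue = qbar / partial: "\<lambda>x y. x \<in> integers \<and> y \<in> integers \<and> x - y \<in> max_ideal"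
proof (rule part_equivpI)
  show "\<exists>x. x \<in> integers \<and> x \<in> integers \<and> x - x \<in> max_ideal"
    by (rule exI[of _ 0]) (simp add: max_ideal_0)
  show "symp (\<lambda>x y. x \<in> integers \<and> y \<in> integers \<and> x - y \<in> max_ideal)"
    using max_ideal_uminus by (force intro!: sympI)
  show "transp (\<lambda>x y. x \<in> integers \<and> y \<in> integers \<and> x - y \<in> max_ideal)"
    using max_ideal_add by (force intro!: transpI)
qed

instantiation residue :: comm_ring_1
begin

lift_definition zero_residue :: residue is 0 by (simp add: max_ideal_0)
lift_definition one_residue :: residue is 1 by (simp add: max_ideal_0)
lift_definition plus_residue :: "residue \<Rightarrow> residue \<Rightarrow> residue" is "(+)"
proof -
  fix a b c d :: qbar
  assume ab: "a \<in> integers \<and> b \<in> integers \<and> a - b \<in> max_ideal"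
    and cd: "c \<in> integers \<and> d \<in> integers \<and> c - d \<in> max_ideal"
  then have "(a - b) + (c - d) \<in> max_ideal" by (intro max_ideal_add) auto
  moreover have "a + c - (b + d) = (a - b) + (c - d)" by simp
  ultimately have "a + c - (b + d) \<in> max_ideal" by (simp only:)
  then show "a + c \<in> integers \<and> b + d \<in> integers \<and> a + c - (b + d) \<in> max_ideal"
    using ab cd integers_add by blast
qed
lift_definition minus_residue :: "residue \<Rightarrow> residue \<Rightarrow> residue" is "(-)"
proof -
  fix a b c d :: qbar
  assume ab: "a \<in> integers \<and> b \<in> integers \<and> a - b \<in> max_ideal"
    and cd: "c \<in> integers \<and> d \<in> integers \<and> c - d \<in> max_ideal"
  then have "(a - b) - (c - d) \<in> max_ideal" using max_ideal_diff[of "a - b" "c - d"] by blast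
  moreover have "a - c - (b - d) = (a - b) - (c - d)" by simp
  ultimately have "a - c - (b - d) \<in> max_ideal" by (simp only:)
  then show "a - c \<in> integers \<and> b - d \<in> integers \<and> a - c - (b - d) \<in> max_ideal"
    using ab cd integers_diff by blast
qed
lift_definition uminus_residue :: "residue \<Rightarrow> residue" is "uminus"
proof -
  fix a b :: qbar
  assume ab: "a \<in> integers \<and> b \<in> integers \<and> a - b \<in> max_ideal"
  then have "- (a - b) \<in> max_ideal" by (intro max_ideal_uminus) auto
  moreover have "- a - - b = - (a - b)" by simp
  ultimately show "- a \<in> integers \<and> - b \<in> integers \<and> - a - - b \<in> max_ideal"
    using ab integers_uminus by metis
qed
lift_definition times_residue :: "residue \<Rightarrow> residue \<Rightarrow> residue" is "(*)"
proof -
  fix a b c d :: qbar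
  assume ab: "a \<in> integers \<and> b \<in> integers \<and> a - b \<in> max_ideal"
    and cd: "c \<in> integers \<and> d \<in> integers \<and> c - d \<in> max_ideal"
  have "a * c - b * d = (a - b) * c + (c - d) * b" by (simp add: algebra_simps)
  moreover have "(a - b) * c + (c - d) * b \<in> max_ideal"
    using ab cd by (intro max_ideal_add max_ideal_mult) auto
  ultimately show "a * c \<in> integers \<and> b * d \<in> integers \<and> a * c - b * d \<in> max_ideal"
    using ab cd by (simp add: integers_mult)
qed

instance
proof
  fix a b c :: residue
  show "a * b * c = a * (b * c)" by transfer (simp add: mult.assoc max_ideal_0 integers_mult)
  show "a * b = b * a" by transfer (simp add: mult.commute max_ideal_0 integers_mult)
  show "1 * a = a" by transfer (simp add: max_ideal_0)
  show "a + b + c = a + (b + c)" by transfer (simp add: add.assoc max_ideal_0 integers_add)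
  show "a + b = b + a" by transfer (simp add: add.commute max_ideal_0 integers_add)
  show "0 + a = a" by transfer (simp add: max_ideal_0)
  show "- a + a = 0" by transfer (simp add: max_ideal_0)
  show "a - b = a + - b" by transfer (simp add: max_ideal_0 integers_diff)
  show "(a + b) * c = a * c + b * c"
    by transfer (simp add: distrib_right max_ideal_0 integers_add integers_mult)
  show "(0 :: residue) \<noteq> 1" by transfer (use max_ideal_uminus one_notin_max_ideal in fastforce)
qed

end

text \<open>Elements outside the integers go to the residue 0 only to make the map total.\<close>

lift_definition red :: "qbar \<Rightarrow> residue" is "\<lambda>x. if x \<in> integers then x else 0"
  by (simp add: max_ideal_0)

lemma red_eq_iff:
  assumes "x \<in> integers" "y \<in> integers"
  shows "red x = red y \<longleftrightarrow> x - y \<in> max_ideal"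
  using assms by transfer simp

lemma red_simps:
  assumes "x \<in> integers" "y \<in> integers"
  shows "red (x + y) = red x + red y" "red (x * y) = red x * red y" "red (- x) = - red x"
  using assms by (transfer; simp add: integers_add integers_mult integers_uminus max_ideal_0)+

lemma red_0_1: "red 0 = 0" "red 1 = 1" "red 2 = 0"
proof -
  show 1: "red 0 = 0" "red 1 = 1" by (transfer; simp add: max_ideal_0)+
  have "red 2 = red 0"
    using red_eq_iff[of 2 0] max_ideal_2 max_ideal_subset by auto
  then show "red 2 = 0" by (simp add: 1)
qed

lemma red_power:
  assumes "x \<in> integers"
  shows "red (x ^ n) = red x ^ n"
  by (induction n) (simp_all add: red_simps red_0_1 assms integers_power)

lemma residue_card_eq: "residue_card F = card (red ` (integers \<inter> F))"
proof -
  define r where "r = {(x, y). x \<in> integers \<inter> F \<and> y \<in> integers \<inter> F \<and> x - y \<in> max_ideal}"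
  have r: "r `` {x} = {y \<in> integers \<inter> F. red y = red x}" if "x \<in> integers \<inter> F" for x
    using that by (auto simp: r_def red_eq_iff[symmetric])
  have "bij_betw (\<lambda>a. {y \<in> integers \<inter> F. red y = a}) (red ` (integers \<inter> F)) ((integers \<inter> F) // r)"
    unfolding bij_betw_def
  proof
    show "inj_on (\<lambda>a. {y \<in> integers \<inter> F. red y = a}) (red ` (integers \<inter> F))"
      by (rule inj_onI) blast
    show "(\<lambda>a. {y \<in> integers \<inter> F. red y = a}) ` red ` (integers \<inter> F) = (integers \<inter> F) // r"
      unfolding quotient_def using r by (auto simp: image_iff)
  qed
  then show ?thesis
    unfolding residue_card_def r_def[symmetric] by (rule bij_betw_same_card[symmetric])
qed

lemma red_eq_0_iff: "x \<in> integers \<Longrightarrow> red x = 0 \<longleftrightarrow> x \<in> max_ideal"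
  using red_eq_iff[of x 0] by (simp add: red_0_1)

text \<open>A residue different from 0 comes from a unit of the integers, and the inverse of that
  unit lies in \<open>E\<close> since \<open>E\<close> is a field.\<close>

lemma residue_field_subfield:
  assumes "subfield E QBar"
  shows "Ring.field (ring_of_type_algebra\<lparr>carrier := red ` (integers \<inter> E)\<rparr>)"
proof -
  define k where "k = red ` (integers \<inter> E)"
  define R :: "residue ring" where "R = ring_of_type_algebra\<lparr>carrier := k\<rparr>"
  note E = assms[unfolded subfield_QBar_iff]
  have k: "0 \<in> k" "1 \<in> k" "\<And>a b. a \<in> k \<Longrightarrow> b \<in> k \<Longrightarrow> a + b \<in> k" "\<And>a b. a \<in> k \<Longrightarrow> b \<in> k \<Longrightarrow> a * b \<in> k"
    "\<And>a. a \<in> k \<Longrightarrow> - a \<in> k"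
  proof -
    show "0 \<in> k" unfolding k_def using E by (intro image_eqI[of _ _ 0]) (auto simp: red_0_1)
    show "1 \<in> k" unfolding k_def using E by (intro image_eqI[of _ _ 1]) (auto simp: red_0_1)
    show "- a \<in> k" if "a \<in> k" for a
      using that E unfolding k_def by (auto simp: red_simps[symmetric] integers_uminus)
    show "a + b \<in> k" "a * b \<in> k" if "a \<in> k" "b \<in> k" for a b
      using that E unfolding k_def by (auto simp: red_simps[symmetric] integers_add integers_mult)
  qed
  have inv: "\<exists>b\<in>k. a * b = 1" if a: "a \<in> k" "a \<noteq> 0" for a
  proof -
    obtain x where x: "x \<in> integers" "x \<in> E" "a = red x" using a(1) unfolding k_def by auto
    then obtain y where y: "y \<in> integers" "x * y = 1"
      using a(2) by (auto simp: red_eq_0_iff max_ideal_def)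
    then have "y = inverse x" by (metis inverse_unique)
    then have "red y \<in> k" unfolding k_def using E x y by blast
    moreover have "a * red y = 1" using x y by (metis red_simps(2) red_0_1(2))
    ultimately show ?thesis by blast
  qed
  have "cring R"
  proof (rule cringI)
    show "abelian_group R"
      by (rule abelian_groupI) (use k in \<open>auto simp: R_def ring_of_type_algebra_def algebra_simps intro!: bexI[of _ "- _"]\<close>)
    show "comm_monoid R"
      by (rule comm_monoidI) (use k in \<open>auto simp: R_def ring_of_type_algebra_def algebra_simps\<close>)
  qed (use k in \<open>auto simp: R_def ring_of_type_algebra_def algebra_simps\<close>)
  then interpret R: cring R .
  have "Ring.field R"
  proof (rule R.cring_fieldI2)
    show "\<zero>\<^bsub>R\<^esub> \<noteq> \<one>\<^bsub>R\<^esub>" by (simp add: R_def ring_of_type_algebra_def)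
    show "\<exists>b\<in>carrier R. a \<otimes>\<^bsub>R\<^esub> b = \<one>\<^bsub>R\<^esub>" if "a \<in> carrier R" "a \<noteq> \<zero>\<^bsub>R\<^esub>" for a
      using inv that by (auto simp: R_def ring_of_type_algebra_def)
  qed
  then show ?thesis unfolding R_def k_def .
qed

text \<open>A finite residue field has \<open>2 ^ b\<close> elements since its additive group has exponent 2,
  and its multiplicative group is cyclic.\<close>

lemma residue_field_finite:
  assumes E: "subfield E QBar" and fin: "residue_card E > 0"
  obtains b a where "b > 0" "residue_card E = 2 ^ b"
    "\<And>x. x \<in> integers \<inter> E \<Longrightarrow> red x ^ residue_card E = red x"
    "a \<in> integers \<inter> E" "\<And>i. red a ^ i = 1 \<longleftrightarrow> (residue_card E - 1) dvd i"
proof -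
  define k where "k = red ` (integers \<inter> E)"
  define R :: "residue ring" where "R = ring_of_type_algebra\<lparr>carrier := k\<rparr>"
  define q where "q = residue_card E"
  have q: "q = card k" by (simp add: q_def k_def residue_card_eq)
  have fink: "finite k" using fin by (metis card_ge_0_finite q q_def)
  interpret R: Ring.field R unfolding R_def k_def by (rule residue_field_subfield[OF E])
  have R_simps: "carrier R = k" "\<zero>\<^bsub>R\<^esub> = 0" "\<one>\<^bsub>R\<^esub> = 1" "a \<oplus>\<^bsub>R\<^esub> b = a + b" "a \<otimes>\<^bsub>R\<^esub> b = a * b" for a b
    by (simp_all add: R_def ring_of_type_algebra_def)
  have two: "a + a = (0 :: residue)" if "a \<in> k" for a
  proof -
    have "(1 :: residue) + 1 = red (1 + 1)" by (subst red_simps) (auto simp: red_0_1)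
    then have "(1 :: residue) + 1 = 0" by (simp add: red_0_1)
    then have "a * (1 + 1) = 0" by (simp only: mult_zero_right)
    then show ?thesis by (simp only: distrib_left mult_1_right)
  qed
  have "1 \<in> k" "0 \<in> k" using R.one_closed R.zero_closed by (simp_all add: R_simps)
  then have "card {0, 1 :: residue} \<le> q" unfolding q using fink by (intro card_mono) auto
  then have q2: "q \<ge> 2" by simp
  have pow2: "\<exists>b. q = 2 ^ b"
  proof (rule ccontr)
    assume "\<nexists>b. q = 2 ^ b"
    obtain m where m: "q = 2 ^ multiplicity 2 q * m" "odd m"
      using multiplicity_decompose'[of q 2] q2 by auto
    then have "m \<noteq> 1" using \<open>\<nexists>b. q = 2 ^ b\<close> by (metis mult_1_right)
    then obtain p where p: "Factorial_Ring.prime p" "p dvd m" by (metis prime_factor_nat)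
    have "odd p" using p(2) m(2) by (metis dvd_trans)
    have "p dvd q" using p(2) m(1) by (metis dvd_mult)
    \<comment> \<open>Sylow's theorem gives a subgroup of odd prime order \<open>p\<close> in the
      additive group; its elements are killed by 2 and by \<open>p\<close>, so all of them are
      0.\<close>
    define A where "A = add_monoid R"
    have A: "group A" "carrier A = k" "\<And>a b. a \<otimes>\<^bsub>A\<^esub> b = a + b" "\<one>\<^bsub>A\<^esub> = 0"
      using R.a_group by (simp_all add: A_def R_simps)
    have "\<exists>H. subgroup H A \<and> card H = p ^ 1"
      using p(1) \<open>p dvd q\<close> A fink by (intro sylow_thm[of p A 1 "q div p"]) (auto simp: order_def q)
    then obtain H where H: "subgroup H A" "card H = p" by auto
    interpret AH: group "A\<lparr>carrier := H\<rparr>"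
      by (rule group.subgroup_imp_group[OF A(1) H(1)])
    have AH: "x \<otimes>\<^bsub>A\<lparr>carrier := H\<rparr>\<^esub> y = x + y" "\<one>\<^bsub>A\<lparr>carrier := H\<rparr>\<^esub> = 0" for x y using A by simp_all
    have "h = 0" if h: "h \<in> H" for h
    proof -
      have hk: "h \<in> k" using subgroup.subset[OF H(1)] h A by auto
      have "h [^]\<^bsub>A\<lparr>carrier := H\<rparr>\<^esub> (2 * i) = 0" for i :: nat
      proof (induction i)
        case (Suc i)
        have "2 * Suc i = Suc (Suc (2 * i))" by simp
        then show ?case using Suc two[OF hk] by (simp add: A)
      qed (simp add: A)
      moreover obtain i where "p = 2 * i + 1" using \<open>odd p\<close> oddE by blast
      ultimately have "h [^]\<^bsub>A\<lparr>carrier := H\<rparr>\<^esub> p = h" by (simp add: A)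
      moreover have "h [^]\<^bsub>A\<lparr>carrier := H\<rparr>\<^esub> p = 0"
        using AH.pow_order_eq_1[of h] h H(2) by (simp add: order_def A)
      ultimately show ?thesis by simp
    qed
    then have "H \<subseteq> {0}" by blast
    then have "card H \<le> 1" using card_mono[of "{0}" H] by simp
    then show False using H(2) prime_gt_1_nat[OF p(1)] by simp
  qed
  then obtain b where b: "q = 2 ^ b" by blast
  then have "b > 0" using q2 by (cases b) auto
  note Multiplicative_Group.mult_of_simps [simp]
  interpret M: group "Multiplicative_Group.mult_of R" by (rule R.field_mult_group)
  have pow: "x [^]\<^bsub>Multiplicative_Group.mult_of R\<^esub> i = x ^ i" for x and i :: nat
    by (induction i) (simp_all add: R_simps mult.commute)
  have powR: "x [^]\<^bsub>R\<^esub> i = x ^ i" for x and i :: nat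
    by (induction i) (simp_all add: R_simps mult.commute)
  have cM: "carrier (Multiplicative_Group.mult_of R) = k - {0}" by (simp add: R_simps)
  have ord: "order (Multiplicative_Group.mult_of R) = q - 1"
    using fink \<open>0 \<in> k\<close> unfolding order_def cM q by simp
  have Frob: "red x ^ q = red x" if "x \<in> integers \<inter> E" for x
  proof (cases "red x = 0")
    case False
    then have "red x \<in> carrier (Multiplicative_Group.mult_of R)" using that unfolding cM k_def by blast
    then have "red x ^ (q - 1) = 1"
      using M.pow_order_eq_1[of "red x"] by (simp add: pow powR ord R_simps)
    moreover have "red x ^ q = red x * red x ^ (q - 1)" using q2 by (simp flip: power_Suc)
    ultimately show ?thesis by simp
  qed (use q2 in \<open>simp add: zero_power\<close>)
  obtain c where c: "c \<in> carrier (Multiplicative_Group.mult_of R)" "carrier (Multiplicative_Group.mult_of R) = {c [^]\<^bsub>R\<^esub> i | i :: nat. i \<in> UNIV}"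
    using R.finite_field_mult_group_has_gen fink by (auto simp: R_simps)
  have "M.ord c = q - 1"
  proof -
    have "carrier (Multiplicative_Group.mult_of R) \<subseteq> generate (Multiplicative_Group.mult_of R) {c}"
    proof
      fix x assume "x \<in> carrier (Multiplicative_Group.mult_of R)"
      then obtain i :: nat where "x = c ^ i" using c(2) by (auto simp: powR)
      then have "x = c [^]\<^bsub>Multiplicative_Group.mult_of R\<^esub> int i" using pow by (simp add: int_pow_int)
      then show "x \<in> generate (Multiplicative_Group.mult_of R) {c}" using M.generate_pow[OF c(1)] by blast
    qed
    then have "generate (Multiplicative_Group.mult_of R) {c} = carrier (Multiplicative_Group.mult_of R)"
      using M.generate_incl[of "{c}"] c(1) by auto
    then show ?thesis
      using M.generate_pow_card[OF c(1)] ord by (simp add: order_def)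
  qed
  then have c_pow: "c ^ i = 1 \<longleftrightarrow> (q - 1) dvd i" for i
    using M.pow_eq_id[OF c(1), of i] by (simp add: pow powR R_simps)
  obtain a where "a \<in> integers \<inter> E" "c = red a"
    using c(1) unfolding cM k_def by blast
  then show ?thesis
    using that[of b a] \<open>b > 0\<close> b Frob c_pow unfolding q_def by blast
qed

text \<open>Euclid's step on the exponents: subtracting \<open>2 ^ a - 1\<close> from
  \<open>2 ^ b - 1\<close> leaves \<open>2 ^ a\<close> times \<open>2 ^ (b - a) - 1\<close>, and
  \<open>2 ^ a\<close> is coprime to the divisor.\<close>

lemma pow2_minus_1_dvd_iff:
  assumes "(2 :: nat) ^ a - 1 dvd 2 ^ b - 1" "a > 0"
  shows "a dvd b"
  using assms(1)
proof (induction b rule: less_induct)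
  case (less b)
  have a2: "(2 :: nat) ^ a \<ge> 2" using assms(2) by (cases a) auto
  show ?case
  proof (cases "b < a")
    case True
    then have "(2 :: nat) ^ b < 2 ^ a" by simp
    then have "(2 :: nat) ^ b - 1 < 2 ^ a - 1" using a2 by (simp add: diff_less_mono)
    then have "(2 :: nat) ^ b - 1 = 0" using less.prems by (meson nat_dvd_not_less not_gr0)
    moreover have "(2 :: nat) ^ b \<ge> 2" if "b \<noteq> 0"
      using that by (cases b) auto
    ultimately have "b = 0" by fastforce
    then show ?thesis by simp
  next
    case False
    have "(2 :: nat) ^ b - 1 = (2 ^ (b - a) - 1) * 2 ^ a + (2 ^ a - 1)"
      using False a2 by (simp add: diff_mult_distrib flip: power_add)
    then have "(2 :: nat) ^ a - 1 dvd (2 ^ (b - a) - 1) * 2 ^ a"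
      using less.prems by (metis dvd_add_left_iff dvd_refl)
    moreover have "coprime ((2 :: nat) ^ a - 1) (2 ^ a)"
      using a2 by (metis coprime_diff_one_left_nat zero_less_power pos2)
    ultimately have "(2 :: nat) ^ a - 1 dvd 2 ^ (b - a) - 1"
      using coprime_dvd_mult_left_iff by blast
    then have "a dvd b - a" using less.IH[of "b - a"] False assms(2) by simp
    then show ?thesis using False by (metis dvd_diffD dvd_refl linorder_not_less)
  qed
qed

text \<open>Here \<open>f\<close> is the residue degree. Divisibilities are tested on generators of
  the multiplicative groups: if a power of Frobenius fixes the residues of \<open>E\<close>, the
  order of a generator divides \<open>residue_card F ^ n - 1\<close>, and this descends to the
  exponents of 2.\<close>

lemma residue_card_extension:
  assumes F: "subfield F QBar" and E: "subfield E QBar" and sub: "F \<subseteq> E" and pos: "residue_card E > 0"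
  obtains f where "residue_card F > 1" "residue_card E = residue_card F ^ f"
    "\<And>n. (\<And>x. x \<in> integers \<inter> E \<Longrightarrow> red x ^ (residue_card F ^ n) = red x) \<Longrightarrow> f dvd n"
proof -
  have "red ` (integers \<inter> F) \<subseteq> red ` (integers \<inter> E)" using sub by auto
  moreover have "finite (red ` (integers \<inter> E))"
    using pos unfolding residue_card_eq by (rule card_ge_0_finite)
  ultimately have "finite (red ` (integers \<inter> F))" by (rule finite_subset)
  moreover have "0 \<in> integers \<inter> F" using F by (simp add: subfield_QBar_iff)
  ultimately have posF: "residue_card F > 0"
    unfolding residue_card_eq by (metis card_gt_0_iff empty_iff image_is_empty)
  obtain a x where a: "a > 0" "residue_card F = 2 ^ a" "x \<in> integers \<inter> F"
    "\<And>i. red x ^ i = 1 \<longleftrightarrow> (residue_card F - 1) dvd i"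
    using residue_field_finite[OF F posF] by metis
  obtain b y where b: "b > 0" "residue_card E = 2 ^ b" "\<And>z. z \<in> integers \<inter> E \<Longrightarrow> red z ^ residue_card E = red z"
    "y \<in> integers \<inter> E" "\<And>i. red y ^ i = 1 \<longleftrightarrow> (residue_card E - 1) dvd i"
    using residue_field_finite[OF E pos] by metis
  \<comment> \<open>Division of \<open>red z ^ N = red z\<close> by \<open>red z\<close>, which is
    invertible because one of its powers is 1.\<close>
  have cancel: "red z ^ (N - 1) = 1" if "red z ^ N = red z" "N > 0" "red z ^ i = 1" "i > 0" for z N i
  proof -
    have "red z ^ (N - 1) = red z ^ (N - 1) * (red z * red z ^ (i - 1))"
      using that(3,4) by (metis mult_1_right power_Suc Suc_diff_1)
    also have "\<dots> = red z ^ N * red z ^ (i - 1)"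
      using that(2) by (metis mult.assoc power_Suc2 Suc_diff_1)
    also have "\<dots> = 1" using that by (metis power_Suc Suc_diff_1)
    finally show ?thesis .
  qed
  have two: "(2 :: nat) ^ n \<ge> 2" if "n > 0" for n :: nat using that by (cases n) auto
  have "red x ^ (2 ^ b - 1) = 1"
  proof (rule cancel[of x "2 ^ b" "2 ^ a - 1"])
    have "x \<in> integers \<inter> E" using a(3) sub by blast
    then show "red x ^ 2 ^ b = red x" using b(3) unfolding b(2) by blast
    show "red x ^ (2 ^ a - 1) = 1" using a(4)[of "2 ^ a - 1"] unfolding a(2) by simp
    show "(2 :: nat) ^ a - 1 > 0" using two[OF a(1)] by simp
  qed simp
  then have "(2 :: nat) ^ a - 1 dvd 2 ^ b - 1" using a(4) unfolding a(2) by blast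
  then have "a dvd b" using a(1) by (rule pow2_minus_1_dvd_iff)
  then obtain f where f: "b = a * f" by (elim dvdE)
  have "f dvd n" if n: "\<And>z. z \<in> integers \<inter> E \<Longrightarrow> red z ^ (residue_card F ^ n) = red z" for n
  proof -
    have "red y ^ (2 ^ (a * n) - 1) = 1"
    proof (rule cancel[of y "2 ^ (a * n)" "2 ^ b - 1"])
      show "red y ^ 2 ^ (a * n) = red y" using n[OF b(4)] unfolding a(2) power_mult .
      show "red y ^ (2 ^ b - 1) = 1" using b(5)[of "2 ^ b - 1"] unfolding b(2) by simp
      show "(2 :: nat) ^ b - 1 > 0" using two[OF b(1)] by simp
    qed simp
    then have "(2 :: nat) ^ b - 1 dvd 2 ^ (a * n) - 1" using b(5) unfolding b(2) by blast
    then have "b dvd a * n" using b(1) by (rule pow2_minus_1_dvd_iff)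
    then show ?thesis using f a(1) by simp
  qed
  moreover have "residue_card F > 1" using two[OF a(1)] a(2) by simp
  moreover have "residue_card E = residue_card F ^ f" using a(2) b(2) f by (simp add: power_mult)
  ultimately show ?thesis using that by blast
qed

section \<open>Extension of field homomorphisms\<close>

abbreviation poly_over :: "'a::comm_ring_1 set \<Rightarrow> 'a poly \<Rightarrow> bool" where
  "poly_over D p \<equiv> \<forall>i. Polynomial.coeff p i \<in> D"

definition subring_of :: "'a::comm_ring_1 set \<Rightarrow> bool" where
  "subring_of D \<longleftrightarrow> 0 \<in> D \<and> 1 \<in> D \<and> (\<forall>x\<in>D. \<forall>y\<in>D. x + y \<in> D \<and> x * y \<in> D) \<and> (\<forall>x\<in>D. - x \<in> D)"

lemma subring_ofD:
  assumes "subring_of D"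
  shows "0 \<in> D" "1 \<in> D" "x \<in> D \<Longrightarrow> y \<in> D \<Longrightarrow> x + y \<in> D" "x \<in> D \<Longrightarrow> y \<in> D \<Longrightarrow> x * y \<in> D"
    "x \<in> D \<Longrightarrow> - x \<in> D" "x \<in> D \<Longrightarrow> y \<in> D \<Longrightarrow> x - y \<in> D" "x \<in> D \<Longrightarrow> x ^ n \<in> D"
    "(\<And>i. i \<in> I \<Longrightarrow> f i \<in> D) \<Longrightarrow> sum f I \<in> D"
proof -
  show *: "0 \<in> D" "1 \<in> D" "x \<in> D \<Longrightarrow> y \<in> D \<Longrightarrow> x + y \<in> D" "x \<in> D \<Longrightarrow> y \<in> D \<Longrightarrow> x * y \<in> D"
    "x \<in> D \<Longrightarrow> - x \<in> D" for x y
    using assms unfolding subring_of_def by blast+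
  show "x \<in> D \<Longrightarrow> y \<in> D \<Longrightarrow> x - y \<in> D" using *(3)[of x "- y"] *(5)[of y] by simp
  show "x \<in> D \<Longrightarrow> x ^ n \<in> D" by (induction n) (auto intro: *)
  show "(\<And>i. i \<in> I \<Longrightarrow> f i \<in> D) \<Longrightarrow> sum f I \<in> D"
    by (induction I rule: infinite_finite_induct) (auto intro: *)
qed

lemma poly_over_arith:
  assumes D: "subring_of D" and p: "poly_over D p" and q: "poly_over D q"
  shows "poly_over D (p + q)" "poly_over D (p * q)" "poly_over D (- p)" "poly_over D (p - q)"
  using p q by (auto simp: coeff_mult intro!: subring_ofD[OF D])

lemma poly_over_basic:
  assumes D: "subring_of D"
  shows "poly_over D 0" "poly_over D 1" "x \<in> D \<Longrightarrow> poly_over D [:x:]" "poly_over D [:0, 1:]"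
    "x \<in> D \<Longrightarrow> poly_over D (Polynomial.monom x n)" "x \<in> D \<Longrightarrow> poly_over D p \<Longrightarrow> poly_over D (pCons x p)"
  using subring_ofD(1,2)[OF D]
  by (auto simp: coeff_pCons coeff_1 coeff_monom split: nat.splits)

lemma poly_over_eval:
  assumes "subring_of D" "poly_over D p" "x \<in> D"
  shows "poly p x \<in> D"
  unfolding poly_altdef using assms by (intro subring_ofD(8) subring_ofD(4) subring_ofD(7)) auto

definition hom_on :: "'a::comm_ring_1 set \<Rightarrow> ('a \<Rightarrow> 'a) \<Rightarrow> bool" where
  "hom_on D f \<longleftrightarrow> f 0 = 0 \<and> f 1 = 1 \<and> (\<forall>x\<in>D. \<forall>y\<in>D. f (x + y) = f x + f y \<and> f (x * y) = f x * f y)"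

lemma hom_on_sum:
  assumes "subring_of D" "hom_on D f" "\<And>i. i \<in> I \<Longrightarrow> g i \<in> D"
  shows "f (sum g I) = (\<Sum>i\<in>I. f (g i))"
  using assms(3)
proof (induction I rule: infinite_finite_induct)
  case (insert i I)
  then have "sum g I \<in> D" by (intro subring_ofD(8)[OF assms(1)]) auto
  then show ?case using insert assms(2) by (simp add: hom_on_def)
qed (use assms(2) in \<open>auto simp: hom_on_def\<close>)

lemma map_poly_hom_on:
  assumes D: "subring_of D" and f: "hom_on D f" and p: "poly_over D p" and q: "poly_over D q"
  shows "map_poly f (p + q) = map_poly f p + map_poly f q"
    "map_poly f (p * q) = map_poly f p * map_poly f q"
proof -
  have f0: "f 0 = 0" using f by (simp add: hom_on_def)
  show "map_poly f (p + q) = map_poly f p + map_poly f q"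
    using f p q by (intro poly_eqI) (simp add: coeff_map_poly f0 hom_on_def)
  show "map_poly f (p * q) = map_poly f p * map_poly f q"
  proof (rule poly_eqI)
    fix n
    have "f (\<Sum>i\<le>n. Polynomial.coeff p i * Polynomial.coeff q (n - i)) =
        (\<Sum>i\<le>n. f (Polynomial.coeff p i * Polynomial.coeff q (n - i)))"
      using p q by (intro hom_on_sum[OF D f] subring_ofD(4)[OF D]) auto
    also have "\<dots> = (\<Sum>i\<le>n. f (Polynomial.coeff p i) * f (Polynomial.coeff q (n - i)))"
      using f p q by (simp add: hom_on_def)
    finally show "Polynomial.coeff (map_poly f (p * q)) n = Polynomial.coeff (map_poly f p * map_poly f q) n"
      by (simp add: coeff_map_poly f0 coeff_mult)
  qed
qed

text \<open>Because \<open>m\<close> is monic no coefficient has to be inverted, so quotient and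
  remainder stay over the subring.\<close>

lemma poly_over_division:
  fixes m :: "'a::field poly"
  assumes D: "subring_of D" and m: "poly_over D m" "Polynomial.lead_coeff m = 1" and p: "poly_over D p"
  obtains q r where "poly_over D q" "poly_over D r" "p = m * q + r"
    "r = 0 \<or> Polynomial.degree r < Polynomial.degree m"
proof -
  have "\<exists>q r. poly_over D q \<and> poly_over D r \<and> p = m * q + r \<and>
    (r = 0 \<or> Polynomial.degree r < Polynomial.degree m)"
    using p
  proof (induction "Polynomial.degree p" arbitrary: p rule: less_induct)
    case less
    show ?case
    proof (cases "p = 0 \<or> Polynomial.degree p < Polynomial.degree m")
      case True
      then show ?thesis using less.prems poly_over_basic(1)[OF D]
        by (intro exI[of _ 0] exI[of _ p]) auto
    next
      case False
      define c where "c = Polynomial.lead_coeff p"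
      define t where "t = Polynomial.monom c (Polynomial.degree p - Polynomial.degree m)"
      have t: "poly_over D t" unfolding t_def using less.prems by (intro poly_over_basic[OF D]) (simp add: c_def)
      have c0: "c \<noteq> 0" using False by (simp add: c_def)
      have m0: "m \<noteq> 0" using m(2) by auto
      have degmt: "Polynomial.degree (m * t) = Polynomial.degree p"
      proof -
        have "t \<noteq> 0" using c0 by (simp add: t_def monom_eq_0_iff)
        then have "Polynomial.degree (m * t) = Polynomial.degree m + Polynomial.degree t"
          by (rule degree_mult_eq[OF m0])
        also have "Polynomial.degree t = Polynomial.degree p - Polynomial.degree m"
          unfolding t_def using c0 by (rule degree_monom_eq)
        finally show ?thesis using False by simp
      qed
      have lc: "Polynomial.lead_coeff (m * t) = c"
        by (simp only: lead_coeff_mult m(2) t_def lead_coeff_monom mult_1_left)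
      have po: "poly_over D (p - m * t)"
        by (intro poly_over_arith(4)[OF D] poly_over_arith(2)[OF D]) (use less.prems m t in auto)
      show ?thesis
      proof (cases "p - m * t = 0 \<or> Polynomial.degree p = 0")
        case True
        then have "p - m * t = 0"
        proof
          assume dp: "Polynomial.degree p = 0"
          then obtain a b where ab: "p = [:a:]" "m * t = [:b:]" using degmt by (metis degree_eq_zeroE)
          then have "a = b" using lc c_def by simp
          then show ?thesis using ab by simp
        qed auto
        then show ?thesis using t poly_over_basic(1)[OF D] by (intro exI[of _ t] exI[of _ 0]) auto
      next
        case False
        have "Polynomial.degree (p - m * t) < Polynomial.degree p"
        proof -
          have "Polynomial.degree (p - m * t) \<le> Polynomial.degree p"
            using degmt by (intro degree_diff_le) auto
          moreover have "Polynomial.coeff (p - m * t) (Polynomial.degree p) = 0"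
            using lc degmt c_def by simp
          ultimately show ?thesis using False by (metis le_neq_implies_less leading_coeff_0_iff)
        qed
        then obtain q r where qr: "poly_over D q" "poly_over D r" "p - m * t = m * q + r"
          "r = 0 \<or> Polynomial.degree r < Polynomial.degree m"
          using less.hyps[OF _ po] by blast
        then have "p = m * (t + q) + r" by (simp add: algebra_simps)
        then show ?thesis using qr t poly_over_arith(1)[OF D t qr(1)]
          by (intro exI[of _ "t + q"] exI[of _ r]) auto
      qed
    qed
  qed
  then show ?thesis using that by blast
qed

definition algebraic_over :: "'a::field set \<Rightarrow> 'a \<Rightarrow> bool" where
  "algebraic_over D x \<longleftrightarrow> (\<exists>p. p \<noteq> 0 \<and> poly_over D p \<and> poly p x = 0)"

text \<open>Division with remainder turns minimality of the degree into the divisibility criterion,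
  which takes the place of irreducibility in what follows.\<close>

lemma min_poly_exists:
  assumes D: "subring_of D" "\<And>x. x \<in> D \<Longrightarrow> inverse x \<in> D" and x: "algebraic_over D x"
  obtains m where "poly_over D m" "Polynomial.lead_coeff m = 1" "Polynomial.degree m > 0"
    "\<And>p. poly_over D p \<Longrightarrow> poly p x = 0 \<longleftrightarrow> (\<exists>q. poly_over D q \<and> p = m * q)"
proof -
  define P where "P m \<longleftrightarrow> m \<noteq> 0 \<and> poly_over D m \<and> poly m x = 0" for m
  obtain m0 where m0: "P m0" "\<And>m'. Polynomial.degree m' < Polynomial.degree m0 \<Longrightarrow> \<not> P m'"
    using x ex_has_least_nat[of P _ Polynomial.degree] unfolding algebraic_over_def P_def[symmetric]
    by (metis not_less)
  define m where "m = [:inverse (Polynomial.lead_coeff m0):] * m0"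
  have c: "inverse (Polynomial.lead_coeff m0) \<noteq> 0" using m0(1) by (simp add: P_def)
  have pm: "poly_over D m"
    unfolding m_def using m0(1) by (intro poly_over_arith(2)[OF D(1)] poly_over_basic(3)[OF D(1)] D(2)) (auto simp: P_def)
  have lm: "Polynomial.lead_coeff m = 1"
    unfolding m_def using m0(1) by (simp add: P_def)
  have dm: "Polynomial.degree m = Polynomial.degree m0" unfolding m_def using c by simp
  have xm: "poly m x = 0" unfolding m_def using m0(1) by (simp add: P_def)
  have "Polynomial.degree m > 0"
  proof (rule ccontr)
    assume "\<not> Polynomial.degree m > 0"
    then obtain a where "m = [:a:]" by (auto elim: degree_eq_zeroE)
    then show False using lm xm by simp
  qed
  moreover have "poly p x = 0 \<longleftrightarrow> (\<exists>q. poly_over D q \<and> p = m * q)" if p: "poly_over D p" for p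
  proof
    assume px: "poly p x = 0"
    obtain q r where qr: "poly_over D q" "poly_over D r" "p = m * q + r"
      "r = 0 \<or> Polynomial.degree r < Polynomial.degree m"
      using poly_over_division[OF D(1) pm lm p] by blast
    then have "poly r x = 0" using px xm by simp
    then have "r = 0" using m0(2)[of r] qr(2,4) dm unfolding P_def by auto
    then show "\<exists>q. poly_over D q \<and> p = m * q" using qr by auto
  qed (use xm in auto)
  ultimately show ?thesis using that pm lm by blast
qed

text \<open>The element \<open>poly p x\<close> is sent to the value at \<open>z\<close> of the
  image of \<open>p\<close>. Two choices of \<open>p\<close> differ by a multiple of
  \<open>m\<close>, whose image vanishes at \<open>z\<close>, so this is well defined.\<close>

lemma hom_on_adjoin:
  fixes f :: "'a::field \<Rightarrow> 'a"
  assumes D: "subring_of D" and f: "hom_on D f"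
    and m: "poly_over D m" "\<And>p. poly_over D p \<Longrightarrow> poly p x = 0 \<longleftrightarrow> (\<exists>q. poly_over D q \<and> p = m * q)"
    and z: "poly (map_poly f m) z = 0"
  obtains D' g where "subring_of D'" "hom_on D' g" "D \<subseteq> D'" "x \<in> D'" "\<And>y. y \<in> D \<Longrightarrow> g y = f y" "g x = z"
proof -
  define D' where "D' = {poly p x |p. poly_over D p}"
  have wd: "poly (map_poly f p) z = poly (map_poly f q) z"
    if "poly_over D p" "poly_over D q" "poly p x = poly q x" for p q
  proof -
    have "poly_over D (p - q)" using that(1,2) by (intro poly_over_arith(4)[OF D])
    moreover have "poly (p - q) x = 0" using that(3) by simp
    ultimately obtain r where r: "poly_over D r" "p - q = m * r" using m(2) by blast
    have "map_poly f p = map_poly f (q + m * r)" using r(2) by (simp flip: r(2))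
    also have "\<dots> = map_poly f q + map_poly f m * map_poly f r"
      using that m(1) r(1) poly_over_arith(2)[OF D m(1) r(1)] by (simp add: map_poly_hom_on[OF D f])
    finally show ?thesis using z by simp
  qed
  define g where "g y = poly (map_poly f (SOME p. poly_over D p \<and> poly p x = y)) z" for y
  have g: "g (poly p x) = poly (map_poly f p) z" if "poly_over D p" for p
  proof -
    have "poly_over D (SOME q. poly_over D q \<and> poly q x = poly p x) \<and> poly (SOME q. poly_over D q \<and> poly q x = poly p x) x = poly p x"
      by (rule someI[of "\<lambda>q. poly_over D q \<and> poly q x = poly p x" p]) (use that in auto)
    then show ?thesis unfolding g_def using that by (intro wd) auto
  qed
  have f01: "f 0 = 0" "f 1 = 1" using f by (auto simp: hom_on_def)
  have const: "y \<in> D' \<and> g y = f y" if "y \<in> D" for y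
  proof -
    have "poly [:y:] x = y" "poly_over D [:y:]" using poly_over_basic(3)[OF D that] by simp_all
    then show ?thesis using g[of "[:y:]"] unfolding D'_def by (auto simp: map_poly_pCons f01 intro: exI[of _ "[:y:]"])
  qed
  have X: "poly [:0, 1:] x = x" "poly_over D [:0, 1:]" using poly_over_basic(4)[OF D] by simp_all
  have "x \<in> D'" unfolding D'_def using X by force
  moreover have "g x = z" using g[OF X(2)] by (simp add: map_poly_pCons f01)
  moreover have "subring_of D'"
  proof -
    have z: "0 \<in> D'" "1 \<in> D'" using const subring_ofD(1,2)[OF D] by auto
    have c: "a + b \<in> D'" "a * b \<in> D'" "- a \<in> D'" if "a \<in> D'" "b \<in> D'" for a b
    proof -
      from that obtain p q where pq: "poly_over D p" "poly_over D q" and ab: "a = poly p x" "b = poly q x"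
        by (auto simp: D'_def)
      show "a + b \<in> D'" unfolding D'_def using poly_over_arith(1)[OF D pq]
        by (intro CollectI exI[of _ "p + q"]) (simp add: ab)
      show "a * b \<in> D'" unfolding D'_def using poly_over_arith(2)[OF D pq]
        by (intro CollectI exI[of _ "p * q"]) (simp add: ab)
      show "- a \<in> D'" unfolding D'_def using poly_over_arith(3)[OF D pq]
        by (intro CollectI exI[of _ "- p"]) (simp add: ab)
    qed
    show ?thesis unfolding subring_of_def by (intro conjI ballI z c)
  qed
  moreover have "hom_on D' g"
  proof -
    have h: "g (a + b) = g a + g b \<and> g (a * b) = g a * g b" if "a \<in> D'" "b \<in> D'" for a b
    proof -
      from that obtain p q where pq: "poly_over D p" "poly_over D q" "a = poly p x" "b = poly q x" by (auto simp: D'_def)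
      show ?thesis
        using g[OF poly_over_arith(1)[OF D pq(1,2)]] g[OF poly_over_arith(2)[OF D pq(1,2)]] g[OF pq(1)] g[OF pq(2)]
        by (simp add: pq(3,4) map_poly_hom_on[OF D f pq(1,2)])
    qed
    have "g 0 = 0" "g 1 = 1" using const[of 0] const[of 1] subring_ofD(1,2)[OF D] f01 by auto
    then show ?thesis unfolding hom_on_def by (intro conjI ballI h[THEN conjunct1] h[THEN conjunct2])
  qed
  moreover have "D \<subseteq> D'" using const by blast
  moreover have "g y = f y" if "y \<in> D" for y using const[OF that] by blast
  ultimately show ?thesis by (intro that)
qed

text \<open>The minimal equation of a nonzero \<open>y\<close> has nonzero constant term and can be
  solved for the inverse. A maximal domain of definition of a homomorphism is therefore again a
  field.\<close>

lemma inverse_in_subring: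
  fixes y :: "'a::field"
  assumes F: "subring_of F" "\<And>x. x \<in> F \<Longrightarrow> inverse x \<in> F" and D: "subring_of D" "F \<subseteq> D"
    and y: "y \<in> D" "algebraic_over F y"
  shows "inverse y \<in> D"
proof (cases "y = 0")
  case False
  obtain m where m: "poly_over F m" "Polynomial.lead_coeff m = 1" "Polynomial.degree m > 0"
    "\<And>p. poly_over F p \<Longrightarrow> poly p y = 0 \<longleftrightarrow> (\<exists>q. poly_over F q \<and> p = m * q)"
    using min_poly_exists[OF F y(2)] by blast
  obtain a m' where am: "m = pCons a m'" by (cases m)
  have "poly m y = 0" using m(4)[OF m(1)] poly_over_basic(2)[OF F(1)] by (metis mult_1_right)
  then have eq: "a + y * poly m' y = 0" by (simp add: am)
  have aF: "a \<in> F" using m(1)[rule_format, of 0] by (simp add: am)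
  have "Polynomial.coeff m' i \<in> F" for i using m(1)[rule_format, of "Suc i"] by (simp add: am)
  then have m'F: "poly_over F m'" by blast
  have "a \<noteq> 0"
  proof
    assume "a = 0"
    then have "poly m' y = 0" using eq False by simp
    then obtain q where q: "m' = m * q" using m(4)[OF m'F] by blast
    have "m' \<noteq> 0" using m(3) am by auto
    then have "Polynomial.degree m \<le> Polynomial.degree m'" using q by (metis dvd_imp_degree_le dvd_triv_left)
    then show False using am m(3) \<open>m' \<noteq> 0\<close> by simp
  qed
  moreover have "y * poly m' y = - a" using eq by (simp add: add_eq_0_iff)
  moreover have "y * (- (inverse a * poly m' y)) = - (inverse a * (y * poly m' y))" by (simp add: algebra_simps)
  ultimately have "y * (- (inverse a * poly m' y)) = 1" by simp
  then have "inverse y = - (inverse a * poly m' y)" by (rule inverse_unique)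
  moreover have "- (inverse a * poly m' y) \<in> D"
    using F(2)[OF aF] D(2) m'F by (intro subring_ofD(5)[OF D(1)] subring_ofD(4)[OF D(1)] poly_over_eval[OF D(1) _ y(1)]) auto
  ultimately show ?thesis by simp
qed (use D subring_ofD(1) in auto)

text \<open>Partial homomorphisms are ordered as graphs, so that extension is inclusion and unions
  of chains are upper bounds.\<close>

definition hom_graph :: "'a::comm_ring_1 set \<Rightarrow> ('a \<Rightarrow> 'a) \<Rightarrow> ('a \<times> 'a) set" where
  "hom_graph D f = {(x, f x) |x. x \<in> D}"

definition graph_ok :: "('a::comm_ring_1 \<times> 'a) set \<Rightarrow> bool" where
  "graph_ok \<Gamma> \<longleftrightarrow> (0, 0) \<in> \<Gamma> \<and> (1, 1) \<in> \<Gamma> \<and>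
     (\<forall>x y x' y'. (x, y) \<in> \<Gamma> \<longrightarrow> (x', y') \<in> \<Gamma> \<longrightarrow> (x + x', y + y') \<in> \<Gamma> \<and> (x * x', y * y') \<in> \<Gamma> \<and> (- x, - y) \<in> \<Gamma> \<and>
       (x = x' \<longrightarrow> y = y'))"

lemma graph_ok_hom_graph:
  assumes "subring_of D" "hom_on D f"
  shows "graph_ok (hom_graph D f)"
proof -
  have "f (- x) = - f x" if "x \<in> D" for x
  proof -
    have "f (x + - x) = f x + f (- x)" "f 0 = 0"
      using assms that subring_ofD(5)[OF assms(1)] unfolding hom_on_def by blast+
    then show ?thesis by (simp add: eq_neg_iff_add_eq_0 add.commute)
  qed
  then show ?thesis
    using assms subring_ofD(1-5)[OF assms(1)] unfolding graph_ok_def hom_graph_def hom_on_def by auto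
qed

lemma graph_okD:
  assumes "graph_ok \<Gamma>"
  obtains g where "subring_of (Domain \<Gamma>)" "hom_on (Domain \<Gamma>) g" "\<Gamma> = hom_graph (Domain \<Gamma>) g"
proof -
  have "\<forall>x\<in>Domain \<Gamma>. \<exists>y. (x, y) \<in> \<Gamma>" by blast
  then obtain g where g: "\<And>x. x \<in> Domain \<Gamma> \<Longrightarrow> (x, g x) \<in> \<Gamma>" by (auto dest!: bchoice)
  have u: "y = g x" if "(x, y) \<in> \<Gamma>" for x y
    using assms that g[of x] unfolding graph_ok_def by blast
  have z: "(0, 0) \<in> \<Gamma>" "(1, 1) \<in> \<Gamma>" using assms by (auto simp: graph_ok_def)
  have c: "(x + x', y + y') \<in> \<Gamma>" "(x * x', y * y') \<in> \<Gamma>" "(- x, - y) \<in> \<Gamma>" if "(x, y) \<in> \<Gamma>" "(x', y') \<in> \<Gamma>" for x y x' y'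
    using assms that unfolding graph_ok_def by blast+
  have "subring_of (Domain \<Gamma>)"
    unfolding subring_of_def using z c by (auto intro!: DomainI simp: Domain_iff) (metis c)+
  moreover have "hom_on (Domain \<Gamma>) g"
  proof -
    have "g (x + y) = g x + g y" "g (x * y) = g x * g y" if "x \<in> Domain \<Gamma>" "y \<in> Domain \<Gamma>" for x y
      using u[OF c(1)[OF g[OF that(1)] g[OF that(2)]]] u[OF c(2)[OF g[OF that(1)] g[OF that(2)]]] by simp_all
    then show ?thesis unfolding hom_on_def using u[OF z(1)] u[OF z(2)] by simp
  qed
  moreover have "\<Gamma> = hom_graph (Domain \<Gamma>) g"
    unfolding hom_graph_def using g u by auto
  ultimately show ?thesis using that by blast
qed

lemma hom_on_poly:
  assumes D: "subring_of D" and f: "hom_on D f" and p: "poly_over D p" and x: "x \<in> D"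
  shows "f (poly p x) = poly (map_poly f p) (f x)"
  using p
proof (induction p)
  case 0
  then show ?case using f by (simp add: hom_on_def)
next
  case (pCons a p)
  have a: "a \<in> D" using pCons.prems[rule_format, of 0] by simp
  have "Polynomial.coeff p i \<in> D" for i using pCons.prems[rule_format, of "Suc i"] by simp
  then have p: "poly_over D p" by blast
  have "poly p x \<in> D" using poly_over_eval[OF D p x] .
  then show ?case
    using pCons.IH[OF p] f a x subring_ofD(4)[OF D x] pCons.hyps
    by (simp add: hom_on_def map_poly_pCons)
qed

text \<open>The ring homomorphisms defined on subrings form an inductive order, and a maximal one is
  defined everywhere, since it could otherwise be extended by adjoining one more element.\<close>

lemma hom_on_extends:
  fixes f :: "'a::alg_closed_field \<Rightarrow> 'a"
  assumes F: "subring_of F" "\<And>x. x \<in> F \<Longrightarrow> inverse x \<in> F" "\<And>x. algebraic_over F x"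
    and D: "subring_of D" "F \<subseteq> D" and f: "hom_on D f" "\<And>x. x \<in> F \<Longrightarrow> f x = x"
  obtains g where "bij g" "\<And>x y. g (x + y) = g x + g y" "\<And>x y. g (x * y) = g x * g y"
    "\<And>x. x \<in> D \<Longrightarrow> g x = f x"
proof -
  define \<A> where "\<A> = {\<Gamma>. graph_ok \<Gamma> \<and> hom_graph D f \<subseteq> \<Gamma>}"
  have "\<exists>M\<in>\<A>. \<forall>Y\<in>\<A>. M \<subseteq> Y \<longrightarrow> Y = M"
  proof (rule subset_Zorn_nonempty)
    show "\<A> \<noteq> {}" using graph_ok_hom_graph[OF D(1) f(1)] by (auto simp: \<A>_def)
    fix \<C> assume ne: "\<C> \<noteq> {}" and chain: "subset.chain \<A> \<C>"
    have ok: "graph_ok \<Gamma>" "hom_graph D f \<subseteq> \<Gamma>" if "\<Gamma> \<in> \<C>" for \<Gamma>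
      using chain that by (auto simp: subset.chain_def \<A>_def)
    have both: "\<exists>\<Gamma>\<in>\<C>. a \<in> \<Gamma> \<and> b \<in> \<Gamma>" if "a \<in> \<Union>\<C>" "b \<in> \<Union>\<C>" for a b
      using chain that unfolding subset_chain_def by blast
    have "graph_ok (\<Union>\<C>)"
      unfolding graph_ok_def
    proof (intro conjI allI impI)
      show "(0, 0) \<in> \<Union>\<C>" "(1, 1) \<in> \<Union>\<C>" using ne ok(1) unfolding graph_ok_def by blast+
      fix x y x' y' assume "(x, y) \<in> \<Union>\<C>" "(x', y') \<in> \<Union>\<C>"
      then obtain \<Gamma> where G: "\<Gamma> \<in> \<C>" "(x, y) \<in> \<Gamma>" "(x', y') \<in> \<Gamma>" using both by blast
      note c = ok(1)[OF G(1), unfolded graph_ok_def, THEN conjunct2, THEN conjunct2, rule_format, OF G(2,3)]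
      show "(x + x', y + y') \<in> \<Union>\<C>" "(x * x', y * y') \<in> \<Union>\<C>" "(- x, - y) \<in> \<Union>\<C>" using c G(1) by blast+
      show "y = y'" if "x = x'" using c that by blast
    qed
    moreover have "hom_graph D f \<subseteq> \<Union>\<C>" using ne ok(2) by blast
    ultimately show "\<Union>\<C> \<in> \<A>" by (simp add: \<A>_def)
  qed
  then obtain M where "M \<in> \<A>" and max: "\<And>Y. Y \<in> \<A> \<Longrightarrow> M \<subseteq> Y \<Longrightarrow> Y = M"
    by blast
  then have M: "graph_ok M" "hom_graph D f \<subseteq> M" by (simp_all add: \<A>_def)
  have M_max: "Y = M" if "graph_ok Y" "M \<subseteq> Y" for Y
    using max[of Y] that M(2) by (simp add: \<A>_def)
  obtain g where g: "subring_of (Domain M)" "hom_on (Domain M) g" "M = hom_graph (Domain M) g"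
    using graph_okD[OF M(1)] by blast
  have gf: "x \<in> Domain M \<and> g x = f x" if "x \<in> D" for x
  proof -
    have "(x, f x) \<in> M" using M(2) that by (auto simp: hom_graph_def)
    then have "(x, f x) \<in> hom_graph (Domain M) g" by (subst g(3)[symmetric])
    then show ?thesis by (auto simp: hom_graph_def)
  qed
  have FM: "F \<subseteq> Domain M" using D(2) gf by blast
  have alg: "algebraic_over (Domain M) x" for x
    using F(3)[of x] FM unfolding algebraic_over_def by blast
  have "x \<in> Domain M" for x
  proof -
    obtain m where m: "poly_over (Domain M) m" "Polynomial.lead_coeff m = 1" "Polynomial.degree m > 0"
      "\<And>p. poly_over (Domain M) p \<Longrightarrow> poly p x = 0 \<longleftrightarrow> (\<exists>q. poly_over (Domain M) q \<and> p = m * q)"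
      using min_poly_exists[OF g(1) inverse_in_subring[OF F(1,2) g(1) FM _ F(3)] alg] by metis
    have g01: "g 0 = 0" "g 1 = 1" using g(2) by (auto simp: hom_on_def)
    have "Polynomial.coeff (map_poly g m) (Polynomial.degree m) = 1"
      using m(2) g01 by (simp add: coeff_map_poly)
    then have "Polynomial.degree (map_poly g m) > 0"
      using m(3) by (metis le_degree less_le_trans zero_neq_one)
    then obtain z where z: "poly (map_poly g m) z = 0" using alg_closed_imp_poly_has_root by blast
    obtain D' h where h: "subring_of D'" "hom_on D' h" "Domain M \<subseteq> D'" "x \<in> D'" "\<And>y. y \<in> Domain M \<Longrightarrow> h y = g y"
      using hom_on_adjoin[OF g(1,2) m(1,4) z] by metis
    have "M \<subseteq> hom_graph D' h"
    proof
      fix a assume "a \<in> M"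
      then have "a \<in> hom_graph (Domain M) g" by (subst g(3)[symmetric])
      then obtain x where x: "x \<in> Domain M" "a = (x, g x)" unfolding hom_graph_def by blast
      then have "x \<in> D'" "h x = g x" using h(3,5) by auto
      then show "a \<in> hom_graph D' h" by (simp add: hom_graph_def x(2))
    qed
    then have "hom_graph D' h = M" using graph_ok_hom_graph[OF h(1,2)] by (intro M_max)
    then show ?thesis using h(4) by (auto simp: hom_graph_def)
  qed
  then have UNIV: "Domain M = UNIV" by blast
  have hom: "g (x + y) = g x + g y" "g (x * y) = g x * g y" "g 0 = 0" "g 1 = 1" for x y
    using g(2) by (auto simp: UNIV hom_on_def)
  have g0: "x = 0" if "g x = 0" for x
  proof (rule ccontr)
    assume "x \<noteq> 0"
    then have "g (x * inverse x) = 1" using hom(4) by simp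
    then show False using hom(2)[of x "inverse x"] that by simp
  qed
  have inj: "inj g"
  proof (rule injI)
    fix x y assume "g x = g y"
    moreover have "g (x - y) + g y = g x" using hom(1)[of "x - y" y] by simp
    ultimately show "x = y" using g0[of "x - y"] by simp
  qed
  have "\<exists>x. g x = y" for y
  proof -
    obtain p where p: "p \<noteq> 0" "poly_over F p" "poly p y = 0"
      using F(3)[of y] unfolding algebraic_over_def by blast
    have "map_poly g p = p"
    proof (rule poly_eqI)
      fix i show "Polynomial.coeff (map_poly g p) i = Polynomial.coeff p i"
        using gf[of "Polynomial.coeff p i"] f(2)[of "Polynomial.coeff p i"] p(2) D(2) hom(3)
        by (auto simp: coeff_map_poly)
    qed
    then have root: "poly p (g x) = g (poly p x)" for x
      using hom_on_poly[OF g(1,2), of p x] by (simp add: UNIV)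
    \<comment> \<open>The coefficients of \<open>p\<close> are fixed, so \<open>g\<close> maps the
      finite set of roots to itself, and injectivity makes it a permutation of them.\<close>
    have "g ` {x. poly p x = 0} = {x. poly p x = 0}"
    proof (rule endo_inj_surj)
      show "finite {x. poly p x = 0}" using p(1) by (rule poly_roots_finite)
      show "g ` {x. poly p x = 0} \<subseteq> {x. poly p x = 0}" using root hom(3) by auto
      show "inj_on g {x. poly p x = 0}" using inj by (rule inj_on_subset) simp
    qed
    then have "y \<in> g ` {x. poly p x = 0}" using p(3) by simp
    then show ?thesis by auto
  qed
  then have "bij g" using inj by (metis bijI surjI surj_def)
  then show ?thesis using that hom gf by blast
qed

section \<open>Galois theory of the algebraic closure over fields containing
  \<open>Q2\<close>\<close>

lemma subfield_subring_of:
  assumes "subfield F QBar"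
  shows "subring_of F" "\<And>x. x \<in> F \<Longrightarrow> inverse x \<in> F"
  using assms by (auto simp: subfield_QBar_iff subring_of_def)

lemma algebraic_over_Q2:
  assumes "Q2 \<subseteq> F"
  shows "algebraic_over F x"
proof -
  obtain p where "p \<noteq> 0" "poly (map_poly to_ac p) x = 0" by (rule alg_closure_algebraic)
  then show ?thesis
    unfolding algebraic_over_def using assms
    by (intro exI[of _ "map_poly to_ac p"]) (auto simp: coeff_map_poly Q2_def map_poly_eq_0_iff)
qed

lemma galois_group_UNIV:
  "\<sigma> \<in> carrier (galois_group UNIV F) \<longleftrightarrow> bij \<sigma> \<and> (\<forall>x y. \<sigma> (x + y) = \<sigma> x + \<sigma> y) \<and>
     (\<forall>x y. \<sigma> (x * y) = \<sigma> x * \<sigma> y) \<and> (\<forall>x\<in>F. \<sigma> x = x)"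
  by (auto simp: galois_group_def extensional_def)

text \<open>Separability in characteristic 0: with \<open>x\<close> as its only root,
  \<open>m\<close> would be a power of a linear factor. Exponent 1 puts \<open>x\<close> into
  \<open>F\<close>; a higher exponent makes the derivative vanish at \<open>x\<close>, hence a
  multiple of \<open>m\<close> of smaller degree.\<close>

lemma min_poly_other_root:
  fixes x :: "'a::{alg_closed_field, field_char_0}"
  assumes F: "subring_of F" and x: "x \<notin> F" and m: "poly_over F m" "Polynomial.lead_coeff m = 1" "Polynomial.degree m > 0"
    "\<And>p. poly_over F p \<Longrightarrow> poly p x = 0 \<longleftrightarrow> (\<exists>q. poly_over F q \<and> p = m * q)"
  obtains z where "z \<noteq> x" "poly m z = 0"
proof -
  have "\<exists>z. z \<noteq> x \<and> poly m z = 0"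
  proof (rule ccontr)
    assume "\<nexists>z. z \<noteq> x \<and> poly m z = 0"
    then have only: "z = x" if "poly m z = 0" for z using that by blast
    have m0: "m \<noteq> 0" using m(3) by auto
    obtain A where A: "size A = Polynomial.degree m" "m = Polynomial.smult (Polynomial.lead_coeff m) (\<Prod>x\<in>#A. [:- x, 1:])"
      using alg_closed_imp_factorization[OF m0] by blast
    define n where "n = Polynomial.degree m"
    have A': "m = (\<Prod>x\<in>#A. [:- x, 1:])"
      using A(2)[unfolded m(2) smult_1_left] .
    have "z = x" if "z \<in># A" for z
    proof (rule only)
      have "[:- z, 1:] dvd (\<Prod>x\<in>#A. [:- x, 1:])" using that by (intro dvd_prod_mset) auto
      then show "poly m z = 0" unfolding A' poly_eq_0_iff_dvd .
    qed
    then have "set_mset A \<subseteq> {x}" by blast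
    then have "A = replicate_mset n x"
      unfolding n_def A(1)[symmetric] by (rule set_mset_subset_singletonD)
    then have mx: "m = [:- x, 1:] ^ n"
      unfolding A' by simp
    show False
    proof (cases "n = 1")
      case True
      then have "m = [:- x, 1:]" using mx by simp
      then have "- x \<in> F" using m(1)[rule_format, of 0] by simp
      then have "- (- x) \<in> F" by (rule subring_ofD(5)[OF F])
      then show False using x by simp
    next
      case False
      then have "n \<ge> 2" using m(3) by (simp add: n_def)
      then obtain k where k: "n = Suc (Suc k)" by (metis Suc_diff_le Suc_1 add_2_eq_Suc le_add_diff_inverse)
      have "poly_over F (pderiv m)"
      proof
        fix i
        have "of_nat n * a \<in> F" if "a \<in> F" for n a
          using that subring_ofD[OF F] by (induction n) (auto simp: distrib_right)
        then show "Polynomial.coeff (pderiv m) i \<in> F" using m(1) by (simp add: coeff_pderiv del: of_nat_Suc)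
      qed
      moreover have "poly (pderiv m) x = 0"
        unfolding mx k pderiv_power_Suc poly_mult poly_smult poly_power by simp
      ultimately obtain q where "pderiv m = m * q" using m(4) by blast
      moreover have "pderiv m \<noteq> 0" using m(3) by (simp add: pderiv_eq_0_iff)
      ultimately have "Polynomial.degree m \<le> Polynomial.degree (pderiv m)"
        by (metis dvd_imp_degree_le dvd_triv_left)
      then show False using m(3) by (simp add: degree_pderiv)
    qed
  qed
  then show ?thesis using that by blast
qed

text \<open>An element outside \<open>F\<close> has a second conjugate, and sending it there extends
  to an automorphism of the algebraic closure.\<close>

theorem galois_fixed_field:
  assumes F: "subfield F QBar" "Q2 \<subseteq> F" and fixed: "\<And>\<sigma>. \<sigma> \<in> carrier (galois_group UNIV F) \<Longrightarrow> \<sigma> x = x"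
  shows "x \<in> F"
proof (rule ccontr)
  assume x: "x \<notin> F"
  note S = subfield_subring_of[OF F(1)]
  obtain m where m: "poly_over F m" "Polynomial.lead_coeff m = 1" "Polynomial.degree m > 0"
    "\<And>p. poly_over F p \<Longrightarrow> poly p x = 0 \<longleftrightarrow> (\<exists>q. poly_over F q \<and> p = m * q)"
    using min_poly_exists[OF S algebraic_over_Q2[OF F(2)]] by metis
  obtain z where z: "z \<noteq> x" "poly m z = 0"
    using min_poly_other_root[OF S(1) x m] by blast
  have id: "hom_on F (\<lambda>x. x)" by (simp add: hom_on_def)
  have "poly (map_poly (\<lambda>x. x) m) z = 0" using z by (simp add: map_poly_idI)
  then obtain D g where g: "subring_of D" "hom_on D g" "F \<subseteq> D" "x \<in> D" "\<And>y. y \<in> F \<Longrightarrow> g y = y" "g x = z"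
    using hom_on_adjoin[OF S(1) id m(1,4)] by metis
  obtain \<sigma> where s: "bij \<sigma>" "\<And>x y. \<sigma> (x + y) = \<sigma> x + \<sigma> y" "\<And>x y. \<sigma> (x * y) = \<sigma> x * \<sigma> y"
    "\<And>x. x \<in> D \<Longrightarrow> \<sigma> x = g x"
    using hom_on_extends[OF S algebraic_over_Q2[OF F(2)] g(1,3,2,5)] by metis
  have "\<sigma> y = y" if "y \<in> F" for y using s(4)[of y] g(3,5) that by auto
  then have "\<sigma> \<in> carrier (galois_group UNIV F)" using s by (simp add: galois_group_UNIV)
  then have "\<sigma> x = x" by (rule fixed)
  then show False using s(4)[OF g(4)] g(6) z(1) by simp
qed

section \<open>Degrees and intermediate fields\<close>

lemma QBar_field: "Ring.field QBar"
  unfolding QBar_def by (rule field_from_type_algebra)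

lemma QBar_simps: "carrier QBar = UNIV" "\<zero>\<^bsub>QBar\<^esub> = 0" "\<one>\<^bsub>QBar\<^esub> = 1"
    "x \<oplus>\<^bsub>QBar\<^esub> y = x + y" "x \<otimes>\<^bsub>QBar\<^esub> y = x * y"
  by (auto simp: QBar_def ring_of_type_algebra_def)

lemma subfieldD:
  assumes "subfield E QBar"
  shows "0 \<in> E" "1 \<in> E" "x \<in> E \<Longrightarrow> y \<in> E \<Longrightarrow> x + y \<in> E" "x \<in> E \<Longrightarrow> y \<in> E \<Longrightarrow> x * y \<in> E"
    "x \<in> E \<Longrightarrow> - x \<in> E" "x \<in> E \<Longrightarrow> inverse x \<in> E" "x \<in> E \<Longrightarrow> y \<in> E \<Longrightarrow> x - y \<in> E"
  using assms subring_ofD(6)[OF subfield_subring_of(1)[OF assms]] by (auto simp: subfield_QBar_iff)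

lemma subfield_subalgebra:
  assumes "subfield F QBar" "subfield E QBar" "F \<subseteq> E"
  shows "subalgebra F E QBar"
proof -
  interpret Q: Ring.field QBar by (rule QBar_field)
  have "subgroup E (add_monoid QBar)"
    using subringE(1,2,5,7)[OF subfieldE(1)[OF assms(2)]]
    by (intro Q.add.subgroupI) auto
  then show ?thesis
    using subfieldD(4)[OF assms(2)] assms(3) by (auto simp: subalgebra_def subalgebra_axioms_def QBar_simps)
qed

text \<open>The single vector 1 is independent and spans \<open>F\<close>; its length already equals
  the dimension of \<open>E\<close>.\<close>

lemma extension_dimension_eq:
  assumes F: "subfield F QBar" and E: "subfield E QBar" "F \<subseteq> E" and d: "ring.dimension QBar 1 F E"
  shows "E = F"
proof -
  interpret Q: Ring.field QBar by (rule QBar_field)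
  have "Q.independent F [\<one>\<^bsub>QBar\<^esub>]" "Q.Span F [\<one>\<^bsub>QBar\<^esub>] = F"
  proof -
    have S: "Q.Span F [\<one>\<^bsub>QBar\<^esub>] = F"
      using Q.line_extension_mem_iff[of _ F 1 "{0}"] by (auto simp: QBar_simps)
    then show "Q.Span F [\<one>\<^bsub>QBar\<^esub>] = F" .
    show "Q.independent F [\<one>\<^bsub>QBar\<^esub>]"
      by (rule Q.independent.li_Cons) (auto simp: QBar_simps Q.independent.li_Nil)
  qed
  moreover have "set [\<one>\<^bsub>QBar\<^esub>] \<subseteq> E" using subfieldD(2)[OF E(1)] by (simp add: QBar_simps)
  ultimately show ?thesis
    using Q.independent_length_eq_dimension[OF F d, of "[\<one>\<^bsub>QBar\<^esub>]"] by simp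
qed

text \<open>\<open>M\<close> is finite over \<open>F\<close> as a subspace of \<open>L\<close>, and
  a basis of \<open>L\<close> over \<open>F\<close> still spans \<open>L\<close> over
  \<open>M\<close>; then the tower law applies.\<close>

lemma finite_dimension_intermediate:
  assumes F: "subfield F QBar" and M: "subfield M QBar" and L: "subfield L QBar"
    and FM: "F \<subseteq> M" and sub: "M \<subseteq> L" and d: "ring.dimension QBar n F L"
  obtains d e where "ring.dimension QBar d F M" "ring.dimension QBar e M L" "n = d * e"
proof -
  interpret Q: Ring.field QBar by (rule QBar_field)
  have "Q.finite_dimension F M"
    using Q.subalbegra_incl_imp_finite_dimension[OF F Q.finite_dimensionI[OF d] subfield_subalgebra[OF F M FM] sub] .
  then obtain d' where d': "Q.dimension d' F M" by blast
  obtain Us where Us: "set Us \<subseteq> carrier QBar" "Q.independent F Us" "length Us = n" "Q.Span F Us = L"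
    using Q.exists_base[OF F d] by blast
  have "Q.Span F Vs \<subseteq> Q.Span M Vs" for Vs
  proof (induction Vs)
    case (Cons v Vs)
    then show ?case using FM by (force simp: Q.line_extension_mem_iff)
  qed simp
  moreover have "Q.Span M Us \<subseteq> L"
    unfolding Q.Span_subalgebra_minimal[OF M Us(1)]
    using Q.Span_base_incl[OF F Us(1)] Us(4) subfield_subalgebra[OF M L sub] by blast
  ultimately have "Q.Span M Us = L" using Us(4) by blast
  then have "Q.finite_dimension M L" using Q.Span_finite_dimension[OF M Us(1)] by simp
  then obtain e where e: "Q.dimension e M L" by blast
  have "n = d' * e"
    using Q.dimension_is_inj[OF F d Q.telescopic_base[OF F M d' e]] .
  then show ?thesis using that d' e by blast
qed

lemma finite_extension_subfields:
  assumes "finite_extension Q2 F"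
  shows "subfield F QBar" "Q2 \<subseteq> F"
  using assms by (auto simp: finite_extension_def extension_of_degree_def)

text \<open>Since \<open>x\<close> is algebraic over \<open>F\<close>, its polynomial expressions
  are closed under inverses.\<close>

lemma poly_over_image_subfield:
  assumes F: "subfield F QBar" "Q2 \<subseteq> F"
  shows "subfield {poly p x |p. poly_over F p} QBar" "F \<subseteq> {poly p x |p. poly_over F p}"
    "x \<in> {poly p x |p. poly_over F p}"
proof -
  note S = subfield_subring_of[OF F(1)]
  let ?D = "{poly p x |p. poly_over F p}"
  have c: "a + b \<in> ?D" "a * b \<in> ?D" "- a \<in> ?D" if "a \<in> ?D" "b \<in> ?D" for a b
  proof -
    from that obtain p q where pq: "poly_over F p" "poly_over F q" and ab: "a = poly p x" "b = poly q x"
      by auto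
    show "a + b \<in> ?D" using poly_over_arith(1)[OF S(1) pq]
      by (intro CollectI exI[of _ "p + q"]) (simp add: ab)
    show "a * b \<in> ?D" using poly_over_arith(2)[OF S(1) pq]
      by (intro CollectI exI[of _ "p * q"]) (simp add: ab)
    show "- a \<in> ?D" using poly_over_arith(3)[OF S(1) pq]
      by (intro CollectI exI[of _ "- p"]) (simp add: ab)
  qed
  show sub: "F \<subseteq> ?D"
  proof
    fix a assume "a \<in> F"
    then show "a \<in> ?D" using poly_over_basic(3)[OF S(1)] by (intro CollectI exI[of _ "[:a:]"]) simp
  qed
  show "x \<in> ?D" using poly_over_basic(4)[OF S(1)] by (intro CollectI exI[of _ "[:0, 1:]"]) simp
  have D: "subring_of ?D"
  proof -
    have z: "0 \<in> ?D" "1 \<in> ?D" using sub subfieldD(1,2)[OF F(1)] by blast+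
    show ?thesis unfolding subring_of_def by (intro conjI ballI z c)
  qed
  have "inverse a \<in> ?D" if "a \<in> ?D" for a
    using inverse_in_subring[OF S D sub that algebraic_over_Q2[OF F(2)]] .
  then show "subfield ?D QBar"
    unfolding subfield_QBar_iff by (intro conjI ballI c subring_ofD(1,2)[OF D])
qed

section \<open>Calculation with automorphisms\<close>

lemma galoisD:
  assumes "\<sigma> \<in> carrier (galois_group UNIV F)"
  shows "bij \<sigma>" "\<sigma> (x + y) = \<sigma> x + \<sigma> y" "\<sigma> (x * y) = \<sigma> x * \<sigma> y" "x \<in> F \<Longrightarrow> \<sigma> x = x"
    "\<sigma> 0 = 0" "\<sigma> 1 = 1" "\<sigma> (- x) = - \<sigma> x" "\<sigma> (x - y) = \<sigma> x - \<sigma> y" "\<sigma> (x ^ n) = \<sigma> x ^ n"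
    "\<sigma> (inverse x) = inverse (\<sigma> x)" "\<sigma> x = \<sigma> y \<longleftrightarrow> x = y"
proof -
  note G = assms[unfolded galois_group_UNIV]
  show b: "bij \<sigma>" and add: "\<sigma> (x + y) = \<sigma> x + \<sigma> y" and mult: "\<sigma> (x * y) = \<sigma> x * \<sigma> y"
    and "x \<in> F \<Longrightarrow> \<sigma> x = x" for x y
    using G by blast+
  show inj: "\<sigma> x = \<sigma> y \<longleftrightarrow> x = y" for x y using b by (simp add: bij_is_inj inj_eq)
  show 0: "\<sigma> 0 = 0" using add[of 0 0] by simp
  have "\<sigma> 1 * \<sigma> 1 = \<sigma> 1" using mult[of 1 1] by simp
  moreover have "\<sigma> 1 \<noteq> 0" using inj[of 1 0] 0 by simp
  ultimately show 1: "\<sigma> 1 = 1" by simp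
  show m: "\<sigma> (- x) = - \<sigma> x" for x using add[of x "- x"] 0 by (simp add: eq_neg_iff_add_eq_0 add.commute)
  show "\<sigma> (x - y) = \<sigma> x - \<sigma> y" using add[of x "- y"] m[of y] by simp
  show "\<sigma> (x ^ n) = \<sigma> x ^ n" by (induction n) (simp_all add: 1 mult)
  show "\<sigma> (inverse x) = inverse (\<sigma> x)"
  proof (cases "x = 0")
    case False
    then have "\<sigma> x * \<sigma> (inverse x) = 1" using mult[of x "inverse x"] 1 by simp
    then show ?thesis by (metis inverse_unique)
  qed (simp add: 0)
qed

lemma galois_poly:
  assumes "\<sigma> \<in> carrier (galois_group UNIV F)" "poly_over F p"
  shows "\<sigma> (poly p x) = poly p (\<sigma> x)"
  using assms(2)
proof (induction p)
  case (pCons a p)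
  have "a \<in> F" using pCons.prems[rule_format, of 0] by simp
  moreover have "Polynomial.coeff p i \<in> F" for i using pCons.prems[rule_format, of "Suc i"] by simp
  ultimately show ?case using pCons.IH by (simp add: galoisD[OF assms(1)])
qed (simp add: galoisD[OF assms(1)])

lemma galois_inverse:
  assumes "\<sigma> \<in> carrier (galois_group UNIV F)"
  shows "the_inv \<sigma> \<in> carrier (galois_group UNIV F)" "\<sigma> (the_inv \<sigma> x) = x" "the_inv \<sigma> (\<sigma> x) = x"
proof -
  note G = galoisD[OF assms]
  have inj: "inj \<sigma>" using G(1) by (rule bij_is_inj)
  show 1: "\<sigma> (the_inv \<sigma> x) = x" for x
    by (rule f_the_inv_into_f[OF inj]) (use bij_is_surj[OF G(1)] in auto)
  show 2: "the_inv \<sigma> (\<sigma> x) = x" for x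
    by (rule the_inv_f_f[OF inj])
  have "bij (the_inv \<sigma>)" by (rule o_bij[of \<sigma>]) (auto simp: fun_eq_iff 1 2)
  moreover have "the_inv \<sigma> (x + y) = the_inv \<sigma> x + the_inv \<sigma> y" "the_inv \<sigma> (x * y) = the_inv \<sigma> x * the_inv \<sigma> y" for x y
  proof -
    have "\<sigma> (the_inv \<sigma> (x + y)) = \<sigma> (the_inv \<sigma> x + the_inv \<sigma> y)" "\<sigma> (the_inv \<sigma> (x * y)) = \<sigma> (the_inv \<sigma> x * the_inv \<sigma> y)"
      by (simp_all only: 1 G(2,3))
    then show "the_inv \<sigma> (x + y) = the_inv \<sigma> x + the_inv \<sigma> y" "the_inv \<sigma> (x * y) = the_inv \<sigma> x * the_inv \<sigma> y"
      by (simp_all only: G(11))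
  qed
  moreover have "the_inv \<sigma> x = x" if "x \<in> F" for x using 2[of x] G(4)[OF that] by simp
  ultimately show "the_inv \<sigma> \<in> carrier (galois_group UNIV F)" unfolding galois_group_UNIV by blast
qed

lemma galois_compose:
  assumes "\<sigma> \<in> carrier (galois_group UNIV F)" "\<tau> \<in> carrier (galois_group UNIV F)"
  shows "\<sigma> \<circ> \<tau> \<in> carrier (galois_group UNIV F)"
  using assms unfolding galois_group_UNIV by (auto intro: bij_comp)

lemma galois_group_UNIV_ops:
  "\<sigma> \<otimes>\<^bsub>galois_group UNIV F\<^esub> \<tau> = \<sigma> \<circ> \<tau>" "\<one>\<^bsub>galois_group UNIV F\<^esub> = id"
  by (auto simp: galois_group_def compose_def fun_eq_iff)

lemma galois_id: "id \<in> carrier (galois_group UNIV F)"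
  unfolding galois_group_UNIV by simp

lemma galois_preimage_subfield:
  assumes "\<sigma> \<in> carrier (galois_group UNIV F)" "subfield M QBar"
  shows "subfield {x. \<sigma> x \<in> M} QBar"
  unfolding subfield_QBar_iff using subfieldD[OF assms(2)] by (auto simp: galoisD[OF assms(1)])

section \<open>Quadratic extensions\<close>

text \<open>Inverses come from the norm \<open>a * a - b * b * (\<delta> * \<delta>)\<close>, which
  lies in \<open>F\<close> and is nonzero on nonzero elements because \<delta> is not in
  \<open>F\<close>.\<close>

lemma quadratic_extension:
  assumes F: "subfield F QBar" and d: "\<delta> * \<delta> \<in> F" "\<delta> \<notin> F"
  defines "E \<equiv> {a + b * \<delta> |a b. a \<in> F \<and> b \<in> F}"
  shows "extension_of_degree 2 F E" "\<delta> \<in> E"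
proof -
  interpret Q: Ring.field QBar by (rule QBar_field)
  note FD = subfieldD[OF F]
  have sub: "F \<subseteq> E"
  proof
    fix a assume "a \<in> F"
    then show "a \<in> E" unfolding E_def using FD(1) by (intro CollectI exI[of _ a] exI[of _ 0]) simp
  qed
  show "\<delta> \<in> E" unfolding E_def using FD(1,2) by (intro CollectI exI[of _ 0] exI[of _ 1]) simp
  have E: "a + b * \<delta> \<in> E" if "a \<in> F" "b \<in> F" for a b using that unfolding E_def by blast
  have "subfield E QBar"
    unfolding subfield_QBar_iff
  proof (intro conjI ballI)
    show "0 \<in> E" "1 \<in> E" using sub FD(1,2) by auto
    fix x assume "x \<in> E"
    then obtain a b where x: "x = a + b * \<delta>" "a \<in> F" "b \<in> F" unfolding E_def by blast
    have "- x = (- a) + (- b) * \<delta>" by (simp add: x(1))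
    then show "- x \<in> E" using x FD by (simp only: E)
    show "inverse x \<in> E"
    proof (cases "x = 0")
      case False
      define n where "n = a * a - b * b * (\<delta> * \<delta>)"
      have n: "n = x * (a - b * \<delta>)" by (simp add: n_def x(1) algebra_simps)
      have "a - b * \<delta> \<noteq> 0"
      proof
        assume eq: "a - b * \<delta> = 0"
        show False
        proof (cases "b = 0")
          case True
          then show ?thesis using eq False x by simp
        next
          case b: False
          then have "\<delta> = a * inverse b" using eq by (simp add: field_simps)
          then show ?thesis using d(2) x FD by auto
        qed
      qed
      then have n0: "n \<noteq> 0" using n False by simp
      have "n \<in> F" unfolding n_def using x d FD by simp
      then have ni: "inverse n \<in> F" by (rule FD(6))
      have "x * (a * inverse n + (- b * inverse n) * \<delta>) = n * inverse n"
        unfolding n by (simp add: algebra_simps)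
      then have "x * (a * inverse n + (- b * inverse n) * \<delta>) = 1" using n0 by simp
      then have "inverse x = a * inverse n + (- b * inverse n) * \<delta>" by (rule inverse_unique)
      then show ?thesis using x ni FD by (simp only: E)
    qed (use sub FD(1) in auto)
    fix y assume "y \<in> E"
    then obtain a' b' where y: "y = a' + b' * \<delta>" "a' \<in> F" "b' \<in> F" unfolding E_def by blast
    have "x + y = (a + a') + (b + b') * \<delta>" by (simp add: x(1) y(1) algebra_simps)
    then show "x + y \<in> E" using x y FD by (simp only: E)
    have "x * y = (a * a' + b * b' * (\<delta> * \<delta>)) + (a * b' + b * a') * \<delta>" by (simp add: x(1) y(1) algebra_simps)
    then show "x * y \<in> E" using x y FD d by (simp only: E)
  qed
  moreover have "Q.dimension 2 F E"
  proof -
    have S1: "Q.Span F [1] = F"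
      using Q.line_extension_mem_iff[of _ F 1 "{0}"] by (auto simp: QBar_simps)
    have i1: "Q.independent F [1]"
      by (rule Q.independent.li_Cons) (auto simp: QBar_simps Q.independent.li_Nil)
    have "Q.independent F [\<delta>, 1]"
    proof (rule Q.independent.li_Cons[OF _ _ i1])
      show "\<delta> \<in> carrier QBar" by (simp add: QBar_simps)
      show "\<delta> \<notin> Q.Span F [1]" using d(2) unfolding S1 .
    qed
    moreover have "Q.Span F [\<delta>, 1] = E"
    proof (rule Set.set_eqI)
      fix u
      have "Q.Span F [\<delta>, 1] = Q.line_extension F \<delta> F" using S1 by simp
      then have "u \<in> Q.Span F [\<delta>, 1] \<longleftrightarrow> (\<exists>k\<in>F. \<exists>v\<in>F. u = k * \<delta> + v)"
        using Q.line_extension_mem_iff[of u F \<delta> F] by (simp only: QBar_simps)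
      also have "\<dots> \<longleftrightarrow> u \<in> E" unfolding E_def mem_Collect_eq by (metis add.commute)
      finally show "u \<in> Q.Span F [\<delta>, 1] \<longleftrightarrow> u \<in> E" .
    qed
    ultimately have "Q.dimension (length [\<delta>, 1]) F E" by (intro Q.dimensionI[OF F])
    then show ?thesis by (simp add: numeral_2_eq_2)
  qed
  ultimately show "extension_of_degree 2 F E"
    unfolding extension_of_degree_def using F sub by blast
qed

section \<open>Cubic extensions\<close>

text \<open>The degree 3 is prime, so an element outside \<open>F\<close> generates all of
  \<open>L\<close>. The bounded polynomial comes from the dependence of four powers of
  \<open>x\<close>; its degree later limits the number of conjugates to three.\<close>

lemma cubic_generated:
  assumes F: "subfield F QBar" "Q2 \<subseteq> F" and L: "extension_of_degree 3 F L" and x: "x \<in> L" "x \<notin> F"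
  shows "L = {poly p x |p. poly_over F p}"
    "\<exists>p. p \<noteq> 0 \<and> poly_over F p \<and> poly p x = 0 \<and> Polynomial.degree p \<le> 3"
proof -
  interpret Q: Ring.field QBar by (rule QBar_field)
  let ?D = "{poly p x |p. poly_over F p}"
  have Ls: "subfield L QBar" "F \<subseteq> L" "Q.dimension 3 F L"
    using L by (auto simp: extension_of_degree_def)
  note D = poly_over_image_subfield[OF F, of x]
  have DL: "?D \<subseteq> L"
  proof
    fix y assume "y \<in> ?D"
    then obtain p where p: "poly_over F p" "y = poly p x" by blast
    then have "poly_over L p" using Ls(2) by blast
    then show "y \<in> L" using poly_over_eval[OF subfield_subring_of(1)[OF Ls(1)] _ x(1)] p(2) by blast
  qed
  obtain d e where de: "Q.dimension d F ?D" "Q.dimension e ?D L" "3 = d * e"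
    using finite_dimension_intermediate[OF F(1) D(1) Ls(1) D(2) DL Ls(3)] .
  have "d \<noteq> 1"
  proof
    assume "d = 1"
    then have "?D = F" using extension_dimension_eq[OF F(1) D(1,2)] de(1) by simp
    then show False using D(3) x(2) by blast
  qed
  moreover have "d dvd 3" using de(3) by (metis dvd_triv_left)
  ultimately have "d = 3" using prime_nat_iff[of 3] by auto
  then have "3 = 3 * e" using de(3) by (simp only:)
  then have "e = 1" by simp
  then show "L = ?D" using extension_dimension_eq[OF D(1) Ls(1) DL] de(2) by simp
  show "\<exists>p. p \<noteq> 0 \<and> poly_over F p \<and> poly p x = 0 \<and> Polynomial.degree p \<le> 3"
  proof -
    define Us where "Us = [1, x, x ^ 2, x ^ 3]"
    have sub: "set Us \<subseteq> L"
      using x subring_ofD(2,7)[OF subfield_subring_of(1)[OF Ls(1)]] by (simp add: Us_def)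
    have "\<not> Q.independent F Us"
    proof
      assume "Q.independent F Us"
      then have "length Us \<le> 3" using Q.independent_length_le_dimension[OF F(1) Ls(3)] sub by blast
      then show False by (simp add: Us_def)
    qed
    moreover have "set Us \<subseteq> carrier QBar" by (simp add: QBar_simps)
    ultimately obtain Ks where Ks: "length Ks = length Us" "Q.combine Ks Us = \<zero>\<^bsub>QBar\<^esub>" "set Ks \<subseteq> F" "set Ks \<noteq> {\<zero>\<^bsub>QBar\<^esub>}"
      using Q.dependent_imp_non_trivial_combine[OF F(1)] by blast
    obtain a b c d where abcd: "Ks = [a, b, c, d]"
      using Ks(1) by (auto simp: Us_def length_Suc_conv)
    have eq: "a * 1 + (b * x + (c * x ^ 2 + (d * x ^ 3 + 0))) = 0"
      using Ks(2) by (simp only: abcd Us_def Q.combine.simps QBar_simps)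
    have "poly_over F [:a, b, c, d:]"
      using Ks(3) subfieldD(1)[OF F(1)] by (auto simp: abcd coeff_pCons split: nat.splits)
    moreover have "[:a, b, c, d:] \<noteq> 0" using Ks(4) by (auto simp: abcd QBar_simps)
    moreover have "poly [:a, b, c, d:] x = 0"
      using eq by (simp add: algebra_simps power2_eq_square power3_eq_cube)
    moreover have "Polynomial.degree [:a, b, c, d:] \<le> 3"
      by (auto intro: order_trans[OF degree_pCons_le])
    ultimately show ?thesis by blast
  qed
qed

section \<open>Weil groups of intermediate fields\<close>

lemma integers_galois:
  assumes "\<sigma> \<in> carrier (galois_group UNIV F)" "Q2 \<subseteq> F" "x \<in> integers"
  shows "\<sigma> x \<in> integers"
proof -
  obtain p where p: "Polynomial.lead_coeff p = 1" "poly (map_poly of_zadic2 p) x = 0"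
    using assms(3) unfolding integers_def by blast
  have "poly_over F (map_poly of_zadic2 p)"
  proof
    have "of_zadic2 a \<in> F" for a using assms(2) by (auto simp: of_zadic2_def Q2_def)
    then show "Polynomial.coeff (map_poly of_zadic2 p) i \<in> F" for i by (simp add: coeff_map_poly)
  qed
  then have "\<sigma> (poly (map_poly of_zadic2 p) x) = poly (map_poly of_zadic2 p) (\<sigma> x)"
    using galois_poly[OF assms(1)] by blast
  then show ?thesis
    using p galoisD(5)[OF assms(1)] unfolding integers_def by auto
qed

lemma max_ideal_galois:
  assumes "\<sigma> \<in> carrier (galois_group UNIV F)" "Q2 \<subseteq> F" "x \<in> max_ideal"
  shows "\<sigma> x \<in> max_ideal"
proof -
  obtain m d where m: "m > 0" "d \<in> integers" "x ^ m = 2 * d" and x: "x \<in> integers"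
    using assms(3) by (auto simp: max_ideal_eq)
  note G = galoisD[OF assms(1)]
  have "\<sigma> 2 = 2" using G(2)[of 1 1] G(6) by simp
  then have "\<sigma> x ^ m = 2 * \<sigma> d" using G(9)[of x m] G(3)[of 2 d] m(3) by simp
  then show ?thesis
    using m(1) integers_galois[OF assms(1,2)] x m(2) unfolding max_ideal_eq by blast
qed

locale weil_setting =
  fixes F :: "qbar set"
  assumes F: "subfield F QBar" "Q2 \<subseteq> F"
begin

lemma weil_carrier:
  "\<sigma> \<in> carrier (weil_group F) \<longleftrightarrow> \<sigma> \<in> carrier (galois_group UNIV F) \<and>
     (\<exists>n. (\<forall>x\<in>integers. red (\<sigma> x) = red x ^ (residue_card F ^ n)) \<or>
          (\<forall>x\<in>integers. red (\<sigma> x) ^ (residue_card F ^ n) = red x))"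
proof (cases "\<sigma> \<in> carrier (galois_group UNIV F)")
  case True
  have i: "\<sigma> x \<in> integers" if "x \<in> integers" for x using integers_galois[OF True F(2) that] .
  have "(\<sigma> x - x ^ k \<in> max_ideal) = (red (\<sigma> x) = red x ^ k)" "(\<sigma> x ^ k - x \<in> max_ideal) = (red (\<sigma> x) ^ k = red x)"
    if "x \<in> integers" for x k
    using that i by (simp_all add: red_eq_iff[symmetric] integers_power red_power)
  then show ?thesis using True by (simp add: weil_group_def)
qed (simp add: weil_group_def)

lemma weil_ops:
  "\<sigma> \<otimes>\<^bsub>weil_group F\<^esub> \<tau> = \<sigma> \<circ> \<tau>" "\<one>\<^bsub>weil_group F\<^esub> = id"
  using galois_group_UNIV_ops[where F = F] by (simp_all add: weil_group_def)

lemma weil_galois: "\<sigma> \<in> carrier (weil_group F) \<Longrightarrow> \<sigma> \<in> carrier (galois_group UNIV F)"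
  by (simp add: weil_group_def)

lemma inertia_iff:
  "\<sigma> \<in> inertia F \<longleftrightarrow> \<sigma> \<in> carrier (galois_group UNIV F) \<and> (\<forall>x\<in>integers. red (\<sigma> x) = red x)"
  using integers_galois[OF _ F(2)] by (auto simp: inertia_def red_eq_iff)

lemma inertia_weil: "\<sigma> \<in> inertia F \<Longrightarrow> \<sigma> \<in> carrier (weil_group F)"
  unfolding inertia_iff weil_carrier by (metis power_0 power_one_right)

text \<open>Exponents of Frobenius add when both elements act in the same direction and subtract
  otherwise. The four cases arise because an integer exponent is encoded as a natural number with a
  direction.\<close>

lemma weil_compose:
  assumes "\<sigma> \<in> carrier (weil_group F)" "\<tau> \<in> carrier (weil_group F)"
  shows "\<sigma> \<circ> \<tau> \<in> carrier (weil_group F)"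
proof -
  define q where "q = residue_card F"
  have G: "\<sigma> \<in> carrier (galois_group UNIV F)" "\<tau> \<in> carrier (galois_group UNIV F)" "\<sigma> \<circ> \<tau> \<in> carrier (galois_group UNIV F)"
    using assms weil_galois galois_compose by auto
  have i: "\<tau> x \<in> integers" if "x \<in> integers" for x using integers_galois[OF G(2) F(2) that] .
  obtain m where m: "(\<forall>x\<in>integers. red (\<sigma> x) = red x ^ (q ^ m)) \<or> (\<forall>x\<in>integers. red (\<sigma> x) ^ (q ^ m) = red x)"
    using assms(1) unfolding weil_carrier q_def by blast
  obtain n where n: "(\<forall>x\<in>integers. red (\<tau> x) = red x ^ (q ^ n)) \<or> (\<forall>x\<in>integers. red (\<tau> x) ^ (q ^ n) = red x)"
    using assms(2) unfolding weil_carrier q_def by blast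
  have "\<exists>k. (\<forall>x\<in>integers. red (\<sigma> (\<tau> x)) = red x ^ (q ^ k)) \<or> (\<forall>x\<in>integers. red (\<sigma> (\<tau> x)) ^ (q ^ k) = red x)"
    using m
  proof
    assume s: "\<forall>x\<in>integers. red (\<sigma> x) = red x ^ (q ^ m)"
    show ?thesis
      using n
    proof
      assume t: "\<forall>x\<in>integers. red (\<tau> x) = red x ^ (q ^ n)"
      have "red (\<sigma> (\<tau> x)) = red x ^ (q ^ (n + m))" if "x \<in> integers" for x
        using s t i that by (simp add: power_add power_mult)
      then show ?thesis by blast
    next
      assume t: "\<forall>x\<in>integers. red (\<tau> x) ^ (q ^ n) = red x"
      show ?thesis
      proof (cases "n \<le> m")
        case True
        have "red (\<sigma> (\<tau> x)) = red x ^ (q ^ (m - n))" if "x \<in> integers" for x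
        proof -
          have "q ^ m = q ^ n * q ^ (m - n)" using True by (simp flip: power_add)
          then have "red (\<sigma> (\<tau> x)) = (red (\<tau> x) ^ (q ^ n)) ^ (q ^ (m - n))"
            using s i[OF that] by (simp add: power_mult)
          then show ?thesis using t that by simp
        qed
        then show ?thesis by blast
      next
        case False
        have "red (\<sigma> (\<tau> x)) ^ (q ^ (n - m)) = red x" if "x \<in> integers" for x
        proof -
          have "q ^ n = q ^ m * q ^ (n - m)" using False by (simp flip: power_add)
          then have "red (\<sigma> (\<tau> x)) ^ (q ^ (n - m)) = red (\<tau> x) ^ (q ^ n)"
            using s i[OF that] by (simp add: power_mult)
          then show ?thesis using t that by simp
        qed
        then show ?thesis by blast
      qed
    qed
  next
    assume s: "\<forall>x\<in>integers. red (\<sigma> x) ^ (q ^ m) = red x"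
    show ?thesis
      using n
    proof
      assume t: "\<forall>x\<in>integers. red (\<tau> x) = red x ^ (q ^ n)"
      \<comment> \<open>\<open>\<sigma>\<close> preserves congruence modulo the maximal ideal, so on
        residues it commutes with taking powers.\<close>
      have st: "red (\<sigma> (\<tau> x)) = red (\<sigma> x) ^ (q ^ n)" if x: "x \<in> integers" for x
      proof -
        have "\<tau> x - x ^ (q ^ n) \<in> max_ideal"
          using t x i[OF x] by (simp add: red_eq_iff[symmetric] integers_power red_power)
        then have "\<sigma> (\<tau> x - x ^ (q ^ n)) \<in> max_ideal" by (rule max_ideal_galois[OF G(1) F(2)])
        then have "red (\<sigma> (\<tau> x)) = red (\<sigma> x ^ (q ^ n))"
          using integers_galois[OF G(1) F(2)] x i[OF x]
          by (simp add: galoisD[OF G(1)] red_eq_iff integers_power)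
        then show ?thesis using integers_galois[OF G(1) F(2) x] by (simp add: red_power)
      qed
      show ?thesis
      proof (cases "m \<le> n")
        case True
        have "red (\<sigma> (\<tau> x)) = red x ^ (q ^ (n - m))" if "x \<in> integers" for x
        proof -
          have "q ^ n = q ^ m * q ^ (n - m)" using True by (simp flip: power_add)
          then have "red (\<sigma> (\<tau> x)) = (red (\<sigma> x) ^ (q ^ m)) ^ (q ^ (n - m))"
            using st[OF that] by (simp add: power_mult)
          then show ?thesis using s that by simp
        qed
        then show ?thesis by blast
      next
        case False
        have "red (\<sigma> (\<tau> x)) ^ (q ^ (m - n)) = red x" if "x \<in> integers" for x
        proof -
          have "q ^ m = q ^ n * q ^ (m - n)" using False by (simp flip: power_add)
          then have "red (\<sigma> (\<tau> x)) ^ (q ^ (m - n)) = red (\<sigma> x) ^ (q ^ m)"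
            using st[OF that] by (simp add: power_mult)
          then show ?thesis using s that by simp
        qed
        then show ?thesis by blast
      qed
    next
      assume t: "\<forall>x\<in>integers. red (\<tau> x) ^ (q ^ n) = red x"
      have "red (\<sigma> (\<tau> x)) ^ (q ^ (m + n)) = red x" if "x \<in> integers" for x
        using s t i[OF that] that by (simp add: power_add power_mult)
      then show ?thesis by blast
    qed
  qed
  then show ?thesis using G(3) unfolding weil_carrier q_def by (simp add: comp_def)
qed

lemma weil_inverse:
  assumes "\<sigma> \<in> carrier (weil_group F)"
  shows "the_inv \<sigma> \<in> carrier (weil_group F)"
proof -
  define q where "q = residue_card F"
  have G: "\<sigma> \<in> carrier (galois_group UNIV F)" using assms by (rule weil_galois)
  note I = galois_inverse[OF G]
  have i: "the_inv \<sigma> x \<in> integers" if "x \<in> integers" for x using integers_galois[OF I(1) F(2) that] .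
  obtain m where m: "(\<forall>x\<in>integers. red (\<sigma> x) = red x ^ (q ^ m)) \<or> (\<forall>x\<in>integers. red (\<sigma> x) ^ (q ^ m) = red x)"
    using assms(1) unfolding weil_carrier q_def by blast
  have "(\<forall>x\<in>integers. red (the_inv \<sigma> x) ^ (q ^ m) = red x) \<or> (\<forall>x\<in>integers. red (the_inv \<sigma> x) = red x ^ (q ^ m))"
    using m
  proof
    assume s: "\<forall>x\<in>integers. red (\<sigma> x) = red x ^ (q ^ m)"
    have "red (the_inv \<sigma> x) ^ (q ^ m) = red x" if "x \<in> integers" for x
      using s[rule_format, OF i[OF that]] I(2)[of x] by simp
    then show ?thesis by blast
  next
    assume s: "\<forall>x\<in>integers. red (\<sigma> x) ^ (q ^ m) = red x"
    have "red (the_inv \<sigma> x) = red x ^ (q ^ m)" if "x \<in> integers" for x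
      using s[rule_format, OF i[OF that]] I(2)[of x] by simp
    then show ?thesis by blast
  qed
  then show ?thesis using I(1) unfolding weil_carrier q_def by blast
qed

lemma weil_group: "group (weil_group F)"
proof (rule groupI)
  show "\<one>\<^bsub>weil_group F\<^esub> \<in> carrier (weil_group F)"
    unfolding weil_ops by (rule inertia_weil) (simp add: inertia_iff galois_id)
  show "\<sigma> \<otimes>\<^bsub>weil_group F\<^esub> \<tau> \<in> carrier (weil_group F)"
    if "\<sigma> \<in> carrier (weil_group F)" "\<tau> \<in> carrier (weil_group F)" for \<sigma> \<tau>
    unfolding weil_ops using that by (rule weil_compose)
  show "\<exists>\<tau>\<in>carrier (weil_group F). \<tau> \<otimes>\<^bsub>weil_group F\<^esub> \<sigma> = \<one>\<^bsub>weil_group F\<^esub>"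
    if "\<sigma> \<in> carrier (weil_group F)" for \<sigma>
    using weil_inverse[OF that] galois_inverse(3)[OF weil_galois[OF that]]
    by (intro bexI[of _ "the_inv \<sigma>"]) (auto simp: weil_ops fun_eq_iff)
qed (simp_all add: weil_ops o_assoc)

lemma weil_inv: "\<sigma> \<in> carrier (weil_group F) \<Longrightarrow> inv\<^bsub>weil_group F\<^esub> \<sigma> = the_inv \<sigma>"
proof -
  interpret group "weil_group F" by (rule weil_group)
  assume "\<sigma> \<in> carrier (weil_group F)"
  then show ?thesis
    using weil_inverse galois_inverse(3)[OF weil_galois]
    by (intro inv_equality) (auto simp: weil_ops fun_eq_iff)
qed

end

lemma residue_nonzero_inverse:
  assumes "a \<noteq> (0 :: residue)"
  obtains b where "a * b = 1"
proof -
  have "\<exists>x\<in>integers. a = red x"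
    by transfer (metis diff_self max_ideal_0)
  then obtain x where x: "x \<in> integers" "a = red x" by blast
  then obtain y where "y \<in> integers" "x * y = 1"
    using assms by (auto simp: red_eq_0_iff max_ideal_def)
  then have "a * red y = 1" using x by (metis red_simps(2) red_0_1(2))
  then show ?thesis by (rule that)
qed

instance residue :: idom
proof
  fix a b :: residue
  assume a: "a \<noteq> 0" and b: "b \<noteq> 0"
  obtain c where c: "a * c = 1" using residue_nonzero_inverse[OF a] .
  show "a * b \<noteq> 0"
  proof
    assume "a * b = 0"
    then have "c * (a * b) = 0" by simp
    then show False using b c by (simp add: mult.commute[of c a] flip: mult.assoc)
  qed
qed

text \<open>For residues this says that a field on whose residues some nontrivial power of Frobenius
  acts trivially has a finite residue field.\<close>

lemma finite_fixed_points:
  assumes "N \<ge> 2"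
  shows "finite {x :: 'a::idom. x ^ N = x}"
proof -
  define p where "p = Polynomial.monom (1 :: 'a) N - [:0, 1:]"
  have "Polynomial.coeff p N = 1"
    using assms by (simp add: p_def coeff_pCons split: nat.splits)
  then have "p \<noteq> 0" by auto
  moreover have "{x. x ^ N = x} = {x. poly p x = 0}" by (simp add: p_def poly_monom)
  ultimately show ?thesis using poly_roots_finite by simp
qed

text \<open>An element acting on the residue field as the \<open>n\<close>-th power of the Frobenius of \<open>F\<close> and
  trivially on the residue field of \<open>E\<close> acts as a power of the Frobenius of \<open>E\<close>.\<close>

lemma weil_group_extension:
  assumes F: "subfield F QBar" "Q2 \<subseteq> F" and E: "subfield E QBar" "F \<subseteq> E"
  shows "carrier (weil_group E) = {\<sigma> \<in> carrier (weil_group F). \<forall>x\<in>E. \<sigma> x = x}"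
proof -
  interpret F: weil_setting F by (rule weil_setting.intro[OF F])
  interpret E: weil_setting E by (rule weil_setting.intro) (use F E in auto)
  have gal: "\<sigma> \<in> carrier (galois_group UNIV E) \<longleftrightarrow> \<sigma> \<in> carrier (galois_group UNIV F) \<and> (\<forall>x\<in>E. \<sigma> x = x)" for \<sigma>
    using E(2) by (auto simp: galois_group_UNIV)
  show ?thesis
  proof (intro equalityI subsetI)
    fix \<sigma> assume s: "\<sigma> \<in> carrier (weil_group E)"
    then have G: "\<sigma> \<in> carrier (galois_group UNIV F)" "\<forall>x\<in>E. \<sigma> x = x"
      using E.weil_galois gal by auto
    obtain n where n: "(\<forall>x\<in>integers. red (\<sigma> x) = red x ^ (residue_card E ^ n)) \<or> (\<forall>x\<in>integers. red (\<sigma> x) ^ (residue_card E ^ n) = red x)"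
      using s unfolding E.weil_carrier by blast
    have "\<sigma> \<in> carrier (weil_group F)"
    proof (cases "residue_card E > 0")
      case True
      obtain f where "residue_card E = residue_card F ^ f"
        using residue_card_extension[OF F(1) E(1,2) True] by metis
      then have "residue_card E ^ n = residue_card F ^ (f * n)" by (simp add: power_mult)
      then show ?thesis using n G(1) unfolding F.weil_carrier by metis
    next
      case False
      \<comment> \<open>An infinite residue field has \<open>residue_card E = 0\<close>. A positive
        \<open>n\<close> would then turn the Frobenius condition at 0 into \<open>red 0 = 1\<close>,
        so \<open>n = 0\<close> and \<open>\<sigma>\<close> is trivial on residues.\<close>
      have "red (\<sigma> x) = red x" if "x \<in> integers" for x
      proof (cases "n = 0")
        case True
        then show ?thesis using n that by simp
      next
        case n0: False
        then have q0: "residue_card E ^ n = 0" using False by simp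
        have "red 0 \<noteq> 1" using one_notin_max_ideal red_0_1 by simp
        then show ?thesis using n unfolding q0 using galoisD(5)[OF G(1)] red_0_1 by (metis integers_0 power_0)
      qed
      then show ?thesis using G(1) by (intro F.inertia_weil) (simp add: F.inertia_iff)
    qed
    then show "\<sigma> \<in> {\<sigma> \<in> carrier (weil_group F). \<forall>x\<in>E. \<sigma> x = x}" using G(2) by blast
  next
    fix \<sigma> assume "\<sigma> \<in> {\<sigma> \<in> carrier (weil_group F). \<forall>x\<in>E. \<sigma> x = x}"
    then have s: "\<sigma> \<in> carrier (weil_group F)" and fix': "\<And>x. x \<in> E \<Longrightarrow> \<sigma> x = x" by auto
    have GE: "\<sigma> \<in> carrier (galois_group UNIV E)" using s fix' F.weil_galois gal by blast
    define q where "q = residue_card F"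
    obtain n where n: "(\<forall>x\<in>integers. red (\<sigma> x) = red x ^ (q ^ n)) \<or> (\<forall>x\<in>integers. red (\<sigma> x) ^ (q ^ n) = red x)"
      using s unfolding F.weil_carrier q_def by blast
    have triv: "red x ^ (q ^ n) = red x" if "x \<in> integers \<inter> E" for x
      using n fix'[of x] that by auto
    show "\<sigma> \<in> carrier (weil_group E)"
    proof (cases "q ^ n = 1")
      case True
      then have "\<sigma> \<in> inertia E" using n GE unfolding E.inertia_iff True by simp
      then show ?thesis by (rule E.inertia_weil)
    next
      case False
      have "q ^ n \<noteq> 0"
      proof
        assume "q ^ n = 0"
        then have "red 0 = (1 :: residue)" using triv[of 0] subfieldD(1)[OF E(1)] by (metis IntI integers_0 power_0)
        then show False using red_0_1 by simp
      qed
      then have N: "q ^ n \<ge> 2" using False by linarith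
      \<comment> \<open>The residues of \<open>E\<close> are fixed by a power map with exponent at
        least 2, so there are finitely many. Thus \<open>E\<close> has a residue degree over
        \<open>F\<close>, and it divides \<open>n\<close>.\<close>
      have "finite {x :: residue. x ^ (q ^ n) = x}"
        by (rule finite_fixed_points[OF N])
      then have "finite (red ` (integers \<inter> E))"
        by (rule finite_subset[rotated]) (use triv in auto)
      moreover have "0 \<in> integers \<inter> E" using E(1) by (simp add: subfield_QBar_iff)
      ultimately have "residue_card E > 0"
        unfolding residue_card_eq by (metis card_gt_0_iff empty_iff image_is_empty)
      then obtain f where f: "residue_card E = q ^ f"
        "\<And>n. (\<And>x. x \<in> integers \<inter> E \<Longrightarrow> red x ^ (q ^ n) = red x) \<Longrightarrow> f dvd n"
        using residue_card_extension[OF F(1) E(1,2)] unfolding q_def by metis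
      obtain k where "n = f * k" using f(2)[of n] triv by blast
      then have "q ^ n = residue_card E ^ k" by (simp add: f(1) power_mult)
      then show ?thesis using n GE unfolding E.weil_carrier by metis
    qed
  qed
qed

section \<open>The adjoint representation\<close>

lemma matrix_add_rdistrib: "(A + B) ** C = A ** C + B ** C" for A :: "'a::semiring_1 ^ 'n ^ 'm"
  by (simp add: vec_eq_iff matrix_matrix_mult_def sum.distrib distrib_right)

lemma matrix_inv_mult:
  assumes "invertible (A :: 'a::field ^ 'n ^ 'n)"
  shows "A ** matrix_inv A = mat 1" "matrix_inv A ** A = mat 1"
  using someI_ex[OF assms[unfolded invertible_def]] unfolding matrix_inv_def by blast+

lemma matrix_inv_unique_left:
  fixes A :: "'a::field ^ 'n ^ 'n"
  assumes "B ** A = mat 1"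
  shows "matrix_inv A = B"
proof -
  have "invertible A" using assms invertible_left_inverse by blast
  then have "B ** (A ** matrix_inv A) = B" by (simp add: matrix_inv_mult)
  then show ?thesis using assms by (simp add: matrix_mul_assoc)
qed

lemma invertible_matrix_inv: "invertible A \<Longrightarrow> invertible (matrix_inv (A :: 'a::field ^ 'n ^ 'n))"
  using matrix_inv_mult by (metis invertible_def)

lemma mat_mult_component [simp]:
  "(mat c ** A) $ i $ j = c * A $ i $ j" for c :: "'a::semiring_1"
  by (simp add: matrix_matrix_mult_def mat_def if_distrib[of "\<lambda>x. x * _"] cong: if_cong)

lemma mult_mat_component [simp]:
  "(A ** mat c) $ i $ j = A $ i $ j * c" for c :: "'a::semiring_1"
  by (simp add: matrix_matrix_mult_def mat_def if_distrib[of "\<lambda>x. _ * x"] cong: if_cong)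

lemma mat_mult_commute: "A ** mat c = mat c ** A" for A :: "'a::comm_semiring_1 ^ 'n ^ 'm"
  by (simp add: vec_eq_iff mult.commute)

lemma mat_mult_mat: "mat a ** mat b = (mat (a * b) :: 'a::semiring_1 ^ 'n ^ 'n)"
  by (simp add: vec_eq_iff) (simp add: mat_def)

lemma vec_linearI:
  fixes f :: "'a::field ^ 'm \<Rightarrow> 'a ^ 'n"
  assumes "\<And>x y. f (x + y) = f x + f y" "\<And>c x. f (c *s x) = c *s f x"
  shows "Vector_Spaces.linear (*s) (*s) f"
  by unfold_locales (use assms in auto)

lemma mat_vector_mult [simp]: "mat c *v x = c *s x" for x :: "'a::semiring_1 ^ 'n"
  by (simp add: vec_eq_iff matrix_vector_mult_def mat_def if_distrib[of "\<lambda>x. x * _"] cong: if_cong)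

lemma invertible_mat: "c \<noteq> 0 \<Longrightarrow> invertible (mat c :: 'a::field ^ 'n ^ 'n)"
  unfolding invertible_def by (rule exI[of _ "mat (inverse c)"]) (simp add: mat_mult_mat)

lemma trace_mat_mult: "trace (mat c ** A) = c * trace A" for A :: "'a::semiring_1 ^ 'n ^ 'n"
  by (simp add: trace_def sum_distrib_left)

lemma twist_eq: "twist \<eta> \<rho> g = mat (\<eta> g) ** \<rho> g"
  by (simp add: vec_eq_iff twist_def)

text \<open>The adjugate. Unlike the inverse it is linear and defined for all matrices, and
  \<open>trace (adj2 A ** B)\<close> is the polar form of the determinant.\<close>

definition adj2 :: "'a::comm_ring_1 ^ 2 ^ 2 \<Rightarrow> 'a ^ 2 ^ 2" where
  "adj2 A = vector [vector [A $ 2 $ 2, - A $ 1 $ 2], vector [- A $ 2 $ 1, A $ 1 $ 1]]"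

lemma adj2_mult: "A ** adj2 A = mat (det A)" "adj2 A ** A = mat (det A)"
  by (simp_all add: vec_eq_iff forall_2 adj2_def matrix_matrix_mult_def sum_2 det_2 mat_def algebra_simps)

lemma adj2_prod: "adj2 (A ** B) = adj2 B ** adj2 A"
  by (simp add: vec_eq_iff forall_2 adj2_def matrix_matrix_mult_def sum_2 algebra_simps)

lemma adj2_adj2 [simp]: "adj2 (adj2 A) = A"
  by (simp add: vec_eq_iff forall_2 adj2_def)

lemma det_adj2 [simp]: "det (adj2 A) = det A"
  by (simp add: det_2 adj2_def algebra_simps)

lemma adj2_eq_matrix_inv:
  assumes "invertible (A :: 'a::field ^ 2 ^ 2)"
  shows "adj2 A = mat (det A) ** matrix_inv A"
proof -
  have "adj2 A = adj2 A ** (A ** matrix_inv A)" using assms by (simp add: matrix_inv_mult)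
  then show ?thesis by (simp add: matrix_mul_assoc adj2_mult)
qed

lemma hom_GL:
  fixes G (structure)
  assumes "group G" "\<rho> \<in> hom G GL" "g \<in> carrier G"
  shows "invertible (\<rho> g)"
    "h \<in> carrier G \<Longrightarrow> \<rho> (g \<otimes> h) = \<rho> g ** \<rho> h"
    "\<rho> \<one> = mat 1"
    "\<rho> (inv g) = matrix_inv (\<rho> g)"
proof -
  interpret group G by fact
  have *: "invertible (\<rho> g)" if "g \<in> carrier G" for g
    using assms(2) that by (auto simp: hom_def GL_def)
  have **: "\<rho> (g \<otimes> h) = \<rho> g ** \<rho> h" if "g \<in> carrier G" "h \<in> carrier G" for g h
    using assms(2) that by (auto simp: hom_def GL_def)
  have "\<rho> \<one> ** \<rho> \<one> = \<rho> \<one>"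
    using **[of \<one> \<one>] by simp
  then have "matrix_inv (\<rho> \<one>) ** (\<rho> \<one> ** \<rho> \<one>) = matrix_inv (\<rho> \<one>) ** \<rho> \<one>" by simp
  then have 1: "\<rho> \<one> = mat 1"
    using *[of \<one>] by (simp add: matrix_mul_assoc matrix_inv_mult)
  have "\<rho> (inv g) ** \<rho> g = mat 1"
    using **[of "inv g" g] assms(3) 1 by simp
  then show "\<rho> (inv g) = matrix_inv (\<rho> g)"
    using matrix_inv_unique_left by metis
  show "invertible (\<rho> g)" "\<rho> \<one> = mat 1" "h \<in> carrier G \<Longrightarrow> \<rho> (g \<otimes> h) = \<rho> g ** \<rho> h"
    using * ** 1 assms(3) by auto
qed

lemma linear_sl2_matrix: "sl2_matrix (v + w) = sl2_matrix v + sl2_matrix w"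
  "sl2_matrix (c *s v) = mat c ** sl2_matrix v"
  by (simp_all add: vec_eq_iff forall_2 sl2_matrix_def)

lemma linear_sl2_coords: "sl2_coords (v + w) = sl2_coords v + sl2_coords w"
  "sl2_coords (mat c ** v) = c *s sl2_coords v"
  by (simp_all add: vec_eq_iff forall_3 sl2_coords_def)

lemma Ad0_mult:
  assumes "invertible (\<rho> g)"
  shows "sl2_matrix (Ad0 \<rho> g *v v) = \<rho> g ** sl2_matrix v ** matrix_inv (\<rho> g)"
proof -
  let ?f = "\<lambda>v. sl2_coords (\<rho> g ** sl2_matrix v ** matrix_inv (\<rho> g))"
  have "Vector_Spaces.linear (*s) (*s) ?f"
    by (rule vec_linearI)
       (simp_all add: linear_sl2_matrix matrix_add_ldistrib matrix_add_rdistrib linear_sl2_coords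
          matrix_mul_assoc mat_mult_commute flip: linear_sl2_coords(2))
  then have "Ad0 \<rho> g *v v = ?f v"
    unfolding Ad0_def by (rule matrix_works)
  moreover have "trace (\<rho> g ** sl2_matrix v ** matrix_inv (\<rho> g)) = 0"
    by (subst trace_mul_sym) (simp add: matrix_mul_assoc matrix_inv_mult assms trace_sl2_matrix)
  ultimately show ?thesis by (simp add: sl2_matrix_coords)
qed

lemma sl2_matrix_inject: "sl2_matrix v = sl2_matrix w \<longleftrightarrow> v = w"
  by (metis sl2_coords_matrix)

lemma Ad0_group:
  fixes G (structure)
  assumes "group G" "\<rho> \<in> hom G GL" "g \<in> carrier G"
  shows "h \<in> carrier G \<Longrightarrow> Ad0 \<rho> (g \<otimes> h) = Ad0 \<rho> g ** Ad0 \<rho> h"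
    "Ad0 \<rho> g ** Ad0 \<rho> (inv g) = mat 1" "Ad0 \<rho> (inv g) ** Ad0 \<rho> g = mat 1"
    "invertible (Ad0 \<rho> g)"
proof -
  interpret group G by fact
  note H = hom_GL[OF assms(1,2)]
  have m: "matrix_inv (\<rho> g ** \<rho> h) = matrix_inv (\<rho> h) ** matrix_inv (\<rho> g)" if "g \<in> carrier G" "h \<in> carrier G" for g h
  proof (rule matrix_inv_unique_left)
    have "matrix_inv (\<rho> h) ** matrix_inv (\<rho> g) ** (\<rho> g ** \<rho> h) = matrix_inv (\<rho> h) ** (matrix_inv (\<rho> g) ** \<rho> g) ** \<rho> h"
      by (simp add: matrix_mul_assoc)
    then show "matrix_inv (\<rho> h) ** matrix_inv (\<rho> g) ** (\<rho> g ** \<rho> h) = mat 1"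
      using H(1) that by (simp add: matrix_inv_mult)
  qed
  have *: "Ad0 \<rho> (g \<otimes> h) = Ad0 \<rho> g ** Ad0 \<rho> h" if "g \<in> carrier G" "h \<in> carrier G" for g h
  proof -
    have "sl2_matrix (Ad0 \<rho> (g \<otimes> h) *v v) = sl2_matrix ((Ad0 \<rho> g ** Ad0 \<rho> h) *v v)" for v
      using Ad0_mult[of \<rho> "g \<otimes> h", OF H(1)] that
      by (simp add: Ad0_mult H(1,2) m matrix_mul_assoc flip: matrix_vector_mul_assoc)
    then show ?thesis unfolding sl2_matrix_inject by (simp add: matrix_eq)
  qed
  have one: "Ad0 \<rho> \<one> = mat 1"
  proof -
    have "matrix_inv (mat 1 :: complex^2^2) = mat 1" by (rule matrix_inv_unique_left) simp
    then have "sl2_matrix (Ad0 \<rho> \<one> *v v) = sl2_matrix v" for v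
      using Ad0_mult[of \<rho> \<one>, OF H(1)] H(3)[of \<one>] by simp
    then show ?thesis unfolding sl2_matrix_inject by (simp add: matrix_eq)
  qed
  show "Ad0 \<rho> g ** Ad0 \<rho> (inv g) = mat 1" "Ad0 \<rho> (inv g) ** Ad0 \<rho> g = mat 1"
    using *[of g "inv g"] *[of "inv g" g] assms(3) one by simp_all
  then show "invertible (Ad0 \<rho> g)" unfolding invertible_def by blast
  show "h \<in> carrier G \<Longrightarrow> Ad0 \<rho> (g \<otimes> h) = Ad0 \<rho> g ** Ad0 \<rho> h"
    using * assms(3) .
qed

text \<open>\<open>Ad0\<close> is self-dual because conjugation preserves the trace form; \<open>J\<close> is its Gram matrix.\<close>

lemma Ad0_self_dual:
  fixes G (structure)
  assumes "group G" "\<rho> \<in> hom G GL"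
  obtains J :: "complex ^ 3 ^ 3" where "invertible J"
    "\<And>g. g \<in> carrier G \<Longrightarrow> transpose (Ad0 \<rho> (inv g)) ** J = J ** Ad0 \<rho> g"
proof -
  interpret group G by fact
  define J :: "complex^3^3" where "J = vector [vector [2, 0, 0], vector [0, 0, 1], vector [0, 1, 0]]"
  have "J ** vector [vector [1/2, 0, 0], vector [0, 0, 1], vector [0, 1, 0]] = mat 1"
    by (simp add: vec_eq_iff forall_3 J_def matrix_matrix_mult_def sum_3 mat_def)
  then have "invertible J" using invertible_right_inverse by blast
  define dot :: "complex^3 \<Rightarrow> complex^3 \<Rightarrow> complex" where "dot v w = (\<Sum>i\<in>UNIV. v $ i * w $ i)" for v w
  have J: "dot v (J *v w) = trace (sl2_matrix v ** sl2_matrix w)" for v w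
    by (simp add: dot_def J_def sum_3 trace_def sum_2 sl2_matrix_def matrix_matrix_mult_def matrix_vector_mult_def algebra_simps)
  have tr: "dot v (transpose A *v w) = dot (A *v v) w" for v w A
    by (simp add: dot_def sum_3 transpose_def matrix_vector_mult_def algebra_simps del: transpose_matrix_vector)
  have ext: "x = y" if "\<And>v. dot v x = dot v y" for x y
  proof -
    have "dot (axis i 1) z = z $ i" for i z
      by (simp add: dot_def axis_def if_distrib[of "\<lambda>x. x * _"] cong: if_cong)
    then show ?thesis using that by (metis vec_eq_iff)
  qed
  have "transpose (Ad0 \<rho> (inv g)) ** J = J ** Ad0 \<rho> g" if g: "g \<in> carrier G" for g
  proof -
    note R = hom_GL(1)[OF assms g] hom_GL(1)[OF assms inv_closed[OF g]] hom_GL(4)[OF assms g]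
    note I = matrix_inv_mult[OF R(1)]
    have I': "matrix_inv (matrix_inv (\<rho> g)) = \<rho> g" by (rule matrix_inv_unique_left) (rule I)
    have "dot v (transpose (Ad0 \<rho> (inv g)) *v (J *v w)) = dot v (J *v (Ad0 \<rho> g *v w))" for v w
    proof -
      have "dot v (transpose (Ad0 \<rho> (inv g)) *v (J *v w)) = trace (matrix_inv (\<rho> g) ** (sl2_matrix v ** \<rho> g ** sl2_matrix w))"
        using R by (simp only: tr J Ad0_mult I' matrix_mul_assoc)
      also have "\<dots> = trace (sl2_matrix v ** \<rho> g ** sl2_matrix w ** matrix_inv (\<rho> g))"
        by (rule trace_mul_sym)
      also have "\<dots> = dot v (J *v (Ad0 \<rho> g *v w))"
        using R by (simp only: J Ad0_mult matrix_mul_assoc)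
      finally show ?thesis .
    qed
    then show ?thesis unfolding matrix_eq by (metis ext matrix_vector_mul_assoc)
  qed
  then show ?thesis using that \<open>invertible J\<close> by blast
qed

text \<open>The transpose of \<open>M\<close> is onto and has a right inverse \<open>R\<close>. The
  map \<open>p \<mapsto> p $ 4 *s x + R *v t p\<close> is used twice: for \<open>x = 0\<close> it
  ignores the last coordinate, so it misses some \<open>z\<close>; for the kernel component
  \<open>x\<close> of that \<open>z\<close> it is bijective, so the kernel is the line of
  \<open>x\<close>.\<close>

lemma left_kernel_3_4:
  fixes M :: "complex ^ 3 ^ 4"
  assumes inj: "\<And>v. M *v v = 0 \<Longrightarrow> v = 0"
  obtains x where "x \<noteq> 0" "x v* M = 0" "\<And>y. y v* M = 0 \<Longrightarrow> \<exists>c. y = c *s x"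
proof -
  obtain L where L: "L ** M = mat 1"
    using matrix_left_invertible_ker[of M] inj by blast
  define F where "F = transpose M"
  define R where "R = transpose L"
  have FR: "F ** R = mat 1"
    unfolding F_def R_def matrix_transpose_mul[symmetric] L by simp
  have Fv: "F *v y = y v* M" for y unfolding F_def by simp
  define t :: "complex^4 \<Rightarrow> complex^3" where "t p = vector [p $ 1, p $ 2, p $ 3]" for p
  have t: "t (p + q) = t p + t q" "t (c *s p) = c *s t p" "t 0 = 0" for p q c
    by (simp_all add: t_def vec_eq_iff forall_3)
  have t_surj: "\<exists>p. t p = w \<and> p $ 4 = c" for w c
    by (rule exI[of _ "vector [w $ 1, w $ 2, w $ 3, c]"]) (simp add: t_def vec_eq_iff forall_3, simp add: vector_def)
  have lin: "Vector_Spaces.linear (*s) (*s) (\<lambda>p. p $ 4 *s x + R *v t p)" for x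
    by (rule vec_linearI) (simp_all add: t vector_add_ldistrib vector_sadd_rdistrib matrix_vector_right_distrib
        vector_scalar_commute algebra_simps)
  have FRw: "F *v (R *v w) = w" for w
    by (simp only: matrix_vector_mul_assoc FR matrix_vector_mul_lid)
  have "\<not> surj (\<lambda>p. p $ 4 *s 0 + R *v t p)"
  proof
    assume "surj (\<lambda>p. p $ 4 *s 0 + R *v t p)"
    then have inj: "inj (\<lambda>p. p $ 4 *s 0 + R *v t p)"
      using vec.linear_surj_imp_inj[OF lin] by blast
    obtain p :: "complex^4" where p: "t p = 0" "p $ 4 = 1" using t_surj by blast
    have "p = 0"
      by (rule injD[OF inj]) (simp add: p t(3))
    then show False using p by simp
  qed
  then have "\<exists>z. \<forall>p. R *v t p \<noteq> z" by (auto simp: surj_def) metis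
  then obtain z where z: "\<And>p. R *v t p \<noteq> z" by blast
  define x where "x = z - R *v (F *v z)"
  have "x \<noteq> 0" using z t_surj unfolding x_def by (metis eq_iff_diff_eq_0)
  moreover have Fx: "F *v x = 0"
    unfolding x_def by (simp only: matrix_vector_mult_diff_distrib FRw) simp
  moreover have "\<exists>c. y = c *s x" if Fy: "F *v y = 0" for y
  proof -
    have F_app: "F *v (p $ 4 *s x + R *v t p) = t p" for p
      by (simp only: matrix_vector_right_distrib vector_scalar_commute Fx FRw) simp
    have "inj (\<lambda>p. p $ 4 *s x + R *v t p)"
    proof (rule injI)
      fix p q :: "complex^4" assume eq: "p $ 4 *s x + R *v t p = q $ 4 *s x + R *v t q"
      then have "t p = t q" using F_app by metis
      with eq have "p $ 4 *s x = q $ 4 *s x" by simp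
      then have "p $ 4 = q $ 4" using \<open>x \<noteq> 0\<close> by simp
      with \<open>t p = t q\<close> show "p = q"
        by (simp add: t_def vec_eq_iff forall_3 forall_4)
    qed
    then have surj: "surj (\<lambda>p. p $ 4 *s x + R *v t p)"
      using vec.linear_inj_imp_surj[OF lin] by blast
    obtain p :: "complex^4" where p: "y = p $ 4 *s x + R *v t p" using surjD[OF surj, of y] by blast
    then have "t p = 0" using F_app Fy by metis
    then show ?thesis using p by auto
  qed
  ultimately show ?thesis using that Fv by metis
qed

definition vec4_of :: "complex ^ 2 ^ 2 \<Rightarrow> complex ^ 4" where
  "vec4_of M = vector [M $ 1 $ 1, M $ 1 $ 2, M $ 2 $ 1, M $ 2 $ 2]"

definition mat2_of :: "complex ^ 4 \<Rightarrow> complex ^ 2 ^ 2" where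
  "mat2_of v = vector [vector [v $ 1, v $ 2], vector [v $ 3, v $ 4]]"

lemma vector_4_complex [simp]:
  "(vector [a, b, c, d] :: complex ^ 4) $ 1 = a" "(vector [a, b, c, d] :: complex ^ 4) $ 2 = b"
  "(vector [a, b, c, d] :: complex ^ 4) $ 3 = c" "(vector [a, b, c, d] :: complex ^ 4) $ 4 = d"
  by (simp_all add: vector_def)

lemma mat2_of_vec4_of [simp]: "mat2_of (vec4_of M) = M"
  by (simp add: vec_eq_iff forall_2 mat2_of_def vec4_of_def)

lemma vec4_of_mat2_of [simp]: "vec4_of (mat2_of M) = M"
  by (simp add: vec_eq_iff forall_4 mat2_of_def vec4_of_def)

lemma irreducible_repD:
  assumes "irreducible_rep G \<rho>" "vec.subspace S" "\<And>g v. g \<in> carrier G \<Longrightarrow> v \<in> S \<Longrightarrow> \<rho> g *v v \<in> S"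
  shows "S = {0} \<or> S = UNIV"
  using assms unfolding irreducible_rep_def by blast

text \<open>Let a three-dimensional \<open>S\<close> embed into the four-dimensional space \<open>Hom(R, T)\<close>, on which the
  group preserves the quadratic form \<open>det\<close> up to a scalar. The orthogonal complement of \<open>S\<close> is an
  invariant line; it is spanned by an isomorphism \<open>B\<close> from a twist of \<open>R\<close> to \<open>T\<close>, and
  composition with the inverse of \<open>B\<close> identifies \<open>S\<close> with a space of traceless endomorphisms of \<open>R\<close>.\<close>

lemma three_dim_in_Hom:
  fixes R T :: "'g \<Rightarrow> complex ^ 2 ^ 2" and S :: "'g \<Rightarrow> complex ^ 3 ^ 3"
    and A :: "complex ^ 3 \<Rightarrow> complex ^ 2 ^ 2"
  assumes irred: "irreducible_rep G R"
    and inv: "\<And>g. g \<in> carrier G \<Longrightarrow> invertible (R g)" "\<And>g. g \<in> carrier G \<Longrightarrow> invertible (S g)"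
      "\<And>g. g \<in> carrier G \<Longrightarrow> invertible (T g)"
    and add: "\<And>v w. A (v + w) = A v + A w" and scale: "\<And>c v. A (c *s v) = mat c ** A v"
    and inj: "\<And>v. A v = 0 \<Longrightarrow> v = 0"
    and eq: "\<And>g v. g \<in> carrier G \<Longrightarrow> A (S g *v v) ** R g = T g ** A v"
  obtains P :: "complex ^ 3 ^ 3" and \<kappa> where "invertible P"
    "\<And>g. g \<in> carrier G \<Longrightarrow> P ** S g = mat (\<kappa> g) ** Ad0 R g ** P"
    "\<And>g. g \<in> carrier G \<Longrightarrow> \<kappa> g \<noteq> 0"
proof -
  \<comment> \<open>The polar form of the determinant; multiplying both arguments by the same matrix
    on one side scales it by the determinant of that matrix.\<close>
  define \<beta> where "\<beta> B M = trace (adj2 B ** M)" for B M :: "complex ^ 2 ^ 2"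
  have lin: "Vector_Spaces.linear (*s) (*s) (\<lambda>v. vec4_of (adj2 (A v)))"
    by (rule vec_linearI)
       (simp_all add: add scale vec4_of_def adj2_def vec_eq_iff forall_4)
  define M where "M = matrix (\<lambda>v. vec4_of (adj2 (A v)))"
  have M: "M *v v = vec4_of (adj2 (A v))" for v
    unfolding M_def by (rule matrix_works[OF lin])
  have Minj: "v = 0" if "M *v v = 0" for v
  proof -
    have "adj2 (A v) = 0" using that M by (simp add: vec_eq_iff forall_2 forall_4 vec4_of_def)
    then have "adj2 (adj2 (A v)) = adj2 0" by simp
    then have "A v = 0" by (simp only: adj2_adj2) (simp add: vec_eq_iff forall_2 adj2_def)
    then show ?thesis by (rule inj)
  qed
  define dot :: "complex^4 \<Rightarrow> complex^4 \<Rightarrow> complex" where "dot v w = (\<Sum>i\<in>UNIV. v $ i * w $ i)" for v w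
  \<comment> \<open>\<open>sw B\<close> lists the entries of the transpose of \<open>B\<close>, so
    that its coordinatewise product with an adjugate computes the trace form \<beta>.\<close>
  define sw :: "complex^2^2 \<Rightarrow> complex^4" where "sw B = vector [B $ 1 $ 1, B $ 2 $ 1, B $ 1 $ 2, B $ 2 $ 2]" for B
  have dot_sw: "dot (sw B) (vec4_of (adj2 N)) = \<beta> B N" for B N
    by (simp add: dot_def sw_def sum_4 vec4_of_def \<beta>_def trace_def sum_2 adj2_def matrix_matrix_mult_def algebra_simps)
  have zero_iff: "y v* M = 0 \<longleftrightarrow> (\<forall>v. dot y (M *v v) = 0)" for y
  proof -
    have *: "dot y (M *v v) = (\<Sum>i\<in>UNIV. (y v* M) $ i * v $ i)" for v
      by (simp add: dot_def sum_4 sum_3 matrix_vector_mult_def vector_matrix_mult_def algebra_simps)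
    have comp: "(y v* M) $ i = dot y (M *v axis i 1)" for i :: 3
      unfolding * by (simp add: axis_def if_distrib[of "\<lambda>x. _ * x"] cong: if_cong)
    show ?thesis
    proof
      assume "y v* M = 0"
      then show "\<forall>v. dot y (M *v v) = 0" unfolding * by simp
    next
      assume "\<forall>v. dot y (M *v v) = 0"
      then show "y v* M = 0" unfolding vec_eq_iff comp by simp
    qed
  qed
  obtain x where x: "x \<noteq> 0" "x v* M = 0" "\<And>y. y v* M = 0 \<Longrightarrow> \<exists>c. y = c *s x"
    using left_kernel_3_4[of M] Minj by metis
  define B :: "complex^2^2" where "B = vector [vector [x $ 1, x $ 3], vector [x $ 2, x $ 4]]"
  have swB: "sw B = x" by (simp add: sw_def B_def vec_eq_iff forall_4)
  have B0: "B \<noteq> 0"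
  proof
    assume "B = 0"
    then have "sw B = 0" by (simp add: sw_def vec_eq_iff forall_4)
    then show False using x(1) swB by simp
  qed
  have BA: "\<beta> B (A v) = 0" for v
    using x(2) unfolding zero_iff M swB[symmetric] dot_sw by blast
  have Buniq: "\<exists>c. B' = mat c ** B" if "\<And>v. \<beta> B' (A v) = 0" for B'
  proof -
    have "sw B' v* M = 0" unfolding zero_iff M dot_sw using that by blast
    then obtain c where "sw B' = c *s sw B" using x(3) swB by metis
    then have "B' = mat c ** B" by (simp add: sw_def vec_eq_iff forall_4 forall_2)
    then show ?thesis by blast
  qed
  \<comment> \<open>\<open>T g ** B ** Ri\<close> is again orthogonal to every \<open>A v\<close>,
    and the orthogonal complement is a line.\<close>
  have "\<exists>c. T g ** B = mat c ** B ** R g" if g: "g \<in> carrier G" for g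
  proof -
    note I = matrix_inv_mult[OF inv(1)[OF g]] matrix_inv_mult[OF inv(2)[OF g]]
    define Ri where "Ri = matrix_inv (R g)"
    have Ri: "R g ** Ri = mat 1" "Ri ** R g = mat 1" using I by (simp_all add: Ri_def)
    have "\<beta> (T g ** B ** Ri) (A v) = 0" for v
    proof -
      define w where "w = matrix_inv (S g) *v v"
      have "A v = A (S g *v w) ** (R g ** Ri)"
        unfolding w_def by (simp add: matrix_vector_mul_assoc I Ri)
      then have "A v = T g ** A w ** Ri"
        using eq[OF g] by (simp add: matrix_mul_assoc)
      then have "\<beta> (T g ** B ** Ri) (A v) = trace (adj2 Ri ** adj2 B ** (adj2 (T g) ** T g) ** A w ** Ri)"
        by (simp only: \<beta>_def adj2_prod matrix_mul_assoc)
      also have "\<dots> = det (T g) * trace (adj2 Ri ** (adj2 B ** A w ** Ri))"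
        by (simp only: adj2_mult mat_mult_commute trace_mat_mult flip: matrix_mul_assoc)
      also have "trace (adj2 Ri ** (adj2 B ** A w ** Ri)) = trace (adj2 B ** A w ** (Ri ** adj2 Ri))"
        by (subst trace_mul_sym) (simp only: matrix_mul_assoc)
      also have "\<dots> = det Ri * \<beta> B (A w)"
        by (simp only: adj2_mult mat_mult_commute trace_mat_mult \<beta>_def)
      finally show ?thesis by (simp add: BA)
    qed
    then obtain c where "T g ** B ** Ri = mat c ** B" using Buniq by blast
    then have "T g ** B ** (Ri ** R g) = mat c ** B ** R g" by (simp only: matrix_mul_assoc)
    then show ?thesis using Ri by auto
  qed
  then obtain \<kappa>' where \<kappa>': "\<And>g. g \<in> carrier G \<Longrightarrow> T g ** B = mat (\<kappa>' g) ** B ** R g"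
    by metis
  have k0: "\<kappa>' g \<noteq> 0" if g: "g \<in> carrier G" for g
  proof
    assume "\<kappa>' g = 0"
    then have "T g ** B = 0" using \<kappa>'[OF g] by simp
    then have "matrix_inv (T g) ** T g ** B = 0" by (simp flip: matrix_mul_assoc)
    then show False using B0 matrix_inv_mult[OF inv(3)[OF g]] by simp
  qed
  \<comment> \<open>The kernel of \<open>B\<close> is stable under \<open>R\<close>, so
    irreducibility makes \<open>B\<close> invertible.\<close>
  have "{v. B *v v = 0} = {0} \<or> {v. B *v v = 0} = UNIV"
  proof (rule irreducible_repD[OF irred])
    show "vec.subspace {v. B *v v = 0}" by (rule vec.subspace_kernel)
    fix g v assume g: "g \<in> carrier G" and v: "v \<in> {v. B *v v = 0}"
    have "\<kappa>' g *s (B *v (R g *v v)) = (mat (\<kappa>' g) ** B ** R g) *v v"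
      by (simp flip: matrix_vector_mul_assoc)
    also have "\<dots> = 0" using v \<kappa>'[OF g, symmetric] by (simp flip: matrix_vector_mul_assoc)
    finally show "R g *v v \<in> {v. B *v v = 0}" using k0[OF g] by simp
  qed
  moreover have "{v. B *v v = 0} \<noteq> UNIV"
    using B0 by (auto simp: matrix_eq)
  ultimately have "\<exists>C. C ** B = mat 1" unfolding matrix_left_invertible_ker by blast
  then have Binv: "invertible B" using invertible_left_inverse by blast
  define Bi where "Bi = matrix_inv B"
  have Bi: "B ** Bi = mat 1" "Bi ** B = mat 1" using matrix_inv_mult[OF Binv] by (simp_all add: Bi_def)
  have detB: "det B \<noteq> 0" using Binv invertible_det_nz by blast
  \<comment> \<open>The adjugate of \<open>B\<close> is a scalar multiple of its inverse, so
    orthogonality to \<open>B\<close> is tracelessness of \<open>Bi ** A v\<close>.\<close>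
  have tr: "trace (Bi ** A v) = 0" for v
  proof -
    have "trace (adj2 B ** A v) = det B * trace (Bi ** A v)"
      unfolding adj2_eq_matrix_inv[OF Binv] Bi_def[symmetric]
      by (simp only: trace_mat_mult flip: matrix_mul_assoc)
    then show ?thesis using BA detB by (simp add: \<beta>_def)
  qed
  define p where "p v = sl2_coords (Bi ** A v)" for v
  have slp: "sl2_matrix (p v) = Bi ** A v" for v
    unfolding p_def by (rule sl2_matrix_coords) (rule tr)
  have plin: "Vector_Spaces.linear (*s) (*s) p"
  proof (rule vec_linearI)
    show "p (v + w) = p v + p w" for v w by (simp add: p_def add matrix_add_ldistrib linear_sl2_coords)
    have "Bi ** (mat c ** A v) = mat c ** (Bi ** A v)" for c v
      by (simp only: matrix_mul_assoc mat_mult_commute)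
    then show "p (c *s v) = c *s p v" for c v by (simp add: p_def scale linear_sl2_coords)
  qed
  define P where "P = matrix p"
  have P: "P *v v = p v" for v unfolding P_def by (rule matrix_works[OF plin])
  have "v = 0" if "P *v v = 0" for v
  proof -
    have "Bi ** A v = sl2_matrix 0" using that slp[of v] P by simp
    then have "Bi ** A v = 0" by (simp add: sl2_matrix_def vec_eq_iff forall_2)
    then have "B ** Bi ** A v = 0" by (simp flip: matrix_mul_assoc)
    then show ?thesis using Bi inj by simp
  qed
  then have "\<exists>Q. Q ** P = mat 1" unfolding matrix_left_invertible_ker by blast
  then have Pinv: "invertible P" using invertible_left_inverse by blast
  have "P ** S g = mat (\<kappa>' g) ** Ad0 R g ** P" if g: "g \<in> carrier G" for g
  proof -
    note I = matrix_inv_mult[OF inv(1)[OF g]]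
    have BT: "Bi ** T g = mat (\<kappa>' g) ** R g ** Bi"
    proof -
      have "Bi ** T g = Bi ** (T g ** B) ** Bi" using Bi by (simp flip: matrix_mul_assoc)
      also have "\<dots> = Bi ** (mat (\<kappa>' g) ** B ** R g) ** Bi" using \<kappa>'[OF g] by simp
      also have "\<dots> = mat (\<kappa>' g) ** (Bi ** B) ** R g ** Bi"
        by (simp only: matrix_mul_assoc mat_mult_commute)
      finally show ?thesis using Bi by simp
    qed
    have "p (S g *v v) = \<kappa>' g *s (Ad0 R g *v p v)" for v
    proof -
      have "sl2_matrix (p (S g *v v)) = Bi ** (A (S g *v v) ** R g) ** matrix_inv (R g)"
        using I by (simp add: slp flip: matrix_mul_assoc)
      also have "\<dots> = (Bi ** T g) ** A v ** matrix_inv (R g)"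
        using eq[OF g] by (simp add: matrix_mul_assoc)
      also have "\<dots> = mat (\<kappa>' g) ** (R g ** sl2_matrix (p v) ** matrix_inv (R g))"
        unfolding BT slp by (simp only: matrix_mul_assoc)
      also have "\<dots> = sl2_matrix (\<kappa>' g *s (Ad0 R g *v p v))"
        using Ad0_mult[of R g, OF inv(1)[OF g]] by (simp only: linear_sl2_matrix)
      finally show ?thesis by (simp only: sl2_matrix_inject)
    qed
    then have "(P ** S g) *v v = (mat (\<kappa>' g) ** Ad0 R g ** P) *v v" for v
      by (simp add: P flip: matrix_vector_mul_assoc)
    then show ?thesis by (simp add: matrix_eq)
  qed
  then show ?thesis using that Pinv k0 by blast
qed

section \<open>Stable subspaces of tensor products\<close>

lemma sum_UNIV_prod: "sum f (UNIV :: ('a::finite \<times> 'b::finite) set) = (\<Sum>i\<in>UNIV. \<Sum>j\<in>UNIV. f (i, j))"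
  by (simp add: sum.cartesian_product flip: UNIV_Times_UNIV)

lemma invertible_transpose:
  fixes A :: "'a::field ^ 'n ^ 'n"
  assumes "invertible A"
  shows "invertible (transpose A)"
  using assms unfolding invertible_def by (metis matrix_transpose_mul transpose_mat)

definition contract :: "complex ^ 3 \<Rightarrow> complex ^ (2 \<times> 3) \<Rightarrow> complex ^ 2" where
  "contract l x = (\<chi> i. \<Sum>j\<in>UNIV. l $ j * x $ (i, j))"

definition tensor_vec :: "complex ^ 'm \<Rightarrow> complex ^ 'n \<Rightarrow> complex ^ ('m \<times> 'n)" where
  "tensor_vec u v = (\<chi> i. u $ fst i * v $ snd i)"

lemma contract_linear:
  "contract l (x + y) = contract l x + contract l y" "contract l (x - y) = contract l x - contract l y"
  "contract l (c *s x) = c *s contract l x" "contract l 0 = 0"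
  "contract (l + l') x = contract l x + contract l' x" "contract (c *s l) x = c *s contract l x"
  by (simp_all add: contract_def vec_eq_iff sum_3 algebra_simps)

lemma contract_tensor_rep:
  "contract l (tensor_rep R S g *v x) = R g *v contract (l v* S g) x"
  by (simp add: contract_def vec_eq_iff forall_2 tensor_rep_def matrix_vector_mult_def vector_matrix_mult_def
      sum_UNIV_prod sum_2 sum_3 algebra_simps)

lemma tensor_rep_tensor_vec:
  "tensor_rep R S g *v tensor_vec u v = tensor_vec (R g *v u) (S g *v v)"
  by (simp add: tensor_vec_def vec_eq_iff tensor_rep_def matrix_vector_mult_def
      sum_UNIV_prod sum_product algebra_simps)

lemma tensor_vec_linear:
  "tensor_vec (u + u') v = tensor_vec u v + tensor_vec u' v" "tensor_vec (c *s u) v = c *s tensor_vec u v"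
  "tensor_vec u (v + v') = tensor_vec u v + tensor_vec u v'" "tensor_vec u (c *s v) = c *s tensor_vec u v"
  by (simp_all add: tensor_vec_def vec_eq_iff algebra_simps)

lemma tensor_rep_mult:
  assumes "R1 g = R1 g1 ** R1 g2" "R2 g = R2 g1 ** R2 g2"
  shows "tensor_rep R1 R2 g = tensor_rep R1 R2 g1 ** tensor_rep R1 R2 g2"
proof -
  have "tensor_rep R1 R2 g $ i $ j = (tensor_rep R1 R2 g1 ** tensor_rep R1 R2 g2) $ i $ j" for i j
    by (simp add: assms tensor_rep_def matrix_matrix_mult_def sum_UNIV_prod sum_product mult_ac)
  then show ?thesis by (simp add: vec_eq_iff)
qed

lemma tensor_rep_one:
  assumes "R1 g = mat 1" "R2 g = mat 1"
  shows "tensor_rep R1 R2 g = mat 1"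
  using assms by (auto simp: vec_eq_iff tensor_rep_def mat_def prod_eq_iff)

lemma hom_GLI:
  fixes G (structure)
  assumes "group G" "\<rho> \<one> = mat 1" "\<And>g h. g \<in> carrier G \<Longrightarrow> h \<in> carrier G \<Longrightarrow> \<rho> (g \<otimes> h) = \<rho> g ** \<rho> h"
  shows "\<rho> \<in> hom G GL"
proof -
  interpret group G by fact
  have "invertible (\<rho> g)" if "g \<in> carrier G" for g
    unfolding invertible_def using assms(2) assms(3)[of g "inv g"] assms(3)[of "inv g" g] that
    by (intro exI[of _ "\<rho> (inv g)"]) simp
  then show ?thesis using assms(3) by (auto simp: hom_def GL_def)
qed

lemma tensor_rep_hom:
  assumes "group G" "R1 \<in> hom G GL" "R2 \<in> hom G GL"
  shows "tensor_rep R1 R2 \<in> hom G GL"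
proof (rule hom_GLI[OF assms(1)])
  interpret group G by fact
  show "tensor_rep R1 R2 \<one>\<^bsub>G\<^esub> = mat 1"
    using hom_GL(3)[OF assms(1,2)] hom_GL(3)[OF assms(1,3)] by (intro tensor_rep_one) auto
  show "tensor_rep R1 R2 (g \<otimes>\<^bsub>G\<^esub> h) = tensor_rep R1 R2 g ** tensor_rep R1 R2 h"
    if "g \<in> carrier G" "h \<in> carrier G" for g h
    using hom_GL(2)[OF assms(1,2)] hom_GL(2)[OF assms(1,3)] that by (intro tensor_rep_mult) auto
qed

text \<open>The factor \<kappa> is only a function here; its multiplicativity and continuity are
  extracted from the equation later.\<close>

definition twist_equivalent ::
    "'g monoid \<Rightarrow> ('g \<Rightarrow> complex ^ 'n ^ 'n) \<Rightarrow> ('g \<Rightarrow> complex ^ 'n ^ 'n) \<Rightarrow> bool" where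
  "twist_equivalent G S A \<longleftrightarrow> (\<exists>P \<kappa>. invertible P \<and>
     (\<forall>g\<in>carrier G. P ** S g = mat (\<kappa> g) ** A g ** P \<and> \<kappa> g \<noteq> 0))"

text \<open>For a stable subspace of dimension four, written as the kernel of \<open>q\<close>. The
  action descends to a representation \<open>T\<close> on the quotient plane, and sending
  \<open>v\<close> to the map \<open>u \<mapsto> q (tensor_vec u v)\<close> embeds the space of
  \<open>S\<close> into Hom(R, T). The section \<open>s\<close> is merely linear.\<close>

lemma two_dim_quotient:
  fixes G (structure) and R :: "'g \<Rightarrow> complex ^ 2 ^ 2" and S :: "'g \<Rightarrow> complex ^ 3 ^ 3"
    and q :: "complex ^ (2 \<times> 3) \<Rightarrow> complex ^ 2" and s :: "complex ^ 2 \<Rightarrow> complex ^ (2 \<times> 3)"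
  assumes G: "group G" and R: "irreducible_rep G R" and S: "irreducible_rep G S"
    and q: "Vector_Spaces.linear (*s) (*s) q" and s: "Vector_Spaces.linear (*s) (*s) s"
    and qs: "\<And>u. q (s u) = u"
    and ker: "\<And>g x. g \<in> carrier G \<Longrightarrow> q x = 0 \<Longrightarrow> q (tensor_rep R S g *v x) = 0"
  shows "twist_equivalent G S (Ad0 R)"
proof -
  interpret group G by fact
  interpret q: Vector_Spaces.linear "(*s)" "(*s)" q by fact
  interpret s: Vector_Spaces.linear "(*s)" "(*s)" s by fact
  have hom: "R \<in> hom G GL" "S \<in> hom G GL" using R S by (auto simp: irreducible_rep_def)
  note tens = tensor_rep_hom[OF G hom]
  have linq: "Vector_Spaces.linear (*s) (*s) (\<lambda>u. q (f u))"
    if "\<And>u v. f (u + v) = f u + f v" "\<And>c u. f (c *s u) = c *s f u" for f :: "complex^2 \<Rightarrow> complex^(2 \<times> 3)"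
    using that by (intro vec_linearI) (simp_all add: q.add q.scale)
  define T where "T g = matrix (\<lambda>u. q (tensor_rep R S g *v s u))" for g
  have T: "T g *v u = q (tensor_rep R S g *v s u)" for g u
    unfolding T_def
    by (rule matrix_works, rule linq) (simp_all add: s.add s.scale matrix_vector_right_distrib vector_scalar_commute)
  have qT: "q (tensor_rep R S g *v x) = T g *v q x" if g: "g \<in> carrier G" for g x
  proof -
    have "q (x - s (q x)) = 0" by (simp add: q.diff qs)
    then have "q (tensor_rep R S g *v (x - s (q x))) = 0" by (rule ker[OF g])
    then show ?thesis by (simp add: T matrix_vector_mult_diff_distrib q.diff)
  qed
  have "T \<in> hom G GL"
  proof (rule hom_GLI[OF G])
    have "T \<one> *v u = mat 1 *v u" for u using hom_GL(3)[OF G tens one_closed] by (simp add: T qs)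
    then show "T \<one> = mat 1" by (simp add: matrix_eq)
    have "T (g \<otimes> h) *v u = (T g ** T h) *v u" if "g \<in> carrier G" "h \<in> carrier G" for g h u
      using hom_GL(2)[OF G tens that] qT[OF that(1), of "tensor_rep R S h *v s u"]
      by (simp add: T[of "g \<otimes> h"] T[of h] flip: matrix_vector_mul_assoc)
    then show "T (g \<otimes> h) = T g ** T h" if "g \<in> carrier G" "h \<in> carrier G" for g h
      using that by (simp add: matrix_eq)
  qed
  note Tinv = hom_GL(1)[OF G this]
  define A where "A v = matrix (\<lambda>u. q (tensor_vec u v))" for v
  have A: "A v *v u = q (tensor_vec u v)" for v u
    unfolding A_def by (rule matrix_works, rule linq) (simp_all add: tensor_vec_linear)
  have Aadd: "A (v + w) = A v + A w" for v w
    by (simp add: matrix_eq A tensor_vec_linear q.add matrix_vector_mult_add_rdistrib)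
  have Ascale: "A (c *s v) = mat c ** A v" for c v
    by (simp add: matrix_eq A tensor_vec_linear q.scale flip: matrix_vector_mul_assoc)
  have Aeq: "A (S g *v v) ** R g = T g ** A v" if "g \<in> carrier G" for g v
    using qT[OF that] by (simp add: matrix_eq A tensor_rep_tensor_vec flip: matrix_vector_mul_assoc) (metis tensor_rep_tensor_vec)
  \<comment> \<open>The vectors inducing the zero map form a stable subspace. It is not everything,
    since \<open>q\<close> would then vanish on pure tensors and hence identically.\<close>
  have "{v. A v = 0} = {0} \<or> {v. A v = 0} = UNIV"
  proof (rule irreducible_repD[OF S])
    show "vec.subspace {v. A v = 0}"
      using Ascale[of 0 0] by (intro vec.subspaceI) (auto simp: Aadd Ascale)
    fix g v assume g: "g \<in> carrier G" and v: "v \<in> {v. A v = 0}"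
    have "A (S g *v v) ** (R g ** matrix_inv (R g)) = 0"
      using Aeq[OF g, of v] v by (simp add: matrix_mul_assoc)
    then show "S g *v v \<in> {v. A v = 0}"
      using matrix_inv_mult[OF hom_GL(1)[OF G hom(1) g]] by simp
  qed
  moreover have "{v. A v = 0} \<noteq> UNIV"
  proof
    assume *: "{v. A v = 0} = UNIV"
    have q0: "q (tensor_vec u v) = 0" for u v
    proof -
      have "A v = 0" using * by blast
      then show ?thesis using A[of v u] by simp
    qed
    have "q x = 0" for x
    proof -
      have "axis i 1 = tensor_vec (axis (fst i) 1) (axis (snd i) 1)" for i :: "2 \<times> 3"
        by (simp add: tensor_vec_def axis_def vec_eq_iff prod_eq_iff)
      then have "q (axis i 1) = 0" for i using q0 by simp
      then have "q (\<Sum>i\<in>UNIV. x $ i *s axis i 1) = 0" by (simp add: q.sum q.scale)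
      then show ?thesis by (simp only: basis_expansion)
    qed
    then have "axis 1 1 = (0 :: complex^2)" using qs by metis
    then show False by (simp add: axis_eq_0_iff)
  qed
  ultimately have Ainj: "v = 0" if "A v = 0" for v using that by blast
  obtain P \<kappa> where "invertible P" "\<And>g. g \<in> carrier G \<Longrightarrow> P ** S g = mat (\<kappa> g) ** Ad0 R g ** P"
    "\<And>g. g \<in> carrier G \<Longrightarrow> \<kappa> g \<noteq> 0"
    using three_dim_in_Hom[OF R hom_GL(1)[OF G hom(1)] hom_GL(1)[OF G hom(2)] Tinv Aadd Ascale Ainj Aeq] by metis
  then show ?thesis unfolding twist_equivalent_def by blast
qed

text \<open>For a stable plane, the image of \<open>J\<close>. Contraction with functionals gives
  maps from the plane to the space of \<open>R\<close>, indexed by the dual of \<open>S\<close>.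
  Adjugates reverse their direction, and the self-duality of \<open>Ad0\<close> undoes the passage
  to the dual.\<close>

lemma two_dim_subrepresentation:
  fixes G (structure) and R :: "'g \<Rightarrow> complex ^ 2 ^ 2" and S :: "'g \<Rightarrow> complex ^ 3 ^ 3"
    and J :: "complex ^ 2 \<Rightarrow> complex ^ (2 \<times> 3)" and p :: "complex ^ (2 \<times> 3) \<Rightarrow> complex ^ 2"
  assumes G: "group G" and R: "irreducible_rep G R" and S: "irreducible_rep G S"
    and J: "Vector_Spaces.linear (*s) (*s) J" and p: "Vector_Spaces.linear (*s) (*s) p"
    and pJ: "\<And>u. p (J u) = u"
    and range: "\<And>g u. g \<in> carrier G \<Longrightarrow> tensor_rep R S g *v J u \<in> range J"
  shows "twist_equivalent G S (Ad0 R)"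
proof -
  interpret group G by fact
  interpret J: Vector_Spaces.linear "(*s)" "(*s)" J by fact
  interpret p: Vector_Spaces.linear "(*s)" "(*s)" p by fact
  have hom: "R \<in> hom G GL" "S \<in> hom G GL" using R S by (auto simp: irreducible_rep_def)
  note tens = tensor_rep_hom[OF G hom]
  define T where "T g = matrix (\<lambda>u. p (tensor_rep R S g *v J u))" for g
  have T: "T g *v u = p (tensor_rep R S g *v J u)" for g u
    unfolding T_def
    by (rule matrix_works, rule vec_linearI)
       (simp_all add: J.add J.scale matrix_vector_right_distrib vector_scalar_commute p.add p.scale)
  have JT: "tensor_rep R S g *v J u = J (T g *v u)" if "g \<in> carrier G" for g u
    using range[OF that, of u] pJ by (auto simp: T)
  have Thom: "T \<in> hom G GL"
  proof (rule hom_GLI[OF G])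
    have "T \<one> *v u = mat 1 *v u" for u using hom_GL(3)[OF G tens one_closed] by (simp add: T pJ)
    then show "T \<one> = mat 1" by (simp add: matrix_eq)
    have "T (g \<otimes> h) *v u = (T g ** T h) *v u" if "g \<in> carrier G" "h \<in> carrier G" for g h u
    proof -
      have "T (g \<otimes> h) *v u = p (tensor_rep R S g *v (tensor_rep R S h *v J u))"
        using hom_GL(2)[OF G tens that] by (simp add: T flip: matrix_vector_mul_assoc)
      also have "\<dots> = T g *v (T h *v u)" using that by (simp add: JT pJ)
      finally show ?thesis by (simp flip: matrix_vector_mul_assoc)
    qed
    then show "T (g \<otimes> h) = T g ** T h" if "g \<in> carrier G" "h \<in> carrier G" for g h
      using that by (simp add: matrix_eq)
  qed
  define C where "C f = matrix (\<lambda>u. contract f (J u))" for f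
  have C: "C f *v u = contract f (J u)" for f u
    unfolding C_def by (rule matrix_works, rule vec_linearI) (simp_all add: J.add J.scale contract_linear)
  have RC: "R h ** C (f v* S h) = C f ** T h" if "h \<in> carrier G" for f h
    by (simp add: matrix_eq C JT[OF that, symmetric] contract_tensor_rep flip: matrix_vector_mul_assoc)
  define S' where "S' g = transpose (S (inv g))" for g
  have S'inv: "invertible (S' g)" if "g \<in> carrier G" for g
    unfolding S'_def using hom_GL(1)[OF G hom(2)] that by (intro invertible_transpose) auto
  define A where "A f = adj2 (C f)" for f
  have Cadd: "C (v + w) = C v + C w" for v w
    by (simp add: matrix_eq C contract_linear matrix_vector_mult_add_rdistrib)
  have Cscale: "C (c *s v) = mat c ** C v" for c v
    by (simp add: matrix_eq C contract_linear flip: matrix_vector_mul_assoc)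
  have Aadd: "A (v + w) = A v + A w" for v w
    by (simp add: A_def Cadd adj2_def vec_eq_iff forall_2)
  have Ascale: "A (c *s v) = mat c ** A v" for c v
    by (simp add: A_def Cscale adj2_def vec_eq_iff forall_2)
  \<comment> \<open>The factor \<open>det (R g)\<close> appears because
    \<open>adj2 (R g) ** R g\<close> is this scalar.\<close>
  define T' where "T' g = mat (det (R g)) ** adj2 (T (inv g))" for g
  have T'inv: "invertible (T' g)" if g: "g \<in> carrier G" for g
  proof -
    have "det (R g) \<noteq> 0" "det (T (inv g)) \<noteq> 0"
      using hom_GL(1)[OF G hom(1) g] hom_GL(1)[OF G Thom inv_closed[OF g]] invertible_det_nz by auto
    then show ?thesis
      unfolding T'_def by (intro invertible_mult invertible_mat) (simp_all add: invertible_det_nz)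
  qed
  have Aeq: "A (S' g *v f) ** R g = T' g ** A f" if g: "g \<in> carrier G" for g f
  proof -
    have "R g ** R (inv g) = mat 1" using hom_GL(2,3)[OF G hom(1)] g by (metis inv_closed r_inv)
    then have "C (f v* S (inv g)) = R g ** (R (inv g) ** C (f v* S (inv g)))"
      by (simp add: matrix_mul_assoc)
    also have "\<dots> = R g ** C f ** T (inv g)"
      using RC[of "inv g" f] g by (simp add: matrix_mul_assoc)
    finally have "A (S' g *v f) ** R g = adj2 (T (inv g)) ** A f ** (adj2 (R g) ** R g)"
      by (simp add: A_def S'_def adj2_prod matrix_mul_assoc)
    also have "\<dots> = T' g ** A f"
      unfolding T'_def adj2_mult mat_mult_commute by (simp only: matrix_mul_assoc)
    finally show ?thesis .
  qed
  have Cinj: "f = 0" if f: "C f = 0" for f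
  proof -
    define dot :: "complex^3 \<Rightarrow> complex^3 \<Rightarrow> complex" where "dot v w = (\<Sum>i\<in>UNIV. v $ i * w $ i)" for v w
    have dot_lin: "dot f (v + w) = dot f v + dot f w" "dot f (c *s w) = c * dot f w" "dot f 0 = 0" for f v w c
      by (simp_all add: dot_def sum_3 algebra_simps)
    \<comment> \<open>The annihilator of the functionals with zero contraction. It contains the
      slices of every \<open>J u\<close> in the three-dimensional factor, so it is nonzero, and
      irreducibility of \<open>S\<close> makes it everything.\<close>
    define U where "U = {w. \<forall>f. C f = 0 \<longrightarrow> dot f w = 0}"
    have "U = {0} \<or> U = UNIV"
    proof (rule irreducible_repD[OF S])
      show "vec.subspace U"
        by (intro vec.subspaceI) (simp_all add: U_def dot_lin)
      fix g w assume g: "g \<in> carrier G" and w: "w \<in> U"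
      have "dot f (S g *v w) = 0" if "C f = 0" for f
      proof -
        have "dot f (S g *v w) = dot (f v* S g) w"
          by (simp add: dot_def sum_3 matrix_vector_mult_def vector_matrix_mult_def algebra_simps)
        moreover have "R g ** C (f v* S g) = 0" using RC[OF g] that by simp
        then have "matrix_inv (R g) ** R g ** C (f v* S g) = 0" by (simp flip: matrix_mul_assoc)
        then have "C (f v* S g) = 0" using matrix_inv_mult[OF hom_GL(1)[OF G hom(1) g]] by simp
        ultimately show ?thesis using w by (simp add: U_def)
      qed
      then show "S g *v w \<in> U" by (simp add: U_def)
    qed
    moreover have "U \<noteq> {0}"
    proof
      assume U: "U = {0}"
      have "J u = 0" for u
      proof -
        have "(\<chi> j. J u $ (k, j)) \<in> U" for k
        proof -
          have "dot f (\<chi> j. J u $ (k, j)) = contract f (J u) $ k" for f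
            by (simp add: dot_def contract_def)
          then show ?thesis by (simp add: U_def flip: C)
        qed
        then have "(\<chi> j. J u $ (k, j)) = 0" for k using U by blast
        then have "J u $ (k, j) = 0" for k j by (metis vec_lambda_beta zero_index)
        then show ?thesis by (simp add: vec_eq_iff)
      qed
      then have "axis 1 1 = (0 :: complex^2)" using pJ p.zero by metis
      then show False by (simp add: axis_eq_0_iff)
    qed
    ultimately have U: "U = UNIV" by blast
    have "f $ i = 0" for i
    proof -
      have "dot f (axis i 1) = 0" using U f by (auto simp: U_def)
      then show ?thesis by (simp add: dot_def axis_def if_distrib[of "\<lambda>x. _ * x"] cong: if_cong)
    qed
    then show ?thesis by (simp add: vec_eq_iff)
  qed
  have Ainj: "f = 0" if "A f = 0" for f
  proof -
    have "C f = adj2 0" using that by (metis A_def adj2_adj2)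
    then show ?thesis by (intro Cinj) (simp add: adj2_def vec_eq_iff forall_2)
  qed
  obtain P \<kappa> where P: "invertible P" "\<And>g. g \<in> carrier G \<Longrightarrow> P ** S' g = mat (\<kappa> g) ** Ad0 R g ** P"
    "\<And>g. g \<in> carrier G \<Longrightarrow> \<kappa> g \<noteq> 0"
    using three_dim_in_Hom[OF R hom_GL(1)[OF G hom(1)] S'inv T'inv Aadd Ascale Ainj Aeq] by metis
  obtain H :: "complex^3^3" where H: "invertible H"
    "\<And>g. g \<in> carrier G \<Longrightarrow> transpose (Ad0 R (inv g)) ** H = H ** Ad0 R g"
    using Ad0_self_dual[OF G hom(1)] by metis
  \<comment> \<open>Transposing \<open>P\<close> turns an intertwiner for the dual of
    \<open>S\<close> into one for \<open>S\<close> and the dual of \<open>Ad0 R\<close>;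
    \<open>H\<close> identifies the latter with \<open>Ad0 R\<close>.\<close>
  define N where "N = transpose P ** H"
  have Ninv: "invertible N" unfolding N_def using P(1) H(1) by (intro invertible_mult invertible_transpose)
  have SN: "S g ** N = mat (\<kappa> (inv g)) ** N ** Ad0 R g" if g: "g \<in> carrier G" for g
  proof -
    have "transpose (P ** S' (inv g)) = transpose (mat (\<kappa> (inv g)) ** Ad0 R (inv g) ** P)"
      using P(2)[of "inv g"] g by simp
    then have "S g ** transpose P = transpose P ** transpose (Ad0 R (inv g)) ** mat (\<kappa> (inv g))"
      using g by (simp add: matrix_transpose_mul S'_def matrix_mul_assoc transpose_mat)
    then have "S g ** N = mat (\<kappa> (inv g)) ** transpose P ** (transpose (Ad0 R (inv g)) ** H)"
      by (simp add: N_def matrix_mul_assoc mat_mult_commute)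
    then show ?thesis using H(2)[OF g] by (simp add: N_def matrix_mul_assoc)
  qed
  have "matrix_inv N ** S g = mat (\<kappa> (inv g)) ** Ad0 R g ** matrix_inv N" if g: "g \<in> carrier G" for g
  proof -
    note I = matrix_inv_mult[OF Ninv]
    have "matrix_inv N ** S g = matrix_inv N ** (S g ** N) ** matrix_inv N"
      by (simp add: I flip: matrix_mul_assoc)
    also have "\<dots> = mat (\<kappa> (inv g)) ** (matrix_inv N ** N) ** Ad0 R g ** matrix_inv N"
      unfolding SN[OF g] by (simp only: matrix_mul_assoc mat_mult_commute)
    finally show ?thesis by (simp add: I)
  qed
  then show ?thesis
    unfolding twist_equivalent_def using invertible_matrix_inv[OF Ninv] P(3)
    by (intro exI[of _ "matrix_inv N"] exI[of _ "\<lambda>g. \<kappa> (inv g)"]) auto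
qed

text \<open>The rows of \<open>lam\<close> are linear functionals on the space of \<open>S\<close>, on which \<open>S\<close> acts from the right.\<close>

locale monomial_pair =
  fixes G (structure) and R :: "'g \<Rightarrow> complex ^ 2 ^ 2" and S :: "'g \<Rightarrow> complex ^ 3 ^ 3"
    and lam :: "complex ^ 3 ^ 3" and \<pi> :: "'g \<Rightarrow> 3 \<Rightarrow> 3"
  assumes group: "group G" and R: "irreducible_rep G R" and S: "irreducible_rep G S"
    and lam: "invertible lam"
    and monomial: "\<And>g i. g \<in> carrier G \<Longrightarrow> \<exists>c. lam $ \<pi> g i v* S g = c *s lam $ i"
    and perm: "\<And>g. g \<in> carrier G \<Longrightarrow> bij (\<pi> g)"
    and transitive: "\<And>i j. \<exists>g\<in>carrier G. \<pi> g i = j"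
    and irreducible_kernel: "\<And>U. vec.subspace U \<Longrightarrow>
      (\<And>g v. g \<in> carrier G \<Longrightarrow> \<pi> g = id \<Longrightarrow> v \<in> U \<Longrightarrow> R g *v v \<in> U) \<Longrightarrow> U = {0} \<or> U = UNIV"
begin

lemma hom: "R \<in> hom G GL" "S \<in> hom G GL"
  using R S by (auto simp: irreducible_rep_def)

definition coord :: "complex ^ (2 \<times> 3) \<Rightarrow> 3 \<Rightarrow> complex ^ 2" where
  "coord x i = contract (lam $ i) x"

lemma coord_linear:
  "coord (x + y) i = coord x i + coord y i" "coord (x - y) i = coord x i - coord y i"
  "coord (c *s x) i = c *s coord x i" "coord 0 i = 0"
  by (simp_all add: coord_def contract_linear)

lemma coord_eq: "coord x i = (lam ** (\<chi> j k. x $ (k, j))) $ i"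
  by (simp add: coord_def contract_def matrix_matrix_mult_def vec_eq_iff)

lemma coord_eqI:
  assumes "\<And>i. coord x i = coord y i"
  shows "x = y"
proof -
  have "lam ** (\<chi> j k. x $ (k, j)) = lam ** (\<chi> j k. y $ (k, j))"
    using assms unfolding coord_eq by (simp add: vec_eq_iff)
  then have "matrix_inv lam ** lam ** (\<chi> j k. x $ (k, j)) = matrix_inv lam ** lam ** (\<chi> j k. y $ (k, j))"
    by (simp only: flip: matrix_mul_assoc)
  then have "(\<chi> j k. x $ (k, j)) = (\<chi> j k. y $ (k, j))"
    using matrix_inv_mult[OF lam] by simp
  then show ?thesis by (simp add: vec_eq_iff)
qed

definition of_coord :: "(3 \<Rightarrow> complex ^ 2) \<Rightarrow> complex ^ (2 \<times> 3)" where
  "of_coord w = (\<chi> p. (matrix_inv lam ** (\<chi> i. w i)) $ snd p $ fst p)"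

lemma coord_of_coord [simp]: "coord (of_coord w) i = w i"
proof -
  have "(\<chi> j k. of_coord w $ (k, j)) = matrix_inv lam ** (\<chi> i. w i)"
    by (simp add: of_coord_def vec_eq_iff)
  then show ?thesis
    unfolding coord_eq by (simp add: matrix_mul_assoc matrix_inv_mult[OF lam])
qed

lemma coord_action:
  assumes g: "g \<in> carrier G"
  obtains c where "c \<noteq> 0" "\<And>x. coord (tensor_rep R S g *v x) (\<pi> g i) = c *s (R g *v coord x i)"
proof -
  obtain c where c: "lam $ \<pi> g i v* S g = c *s lam $ i" using monomial[OF g] by blast
  have "c \<noteq> 0"
  proof
    assume "c = 0"
    then have "lam $ \<pi> g i v* (S g ** matrix_inv (S g)) = 0"
      using c by (simp flip: vector_matrix_mul_assoc)
    then have 0: "lam $ \<pi> g i = 0" using matrix_inv_mult[OF hom_GL(1)[OF group hom(2) g]] by simp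
    have "(lam ** matrix_inv lam) $ \<pi> g i $ \<pi> g i = 0"
      unfolding matrix_matrix_mult_def by (simp add: 0)
    then show False using matrix_inv_mult[OF lam] by (simp add: mat_def)
  qed
  moreover have "coord (tensor_rep R S g *v x) (\<pi> g i) = c *s (R g *v coord x i)" for x
    by (simp add: coord_def contract_tensor_rep c contract_linear vector_scalar_commute)
  ultimately show ?thesis using that by blast
qed


text \<open>Every coordinate maps \<open>Y\<close> onto a copy of \<open>R\<close>, and no nonzero
  vector of \<open>Y\<close> has just one nonzero coordinate. So \<open>Y\<close> has dimension two
  if its first coordinate determines the second and dimension four otherwise.\<close>

theorem reducible_imp_twist_equivalent:
  assumes Y: "vec.subspace Y" "Y \<noteq> {0}" "Y \<noteq> UNIV"
    and inv: "\<And>g x. g \<in> carrier G \<Longrightarrow> x \<in> Y \<Longrightarrow> tensor_rep R S g *v x \<in> Y"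
  shows "twist_equivalent G S (Ad0 R)"
proof -
  note Y_closed = vec.subspace_add[OF Y(1)] vec.subspace_diff[OF Y(1)] vec.subspace_scale[OF Y(1)]
    vec.subspace_0[OF Y(1)]
  text \<open>By irreducibility on the kernel of \<open>\<pi>\<close>, every coordinate projection of a piece of \<open>Y\<close>
    that is cut out by the vanishing of some coordinates is zero or everything.\<close>
  have piece: "{coord x i |x. x \<in> Y \<and> (\<forall>j\<in>Z. coord x j = 0)} = {0} \<or>
      {coord x i |x. x \<in> Y \<and> (\<forall>j\<in>Z. coord x j = 0)} = UNIV" (is "?U = {0} \<or> _") for i Z
  proof (rule irreducible_kernel)
    show "vec.subspace ?U"
    proof (rule vec.subspaceI)
      show "0 \<in> ?U" using Y_closed(4) by (intro CollectI exI[of _ 0]) (simp add: coord_linear)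
      fix u v assume "u \<in> ?U" "v \<in> ?U"
      then obtain x y where "x \<in> Y" "y \<in> Y" "\<forall>j\<in>Z. coord x j = 0" "\<forall>j\<in>Z. coord y j = 0" "u = coord x i" "v = coord y i"
        by blast
      then show "u + v \<in> ?U" using Y_closed(1)[of x y]
        by (intro CollectI exI[of _ "x + y"]) (simp add: coord_linear)
    next
      fix c u assume "u \<in> ?U"
      then obtain x where "x \<in> Y" "\<forall>j\<in>Z. coord x j = 0" "u = coord x i" by blast
      then show "c *s u \<in> ?U" using Y_closed(3)[of x c]
        by (intro CollectI exI[of _ "c *s x"]) (simp add: coord_linear)
    qed
    fix g u assume g: "g \<in> carrier G" "\<pi> g = id" and "u \<in> ?U"
    then obtain x where x: "x \<in> Y" "\<forall>j\<in>Z. coord x j = 0" "u = coord x i" by blast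
    obtain c where c: "c \<noteq> 0" "coord (tensor_rep R S g *v x) i = c *s (R g *v coord x i)"
      using coord_action[OF g(1), of i] g(2) by (metis id_apply)
    have "coord (tensor_rep R S g *v x) j = 0" if "j \<in> Z" for j
    proof -
      obtain d where "coord (tensor_rep R S g *v x) j = d *s (R g *v coord x j)"
        using coord_action[OF g(1), of j] g(2) by (metis id_apply)
      then show ?thesis using x(2) that by simp
    qed
    then have "coord (inverse c *s (tensor_rep R S g *v x)) i = R g *v u \<and>
        (\<forall>j\<in>Z. coord (inverse c *s (tensor_rep R S g *v x)) j = 0)"
      using c x(3) by (simp add: coord_linear)
    moreover have "inverse c *s (tensor_rep R S g *v x) \<in> Y"
      using inv[OF g(1) x(1)] by (rule Y_closed(3))
    ultimately show "R g *v u \<in> ?U"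
      by (intro CollectI exI[of _ "inverse c *s (tensor_rep R S g *v x)"]) simp
  qed
  have piece': "\<exists>y\<in>Y. coord y i = u \<and> (\<forall>j\<in>Z. coord y j = 0)"
    if x: "x \<in> Y" "\<And>j. j \<in> Z \<Longrightarrow> coord x j = 0" "coord x i \<noteq> 0" for x i Z u
  proof -
    let ?U = "{coord x i |x. x \<in> Y \<and> (\<forall>j\<in>Z. coord x j = 0)}"
    have "coord x i \<in> ?U" using x by (intro CollectI exI[of _ x]) simp
    then have "?U \<noteq> {0}" using x(3) by (metis singletonD)
    then have "u \<in> ?U" using piece[of i Z] by simp
    then show ?thesis by (elim CollectE exE) auto
  qed
  have transport: "\<exists>c. c \<noteq> 0 \<and> (\<forall>x. coord (tensor_rep R S g *v x) (\<pi> g i) = c *s (R g *v coord x i))"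
    if "g \<in> carrier G" for g i
    using coord_action[OF that, of i] by metis
  \<comment> \<open>A nonzero vector of this kind would yield the whole \<open>i\<close>-th copy by
    \<open>piece'\<close>, then every copy by transitivity, and so the full space.\<close>
  have top: "x = 0" if x: "x \<in> Y" "\<And>j. j \<noteq> i \<Longrightarrow> coord x j = 0" for x i
  proof (rule ccontr)
    assume "x \<noteq> 0"
    then have "coord x i \<noteq> 0" using x(2) coord_eqI[of x 0] by (metis coord_linear(4))
    then have full: "\<exists>y\<in>Y. coord y i = u \<and> (\<forall>j\<in>-{i}. coord y j = 0)" for u
      using x \<open>coord x i \<noteq> 0\<close> by (intro piece'[of x]) auto
    have all: "\<exists>y\<in>Y. coord y k = u \<and> (\<forall>j\<in>-{k}. coord y j = 0)" for u k
    proof -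
      obtain g where g: "g \<in> carrier G" "\<pi> g i = k" using transitive by blast
      obtain c where c: "c \<noteq> 0" "\<And>x. coord (tensor_rep R S g *v x) k = c *s (R g *v coord x i)"
        using transport[OF g(1), of i] g(2) by auto
      obtain y where y: "y \<in> Y" "coord y i = inverse c *s (matrix_inv (R g) *v u)" "\<forall>j\<in>-{i}. coord y j = 0"
        using full by blast
      have "coord (tensor_rep R S g *v y) k = u"
        using c y(2) matrix_inv_mult[OF hom_GL(1)[OF group hom(1) g(1)]]
        by (simp add: vector_scalar_commute matrix_vector_mul_assoc)
      moreover have "coord (tensor_rep R S g *v y) j = 0" if "j \<noteq> k" for j
      proof -
        obtain j' where j': "j = \<pi> g j'" using perm[OF g(1)] by (metis bij_pointE)
        then have "j' \<noteq> i" using that g(2) by auto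
        then show ?thesis using transport[OF g(1), of j'] y(3) j' by auto
      qed
      ultimately show ?thesis using inv[OF g(1) y(1)] by blast
    qed
    have "z \<in> Y" for z
    proof -
      have ex: "\<forall>k. \<exists>y. y \<in> Y \<and> coord y k = coord z k \<and> (\<forall>j\<in>-{k}. coord y j = 0)"
        using all by blast
      from choice[OF ex] obtain y where "\<forall>k. y k \<in> Y \<and> coord (y k) k = coord z k \<and> (\<forall>j\<in>-{k}. coord (y k) j = 0)"
        by (rule exE)
      then have y: "\<And>k. y k \<in> Y" "\<And>k. coord (y k) k = coord z k" "\<And>k j. j \<noteq> k \<Longrightarrow> coord (y k) j = 0"
        by auto
      have "z = y 1 + y 2 + y 3"
      proof (rule coord_eqI)
        show "coord z i = coord (y 1 + y 2 + y 3) i" for i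
          using exhaust_3[of i] y(2)[of i] y(3) by (auto simp: coord_linear)
      qed
      then show ?thesis using y(1) Y_closed(1) by blast
    qed
    then show False using Y(3) by blast
  qed
  have onto: "\<exists>x\<in>Y. coord x i = u" for i u
  proof -
    obtain x where x: "x \<in> Y" "x \<noteq> 0" using Y(2) Y_closed(4) by blast
    then obtain k where k: "coord x k \<noteq> 0" using coord_eqI[of x 0] coord_linear(4) by metis
    obtain g where g: "g \<in> carrier G" "\<pi> g k = i" using transitive by blast
    obtain c where c: "c \<noteq> 0" "coord (tensor_rep R S g *v x) i = c *s (R g *v coord x k)"
      using transport[OF g(1), of k] g(2) by auto
    have "R g *v coord x k \<noteq> 0"
    proof
      assume "R g *v coord x k = 0"
      then have "matrix_inv (R g) *v (R g *v coord x k) = 0" by simp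
      then show False
        using k matrix_inv_mult[OF hom_GL(1)[OF group hom(1) g(1)]] by (simp add: matrix_vector_mul_assoc)
    qed
    then have "coord (tensor_rep R S g *v x) i \<noteq> 0" using c by simp
    then show ?thesis using piece'[OF inv[OF g(1) x(1)], of "{}" i u] by auto
  qed
  show ?thesis
  proof (cases "\<forall>x\<in>Y. coord x 1 = 0 \<longrightarrow> coord x 2 = 0")
    case True
    have inj: "x = y" if "x \<in> Y" "y \<in> Y" "coord x 1 = coord y 1" for x y
    proof -
      have 1: "x - y \<in> Y" "coord (x - y) 1 = 0" using that Y_closed(2) by (auto simp: coord_linear)
      then have "coord (x - y) 2 = 0" using True by blast
      then have "x - y = 0" using 1 exhaust_3 by (intro top[of _ 3]) metis+
      then show ?thesis by simp
    qed
    \<comment> \<open>\<open>Y\<close> is a graph over the first coordinate; \<open>J\<close>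
      inverts that projection.\<close>
    obtain J where J: "\<And>u. J u \<in> Y" "\<And>u. coord (J u) 1 = u" using onto[of 1] by metis
    show ?thesis
    proof (rule two_dim_subrepresentation[OF group R S, where J = J and p = "\<lambda>x. coord x 1"])
      show "Vector_Spaces.linear (*s) (*s) J"
        by (intro vec_linearI inj) (auto simp: J coord_linear intro: J Y_closed)
      show "Vector_Spaces.linear (*s) (*s) (\<lambda>x. coord x 1)" by (rule vec_linearI) (simp_all add: coord_linear)
      show "tensor_rep R S g *v J u \<in> range J" if "g \<in> carrier G" for g u
        using inj[OF inv[OF that J(1)[of u]] J(1)] J(2) by (metis rangeI)
    qed (rule J)
  next
    case False
    then obtain x where "x \<in> Y" "coord x 1 = 0" "coord x 2 \<noteq> 0" by blast
    then have 2: "\<exists>x\<in>Y. coord x 1 = 0 \<and> coord x 2 = u" for u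
      using piece'[of x "{1}" 2 u] by auto
    have "\<exists>x\<in>Y. coord x 1 = u \<and> coord x 2 = w" for u w
    proof -
      obtain x where x: "x \<in> Y" "coord x 1 = u" using onto by blast
      obtain y where "y \<in> Y" "coord y 1 = 0" "coord y 2 = w - coord x 2" using 2 by blast
      then show ?thesis using x Y_closed(1) by (intro bexI[of _ "x + y"]) (auto simp: coord_linear)
    qed
    then have ex: "\<forall>x. \<exists>y. y \<in> Y \<and> coord y 1 = coord x 1 \<and> coord y 2 = coord x 2"
      by blast
    from choice[OF ex] obtain e where "\<forall>x. e x \<in> Y \<and> coord (e x) 1 = coord x 1 \<and> coord (e x) 2 = coord x 2"
      by (rule exE)
    then have e: "\<And>x. e x \<in> Y" "\<And>x. coord (e x) 1 = coord x 1" "\<And>x. coord (e x) 2 = coord x 2"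
      by auto
    have inj: "x = y" if "x \<in> Y" "y \<in> Y" "coord x 1 = coord y 1" "coord x 2 = coord y 2" for x y
    proof -
      have "x - y = 0"
      proof (rule top[of _ 3])
        show "x - y \<in> Y" using that Y_closed(2) by auto
        show "coord (x - y) j = 0" if "j \<noteq> 3" for j
          using exhaust_3[of j] that \<open>coord x 1 = coord y 1\<close> \<open>coord x 2 = coord y 2\<close> by (auto simp: coord_linear)
      qed
      then show ?thesis by simp
    qed
    have e_lin: "e (x + y) = e x + e y" "e (c *s x) = c *s e x" for x y c
      by (rule inj; auto simp: e coord_linear intro: e Y_closed)+
    \<comment> \<open>\<open>Y\<close> is a graph over the first two coordinates; \<open>q\<close>
      measures how far the third coordinate deviates from it.\<close>
    define q where "q x = coord (x - e x) 3" for x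
    define s where "s u = of_coord (\<lambda>i. if i = 3 then u else 0)" for u :: "complex^2"
    have qX: "q x = 0 \<longleftrightarrow> x \<in> Y" for x
    proof
      assume "q x = 0"
      then have "coord x i = coord (e x) i" for i
        using exhaust_3[of i] e by (auto simp: q_def coord_linear)
      then have "x = e x" by (rule coord_eqI)
      then show "x \<in> Y" using e(1) by metis
    next
      assume "x \<in> Y"
      then have "e x = x" using e by (intro inj)
      then show "q x = 0" by (simp add: q_def coord_linear)
    qed
    show ?thesis
    proof (rule two_dim_quotient[OF group R S, where q = q and s = s])
      show "Vector_Spaces.linear (*s) (*s) q"
        by (rule vec_linearI) (simp_all add: q_def e_lin coord_linear vector_ssub_ldistrib algebra_simps)
      show "Vector_Spaces.linear (*s) (*s) s"
        by (intro vec_linearI coord_eqI) (simp_all add: s_def coord_linear)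
      show "q (s u) = u" for u
      proof -
        have "e (s u) = 0"
          by (rule inj) (auto simp: e Y_closed coord_linear s_def)
        then show ?thesis by (simp add: q_def s_def coord_linear)
      qed
      show "q (tensor_rep R S g *v x) = 0" if "g \<in> carrier G" "q x = 0" for g x
        using inv that qX by blast
    qed
  qed
qed

end

section \<open>Representations of the symmetric group on three letters\<close>

text \<open>The matrices of the permutation representation of the symmetric group on the basis
  \<open>e1 - e3\<close>, \<open>e2 - e3\<close> of the sum-zero plane.\<close>

definition std_rep :: "(3 \<Rightarrow> 3) \<Rightarrow> complex ^ 2 ^ 2" where
  "std_rep p = (\<chi> i j. (if p (if j = 1 then 1 else 2) = (if i = 1 then 1 else 2) then 1 else 0) -
     (if p 3 = (if i = 1 then 1 else 2) then 1 else 0))"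

definition perm_mat :: "(3 \<Rightarrow> 3) \<Rightarrow> complex ^ 3 ^ 3" where
  "perm_mat p = (\<chi> i j. if p j = i then 1 else 0)"

lemma perm_mat_compose: "perm_mat (p \<circ> q) = perm_mat p ** perm_mat q"
  by (simp add: vec_eq_iff perm_mat_def matrix_matrix_mult_def if_distrib[of "\<lambda>x. _ * x"] cong: if_cong)

definition sum_zero_incl :: "complex ^ 2 ^ 3" where
  "sum_zero_incl = vector [vector [1, 0], vector [0, 1], vector [-1, -1]]"

text \<open>Subtract the mean and keep the first two entries, which are the coordinates in the basis
  \<open>e1 - e3\<close>, \<open>e2 - e3\<close>.\<close>

definition sum_zero_proj :: "complex ^ 3 ^ 2" where
  "sum_zero_proj = vector [vector [2/3, -1/3, -1/3], vector [-1/3, 2/3, -1/3]]"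

lemma sum_zero_proj_incl: "sum_zero_proj ** sum_zero_incl = mat 1"
  by (simp add: vec_eq_iff forall_2 matrix_matrix_mult_def sum_3 sum_zero_incl_def sum_zero_proj_def mat_def)

lemma three_neq: "(1::3) \<noteq> 2" "(1::3) \<noteq> 3" "(2::3) \<noteq> 3" "(2::3) \<noteq> 1" "(3::3) \<noteq> 1" "(3::3) \<noteq> 2"
  by simp_all

lemma perm3_cases:
  assumes "bij (p :: 3 \<Rightarrow> 3)"
  shows "(p 1, p 2, p 3) \<in> {(1,2,3), (1,3,2), (2,1,3), (2,3,1), (3,1,2), (3,2,1)}"
proof -
  have "p 1 \<noteq> p 2" "p 1 \<noteq> p 3" "p 2 \<noteq> p 3"
    using inj_eq[OF bij_is_inj[OF assms]] by simp_all
  then show ?thesis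
    using exhaust_3[of "p 1"] exhaust_3[of "p 2"] exhaust_3[of "p 3"] by (elim disjE) simp_all
qed

lemma perm_mat_std:
  assumes "bij p"
  shows "perm_mat p ** sum_zero_incl = sum_zero_incl ** std_rep p"
    "sum_zero_proj ** perm_mat p = std_rep p ** sum_zero_proj"
proof -
  have "perm_mat p ** sum_zero_incl = sum_zero_incl ** std_rep p \<and>
      sum_zero_proj ** perm_mat p = std_rep p ** sum_zero_proj"
    using perm3_cases[OF assms] unfolding insert_iff empty_iff prod.inject simp_thms
    by (elim disjE conjE; simp add: vec_eq_iff forall_2 forall_3 matrix_matrix_mult_def sum_3 sum_2
        sum_zero_incl_def sum_zero_proj_def perm_mat_def std_rep_def)
  then show "perm_mat p ** sum_zero_incl = sum_zero_incl ** std_rep p"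
    "sum_zero_proj ** perm_mat p = std_rep p ** sum_zero_proj" by blast+
qed

lemma std_rep_compose:
  assumes "bij p" "bij q"
  shows "std_rep (p \<circ> q) = std_rep p ** std_rep q"
proof -
  have "sum_zero_proj ** (perm_mat (p \<circ> q) ** sum_zero_incl) = sum_zero_proj ** (perm_mat p ** (perm_mat q ** sum_zero_incl))"
    by (simp add: perm_mat_compose matrix_mul_assoc)
  then have "sum_zero_proj ** sum_zero_incl ** std_rep (p \<circ> q) = (sum_zero_proj ** perm_mat p) ** sum_zero_incl ** std_rep q"
    unfolding perm_mat_std(1)[OF assms(2)] perm_mat_std(1)[OF bij_comp[OF assms(2,1)]] by (simp add: matrix_mul_assoc)
  also have "\<dots> = std_rep p ** (sum_zero_proj ** sum_zero_incl) ** std_rep q"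
    unfolding perm_mat_std(2)[OF assms(1)] by (simp add: matrix_mul_assoc)
  finally show ?thesis by (simp add: sum_zero_proj_incl)
qed

lemma std_rep_id: "std_rep id = mat 1"
  by (simp add: vec_eq_iff forall_2 std_rep_def mat_def)

text \<open>Together with \<open>swap12\<close> this generates all permutations. Even permutations
  are written throughout as members of \<open>{id, cyc3, cyc3 \<circ> cyc3}\<close>, without a sign
  function.\<close>

definition cyc3 :: "3 \<Rightarrow> 3" where "cyc3 i = (if i = 1 then 2 else if i = 2 then 3 else 1)"
definition swap12 :: "3 \<Rightarrow> 3" where "swap12 i = (if i = 1 then 2 else if i = 2 then 1 else 3)"

lemma cyc3_simps [simp]: "cyc3 1 = 2" "cyc3 2 = 3" "cyc3 3 = 1"
  and swap12_simps [simp]: "swap12 1 = 2" "swap12 2 = 1" "swap12 3 = 3"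
  by (simp_all add: cyc3_def swap12_def)

lemma all3_eqI: "p 1 = q 1 \<Longrightarrow> p 2 = q 2 \<Longrightarrow> p 3 = q 3 \<Longrightarrow> p = (q :: 3 \<Rightarrow> 'a)"
  by (rule ext) (metis exhaust_3)

lemma fun3_eq_iff: "p = q \<longleftrightarrow> p 1 = q 1 \<and> p 2 = q 2 \<and> p 3 = q 3" for p q :: "3 \<Rightarrow> 'a"
  using all3_eqI by blast

lemma bij_cyc3: "bij cyc3" and bij_swap12: "bij swap12"
proof -
  have "cyc3 \<circ> (cyc3 \<circ> cyc3) = id" "(cyc3 \<circ> cyc3) \<circ> cyc3 = id" "swap12 \<circ> swap12 = id"
    by (rule all3_eqI; simp)+
  then show "bij cyc3" "bij swap12" using o_bij by metis+
qed

lemma perm3_words: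
  assumes "bij (p :: 3 \<Rightarrow> 3)"
  shows "p \<in> {id, cyc3, cyc3 \<circ> cyc3, swap12, cyc3 \<circ> swap12, cyc3 \<circ> (cyc3 \<circ> swap12)}"
  using perm3_cases[OF assms] unfolding insert_iff empty_iff prod.inject simp_thms
  by (elim disjE conjE; simp add: fun3_eq_iff)

lemma two_dim_line_independent:
  fixes v w :: "complex ^ 2"
  assumes "v \<noteq> 0" "\<And>c. w \<noteq> c *s v"
  shows "det (vector [v, w] :: complex ^ 2 ^ 2) \<noteq> 0"
proof
  assume "det (vector [v, w] :: complex ^ 2 ^ 2) = 0"
  then have d: "v $ 1 * w $ 2 = v $ 2 * w $ 1" by (simp add: det_2)
  show False
  proof (cases "v $ 1 = 0")
    case True
    then have "v $ 2 \<noteq> 0" using assms(1) by (auto simp: vec_eq_iff forall_2)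
    then have "w = (w $ 2 / v $ 2) *s v" using d True by (simp add: vec_eq_iff forall_2 field_simps)
    then show False using assms(2) by blast
  next
    case False
    then have "w = (w $ 1 / v $ 1) *s v" using d by (simp add: vec_eq_iff forall_2 field_simps)
    then show False using assms(2) by blast
  qed
qed

lemma subspace_line: "vec.subspace {c *s v |c. True}" for v :: "complex ^ 'n"
proof (rule vec.subspaceI)
  show "0 \<in> {c *s v |c. True}" by (rule CollectI, rule exI[of _ 0]) simp
  show "x + y \<in> {c *s v |c. True}" if "x \<in> {c *s v |c. True}" "y \<in> {c *s v |c. True}" for x y
    using that by (auto simp flip: vector_sadd_rdistrib)
  show "c *s x \<in> {c *s v |c. True}" if "x \<in> {c *s v |c. True}" for c x
    using that by (auto simp: vector_smult_assoc)
qed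

lemma line_neq_UNIV: "{c *s v |c. True} \<noteq> UNIV" for v :: "complex ^ 2"
proof
  assume *: "{c *s v |c. True} = UNIV"
  have "axis 1 1 \<in> {c *s v |c. True}" "axis 2 1 \<in> {c *s v |c. True}" by (simp_all only: * UNIV_I)
  then obtain a b where "axis 1 1 = a *s v" "axis 2 1 = b *s v" by blast
  then have "a * v $ 1 = 1" "a * v $ 2 = 0" "b * v $ 1 = 0" "b * v $ 2 = 1"
    by (auto simp: vec_eq_iff forall_2 axis_def)
  then show False by auto
qed

lemma line_eq_0: "{c *s v |c. True} = {0} \<Longrightarrow> v = 0" for v :: "complex ^ 'n"
  by (metis (mono_tags, lifting) mem_Collect_eq singletonD vector_smult_lid)

locale S3_group =
  fixes G :: "'g monoid" (structure) and \<pi> :: "'g \<Rightarrow> 3 \<Rightarrow> 3"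
  assumes group: "group G"
    and \<pi>_mult: "\<And>g h. g \<in> carrier G \<Longrightarrow> h \<in> carrier G \<Longrightarrow> \<pi> (g \<otimes> h) = \<pi> g \<circ> \<pi> h"
    and \<pi>_bij: "bij_betw \<pi> (carrier G) {p. bij p}"
begin

lemma \<pi>_surj: "bij p \<Longrightarrow> \<exists>g\<in>carrier G. \<pi> g = p"
  using \<pi>_bij unfolding bij_betw_def by (metis (mono_tags, lifting) imageE mem_Collect_eq)

lemma \<pi>_inj: "g \<in> carrier G \<Longrightarrow> h \<in> carrier G \<Longrightarrow> \<pi> g = \<pi> h \<Longrightarrow> g = h"
  using \<pi>_bij by (auto simp: bij_betw_def inj_on_def)

lemma \<pi>_perm: "g \<in> carrier G \<Longrightarrow> bij (\<pi> g)"
  using \<pi>_bij by (auto simp: bij_betw_def)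

lemma \<pi>_one: "\<pi> \<one> = id"
proof -
  interpret group G by (rule group)
  have "\<pi> \<one> \<circ> \<pi> \<one> = \<pi> \<one>" using \<pi>_mult[of \<one> \<one>] by simp
  then have "\<pi> \<one> (\<pi> \<one> i) = \<pi> \<one> i" for i by (metis comp_apply)
  then show ?thesis using \<pi>_perm[OF one_closed] by (auto simp: fun_eq_iff dest: bij_is_inj injD)
qed

definition gen_c where "gen_c = (SOME g. g \<in> carrier G \<and> \<pi> g = cyc3)"
definition gen_s where "gen_s = (SOME g. g \<in> carrier G \<and> \<pi> g = swap12)"

lemma gen: "gen_c \<in> carrier G" "\<pi> gen_c = cyc3" "gen_s \<in> carrier G" "\<pi> gen_s = swap12"
  using someI_ex[of "\<lambda>g. g \<in> carrier G \<and> \<pi> g = cyc3"] someI_ex[of "\<lambda>g. g \<in> carrier G \<and> \<pi> g = swap12"]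
    \<pi>_surj[OF bij_cyc3] \<pi>_surj[OF bij_swap12] unfolding gen_c_def gen_s_def by blast+

lemma generated:
  assumes "g \<in> carrier G"
  shows "g \<in> {\<one>, gen_c, gen_c \<otimes> gen_c, gen_s, gen_c \<otimes> gen_s, gen_c \<otimes> (gen_c \<otimes> gen_s)}"
proof -
  interpret group G by (rule group)
  have "g = h" if "h \<in> carrier G" "\<pi> g = \<pi> h" for h using \<pi>_inj[OF assms that] .
  then show ?thesis
    using perm3_words[OF \<pi>_perm[OF assms]] gen by (auto simp: \<pi>_mult \<pi>_one)
qed

lemma relations:
  "gen_c \<otimes> (gen_c \<otimes> gen_c) = \<one>" "gen_s \<otimes> gen_s = \<one>" "gen_c \<otimes> (gen_s \<otimes> gen_c) = gen_s"
proof -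
  interpret group G by (rule group)
  have "\<pi> (gen_c \<otimes> (gen_c \<otimes> gen_c)) = \<pi> \<one>" "\<pi> (gen_s \<otimes> gen_s) = \<pi> \<one>"
    "\<pi> (gen_c \<otimes> (gen_s \<otimes> gen_c)) = \<pi> gen_s"
    by (rule all3_eqI; simp add: \<pi>_mult \<pi>_one gen)+
  then show "gen_c \<otimes> (gen_c \<otimes> gen_c) = \<one>" "gen_s \<otimes> gen_s = \<one>" "gen_c \<otimes> (gen_s \<otimes> gen_c) = gen_s"
    using \<pi>_inj gen by simp_all
qed

text \<open>In a two-dimensional irreducible representation the 3-cycle is diagonalizable with the two
  primitive cube roots of unity as eigenvalues, and the transposition swaps the eigenlines.\<close>

lemma irreducible_normal_form:
  fixes \<rho> :: "'g \<Rightarrow> complex ^ 2 ^ 2" and w :: complex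
  assumes irr: "irreducible_rep G \<rho>" and w: "w ^ 3 = 1" "w \<noteq> 1"
  obtains M :: "complex ^ 2 ^ 2" where "invertible M" "\<rho> gen_c ** M = M ** vector [vector [w, 0], vector [0, inverse w]]"
    "\<rho> gen_s ** M = M ** vector [vector [0, 1], vector [1, 0]]"
proof -
  interpret group G by (rule group)
  have hom: "\<rho> \<in> hom G GL" using irr by (simp add: irreducible_rep_def)
  note H = hom_GL[OF group hom]
  define C where "C = \<rho> gen_c"
  define S where "S = \<rho> gen_s"
  have CCC: "C ** (C ** C) = mat 1"
    using relations(1) H(2)[of gen_c "gen_c \<otimes> gen_c"] H(2)[of gen_c gen_c] H(3)[of gen_c] gen by (simp add: C_def)
  have SS: "S ** S = mat 1"
    using relations(2) H(2)[of gen_s gen_s] H(3)[of gen_c] gen by (simp add: S_def)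
  have CSC: "C ** (S ** C) = S"
    using relations(3) H(2)[of gen_c "gen_s \<otimes> gen_c"] H(2)[of gen_s gen_c] gen by (simp add: C_def S_def)
  have inv_line: False if v: "v \<noteq> 0" "C *v v = a *s v" "S *v v = b *s v" for v :: "complex^2" and a b
  proof -
    have "\<exists>d. \<rho> g *v v = d *s v" if g: "g \<in> carrier G" for g
      using generated[OF g] v gen H(3)[OF g]
      by (auto simp: H(2) C_def S_def vector_scalar_commute vector_smult_assoc simp flip: matrix_vector_mul_assoc
          intro: exI[of _ 1])
    then have "\<rho> g *v x \<in> {c *s v |c. True}" if "g \<in> carrier G" "x \<in> {c *s v |c. True}" for g x
      using that by (fastforce simp: vector_scalar_commute vector_smult_assoc)
    then have "{c *s v |c. True} = {0} \<or> {c *s v |c. True} = UNIV"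
      using irreducible_repD[OF irr subspace_line] by blast
    then show False using line_neq_UNIV line_eq_0 v(1) by blast
  qed
  have w0: "w \<noteq> 0" using w by auto
  have winv: "inverse w ^ 3 = 1" "inverse w \<noteq> 1" using w by (auto simp: power_inverse)
  have "\<exists>u. u \<noteq> 0 \<and> C *v u = w *s u"
  proof -
    \<comment> \<open>\<open>S\<close> carries an eigenvector of \<open>C\<close> to one for the
      inverse eigenvalue.\<close>
    have step: "\<exists>u. u \<noteq> 0 \<and> S *v u = S *v u \<and> C *v u = inverse a *s u" if "u \<noteq> 0" "C *v u = a *s u" "a \<noteq> 0" for u a
    proof (intro exI conjI)
      show "S *v u \<noteq> 0"
      proof
        assume "S *v u = 0"
        then have "(S ** S) *v u = 0" by (simp flip: matrix_vector_mul_assoc)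
        then show False using SS that by simp
      qed
      have "S *v u = (C ** (S ** C)) *v u" by (simp only: CSC)
      also have "\<dots> = a *s (C *v (S *v u))" using that by (simp add: vector_scalar_commute flip: matrix_vector_mul_assoc)
      finally have "inverse a *s (S *v u) = inverse a *s (a *s (C *v (S *v u)))" by simp
      then show "C *v (S *v u) = inverse a *s (S *v u)" using that by (simp add: vector_smult_assoc)
    qed simp
    \<comment> \<open>A vector \<open>u\<close> fixed by \<open>C\<close> would give a stable line:
      that of \<open>u + S *v u\<close>, or that of \<open>u\<close> itself when this sum
      vanishes.\<close>
    have not1: "C *v u \<noteq> u" if "u \<noteq> 0" for u
    proof
      assume u: "C *v u = u"
      have SSu: "S *v (S *v u) = u" using SS by (simp add: matrix_vector_mul_assoc)
      have CS: "C *v (S *v u) = S *v u"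
      proof -
        have "(C ** (S ** C)) *v u = S *v u" by (simp only: CSC)
        then show ?thesis using u by (simp flip: matrix_vector_mul_assoc)
      qed
      have p: "C *v (u + S *v u) = 1 *s (u + S *v u)" "S *v (u + S *v u) = 1 *s (u + S *v u)"
        using u CS SSu by (simp_all add: matrix_vector_right_distrib add.commute)
      then have "u + S *v u = 0" using inv_line by blast
      then have "S *v u = (- 1) *s u" by (metis add.inverse_unique vector_sneg_minus1)
      then show False using inv_line[of u 1 "- 1"] u that by simp
    qed
    text \<open>Since \<open>C ^ 3 = 1\<close> the product \<open>(C - 1) (C - w) (C - 1/w)\<close> vanishes.\<close>
    define u0 :: "complex^2" where "u0 = axis 1 1"
    have u0: "u0 \<noteq> 0" by (simp add: u0_def axis_eq_0_iff)
    define x1 where "x1 = C *v u0 - u0"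
    define x2 where "x2 = C *v x1 - w *s x1"
    have x1: "x1 \<noteq> 0" using not1[OF u0] by (simp add: x1_def)
    have wsum: "1 + w + inverse w = 0"
    proof -
      have "(w - 1) * (1 + w + w * w) = 0" using w(1) by (simp add: algebra_simps power3_eq_cube)
      then have s: "1 + w + w * w = 0" using w(2) by simp
      have "inverse w = w * w" using w(1) by (intro inverse_unique) (simp add: power3_eq_cube mult.assoc)
      then show ?thesis using s by simp
    qed
    show ?thesis
    proof (cases "x2 = 0")
      case True
      then show ?thesis using x1 by (auto simp: x2_def)
    next
      case False
      have "C *v (C *v (C *v u0)) = u0" using CCC by (simp add: matrix_vector_mul_assoc)
      then have sum0: "x1 + C *v x1 + C *v (C *v x1) = 0"
        by (simp add: x1_def matrix_vector_mult_diff_distrib)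
      have "C *v x2 - inverse w *s x2 = C *v (C *v x1) - (w + inverse w) *s (C *v x1) + (inverse w * w) *s x1"
        by (simp add: x2_def matrix_vector_mult_diff_distrib vector_scalar_commute vector_ssub_ldistrib
            vector_smult_assoc vector_sadd_rdistrib)
      also have "w + inverse w = - 1" using wsum by (simp add: algebra_simps eq_neg_iff_add_eq_0)
      also have "C *v (C *v x1) - (- 1) *s (C *v x1) + (inverse w * w) *s x1 = 0"
        using sum0 w0 by (simp add: algebra_simps flip: vector_sneg_minus1)
      finally have "C *v x2 = inverse w *s x2" by simp
      \<comment> \<open>An eigenvector for \<open>inverse w\<close> is moved by \<open>S\<close> to
        one for \<open>w\<close>.\<close>
      then obtain u where "u \<noteq> 0" "C *v u = inverse (inverse w) *s u"
        using step[OF False _ ] w0 by (metis inverse_nonzero_iff_nonzero)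
      then show ?thesis by auto
    qed
  qed
  then obtain u where u: "u \<noteq> 0" "C *v u = w *s u" by blast
  define v where "v = S *v u"
  have Sv: "S *v v = u" using SS by (simp add: v_def matrix_vector_mul_assoc)
  have Cv: "C *v v = inverse w *s v"
  proof -
    have "v = (C ** (S ** C)) *v u" by (simp only: CSC v_def)
    also have "\<dots> = w *s (C *v v)" using u by (simp add: v_def vector_scalar_commute flip: matrix_vector_mul_assoc)
    finally have "inverse w *s v = inverse w *s (w *s (C *v v))" by simp
    then show ?thesis using w0 by (simp add: vector_smult_assoc)
  qed
  have indep: "v \<noteq> c *s u" for c using inv_line[OF u] by (auto simp: v_def)
  define M where "M = transpose (vector [u, v] :: complex^2^2)"
  have "invertible M"
    unfolding M_def using two_dim_line_independent[OF u(1) indep] by (simp add: invertible_det_nz)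
  moreover have "C ** M = M ** vector [vector [w, 0], vector [0, inverse w]]"
    using u(2) Cv by (simp add: M_def vec_eq_iff forall_2 transpose_def matrix_matrix_mult_def matrix_vector_mult_def sum_2 mult.commute)
  moreover have "S ** M = M ** vector [vector [0, 1], vector [1, 0]]"
    using Sv v_def by (simp add: M_def vec_eq_iff forall_2 transpose_def matrix_matrix_mult_def matrix_vector_mult_def sum_2 mult.commute)
  ultimately show ?thesis unfolding C_def S_def by (rule that)
qed

end

section \<open>Monomial structure of an induced representation\<close>

text \<open>The index of \<open>H\<close> is found by counting: functions supported on single right
  cosets of \<open>H\<close> correspond to a basis of the three-dimensional space, so there are
  three cosets. Row \<open>i\<close> of \<open>lam\<close> evaluates an induced function at
  \<open>r i\<close>, and right translation moves the evaluation points between cosets.\<close>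

lemma induced_cosets:
  fixes G (structure) and S :: "'g \<Rightarrow> complex ^ 3 ^ 3"
  assumes G: "group G" and H: "subgroup (carrier H) G" and \<theta>0: "\<And>h. h \<in> carrier H \<Longrightarrow> \<theta> h \<noteq> 0"
    and \<theta>: "\<And>h k. h \<in> carrier H \<Longrightarrow> k \<in> carrier H \<Longrightarrow> \<theta> (h \<otimes> k) = \<theta> h * \<theta> k"
    and ind: "iso_to_induced G H \<theta> S"
  obtains r :: "3 \<Rightarrow> 'g" and lam :: "complex ^ 3 ^ 3" where
    "\<And>i. r i \<in> carrier G"
    "\<And>x. x \<in> carrier G \<Longrightarrow> \<exists>i. x \<otimes> inv (r i) \<in> carrier H"
    "\<And>i j. r i \<otimes> inv (r j) \<in> carrier H \<Longrightarrow> i = j"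
    "invertible lam"
    "\<And>s i j. s \<in> carrier G \<Longrightarrow> r j \<otimes> s \<otimes> inv (r i) \<in> carrier H \<Longrightarrow> \<exists>c. lam $ j v* S s = c *s lam $ i"
proof -
  interpret group G by (rule G)
  interpret H: subgroup "carrier H" G by (rule H)
  obtain T where bij: "bij_betw T UNIV (induced_space G H \<theta>)"
    and add: "\<And>v w g. T (v + w) g = T v g + T w g" and scale: "\<And>c v g. T (c *s v) g = c * T v g"
    and act: "\<And>s v g. s \<in> carrier G \<Longrightarrow> g \<in> carrier G \<Longrightarrow> T (S s *v v) g = T v (g \<otimes> s)"
    using ind unfolding iso_to_induced_def by blast
  have T_in: "T v \<in> induced_space G H \<theta>" for v using bij by (auto simp: bij_betw_def)
  have T_out: "T v g = 0" if "g \<notin> carrier G" for v g using T_in that by (auto simp: induced_space_def)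
  have T_H: "T v (h \<otimes> g) = \<theta> h * T v g" if "h \<in> carrier H" "g \<in> carrier G" for v h g
    using T_in that by (auto simp: induced_space_def)
  have T_inj: "v = w" if "T v = T w" for v w using bij that by (auto simp: bij_betw_def dest: injD)
  have T_zero: "T 0 g = 0" for g using scale[of 0 0 g] by simp
  have T_sum: "T (\<Sum>x\<in>A. f x) g = (\<Sum>x\<in>A. T (f x) g)" for A f g
    by (induction A rule: infinite_finite_induct) (auto simp: add T_zero)
  have \<theta>1: "\<theta> \<one> = 1" using \<theta>[OF H.one_closed H.one_closed] \<theta>0[OF H.one_closed] by simp
  \<comment> \<open>The element of the induced space supported on the coset of \<open>y\<close>,
    with value 1 at \<open>y\<close>.\<close>
  define f where "f y x = (if x \<in> carrier G \<and> x \<otimes> inv y \<in> carrier H then \<theta> (x \<otimes> inv y) else 0)" for x y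
  have f_in: "f y \<in> induced_space G H \<theta>" if y: "y \<in> carrier G" for y
  proof -
    have "f y (h \<otimes> x) = \<theta> h * f y x" if h: "h \<in> carrier H" and x: "x \<in> carrier G" for h x
    proof -
      have hG: "h \<in> carrier G" using h by (rule H.mem_carrier)
      have a: "h \<otimes> x \<otimes> inv y = h \<otimes> (x \<otimes> inv y)" using hG x y by (simp add: m_assoc)
      have "h \<otimes> (x \<otimes> inv y) \<in> carrier H \<longleftrightarrow> x \<otimes> inv y \<in> carrier H"
      proof
        assume "h \<otimes> (x \<otimes> inv y) \<in> carrier H"
        then have "inv h \<otimes> (h \<otimes> (x \<otimes> inv y)) \<in> carrier H" by (rule H.m_closed[OF H.m_inv_closed[OF h]])
        then show "x \<otimes> inv y \<in> carrier H" using hG x y by (simp flip: m_assoc)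
      qed (use h H.m_closed in blast)
      then show ?thesis using hG x h by (auto simp: f_def a \<theta>)
    qed
    then show ?thesis by (auto simp: induced_space_def f_def)
  qed
  define e where "e y = the_inv_into UNIV T (f y)" for y
  have Te: "T (e y) = f y" if "y \<in> carrier G" for y
    unfolding e_def using bij f_in[OF that] by (intro f_the_inv_into_f) (auto simp: bij_betw_def)
  define cls where "cls x = {y \<in> carrier G. y \<otimes> inv x \<in> carrier H}" for x
  \<comment> \<open>The choice depends on the coset alone, so equal cosets get the same
    representative.\<close>
  define rep where "rep x = (SOME y. y \<in> cls x)" for x
  have inv_mult: "inv (x \<otimes> inv y) = y \<otimes> inv x" if "x \<in> carrier G" "y \<in> carrier G" for x y
    using that by (simp add: inv_mult_group)
  have sym: "y \<otimes> inv x \<in> carrier H" if "x \<in> carrier G" "y \<in> carrier G" "x \<otimes> inv y \<in> carrier H" for x y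
    using H.m_inv_closed[OF that(3)] inv_mult[OF that(1,2)] by simp
  have trans: "x \<otimes> inv z \<in> carrier H"
    if "x \<in> carrier G" "y \<in> carrier G" "z \<in> carrier G" "x \<otimes> inv y \<in> carrier H" "y \<otimes> inv z \<in> carrier H" for x y z
  proof -
    have "(x \<otimes> inv y) \<otimes> (y \<otimes> inv z) \<in> carrier H" using that(4,5) by (rule H.m_closed)
    moreover have "inv y \<otimes> (y \<otimes> inv z) = inv z"
      using that(1-3) m_assoc[of "inv y" y "inv z"] by simp
    then have "(x \<otimes> inv y) \<otimes> (y \<otimes> inv z) = x \<otimes> inv z"
      using that(1-3) by (simp add: m_assoc)
    ultimately show ?thesis by simp
  qed
  have rep: "rep x \<in> carrier G" "rep x \<otimes> inv x \<in> carrier H" if x: "x \<in> carrier G" for x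
  proof -
    have "x \<in> cls x" using x by (simp add: cls_def)
    then have "rep x \<in> cls x" unfolding rep_def by (rule someI)
    then show "rep x \<in> carrier G" "rep x \<otimes> inv x \<in> carrier H" by (auto simp: cls_def)
  qed
  have cls_eq: "cls x = cls y" if "x \<in> carrier G" "y \<in> carrier G" "x \<otimes> inv y \<in> carrier H" for x y
    unfolding cls_def using trans[of _ x y] trans[of _ y x] sym[of x y] that by blast
  define Y where "Y = rep ` carrier G"
  have YG: "Y \<subseteq> carrier G" using rep by (auto simp: Y_def)
  have Ydist: "y = z" if yz: "y \<in> Y" "z \<in> Y" "y \<otimes> inv z \<in> carrier H" for y z
  proof -
    obtain a b where ab: "a \<in> carrier G" "b \<in> carrier G" "y = rep a" "z = rep b" using yz unfolding Y_def by blast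
    have "cls (rep a) = cls a" "cls (rep b) = cls b"
      using cls_eq[OF rep(1)[OF ab(1)] ab(1) rep(2)[OF ab(1)]]
        cls_eq[OF rep(1)[OF ab(2)] ab(2) rep(2)[OF ab(2)]] by blast+
    moreover have "cls y = cls z" using that YG by (intro cls_eq) auto
    ultimately have "cls a = cls b" by (simp add: ab(3,4))
    then show ?thesis unfolding ab(3,4) rep_def by simp
  qed
  have fY: "f y z = (if y = z then 1 else 0)" if "y \<in> Y" "z \<in> Y" for y z
    using that YG Ydist[of z y] \<theta>1 by (auto simp: f_def)
  have cover: "\<exists>y\<in>Y. x \<otimes> inv y \<in> carrier H" if "x \<in> carrier G" for x
    using sym[OF rep(1) _ rep(2)] that by (auto simp: Y_def)
  have determined: "v = 0" if v: "\<And>y. y \<in> Y \<Longrightarrow> T v y = 0" for v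
  proof -
    have "T v x = T 0 x" for x
    proof (cases "x \<in> carrier G")
      case True
      then obtain y where y: "y \<in> Y" "x \<otimes> inv y \<in> carrier H" using cover by blast
      have "x = (x \<otimes> inv y) \<otimes> y" using True y(1) YG by (auto simp: m_assoc)
      then have "T v x = \<theta> (x \<otimes> inv y) * T v y" using T_H[OF y(2)] y(1) YG by (metis subsetD)
      then show ?thesis using v[OF y(1)] T_zero by simp
    qed (simp add: T_out)
    then show ?thesis by (intro T_inj) blast
  qed
  have e_inj: "inj_on e Y"
  proof (rule inj_onI)
    fix y z assume yz: "y \<in> Y" "z \<in> Y" "e y = e z"
    then have "f y = f z" using Te YG by (metis subsetD)
    then have "f z y = 1" using fY[OF yz(1,1)] by simp
    then show "y = z" using fY[OF yz(2,1)] by (metis zero_neq_one)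
  qed
  have indep: "vec.independent (e ` Y)"
    unfolding vec.independent_explicit_finite_subsets
  proof (intro allI impI ballI)
    fix A u v assume A: "A \<subseteq> e ` Y" "finite A" "(\<Sum>v\<in>A. u v *s v) = 0" and v: "v \<in> A"
    obtain z where z: "z \<in> Y" "v = e z" using A(1) v by blast
    have val: "T w z = (if w = v then 1 else 0)" if w: "w \<in> A" for w
    proof -
      obtain y where y: "y \<in> Y" "w = e y" using A(1) w by blast
      then have "T w z = f y z" using Te YG by auto
      moreover have "w = v \<longleftrightarrow> y = z" using y z e_inj by (auto dest: inj_onD)
      ultimately show ?thesis using fY y z by auto
    qed
    have "0 = T (\<Sum>v\<in>A. u v *s v) z" using A(3) T_zero by simp
    also have "\<dots> = (\<Sum>w\<in>A. u w * T w z)" by (simp add: T_sum scale)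
    also have "\<dots> = (\<Sum>w\<in>A. if w = v then u w else 0)" by (intro sum.cong) (auto simp: val)
    also have "\<dots> = u v" using A(2) v by (simp add: sum.delta)
    finally show "u v = 0" by simp
  qed
  then have fin: "finite (e ` Y)" by (rule vec.finiteI_independent)
  then have finY: "finite Y" using e_inj by (rule finite_imageD)
  have "UNIV \<subseteq> vec.span (e ` Y)"
  proof
    fix v :: "complex ^ 3"
    have "v - (\<Sum>y\<in>Y. T v y *s e y) = 0"
    proof (rule determined)
      fix z assume z: "z \<in> Y"
      have "T (- w) z = - T w z" for w using scale[of "- 1" w z] by (simp flip: vector_sneg_minus1)
      then have minus: "T (v - w) z = T v z - T w z" for v w using add[of v "- w" z] by simp
      have "T (\<Sum>y\<in>Y. T v y *s e y) z = (\<Sum>y\<in>Y. if y = z then T v y else 0)"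
        unfolding T_sum scale
      proof (rule sum.cong)
        fix y assume "y \<in> Y"
        then show "T v y * T (e y) z = (if y = z then T v y else 0)"
          using Te[of y] fY[OF _ z] YG by auto
      qed simp
      also have "\<dots> = T v z" using finY z by simp
      finally show "T (v - (\<Sum>y\<in>Y. T v y *s e y)) z = 0" by (simp add: minus)
    qed
    then have "v = (\<Sum>y\<in>Y. T v y *s e y)" by simp
    also have "\<dots> \<in> vec.span (e ` Y)" by (intro vec.span_sum vec.span_scale vec.span_base) auto
    finally show "v \<in> vec.span (e ` Y)" .
  qed
  then have "card (e ` Y) = vec.dim (UNIV :: (complex ^ 3) set)"
    using indep by (intro vec.basis_card_eq_dim) auto
  then have "card Y = CARD(3)" using card_image[OF e_inj] vec_dim_card[where 'a = complex and 'n = 3] by simp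
  then obtain r :: "3 \<Rightarrow> 'g" where r: "bij_betw r UNIV Y"
    using finite_same_card_bij[of "UNIV :: 3 set" Y] finY by auto
  have rY: "r i \<in> Y" for i using r by (auto simp: bij_betw_def)
  have rG: "r i \<in> carrier G" for i using rY YG by blast
  define lam :: "complex ^ 3 ^ 3" where "lam = (\<chi> i k. T (axis k 1) (r i))"
  have lam: "(\<Sum>k\<in>UNIV. lam $ i $ k * v $ k) = T v (r i)" for i v
  proof -
    have "T v (r i) = T (\<Sum>k\<in>UNIV. v $ k *s axis k 1) (r i)" by (simp only: basis_expansion)
    then show ?thesis by (simp add: T_sum scale lam_def mult.commute)
  qed
  have "invertible lam"
  proof -
    have "v = 0" if "lam *v v = 0" for v
    proof (rule determined)
      fix y assume "y \<in> Y"
      then obtain i where "y = r i" using r by (auto simp: bij_betw_def)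
      moreover have "(lam *v v) $ i = T v (r i)" by (simp add: matrix_vector_mult_def lam)
      ultimately show "T v y = 0" using that by simp
    qed
    then show ?thesis using matrix_left_invertible_ker invertible_left_inverse by blast
  qed
  moreover have "\<exists>c. lam $ j v* S s = c *s lam $ i"
    if s: "s \<in> carrier G" and h: "r j \<otimes> s \<otimes> inv (r i) \<in> carrier H" for s i j
  proof
    let ?h = "r j \<otimes> s \<otimes> inv (r i)"
    have rs: "r j \<otimes> s = ?h \<otimes> r i" using rG s by (simp add: m_assoc)
    have "(lam $ j v* S s) $ k = \<theta> ?h * lam $ i $ k" for k
    proof -
      have "(lam $ j v* S s) $ k = (\<Sum>l\<in>UNIV. lam $ j $ l * (S s *v axis k 1) $ l)"
        by (simp add: vector_matrix_mult_def matrix_vector_mult_def axis_def if_distrib[of "\<lambda>x. _ * x"] mult.commute cong: if_cong)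
      also have "\<dots> = T (axis k 1) (r j \<otimes> s)" unfolding lam by (rule act[OF s rG])
      also have "\<dots> = T (axis k 1) (?h \<otimes> r i)" by (simp only: rs[symmetric])
      also have "\<dots> = \<theta> ?h * lam $ i $ k" unfolding T_H[OF h rG] lam_def by simp
      finally show ?thesis .
    qed
    then show "lam $ j v* S s = \<theta> ?h *s lam $ i"
      unfolding vec_eq_iff vector_smult_component by blast
  qed
  moreover have "i = j" if "r i \<otimes> inv (r j) \<in> carrier H" for i j
    using bij_betw_imp_inj_on[OF r] Ydist[OF rY rY that] by (rule injD)
  moreover have "\<exists>i. x \<otimes> inv (r i) \<in> carrier H" if "x \<in> carrier G" for x
    using cover[OF that] r by (auto simp: bij_betw_def)
  ultimately show ?thesis using that[of r lam] rG by blast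
qed

section \<open>Restriction to normal subgroups of small index\<close>

lemma line_or_trivial:
  fixes U :: "(complex ^ 2) set"
  assumes U: "vec.subspace U" "U \<noteq> {0}" "U \<noteq> UNIV"
  obtains v where "v \<noteq> 0" "U = {c *s v |c. True}"
proof -
  obtain v where v: "v \<in> U" "v \<noteq> 0" using U(1,2) vec.subspace_0 by blast
  have "w \<in> {c *s v |c. True}" if w: "w \<in> U" for w
  proof (rule ccontr)
    assume "w \<notin> {c *s v |c. True}"
    then have "det (vector [v, w] :: complex^2^2) \<noteq> 0"
      using v(2) by (intro two_dim_line_independent) auto
    then have "invertible (vector [v, w] :: complex^2^2)" by (simp add: invertible_det_nz)
    then obtain B where B: "B ** (vector [v, w] :: complex^2^2) = mat 1" unfolding invertible_def by blast
    have "u \<in> U" for u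
    proof -
      define a where "a = u v* B"
      have "u = a v* (vector [v, w] :: complex^2^2)"
        unfolding a_def by (simp add: vector_matrix_mul_assoc B)
      also have "\<dots> = a $ 1 *s v + a $ 2 *s w"
        by (simp add: vec_eq_iff vector_matrix_mult_def sum_2 mult.commute)
      finally show ?thesis using U(1) v(1) w by (metis vec.subspace_add vec.subspace_scale)
    qed
    then show False using U(3) by blast
  qed
  moreover have "{c *s v |c. True} \<subseteq> U" using U(1) v(1) by (auto intro: vec.subspace_scale)
  ultimately show ?thesis using that v(2) by blast
qed

text \<open>Suppose the kernel of \<pi> stabilizes the line of \<open>v\<close>. With
  \<open>T = R c0\<close> it also stabilizes the lines of \<open>T *v v\<close> and
  \<open>T *v (T *v v)\<close>. These three lines turn out to be different, so the kernel acts by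
  scalars, and any eigenline of \<open>T\<close> is then stable under all even elements, against
  \<open>irr\<close>.\<close>

lemma irreducible_on_index_3:
  fixes G :: "'g monoid" (structure) and R :: "'g \<Rightarrow> complex ^ 2 ^ 2" and \<pi> :: "'g \<Rightarrow> 3 \<Rightarrow> 3"
  assumes G: "group G" and R: "R \<in> hom G GL"
    and \<pi>: "\<And>g h. g \<in> carrier G \<Longrightarrow> h \<in> carrier G \<Longrightarrow> \<pi> (g \<otimes> h) = \<pi> g \<circ> \<pi> h"
    and c0: "c0 \<in> carrier G" "\<pi> c0 = cyc3"
    and irr: "\<And>U. vec.subspace U \<Longrightarrow>
      (\<And>g v. g \<in> carrier G \<Longrightarrow> \<pi> g \<in> {id, cyc3, cyc3 \<circ> cyc3} \<Longrightarrow> v \<in> U \<Longrightarrow> R g *v v \<in> U) \<Longrightarrow> U = {0} \<or> U = UNIV"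
    and U: "vec.subspace U" "\<And>g v. g \<in> carrier G \<Longrightarrow> \<pi> g = id \<Longrightarrow> v \<in> U \<Longrightarrow> R g *v v \<in> U"
  shows "U = {0} \<or> U = UNIV"
proof (rule ccontr)
  assume "\<not> (U = {0} \<or> U = UNIV)"
  then obtain v where v: "v \<noteq> 0" and Uv: "U = {c *s v |c. True}"
    using line_or_trivial[OF U(1)] by blast
  interpret group G by (rule G)
  note RG = hom_GL[OF G R]
  define T where "T = R c0"
  have ccc: "cyc3 \<circ> (cyc3 \<circ> cyc3) = id" by (rule all3_eqI) simp_all
  have bij_c: "inj cyc3" using bij_cyc3 by (rule bij_is_inj)
  have pinv: "cyc3 \<circ> \<pi> (inv c0) = id"
  proof -
    have 1: "\<pi> \<one> = id"
    proof -
      have "\<pi> c0 \<circ> \<pi> \<one> = \<pi> c0" using \<pi>[of c0 \<one>] c0(1) by simp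
      then have "cyc3 (\<pi> \<one> i) = cyc3 i" for i using c0(2) by (metis comp_apply)
      then show ?thesis using bij_c by (auto simp: fun_eq_iff dest: injD)
    qed
    then show ?thesis using \<pi>[of c0 "inv c0"] c0 by simp
  qed
  have pinv': "\<pi> (inv c0) = cyc3 \<circ> cyc3"
  proof -
    have "(cyc3 \<circ> (cyc3 \<circ> cyc3)) \<circ> \<pi> (inv c0) = (cyc3 \<circ> cyc3) \<circ> (cyc3 \<circ> \<pi> (inv c0))" by (simp add: o_assoc)
    then show ?thesis unfolding ccc pinv by simp
  qed
  have no_line: False if u: "u \<noteq> 0" "T *v u = a *s u"
    "\<And>n. n \<in> carrier G \<Longrightarrow> \<pi> n = id \<Longrightarrow> \<exists>c. R n *v u = c *s u" for u :: "complex^2" and a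
  proof -
    have step: "\<exists>c. R (c0 \<otimes> g) *v u = c *s u" if "g \<in> carrier G" "\<exists>c. R g *v u = c *s u" for g
      using that u(2) RG(2)[OF c0(1) that(1)]
      by (auto simp: T_def vector_scalar_commute vector_smult_assoc simp flip: matrix_vector_mul_assoc)
    have cancel: "c0 \<otimes> (inv c0 \<otimes> g) = g" if "g \<in> carrier G" for g
      using that c0(1) by (simp flip: m_assoc)
    have e1: "\<exists>c. R g *v u = c *s u" if "g \<in> carrier G" "\<pi> g = cyc3" for g
    proof -
      have "\<pi> (inv c0 \<otimes> g) = cyc3 \<circ> (cyc3 \<circ> cyc3)"
        using that c0(1) by (simp add: \<pi> pinv' o_assoc)
      then have "\<exists>c. R (inv c0 \<otimes> g) *v u = c *s u" using u(3) that c0(1) ccc by simp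
      then show ?thesis using step[of "inv c0 \<otimes> g"] cancel[OF that(1)] that c0(1) by simp
    qed
    have e2: "\<exists>c. R g *v u = c *s u" if "g \<in> carrier G" "\<pi> g = cyc3 \<circ> cyc3" for g
    proof -
      have "\<pi> (inv c0 \<otimes> g) = (cyc3 \<circ> (cyc3 \<circ> cyc3)) \<circ> cyc3"
        using that c0(1) by (simp add: \<pi> pinv' o_assoc)
      then have "\<exists>c. R (inv c0 \<otimes> g) *v u = c *s u" using e1[of "inv c0 \<otimes> g"] that c0(1) ccc by simp
      then show ?thesis using step[of "inv c0 \<otimes> g"] cancel[OF that(1)] that c0(1) by simp
    qed
    have "{c *s u |c. True} = {0} \<or> {c *s u |c. True} = UNIV"
    proof (rule irr[OF subspace_line])
      fix g w assume g: "g \<in> carrier G" "\<pi> g \<in> {id, cyc3, cyc3 \<circ> cyc3}" and "w \<in> {c *s u |c. True}"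
      then obtain b where w: "w = b *s u" by blast
      obtain c where "R g *v u = c *s u" using g u(3) e1 e2 by blast
      then have "R g *v w = (b * c) *s u" by (simp add: w vector_scalar_commute vector_smult_assoc)
      then show "R g *v w \<in> {c *s u |c. True}" by blast
    qed
    then show False using line_neq_UNIV line_eq_0 u(1) by blast
  qed
  have conj: "\<exists>c. R n *v (T *v u) = c *s (T *v u)"
    if n: "n \<in> carrier G" "\<pi> n = id" and u: "\<And>n. n \<in> carrier G \<Longrightarrow> \<pi> n = id \<Longrightarrow> \<exists>c. R n *v u = c *s u" for n u
  proof -
    define n' where "n' = inv c0 \<otimes> (n \<otimes> c0)"
    have n'G: "n' \<in> carrier G" using n c0 by (simp add: n'_def)
    have "\<pi> n' = \<pi> (inv c0) \<circ> cyc3" using n c0 by (simp add: n'_def \<pi>)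
    also have "\<dots> = id" unfolding pinv' using ccc by (simp add: o_assoc)
    finally obtain c where c: "R n' *v u = c *s u" using u n'G by blast
    have "c0 \<otimes> n' = n \<otimes> c0" using n c0 by (simp add: n'_def flip: m_assoc)
    then have "R n ** T = T ** R n'" using RG(2) n c0 n'G by (metis T_def)
    then have "R n *v (T *v u) = T *v (R n' *v u)" by (simp add: matrix_vector_mul_assoc)
    then show ?thesis using c by (auto simp: vector_scalar_commute)
  qed
  have Nv: "\<exists>c. R n *v v = c *s v" if "n \<in> carrier G" "\<pi> n = id" for n
  proof -
    have "v \<in> U" unfolding Uv by (intro CollectI exI[of _ 1]) simp
    then have "R n *v v \<in> U" using U(2) that by blast
    then show ?thesis unfolding Uv by blast
  qed
  note NTv = conj[OF _ _ Nv]
  note NTTv = conj[OF _ _ NTv]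
  have Tinv: "T *v u = 0 \<Longrightarrow> u = 0" for u
    using matrix_inv_mult(2)[OF RG(1)[OF c0(1)]] by (metis T_def matrix_vector_mul_assoc matrix_vector_mul_lid matrix_vector_mult_0_right)
  define w where "w = T *v v"
  have w: "w \<noteq> c *s v" for c using no_line[OF v _ Nv] by (auto simp: w_def)
  have w0: "w \<noteq> 0" using Tinv v by (auto simp: w_def)
  have "det (vector [v, w] :: complex^2^2) \<noteq> 0" using v w by (rule two_dim_line_independent)
  then have D: "invertible (vector [v, w] :: complex^2^2)" by (simp add: invertible_det_nz)
  then obtain B where B: "B ** (vector [v, w] :: complex^2^2) = mat 1" unfolding invertible_def by blast
  have comb: "\<exists>a b. u = a *s v + b *s w" for u
  proof -
    have "u = (u v* B) v* (vector [v, w] :: complex^2^2)" by (simp add: vector_matrix_mul_assoc B)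
    also have "\<dots> = (u v* B) $ 1 *s v + (u v* B) $ 2 *s w"
      by (simp add: vec_eq_iff vector_matrix_mult_def sum_2 algebra_simps)
    finally show ?thesis by blast
  qed
  have lin_indep: "a = 0 \<and> b = 0" if "a *s v + b *s w = 0" for a b
  proof -
    have "b = 0"
    proof (rule ccontr)
      assume "b \<noteq> 0"
      have "b *s w = - (a *s v)" using that by (metis add_eq_0_iff)
      then have "inverse b *s (b *s w) = inverse b *s (- (a *s v))" by simp
      then have "w = (- (inverse b * a)) *s v"
        using \<open>b \<noteq> 0\<close> by (simp add: vector_smult_assoc vector_smult_rneg vector_smult_lneg)
      then show False using w by blast
    qed
    then show ?thesis using that v by simp
  qed
  obtain a b where ab: "T *v w = a *s v + b *s w" using comb by blast
  \<comment> \<open>If \<open>T\<close> mapped \<open>w\<close> back to the line of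
    \<open>v\<close>, then \<open>T *v (T *v w)\<close> would lie on the line of \<open>w\<close>.
    But it is the image of \<open>v\<close> under the cube of \<open>c0\<close>, which lies in the
    kernel of \<pi> and keeps the line of \<open>v\<close>.\<close>
  have "b \<noteq> 0"
  proof
    assume "b = 0"
    then have TTT: "T *v (T *v w) = a *s w" using ab by (simp add: vector_scalar_commute w_def)
    have "\<pi> (c0 \<otimes> (c0 \<otimes> c0)) = id" using c0 by (simp add: \<pi> ccc)
    then obtain c where "R (c0 \<otimes> (c0 \<otimes> c0)) *v v = c *s v" using Nv c0(1) by blast
    then have "T *v (T *v w) = c *s v"
      using RG(2) c0(1) by (simp add: w_def T_def flip: matrix_vector_mul_assoc)
    then have "(- c) *s v + a *s w = 0" using TTT by (simp add: vector_smult_lneg)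
    then have "a = 0" using lin_indep by blast
    then have "T *v w = 0" using ab \<open>b = 0\<close> by simp
    then show False using Tinv w0 by blast
  qed
  have "a \<noteq> 0"
  proof
    assume "a = 0"
    then have "T *v (w - b *s v) = 0" using ab by (simp add: matrix_vector_mult_diff_distrib vector_scalar_commute w_def)
    then have "w = b *s v" using Tinv by force
    then show False using w by blast
  qed
  have scalar: "\<exists>c. R n *v u = c *s u" if n: "n \<in> carrier G" "\<pi> n = id" for n u
  proof -
    obtain c where c: "R n *v v = c *s v" using Nv[OF n] by blast
    obtain d where d: "R n *v w = d *s w" using NTv[OF n] unfolding w_def by blast
    obtain k where k: "R n *v (T *v w) = k *s (T *v w)" using NTTv[OF n] unfolding w_def by blast
    have "(a * (c - k)) *s v + (b * (d - k)) *s w = 0"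
      using k c d unfolding ab
      by (simp add: matrix_vector_right_distrib vector_scalar_commute vector_add_ldistrib vector_smult_assoc
          vec_eq_iff forall_2 algebra_simps)
    then have "c = k" "d = k" using lin_indep \<open>a \<noteq> 0\<close> \<open>b \<noteq> 0\<close> by fastforce+
    obtain x y where "u = x *s v + y *s w" using comb by blast
    then have "R n *v u = k *s u"
      using c d \<open>c = k\<close> \<open>d = k\<close> by (simp add: matrix_vector_right_distrib vector_scalar_commute vector_add_ldistrib vector_smult_assoc mult.commute)
    then show ?thesis by blast
  qed
  \<comment> \<open>In the basis \<open>v\<close>, \<open>w\<close> the matrix of \<open>T\<close>
    is a companion matrix with characteristic polynomial \<open>X ^ 2 - b * X - a\<close>;
    \<open>m\<close> and \<open>m'\<close> are its roots, and \<open>w - m' *s v\<close> is an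
    eigenvector for \<open>m\<close>.\<close>
  define s where "s = csqrt (b * b + 4 * a)"
  have s: "s * s = b * b + 4 * a" unfolding s_def by (metis power2_csqrt power2_eq_square)
  define m where "m = (b + s) / 2"
  define m' where "m' = (b - s) / 2"
  have mm: "m + m' = b" "m * m' = - a"
    using s by (simp_all add: m_def m'_def field_simps)
  define u where "u = w - m' *s v"
  have "u \<noteq> 0" using w[of m'] by (simp add: u_def)
  moreover have "T *v u = m *s u"
  proof -
    have "T *v u = a *s v + b *s w - m' *s w"
      by (simp add: u_def matrix_vector_mult_diff_distrib vector_scalar_commute ab flip: w_def)
    also have "\<dots> = m *s u"
    proof -
      have a: "a = - (m * m')" using mm(2) by simp
      have b: "b = m + m'" using mm(1) by simp
      show ?thesis unfolding u_def a b by (simp add: vec_eq_iff algebra_simps)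
    qed
    finally show ?thesis .
  qed
  ultimately show False using no_line scalar by blast
qed

section \<open>Decomposition of the tensor product\<close>

context monomial_pair
begin

definition dual_basis :: "3 \<Rightarrow> complex ^ 3" where
  "dual_basis i = matrix_inv lam *v axis i 1"

text \<open>A row of \<open>lam\<close> paired with the image of a dual vector can be computed on
  either side, so both scalars agree. Their equality makes them cancel in the decomposition of the
  tensor product.\<close>

lemma dual_basis_action:
  assumes g: "g \<in> carrier G"
  obtains c where "c \<noteq> 0" "lam $ \<pi> g i v* S g = c *s lam $ i" "S g *v dual_basis i = c *s dual_basis (\<pi> g i)"
proof -
  define dot :: "complex^3 \<Rightarrow> complex^3 \<Rightarrow> complex" where "dot v w = (\<Sum>i\<in>UNIV. v $ i * w $ i)" for v w
  have dot: "dot (v v* M) w = dot v (M *v w)" "dot (c *s v) w = c * dot v w" for v w M c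
    by (simp_all add: dot_def sum_3 matrix_vector_mult_def vector_matrix_mult_def algebra_simps)
  have lam_dot: "(lam *v w) $ j = dot (lam $ j) w" for w j
    by (simp add: dot_def matrix_vector_mult_def)
  have L: "lam *v dual_basis i = axis i 1" for i
    by (simp add: dual_basis_def matrix_vector_mul_assoc matrix_inv_mult[OF lam])
  obtain c where c: "\<And>i. lam $ \<pi> g i v* S g = c i *s lam $ i"
    using monomial[OF g] by metis
  have "lam *v (S g *v dual_basis i) = c i *s axis (\<pi> g i) 1"
  proof -
    have "(lam *v (S g *v dual_basis i)) $ j = (c i *s axis (\<pi> g i) 1) $ j" for j
    proof -
      obtain k where k: "j = \<pi> g k" using perm[OF g] by (metis bij_pointE)
      have "(lam *v (S g *v dual_basis i)) $ j = dot (lam $ \<pi> g k v* S g) (dual_basis i)"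
        by (simp only: lam_dot dot k)
      also have "\<dots> = c k * (lam *v dual_basis i) $ k" unfolding c by (simp only: dot lam_dot)
      also have "\<dots> = c k * axis i 1 $ k" by (simp only: L)
      finally show ?thesis
        using inj_eq[OF bij_is_inj[OF perm[OF g]], of k i] by (auto simp: k axis_def)
    qed
    then show ?thesis unfolding vec_eq_iff by blast
  qed
  then have "matrix_inv lam *v (lam *v (S g *v dual_basis i)) = c i *s dual_basis (\<pi> g i)"
    by (simp add: vector_scalar_commute dual_basis_def)
  then have S: "S g *v dual_basis i = c i *s dual_basis (\<pi> g i)"
    by (simp add: matrix_vector_mul_assoc matrix_inv_mult[OF lam] matrix_mul_assoc)
  have "c i \<noteq> 0"
  proof
    assume "c i = 0"
    then have "matrix_inv (S g) *v (S g *v dual_basis i) = 0" using S by simp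
    then have "dual_basis i = 0"
      using matrix_inv_mult[OF hom_GL(1)[OF group hom(2) g]] by (simp add: matrix_vector_mul_assoc)
    then show False using L[of i] by (simp add: axis_eq_0_iff)
  qed
  then show ?thesis using that c S by blast
qed

text \<open>The line through the \<open>i\<close>-th basis vector of \<open>S\<close> corresponds to the line of a traceless
  matrix \<open>a i\<close>, and conjugation by \<open>R g\<close> maps \<open>a i\<close> to a multiple of \<open>a (\<pi> g i)\<close>. Hence
  \<open>v \<otimes> a i \<mapsto> (a i v) \<otimes> e i\<close> identifies \<open>R \<otimes> Ad0 R\<close> with \<open>R\<close> tensored with the
  permutation representation \<open>\<pi>\<close>.\<close>

theorem tensor_decomposition:
  assumes P: "invertible P" and PS: "\<And>g. g \<in> carrier G \<Longrightarrow> P ** S g = mat (\<eta> g) ** Ad0 R g ** P"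
    and \<eta>0: "\<And>g. g \<in> carrier G \<Longrightarrow> \<eta> g \<noteq> 0"
    and \<phi>: "\<And>g. g \<in> carrier G \<Longrightarrow> \<phi> g = std_rep (\<pi> g)"
  shows "rep_iso G (tensor_rep R S) (sum_rep (twist \<eta> R) (tensor_rep (twist \<eta> R) \<phi>))"
proof -
  define a where "a i = sl2_matrix (P *v dual_basis i)" for i
  have act: "\<exists>c. c \<noteq> 0 \<and> (\<forall>x. coord (tensor_rep R S g *v x) (\<pi> g i) = c *s (R g *v coord x i)) \<and>
      mat (\<eta> g) ** R g ** a i = mat c ** a (\<pi> g i) ** R g" if g: "g \<in> carrier G" for g i
  proof -
    obtain c where c: "c \<noteq> 0" "lam $ \<pi> g i v* S g = c *s lam $ i" "S g *v dual_basis i = c *s dual_basis (\<pi> g i)"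
      using dual_basis_action[OF g] by blast
    have "coord (tensor_rep R S g *v x) (\<pi> g i) = c *s (R g *v coord x i)" for x
      by (simp add: coord_def contract_tensor_rep c contract_linear vector_scalar_commute)
    moreover have "mat (\<eta> g) ** R g ** a i = mat c ** a (\<pi> g i) ** R g"
    proof -
      have Rg: "invertible (R g)" using hom_GL(1)[OF group hom(1) g] .
      have "P *v (S g *v dual_basis i) = \<eta> g *s (Ad0 R g *v (P *v dual_basis i))"
        using PS[OF g] by (simp add: matrix_vector_mul_assoc) (simp flip: matrix_vector_mul_assoc)
      then have "sl2_matrix (c *s (P *v dual_basis (\<pi> g i))) = sl2_matrix (\<eta> g *s (Ad0 R g *v (P *v dual_basis i)))"
        by (simp add: c vector_scalar_commute)
      then have "mat c ** a (\<pi> g i) = mat (\<eta> g) ** (R g ** a i ** matrix_inv (R g))"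
        by (simp only: linear_sl2_matrix Ad0_mult[of R g, OF Rg] a_def)
      then have "mat c ** a (\<pi> g i) ** R g = mat (\<eta> g) ** R g ** a i ** (matrix_inv (R g) ** R g)"
        by (simp only: matrix_mul_assoc)
      then show ?thesis by (simp add: matrix_inv_mult[OF Rg])
    qed
    ultimately show ?thesis using c(1) by blast
  qed
  \<comment> \<open>The kernel of \<open>a i\<close> is stable under the kernel of \<pi>, and
    \<open>a i\<close> is nonzero.\<close>
  have a_inv: "invertible (a i)" for i
  proof -
    have "{v. a i *v v = 0} = {0} \<or> {v. a i *v v = 0} = UNIV"
    proof (rule irreducible_kernel)
      show "vec.subspace {v. a i *v v = 0}" by (rule vec.subspace_kernel)
      fix g v assume g: "g \<in> carrier G" "\<pi> g = id" and v: "v \<in> {v. a i *v v = 0}"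
      obtain c where c: "c \<noteq> 0" "mat (\<eta> g) ** R g ** a i = mat c ** a i ** R g"
        using act[OF g(1), of i] g(2) by auto
      have "c *s (a i *v (R g *v v)) = (mat c ** a i ** R g) *v v" by (simp flip: matrix_vector_mul_assoc)
      also have "\<dots> = 0" unfolding c(2)[symmetric] using v by (simp flip: matrix_vector_mul_assoc)
      finally show "R g *v v \<in> {v. a i *v v = 0}" using c(1) by simp
    qed
    moreover have "{v. a i *v v = 0} \<noteq> UNIV"
    proof
      assume "{v. a i *v v = 0} = UNIV"
      then have "a i = 0" by (auto simp: matrix_eq)
      then have "sl2_coords (a i) = 0" by (simp add: sl2_coords_def vec_eq_iff forall_3)
      then have "P *v dual_basis i = 0" by (simp add: a_def sl2_coords_matrix)
      then have "matrix_inv P *v (P *v dual_basis i) = 0" by simp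
      then have "dual_basis i = 0"
        unfolding matrix_vector_mul_assoc matrix_inv_mult[OF P] by simp
      then have "lam *v dual_basis i = 0" by simp
      then have "axis i 1 = (0 :: complex^3)"
        unfolding dual_basis_def matrix_vector_mul_assoc matrix_inv_mult[OF lam] by simp
      then show False by (simp add: axis_eq_0_iff)
    qed
    ultimately show ?thesis using matrix_left_invertible_ker invertible_left_inverse by blast
  qed
  \<comment> \<open>Applying \<open>a i\<close> to the \<open>i\<close>-th coordinate replaces the
    scalar \<open>c\<close>, which varies with \<open>i\<close>, by \<eta>, which does not.\<close>
  define \<Theta> where "\<Theta> x i = a i *v coord x i" for x i
  have \<Theta>_lin: "\<Theta> (x + y) i = \<Theta> x i + \<Theta> y i" "\<Theta> (c *s x) i = c *s \<Theta> x i" for x y c i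
    by (simp_all add: \<Theta>_def coord_linear matrix_vector_right_distrib vector_scalar_commute)
  have \<Theta>_act: "\<Theta> (tensor_rep R S g *v x) (\<pi> g i) = \<eta> g *s (R g *v \<Theta> x i)" if g: "g \<in> carrier G" for g x i
  proof -
    obtain c where c: "coord (tensor_rep R S g *v x) (\<pi> g i) = c *s (R g *v coord x i)"
      "mat (\<eta> g) ** R g ** a i = mat c ** a (\<pi> g i) ** R g"
      using act[OF g, of i] by blast
    have "\<Theta> (tensor_rep R S g *v x) (\<pi> g i) = (mat c ** a (\<pi> g i) ** R g) *v coord x i"
      unfolding \<Theta>_def c(1) by (simp add: vector_scalar_commute flip: matrix_vector_mul_assoc)
    also have "\<dots> = \<eta> g *s (R g *v \<Theta> x i)"
      unfolding c(2)[symmetric] \<Theta>_def by (simp flip: matrix_vector_mul_assoc)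
    finally show ?thesis .
  qed
  \<comment> \<open>The sum of the three coordinates gives the copy of \<open>R\<close>, the
    sum-zero projection the tensor product with the standard representation.\<close>
  define F :: "complex ^ (2 \<times> 3) \<Rightarrow> complex ^ (2 + 2 \<times> 2)" where
    "F x = (\<chi> p. case p of Inl r \<Rightarrow> \<Sum>i\<in>UNIV. \<Theta> x i $ r
        | Inr q \<Rightarrow> \<Sum>i\<in>UNIV. sum_zero_proj $ snd q $ i * \<Theta> x i $ fst q)" for x
  \<comment> \<open>One third of the sum is the mean of the three coordinates, to which the sum-zero
    part is added back.\<close>
  define E :: "complex ^ (2 + 2 \<times> 2) \<Rightarrow> complex ^ (2 \<times> 3)" where
    "E z = of_coord (\<lambda>i. matrix_inv (a i) *v (\<chi> r. z $ Inl r / 3 + (\<Sum>l\<in>UNIV. sum_zero_incl $ i $ l * z $ Inr (r, l))))" for z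
  have F_lin: "Vector_Spaces.linear (*s) (*s) F"
    by (rule vec_linearI)
       (simp_all add: F_def \<Theta>_lin vec_eq_iff sum_3 algebra_simps split: sum.split)
  have \<Theta>E: "\<Theta> (E z) i = (\<chi> r. z $ Inl r / 3 + (\<Sum>l\<in>UNIV. sum_zero_incl $ i $ l * z $ Inr (r, l)))" for z i
    unfolding \<Theta>_def E_def coord_of_coord matrix_vector_mul_assoc matrix_inv_mult[OF a_inv] by simp
  have FE: "F (E z) = z" for z
  proof -
    have "F (E z) $ p = z $ p" for p
    proof (cases p)
      case (Inl r)
      then show ?thesis
        unfolding F_def \<Theta>E by (simp add: sum_3 sum_2 sum_zero_incl_def)
    next
      case (Inr q)
      obtain r l where q: "q = (r, l)" by (cases q)
      have "(\<Sum>i\<in>UNIV. sum_zero_proj $ l $ i * (z $ Inl r / 3 + (\<Sum>m\<in>UNIV. sum_zero_incl $ i $ m * z $ Inr (r, m)))) = z $ Inr (r, l)"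
      proof -
        define s t1 t2 where "s = z $ Inl r / 3" and "t1 = z $ Inr (r, 1)" and "t2 = z $ Inr (r, 2)"
        have third: "2 / 3 * x + - 1 / 3 * y + - 1 / 3 * w = (2 * x - y - w) / 3"
          "- 1 / 3 * y + 2 / 3 * x + - 1 / 3 * w = (2 * x - y - w) / 3" for x y w :: complex
          by (simp_all add: diff_divide_distrib)
        have incl: "(\<Sum>m\<in>UNIV. sum_zero_incl $ 1 $ m * z $ Inr (r, m)) = t1"
          "(\<Sum>m\<in>UNIV. sum_zero_incl $ 2 $ m * z $ Inr (r, m)) = t2"
          "(\<Sum>m\<in>UNIV. sum_zero_incl $ 3 $ m * z $ Inr (r, m)) = - t1 - t2"
          by (simp_all add: sum_2 sum_zero_incl_def t1_def t2_def)
        have proj: "sum_zero_proj $ 1 $ 1 = 2 / 3" "sum_zero_proj $ 1 $ 2 = - 1 / 3" "sum_zero_proj $ 1 $ 3 = - 1 / 3"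
          "sum_zero_proj $ 2 $ 1 = - 1 / 3" "sum_zero_proj $ 2 $ 2 = 2 / 3" "sum_zero_proj $ 2 $ 3 = - 1 / 3"
          by (simp_all add: sum_zero_proj_def)
        have cancel: "2 * (s + t1) - (s + t2) - (s + (- t1 - t2)) = 3 * t1"
          "2 * (s + t2) - (s + t1) - (s + (- t1 - t2)) = 3 * t2"
          by (simp_all add: algebra_simps)
        consider "l = 1" | "l = 2" using exhaust_2[of l] by blast
        then show ?thesis
        proof cases
          case 1
          show ?thesis
            unfolding 1 sum_3 incl proj s_def[symmetric] third cancel by (simp add: t1_def)
        next
          case 2
          show ?thesis
            unfolding 2 sum_3 incl proj s_def[symmetric] third cancel by (simp add: t2_def)
        qed
      qed
      then show ?thesis unfolding F_def \<Theta>E Inr q by simp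
    qed
    then show ?thesis by (simp add: vec_eq_iff)
  qed
  have EF: "E (F x) = x" for x
  proof (rule coord_eqI)
    fix i
    have "(\<chi> r. F x $ Inl r / 3 + (\<Sum>l\<in>UNIV. sum_zero_incl $ i $ l * F x $ Inr (r, l))) = \<Theta> x i"
    proof -
      have "F x $ Inl r / 3 + (\<Sum>l\<in>UNIV. sum_zero_incl $ i $ l * F x $ Inr (r, l)) = \<Theta> x i $ r" for r
      proof -
        have F0: "F x $ Inl r = \<Theta> x 1 $ r + \<Theta> x 2 $ r + \<Theta> x 3 $ r"
          by (simp add: F_def sum_3)
        have F1: "F x $ Inr (r, 1) = (2 * \<Theta> x 1 $ r - \<Theta> x 2 $ r - \<Theta> x 3 $ r) / 3"
          by (simp add: F_def sum_3 sum_zero_proj_def diff_divide_distrib)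
        have F2: "F x $ Inr (r, 2) = (2 * \<Theta> x 2 $ r - \<Theta> x 1 $ r - \<Theta> x 3 $ r) / 3"
          by (simp add: F_def sum_3 sum_zero_proj_def diff_divide_distrib)
        consider "i = 1" | "i = 2" | "i = 3" using exhaust_3[of i] by blast
        then show ?thesis
          by cases (simp_all add: sum_2 F0 F1 F2 sum_zero_incl_def, simp_all add: field_simps)
      qed
      then show ?thesis by (simp add: vec_eq_iff)
    qed
    then have "coord (E (F x)) i = matrix_inv (a i) *v \<Theta> x i"
      unfolding E_def coord_of_coord by simp
    then show "coord (E (F x)) i = coord x i"
      unfolding \<Theta>_def matrix_vector_mul_assoc matrix_inv_mult[OF a_inv] by simp
  qed
  have E_lin: "Vector_Spaces.linear (*s) (*s) E"
  proof (rule vec_linearI)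
    interpret F: Vector_Spaces.linear "(*s)" "(*s)" F by (rule F_lin)
    show "E (x + y) = E x + E y" for x y by (metis EF FE F.add)
    show "E (c *s x) = c *s E x" for c x by (metis EF FE F.scale)
  qed
  have FM: "matrix F *v x = F x" and EM: "matrix E *v z = E z" for x z
    using matrix_works[OF F_lin] matrix_works[OF E_lin] by blast+
  have "F (tensor_rep R S g *v x) = sum_rep (twist \<eta> R) (tensor_rep (twist \<eta> R) \<phi>) g *v F x"
    if g: "g \<in> carrier G" for g x
  proof -
    note bij = perm[OF g]
    define y where "y = tensor_rep R S g *v x"
    have reindex: "(\<Sum>i\<in>UNIV. h i) = (\<Sum>i\<in>UNIV. h (\<pi> g i))" for h :: "3 \<Rightarrow> complex"
      using sum.reindex_bij_betw[OF bij, of h] by simp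
    have \<Theta>y: "\<Theta> y (\<pi> g i) $ r = \<eta> g * (\<Sum>s\<in>UNIV. R g $ r $ s * \<Theta> x i $ s)" for i r
      unfolding y_def \<Theta>_act[OF g] by (simp add: matrix_vector_mult_def)
    have "F y $ p = (sum_rep (twist \<eta> R) (tensor_rep (twist \<eta> R) \<phi>) g *v F x) $ p" for p
    proof (cases p)
      case (Inl r)
      have "F y $ Inl r = (\<Sum>i\<in>UNIV. \<Theta> y (\<pi> g i) $ r)"
        unfolding F_def using reindex[of "\<lambda>i. \<Theta> y i $ r"] by simp
      also have "\<dots> = (\<Sum>s\<in>UNIV. \<eta> g * R g $ r $ s * F x $ Inl s)"
        unfolding \<Theta>y F_def by (simp add: sum_3 sum_2 algebra_simps)
      also have "\<dots> = (sum_rep (twist \<eta> R) (tensor_rep (twist \<eta> R) \<phi>) g *v F x) $ Inl r"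
        by (simp add: matrix_vector_mult_def sum_rep_def twist_def UNIV_Plus_UNIV[symmetric] sum.Plus del: UNIV_Plus_UNIV)
      finally show ?thesis unfolding Inl .
    next
      case (Inr q)
      obtain r l where q: "q = (r, l)" by (cases q)
      have proj: "sum_zero_proj $ l $ \<pi> g i = (\<Sum>m\<in>UNIV. std_rep (\<pi> g) $ l $ m * sum_zero_proj $ m $ i)" for i
      proof -
        have "(sum_zero_proj ** perm_mat (\<pi> g)) $ l $ i = sum_zero_proj $ l $ \<pi> g i"
          by (simp add: matrix_matrix_mult_def perm_mat_def if_distrib[of "\<lambda>x. _ * x"] cong: if_cong)
        then show ?thesis
          unfolding perm_mat_std(2)[OF bij] by (simp add: matrix_matrix_mult_def)
      qed
      have "F y $ Inr (r, l) = (\<Sum>i\<in>UNIV. sum_zero_proj $ l $ \<pi> g i * \<Theta> y (\<pi> g i) $ r)"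
        unfolding F_def using reindex[of "\<lambda>i. sum_zero_proj $ l $ i * \<Theta> y i $ r"] by simp
      also have "\<dots> = (\<Sum>s\<in>UNIV. \<Sum>m\<in>UNIV. \<eta> g * R g $ r $ s * std_rep (\<pi> g) $ l $ m * F x $ Inr (s, m))"
        unfolding \<Theta>y proj F_def by (simp add: sum_3 sum_2 algebra_simps)
      also have "\<dots> = (sum_rep (twist \<eta> R) (tensor_rep (twist \<eta> R) \<phi>) g *v F x) $ Inr (r, l)"
        by (simp add: matrix_vector_mult_def sum_rep_def tensor_rep_def twist_def \<phi>[OF g] sum_UNIV_prod
            UNIV_Plus_UNIV[symmetric] sum.Plus del: UNIV_Plus_UNIV)
      finally show ?thesis unfolding Inr q .
    qed
    then show ?thesis unfolding y_def by (simp add: vec_eq_iff)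
  qed
  then have "matrix F ** tensor_rep R S g = sum_rep (twist \<eta> R) (tensor_rep (twist \<eta> R) \<phi>) g ** matrix F"
    if "g \<in> carrier G" for g
    using that unfolding matrix_eq by (simp add: FM flip: matrix_vector_mul_assoc)
  moreover have "matrix F ** matrix E = mat 1" "matrix E ** matrix F = mat 1"
    unfolding matrix_eq by (simp_all add: FM EM FE EF flip: matrix_vector_mul_assoc)
  ultimately show ?thesis unfolding rep_iso_def by blast
qed

end

text \<open>Pulled back along the isomorphism, the vectors with zero right component form a proper
  nonzero stable subspace.\<close>

lemma sum_rep_reducible:
  fixes \<rho> :: "'g \<Rightarrow> complex ^ 'm ^ 'm" and \<sigma> :: "'g \<Rightarrow> complex ^ 'n ^ 'n" and \<tau> :: "'g \<Rightarrow> complex ^ 'k ^ 'k"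
  assumes "\<tau> \<in> hom G GL" and iso: "rep_iso G \<tau> (sum_rep \<rho> \<sigma>)"
  shows "reducible_rep G \<tau>"
proof -
  obtain P :: "complex ^ 'k ^ ('m + 'n)" and Q where PQ: "P ** Q = mat 1" "Q ** P = mat 1"
    "\<And>g. g \<in> carrier G \<Longrightarrow> P ** \<tau> g = sum_rep \<rho> \<sigma> g ** P"
    using iso unfolding rep_iso_def by blast
  define U where "U = {v. \<forall>j. (P *v v) $ Inr j = 0}"
  have "vec.subspace U"
    by (intro vec.subspaceI) (simp_all add: U_def matrix_vector_right_distrib vector_scalar_commute)
  moreover have "\<tau> g *v v \<in> U" if "g \<in> carrier G" "v \<in> U" for g v
  proof -
    have "P *v (\<tau> g *v v) = sum_rep \<rho> \<sigma> g *v (P *v v)"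
      using PQ(3)[OF that(1)] by (simp add: matrix_vector_mul_assoc)
    moreover have "(sum_rep \<rho> \<sigma> g *v (P *v v)) $ Inr j = 0" for j
      using that(2)
      by (simp add: U_def matrix_vector_mult_def sum_rep_def UNIV_Plus_UNIV[symmetric] sum.Plus del: UNIV_Plus_UNIV)
    ultimately show ?thesis by (simp add: U_def)
  qed
  moreover have inv: "P *v (Q *v w) = w" for w by (simp add: matrix_vector_mul_assoc PQ)
  have "U \<noteq> {0}"
  proof
    assume U: "U = {0}"
    have "Q *v axis (Inl undefined) 1 \<in> U" by (simp add: U_def inv axis_def)
    then have "Q *v axis (Inl undefined) 1 = 0" using U by blast
    then have "axis (Inl undefined) 1 = (0 :: complex ^ ('m + 'n))" using inv by (metis matrix_vector_mult_0_right)
    then show False by (simp add: axis_eq_0_iff)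
  qed
  moreover have "U \<noteq> UNIV"
  proof
    assume "U = UNIV"
    then have "(P *v (Q *v axis (Inr undefined) 1)) $ Inr undefined = 0" unfolding U_def by blast
    then show False unfolding inv by simp
  qed
  ultimately show ?thesis
    unfolding reducible_rep_def irreducible_rep_def using assms(1) by blast
qed

context S3_group
begin

text \<open>A vector with unequal entries minus its swap is a multiple of \<open>(1, -1)\<close>,
  from which \<open>cyc3\<close> produces a basis. A nonzero vector with equal entries is first
  moved by \<open>cyc3\<close> to one with unequal entries.\<close>

lemma std_rep_irreducible: "irreducible_rep G (\<lambda>g. std_rep (\<pi> g))"
proof -
  interpret group G by (rule group)
  have "(\<lambda>g. std_rep (\<pi> g)) \<in> hom G GL"
    by (rule hom_GLI[OF group]) (simp_all add: \<pi>_one std_rep_id \<pi>_mult std_rep_compose \<pi>_perm)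
  moreover have "U = UNIV" if U: "vec.subspace U" "U \<noteq> {0}"
    "\<And>g v. g \<in> carrier G \<Longrightarrow> v \<in> U \<Longrightarrow> std_rep (\<pi> g) *v v \<in> U" for U :: "(complex ^ 2) set"
  proof -
    have inv: "std_rep p *v v \<in> U" if "bij p" "v \<in> U" for p v
      using U(3) \<pi>_surj[OF that(1)] that(2) by blast
    have swap: "std_rep swap12 *v v = vector [v $ 2, v $ 1]"
      and cyc: "std_rep cyc3 *v v = vector [- v $ 1 - v $ 2, v $ 1]" for v :: "complex ^ 2"
      by (simp_all add: vec_eq_iff forall_2 std_rep_def matrix_vector_mult_def sum_2 algebra_simps)
    have main: "U = UNIV" if v: "v \<in> U" "v $ 1 \<noteq> v $ 2" for v :: "complex ^ 2"
    proof -
      have "v - std_rep swap12 *v v \<in> U"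
        using v(1) inv[OF bij_swap12 v(1)] U(1) by (intro vec.subspace_diff)
      then have "inverse (v $ 1 - v $ 2) *s (v - std_rep swap12 *v v) \<in> U" using U(1) by (intro vec.subspace_scale)
      moreover have "inverse (v $ 1 - v $ 2) *s (v - std_rep swap12 *v v) = vector [1, -1]"
      proof -
        have 1: "inverse (v $ 1 - v $ 2) * (v $ 1 - v $ 2) = 1" using v(2) by simp
        then have "inverse (v $ 1 - v $ 2) * (v $ 2 - v $ 1) = - 1"
          by (metis minus_diff_eq mult_minus_right)
        with 1 show ?thesis by (simp only: swap vec_eq_iff forall_2 vector_smult_component vector_minus_component vector_2)
      qed
      ultimately have f: "vector [1, -1] \<in> U" by simp
      then have "std_rep cyc3 *v vector [1, -1] \<in> U" by (rule inv[OF bij_cyc3])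
      then have h: "vector [0, 1] \<in> U" by (simp add: cyc)
      have "w \<in> U" for w :: "complex ^ 2"
      proof -
        have "w = w $ 1 *s vector [1, -1] + (w $ 1 + w $ 2) *s vector [0, 1]"
          by (simp add: vec_eq_iff forall_2)
        also have "\<dots> \<in> U" using U(1) f h by (intro vec.subspace_add vec.subspace_scale)
        finally show ?thesis .
      qed
      then show ?thesis by blast
    qed
    obtain v :: "complex ^ 2" where v: "v \<in> U" "v \<noteq> 0" using U(1,2) vec.subspace_0 by blast
    show ?thesis
    proof (cases "v $ 1 = v $ 2")
      case True
      then have v1: "v $ 1 \<noteq> 0" using v(2) by (auto simp: vec_eq_iff forall_2)
      have "- v $ 1 - v $ 2 \<noteq> v $ 1"
      proof
        assume e: "- v $ 1 - v $ 2 = v $ 1"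
        have "3 * v $ 1 = v $ 1 + v $ 1 + (- v $ 1 - v $ 2)" unfolding e by simp
        also have "\<dots> = 0" using True by simp
        finally show False using v1 by simp
      qed
      then show ?thesis using main[OF inv[OF bij_cyc3 v(1)]] by (simp add: cyc)
    qed (use main v in blast)
  qed
  ultimately show ?thesis unfolding irreducible_rep_def by blast
qed

lemma two_dim_irreducible_unique:
  fixes \<rho> \<rho>' :: "'g \<Rightarrow> complex ^ 2 ^ 2"
  assumes "irreducible_rep G \<rho>" "irreducible_rep G \<rho>'"
  shows "rep_iso G \<rho> \<rho>'"
proof -
  interpret group G by (rule group)
  \<comment> \<open>A primitive cube root of unity; the same one has to serve both normal
    forms.\<close>
  define w where "w = Complex (- 1 / 2) (sqrt 3 / 2)"
  have w: "w ^ 3 = 1" "w \<noteq> 1"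
    by (simp_all add: w_def complex_eq_iff power3_eq_cube algebra_simps)
  obtain M :: "complex ^ 2 ^ 2" where M: "invertible M" "\<rho> gen_c ** M = M ** vector [vector [w, 0], vector [0, inverse w]]"
    "\<rho> gen_s ** M = M ** vector [vector [0, 1], vector [1, 0]]"
    using irreducible_normal_form[OF assms(1) w] by blast
  obtain N :: "complex ^ 2 ^ 2" where N: "invertible N" "\<rho>' gen_c ** N = N ** vector [vector [w, 0], vector [0, inverse w]]"
    "\<rho>' gen_s ** N = N ** vector [vector [0, 1], vector [1, 0]]"
    using irreducible_normal_form[OF assms(2) w] by blast
  note I = matrix_inv_mult[OF M(1)] matrix_inv_mult[OF N(1)]
  have hom: "\<rho> \<in> hom G GL" "\<rho>' \<in> hom G GL" using assms by (auto simp: irreducible_rep_def)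
  define P where "P = N ** matrix_inv M"
  define Q where "Q = M ** matrix_inv N"
  have PQ: "P ** Q = mat 1" "Q ** P = mat 1"
  proof -
    have "P ** Q = N ** (matrix_inv M ** M) ** matrix_inv N" by (simp only: P_def Q_def matrix_mul_assoc)
    then show "P ** Q = mat 1" by (simp add: I)
    then show "Q ** P = mat 1" using matrix_left_right_inverse by blast
  qed
  have conj: "P ** A = B ** P" if "A ** M = M ** D" "B ** N = N ** D" for A B D :: "complex ^ 2 ^ 2"
  proof -
    have "P ** A = N ** matrix_inv M ** (A ** M) ** matrix_inv M"
      by (simp add: P_def I flip: matrix_mul_assoc)
    also have "\<dots> = N ** (matrix_inv M ** M) ** D ** matrix_inv M" unfolding that(1) by (simp only: matrix_mul_assoc)
    also have "\<dots> = B ** P" by (simp add: I P_def that(2) matrix_mul_assoc)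
    finally show ?thesis .
  qed
  have c: "P ** \<rho> gen_c = \<rho>' gen_c ** P" using M(2) N(2) by (rule conj)
  have s: "P ** \<rho> gen_s = \<rho>' gen_s ** P" using M(3) N(3) by (rule conj)
  have mult: "P ** \<rho> (g \<otimes> h) = \<rho>' (g \<otimes> h) ** P"
    if "g \<in> carrier G" "h \<in> carrier G" "P ** \<rho> g = \<rho>' g ** P" "P ** \<rho> h = \<rho>' h ** P" for g h
  proof -
    have "P ** \<rho> (g \<otimes> h) = \<rho>' g ** (P ** \<rho> h)"
      using that(3) hom_GL(2)[OF group hom(1) that(1,2)] by (simp add: matrix_mul_assoc)
    then show ?thesis using that(4) hom_GL(2)[OF group hom(2) that(1,2)] by (simp add: matrix_mul_assoc)
  qed
  have "P ** \<rho> g = \<rho>' g ** P" if g: "g \<in> carrier G" for g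
  proof -
    have one: "P ** \<rho> \<one> = \<rho>' \<one> ** P" using hom_GL(3)[OF group hom(1) g] hom_GL(3)[OF group hom(2) g] by simp
    have cs: "P ** \<rho> (gen_c \<otimes> gen_s) = \<rho>' (gen_c \<otimes> gen_s) ** P" using mult gen c s by blast
    show ?thesis
      using generated[OF g] one c s cs mult[OF gen(1) gen(1) c c] mult[OF gen(1) m_closed[OF gen(1,3)] c cs] by auto
  qed
  then show ?thesis unfolding rep_iso_def using PQ by blast
qed

end

lemma extension_of_degree_unique:
  assumes "extension_of_degree m F E" "extension_of_degree n F E"
  shows "m = n"
proof -
  interpret Q: Ring.field QBar by (rule QBar_field)
  show ?thesis using assms Q.dimension_is_inj unfolding extension_of_degree_def by blast
qed

lemma extension_of_degree_1:
  assumes "subfield F QBar"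
  shows "extension_of_degree 1 F F"
proof -
  interpret Q: Ring.field QBar by (rule QBar_field)
  show ?thesis using assms Q.dimension_one unfolding extension_of_degree_def by blast
qed

section \<open>Galois groups of normal extensions\<close>

lemma galois_groupD:
  assumes s: "\<sigma> \<in> carrier (galois_group E F)" and F: "subfield F QBar" and E: "subfield E QBar" "F \<subseteq> E"
  shows "\<sigma> \<in> extensional E" "bij_betw \<sigma> E E" "x \<in> E \<Longrightarrow> \<sigma> x \<in> E"
    "x \<in> E \<Longrightarrow> y \<in> E \<Longrightarrow> \<sigma> (x + y) = \<sigma> x + \<sigma> y" "x \<in> E \<Longrightarrow> y \<in> E \<Longrightarrow> \<sigma> (x * y) = \<sigma> x * \<sigma> y"
    "x \<in> F \<Longrightarrow> \<sigma> x = x" "\<sigma> 0 = 0" "\<sigma> 1 = 1" "x \<in> E \<Longrightarrow> \<sigma> (- x) = - \<sigma> x"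
    "x \<in> E \<Longrightarrow> \<sigma> (inverse x) = inverse (\<sigma> x)" "x \<in> E \<Longrightarrow> poly_over F p \<Longrightarrow> \<sigma> (poly p x) = poly p (\<sigma> x)"
proof -
  note ED = subfieldD[OF E(1)]
  show ext: "\<sigma> \<in> extensional E" and b: "bij_betw \<sigma> E E" and F': "x \<in> F \<Longrightarrow> \<sigma> x = x"
    and add: "x \<in> E \<Longrightarrow> y \<in> E \<Longrightarrow> \<sigma> (x + y) = \<sigma> x + \<sigma> y" and mult: "x \<in> E \<Longrightarrow> y \<in> E \<Longrightarrow> \<sigma> (x * y) = \<sigma> x * \<sigma> y"
    for x y
    using s by (auto simp: galois_group_def)
  show "x \<in> E \<Longrightarrow> \<sigma> x \<in> E" using b by (rule bij_betwE[rule_format])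
  show 0: "\<sigma> 0 = 0" and 1: "\<sigma> 1 = 1" using F' subfieldD(1,2)[OF F] by auto
  show "\<sigma> (- x) = - \<sigma> x" if "x \<in> E"
    using add[OF that ED(5)[OF that]] 0 by (simp add: eq_neg_iff_add_eq_0 add.commute)
  show "\<sigma> (inverse x) = inverse (\<sigma> x)" if "x \<in> E"
  proof (cases "x = 0")
    case False
    then have "\<sigma> x * \<sigma> (inverse x) = 1" using mult[OF that ED(6)[OF that]] 1 by simp
    then show ?thesis by (metis inverse_unique)
  qed (simp add: 0)
  show "\<sigma> (poly p x) = poly p (\<sigma> x)" if x: "x \<in> E" and p: "poly_over F p"
  proof -
    have "hom_on E \<sigma>" using 0 1 add mult by (simp add: hom_on_def)
    moreover have "poly_over E p" using p E(2) by blast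
    ultimately have "\<sigma> (poly p x) = poly (map_poly \<sigma> p) (\<sigma> x)"
      using hom_on_poly[OF subfield_subring_of(1)[OF E(1)]] x by blast
    moreover have "map_poly \<sigma> p = p"
      by (rule poly_eqI) (use p F' 0 in \<open>simp add: coeff_map_poly\<close>)
    ultimately show ?thesis by simp
  qed
qed

lemma galois_group_is_group:
  assumes F: "subfield F QBar" and E: "subfield E QBar" "F \<subseteq> E"
  shows "group (galois_group E F)"
proof (rule groupI)
  note ED = subfieldD[OF E(1)]
  have ops: "\<sigma> \<otimes>\<^bsub>galois_group E F\<^esub> \<tau> = compose E \<sigma> \<tau>" "\<one>\<^bsub>galois_group E F\<^esub> = (\<lambda>x\<in>E. x)" for \<sigma> \<tau>
    by (simp_all add: galois_group_def)
  show "\<one>\<^bsub>galois_group E F\<^esub> \<in> carrier (galois_group E F)"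
    unfolding ops using E ED by (auto simp: galois_group_def bij_betw_def inj_on_def)
  fix \<sigma> assume s: "\<sigma> \<in> carrier (galois_group E F)"
  note S = galois_groupD[OF s F E]
  show "\<one>\<^bsub>galois_group E F\<^esub> \<otimes>\<^bsub>galois_group E F\<^esub> \<sigma> = \<sigma>"
    unfolding ops using S(1,3) by (auto simp: compose_def extensional_def fun_eq_iff)
  show "\<exists>\<tau>\<in>carrier (galois_group E F). \<tau> \<otimes>\<^bsub>galois_group E F\<^esub> \<sigma> = \<one>\<^bsub>galois_group E F\<^esub>"
  proof (rule bexI)
    let ?\<tau> = "\<lambda>x\<in>E. inv_into E \<sigma> x"
    have inv: "inv_into E \<sigma> x \<in> E" "\<sigma> (inv_into E \<sigma> x) = x" if "x \<in> E" for x
      using that S(2) by (auto simp: bij_betw_def inv_into_into f_inv_into_f)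
    have inj: "\<sigma> x = \<sigma> y \<Longrightarrow> x = y" if "x \<in> E" "y \<in> E" for x y
      using that S(2) by (auto simp: bij_betw_def inj_on_def)
    have inv_left: "inv_into E \<sigma> (\<sigma> x) = x" if "x \<in> E" for x
      using inj[OF inv(1)[OF S(3)[OF that]] that] inv(2)[OF S(3)[OF that]] by blast
    show "?\<tau> \<otimes>\<^bsub>galois_group E F\<^esub> \<sigma> = \<one>\<^bsub>galois_group E F\<^esub>"
      unfolding ops using S(3) inv_left by (auto simp: compose_def fun_eq_iff)
    have "bij_betw ?\<tau> E E" using bij_betw_inv_into[OF S(2)] by (simp cong: bij_betw_cong)
    moreover have "inv_into E \<sigma> (x + y) = inv_into E \<sigma> x + inv_into E \<sigma> y"
      "inv_into E \<sigma> (x * y) = inv_into E \<sigma> x * inv_into E \<sigma> y" if "x \<in> E" "y \<in> E" for x y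
    proof -
      have "\<sigma> (inv_into E \<sigma> x + inv_into E \<sigma> y) = x + y" "\<sigma> (inv_into E \<sigma> x * inv_into E \<sigma> y) = x * y"
        using S(4,5)[OF inv(1)[OF that(1)] inv(1)[OF that(2)]] inv(2) that by simp_all
      then show "inv_into E \<sigma> (x + y) = inv_into E \<sigma> x + inv_into E \<sigma> y"
        "inv_into E \<sigma> (x * y) = inv_into E \<sigma> x * inv_into E \<sigma> y"
        using inv_left inv(1)[OF that(1)] inv(1)[OF that(2)] ED(3,4) by metis+
    qed
    moreover have "inv_into E \<sigma> x = x" if "x \<in> F" for x
      using inv_left[of x] S(6)[OF that] that E(2) by auto
    ultimately show "?\<tau> \<in> carrier (galois_group E F)"
      using E(2) ED(3,4) by (auto simp: galois_group_def)
  qed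
  fix \<tau> assume t: "\<tau> \<in> carrier (galois_group E F)"
  note T = galois_groupD[OF t F E]
  show "\<sigma> \<otimes>\<^bsub>galois_group E F\<^esub> \<tau> \<in> carrier (galois_group E F)"
  proof -
    have "compose E \<sigma> \<tau> x = \<sigma> (\<tau> x)" if "x \<in> E" for x using that by (simp add: compose_def)
    moreover have "bij_betw (compose E \<sigma> \<tau>) E E" using bij_betw_compose[OF T(2) S(2)] .
    ultimately show ?thesis
      using S(4,5,6) T(3,4,5,6) ED(3,4) E(2) unfolding ops
      by (auto simp: galois_group_def compose_def subset_iff)
  qed
  fix \<upsilon> assume u: "\<upsilon> \<in> carrier (galois_group E F)"
  show "\<sigma> \<otimes>\<^bsub>galois_group E F\<^esub> \<tau> \<otimes>\<^bsub>galois_group E F\<^esub> \<upsilon> = \<sigma> \<otimes>\<^bsub>galois_group E F\<^esub> (\<tau> \<otimes>\<^bsub>galois_group E F\<^esub> \<upsilon>)"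
    unfolding ops using galois_groupD(3)[OF u F E] by (auto simp: compose_def fun_eq_iff)
qed

lemma galois_restrict:
  assumes "\<sigma> \<in> carrier (galois_group UNIV F)" "subfield E QBar" "F \<subseteq> E" "\<sigma> ` E = E"
  shows "restrict \<sigma> E \<in> carrier (galois_group E F)"
proof -
  note G = galoisD[OF assms(1)]
  have "bij_betw (restrict \<sigma> E) E E"
    using assms(4) G(11) by (auto simp: bij_betw_def inj_on_def)
  then show ?thesis
    using G(2,3,4) subfieldD(3,4)[OF assms(2)] assms(3) by (auto simp: galois_group_def)
qed

section \<open>Transitive groups of permutations of three letters\<close>

text \<open>A permutation sending 1 to 2 is \<open>cyc3\<close> or a transposition, and likewise for
  one sending 2 to 3; in the remaining case the product of the two transpositions is
  \<open>cyc3\<close>.\<close>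

lemma transitive_perms_cyc3:
  fixes P :: "(3 \<Rightarrow> 3) set"
  assumes bij: "\<And>p. p \<in> P \<Longrightarrow> bij p" and comp: "\<And>p q. p \<in> P \<Longrightarrow> q \<in> P \<Longrightarrow> p \<circ> q \<in> P"
    and trans: "\<And>i j. \<exists>p\<in>P. p i = j"
  shows "cyc3 \<in> P"
proof -
  obtain p where p: "p \<in> P" "p 1 = 2" using trans by blast
  obtain q where q: "q \<in> P" "q 2 = 3" using trans by blast
  have "p = cyc3 \<or> p = swap12"
    using perm3_words[OF bij[OF p(1)]] p(2) by (auto simp: swap12_def)
  moreover have "q = cyc3 \<or> q = cyc3 \<circ> (cyc3 \<circ> swap12)"
    using perm3_words[OF bij[OF q(1)]] q(2) by (auto simp: swap12_def)
  moreover have "swap12 \<circ> (cyc3 \<circ> (cyc3 \<circ> swap12)) = cyc3"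
    by (rule all3_eqI) (simp_all add: swap12_def)
  ultimately show ?thesis using p q comp by metis
qed

text \<open>Powers of \<open>cyc3\<close> turn any odd element into \<open>swap12\<close>, and these
  two generate everything.\<close>

lemma transitive_perms_all:
  fixes P :: "(3 \<Rightarrow> 3) set"
  assumes bij: "\<And>p. p \<in> P \<Longrightarrow> bij p" and comp: "\<And>p q. p \<in> P \<Longrightarrow> q \<in> P \<Longrightarrow> p \<circ> q \<in> P"
    and trans: "\<And>i j. \<exists>p\<in>P. p i = j" and q: "q \<in> P" "q \<notin> {id, cyc3, cyc3 \<circ> cyc3}" and p: "bij p"
  shows "p \<in> P"
proof -
  have c: "cyc3 \<in> P" using transitive_perms_cyc3[OF bij comp trans] by blast
  have cc: "cyc3 \<circ> (cyc3 \<circ> cyc3) = id" by (rule all3_eqI) simp_all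
  have id: "id \<in> P" using comp[OF c comp[OF c c]] by (simp only: cc)
  have "cyc3 \<circ> (cyc3 \<circ> (cyc3 \<circ> swap12)) = swap12"
    "cyc3 \<circ> (cyc3 \<circ> (cyc3 \<circ> (cyc3 \<circ> swap12))) = cyc3 \<circ> swap12"
    by (rule all3_eqI; simp add: swap12_def)+
  then have "swap12 \<in> P"
    using perm3_words[OF bij[OF q(1)]] q comp[OF c] by (metis insertE insert_iff singletonD)
  then show ?thesis
    using perm3_words[OF p] c id comp by (elim insertE) auto
qed

text \<open>\<open>sym_group 3\<close> permutes the natural numbers 1 to 3 and fixes the others, so
  permutations of the type \<open>3\<close> are transported along a bijection and extended by the
  identity.\<close>

lemma (in S3_group) iso_sym_group: "G \<cong> sym_group 3"
proof -
  have "card (UNIV :: 3 set) = card {1..3::nat}" by simp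
  then obtain e :: "3 \<Rightarrow> nat" where e: "bij_betw e UNIV {1..3}"
    using finite_same_card_bij by (metis finite finite_atLeastAtMost)
  define \<psi> where "\<psi> p x = (if x \<in> {1..3} then e (p (inv_into UNIV e x)) else x)" for p x
  have "bij_betw \<psi> {p. p permutes UNIV} {p. p permutes {1..3}}"
    using bij_betw_permutations[OF e] unfolding \<psi>_def .
  moreover have "{p :: 3 \<Rightarrow> 3. p permutes UNIV} = {p. bij p}"
    using permutes_bij by (auto intro: bij_imp_permutes)
  ultimately have "bij_betw (\<psi> \<circ> \<pi>) (carrier G) (carrier (sym_group 3))"
    using \<pi>_bij by (auto simp: sym_group_def intro: bij_betw_trans)
  moreover have "\<psi> (p \<circ> q) = \<psi> p \<circ> \<psi> q" for p q
  proof
    fix x show "\<psi> (p \<circ> q) x = (\<psi> p \<circ> \<psi> q) x"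
    proof (cases "x \<in> {1..3}")
      case True
      have "e i \<in> {1..3}" "inv_into UNIV e (e i) = i" for i
        using e by (auto simp: bij_betw_def)
      then show ?thesis using True by (auto simp: \<psi>_def)
    qed (auto simp: \<psi>_def)
  qed
  ultimately have "\<psi> \<circ> \<pi> \<in> iso G (sym_group 3)"
    by (auto simp: iso_def hom_def \<pi>_mult sym_group_mult bij_betw_def)
  then show ?thesis by (auto simp: is_iso_def)
qed

section \<open>The conjugates of a generator of a cubic extension\<close>

text \<open>The conjugates are given through automorphisms \<open>h i\<close> that produce them,
  because in the application these arise as inverses of coset representatives in the Weil
  group.\<close>

locale cubic_setting = weil_setting +
  fixes L :: "qbar set" and \<alpha> :: qbar and h :: "3 \<Rightarrow> qbar \<Rightarrow> qbar"
  assumes L: "extension_of_degree 3 F L" and \<alpha>: "\<alpha> \<in> L" "\<alpha> \<notin> F"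
    and h: "\<And>i. h i \<in> carrier (galois_group UNIV F)"
    and conj_inj: "\<And>i j. h i \<alpha> = h j \<alpha> \<Longrightarrow> i = j"
begin

definition conjugate :: "3 \<Rightarrow> qbar" where "conjugate i = h i \<alpha>"

text \<open>Defined for arbitrary functions, so that it applies alike to automorphisms of the
  algebraic closure and to their restrictions to the normal closure.\<close>

definition perm :: "(qbar \<Rightarrow> qbar) \<Rightarrow> 3 \<Rightarrow> 3" where "perm \<sigma> i = (THE j. conjugate j = \<sigma> (conjugate i))"

lemma conj_eq: "conjugate i = conjugate j \<longleftrightarrow> i = j"
  using conj_inj by (auto simp: conjugate_def)

lemma L_field: "subfield L QBar" "F \<subseteq> L"
  using L by (auto simp: extension_of_degree_def)

lemma L_eq: "L = {poly p \<alpha> |p. poly_over F p}"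
  using cubic_generated(1)[OF F L \<alpha>] .

text \<open>An annihilating polynomial of degree at most 3 has no room for roots beside the three
  distinct conjugates, and \<alpha> itself is a root.\<close>

lemma conj_roots: "\<exists>p. poly_over F p \<and> (\<forall>x. poly p x = 0 \<longleftrightarrow> x \<in> range conjugate)"
  and \<alpha>_conj: "\<alpha> \<in> range conjugate"
proof -
  obtain p where p: "p \<noteq> 0" "poly_over F p" "poly p \<alpha> = 0" "Polynomial.degree p \<le> 3"
    using cubic_generated(2)[OF F L \<alpha>] by blast
  have "poly p (conjugate i) = 0" for i
    using galois_poly[OF h[of i] p(2), of \<alpha>] p(3) galoisD(5)[OF h[of i]] by (simp add: conjugate_def)
  then have sub: "range conjugate \<subseteq> {x. poly p x = 0}" by auto
  have "card (range conjugate) = card (UNIV :: 3 set)"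
    by (rule card_image) (simp add: inj_on_def conj_eq)
  then have "card {x. poly p x = 0} \<le> card (range conjugate)"
    using card_poly_roots_bound[OF p(1)] p(4) by simp
  then have eq: "range conjugate = {x. poly p x = 0}"
    using card_seteq[OF poly_roots_finite[OF p(1)] sub] by blast
  show "\<alpha> \<in> range conjugate" unfolding eq using p(3) by simp
  show "\<exists>p. poly_over F p \<and> (\<forall>x. poly p x = 0 \<longleftrightarrow> x \<in> range conjugate)"
    unfolding eq using p(2) by (intro exI[of _ p]) simp
qed

lemma perm_eqI: "conjugate j = \<sigma> (conjugate i) \<Longrightarrow> perm \<sigma> i = j"
  unfolding perm_def by (rule the_equality) (auto simp: conj_eq dest: sym)

lemma conj_perm: "\<sigma> (conjugate i) \<in> range conjugate \<Longrightarrow> conjugate (perm \<sigma> i) = \<sigma> (conjugate i)"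
  using perm_eqI by (metis imageE)

lemma perm_cong: "(\<And>i. \<sigma> (conjugate i) = \<tau> (conjugate i)) \<Longrightarrow> perm \<sigma> = perm \<tau>"
  by (simp add: perm_def fun_eq_iff)

lemma bij_perm:
  assumes "\<And>i. \<sigma> (conjugate i) \<in> range conjugate" "inj_on \<sigma> (range conjugate)"
  shows "bij (perm \<sigma>)"
proof -
  have "inj (perm \<sigma>)"
  proof (rule injI)
    fix i j assume "perm \<sigma> i = perm \<sigma> j"
    then have "\<sigma> (conjugate i) = \<sigma> (conjugate j)" using conj_perm[where \<sigma> = \<sigma>, OF assms(1)] by metis
    then have "conjugate i = conjugate j" using assms(2) by (auto simp: inj_on_def)
    then show "i = j" by (simp add: conj_eq)
  qed
  then show ?thesis by (intro bijI finite_UNIV_inj_surj finite)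
qed

lemma galois_conj:
  assumes s: "\<sigma> \<in> carrier (galois_group UNIV F)"
  shows "\<sigma> (conjugate i) \<in> range conjugate" "conjugate (perm \<sigma> i) = \<sigma> (conjugate i)" "bij (perm \<sigma>)"
proof -
  obtain p where "poly_over F p \<and> (\<forall>x. poly p x = 0 \<longleftrightarrow> x \<in> range conjugate)"
    using conj_roots by (rule exE)
  then have p: "poly_over F p" "\<And>x. poly p x = 0 \<longleftrightarrow> x \<in> range conjugate" by simp_all
  have *: "\<sigma> (conjugate i) \<in> range conjugate" for i
  proof -
    have "poly p (conjugate i) = 0" using p(2) by blast
    then have "poly p (\<sigma> (conjugate i)) = 0" using galois_poly[OF s p(1), of "conjugate i"] galoisD(5)[OF s] by simp
    then show ?thesis using p(2) by blast
  qed
  then show "\<sigma> (conjugate i) \<in> range conjugate" "conjugate (perm \<sigma> i) = \<sigma> (conjugate i)"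
    by (blast, intro conj_perm) blast
  show "bij (perm \<sigma>)" by (rule bij_perm[where \<sigma> = \<sigma>, OF *]) (auto simp: inj_on_def galoisD[OF s])
qed

lemma perm_compose:
  assumes "\<tau> (conjugate i) \<in> range conjugate" "\<sigma> (conjugate (perm \<tau> i)) \<in> range conjugate"
  shows "perm (\<sigma> \<circ> \<tau>) i = perm \<sigma> (perm \<tau> i)"
  using conj_perm[where \<sigma> = \<tau>, OF assms(1)] conj_perm[where \<sigma> = \<sigma>, OF assms(2)]
  by (intro perm_eqI) simp

lemma galois_perm_compose:
  assumes "\<sigma> \<in> carrier (galois_group UNIV F)" "\<tau> \<in> carrier (galois_group UNIV F)"
  shows "perm (\<sigma> \<circ> \<tau>) = perm \<sigma> \<circ> perm \<tau>"
  by (rule ext, unfold comp_apply[of "perm \<sigma>"], rule perm_compose[where \<sigma> = \<sigma> and \<tau> = \<tau>])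
    (rule galois_conj(1)[OF assms(2)], rule galois_conj(1)[OF assms(1)])

lemma galois_L_eq:
  assumes "\<sigma> \<in> carrier (galois_group UNIV F)" "\<tau> \<in> carrier (galois_group UNIV F)"
    and "\<sigma> \<alpha> = \<tau> \<alpha>" "x \<in> L"
  shows "\<sigma> x = \<tau> x"
  using assms(3,4) galois_poly[OF assms(1)] galois_poly[OF assms(2)] unfolding L_eq by auto

lemma weil_L: "carrier (weil_group L) = {\<sigma> \<in> carrier (weil_group F). \<sigma> \<alpha> = \<alpha>}"
proof -
  have "\<sigma> x = x" if "\<sigma> \<in> carrier (weil_group F)" "\<sigma> \<alpha> = \<alpha>" "x \<in> L" for \<sigma> x
    using galois_L_eq[OF weil_galois[OF that(1)] galois_id _ that(3)] that(2) by simp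
  then show ?thesis
    unfolding weil_group_extension[OF F L_field] using \<alpha>(1) by blast
qed

lemma galois_perms:
  defines "P \<equiv> perm ` carrier (galois_group UNIV F)"
  shows "p \<in> P \<Longrightarrow> bij p" "p \<in> P \<Longrightarrow> q \<in> P \<Longrightarrow> p \<circ> q \<in> P" "\<exists>p\<in>P. p i = j"
proof -
  show "p \<in> P \<Longrightarrow> bij p" unfolding P_def using galois_conj(3) by blast
  show "p \<circ> q \<in> P" if pq: "p \<in> P" "q \<in> P"
  proof -
    obtain \<sigma> where "p = perm \<sigma>" "\<sigma> \<in> carrier (galois_group UNIV F)"
      using pq(1) unfolding P_def by (rule imageE)
    moreover obtain \<tau> where "q = perm \<tau>" "\<tau> \<in> carrier (galois_group UNIV F)"
      using pq(2) unfolding P_def by (rule imageE)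
    ultimately show ?thesis
      unfolding P_def by (intro image_eqI[of _ _ "\<sigma> \<circ> \<tau>"] galois_compose) (simp_all add: galois_perm_compose)
  qed
  show "\<exists>p\<in>P. p i = j"
  proof -
    have "h j \<circ> the_inv (h i) \<in> carrier (galois_group UNIV F)"
      using galois_compose[OF h galois_inverse(1)[OF h]] .
    moreover have "perm (h j \<circ> the_inv (h i)) i = j"
      by (rule perm_eqI) (simp add: conjugate_def galois_inverse(3)[OF h])
    ultimately show ?thesis unfolding P_def by blast
  qed
qed

lemma galois_L_image:
  assumes L_conj: "\<And>i. conjugate i \<in> L" and s: "\<sigma> \<in> carrier (galois_group UNIV F)"
  shows "\<sigma> ` L = L"
proof -
  have sub: "\<tau> x \<in> L" if t: "\<tau> \<in> carrier (galois_group UNIV F)" and x: "x \<in> L" for \<tau> x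
  proof -
    obtain p where p: "poly_over F p" "x = poly p \<alpha>" using x L_eq by blast
    have "\<tau> \<alpha> \<in> L" using \<alpha>_conj galois_conj(1)[OF t] L_conj by (metis imageE)
    moreover have "poly_over L p" using p(1) L_field(2) by blast
    ultimately show ?thesis
      using poly_over_eval[OF subfield_subring_of(1)[OF L_field(1)]] galois_poly[OF t p(1)] p(2) by simp
  qed
  show ?thesis
  proof (intro equalityI subsetI)
    fix x assume "x \<in> L"
    then show "x \<in> \<sigma> ` L"
      using sub[OF galois_inverse(1)[OF s]] by (intro image_eqI[of _ _ "the_inv \<sigma> x"]) (auto simp: galois_inverse(2)[OF s])
  qed (use sub[OF s] in auto)
qed

text \<open>If only even permutations of the conjugates occur, then the conjugates are fixed by the
  stabilizer of \<open>\<alpha>\<close> and \<open>L\<close> is a cyclic extension.\<close>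

lemma all_perms_occur:
  assumes nc: "\<not> cyclic_extension F L" and p: "bij p"
  obtains \<sigma> where "\<sigma> \<in> carrier (galois_group UNIV F)" "perm \<sigma> = p"
proof -
  let ?Gal = "carrier (galois_group UNIV F)"
  have "cyclic_extension F L" if even: "\<And>\<sigma>. \<sigma> \<in> ?Gal \<Longrightarrow> perm \<sigma> \<in> {id, cyc3, cyc3 \<circ> cyc3}"
  proof -
    obtain k where k: "\<alpha> = conjugate k" using \<alpha>_conj by blast
    \<comment> \<open>An even permutation with a fixed point is the identity.\<close>
    have fixed: "\<sigma> (conjugate i) = conjugate i" if s: "\<sigma> \<in> ?Gal" "\<sigma> \<alpha> = \<alpha>" for \<sigma> i
    proof -
      have "conjugate (perm \<sigma> k) = conjugate k"
        using galois_conj(2)[OF s(1), of k] s(2) by (simp flip: k)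
      then have "perm \<sigma> k = k" by (simp only: conj_eq)
      moreover have "cyc3 k \<noteq> k" "cyc3 (cyc3 k) \<noteq> k" using exhaust_3[of k] by auto
      ultimately have "perm \<sigma> = id" using even[OF s(1)] by auto
      then show ?thesis using galois_conj(2)[OF s(1), of i] by simp
    qed
    have L_conj: "conjugate i \<in> L" for i
    proof (rule galois_fixed_field[OF L_field(1)])
      show "Q2 \<subseteq> L" using F(2) L_field(2) by blast
      fix \<sigma> assume "\<sigma> \<in> carrier (galois_group UNIV L)"
      then have "\<sigma> \<in> ?Gal" "\<sigma> \<alpha> = \<alpha>" using \<alpha>(1) L_field(2) by (auto simp: galois_group_UNIV)
      then show "\<sigma> (conjugate i) = conjugate i" by (rule fixed)
    qed
    then have normal: "normal_extension F L"
      using F(1) L_field galois_L_image by (auto simp: normal_extension_def)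
    interpret G: group "galois_group L F" using galois_group_is_group[OF F(1) L_field] .
    have "cyc3 \<in> perm ` ?Gal" by (rule transitive_perms_cyc3[OF galois_perms])
    then obtain c where c: "c \<in> ?Gal" "perm c = cyc3" by (metis imageE)
    define g where "g = restrict c L"
    have g: "g \<in> carrier (galois_group L F)"
      unfolding g_def using galois_restrict[OF c(1) L_field galois_L_image[OF L_conj c(1)]] .
    have gi: "g (conjugate i) = conjugate (cyc3 i)" for i
      using galois_conj(2)[OF c(1), of i] L_conj by (simp add: g_def c(2))
    have mult: "(\<sigma> \<otimes>\<^bsub>galois_group L F\<^esub> \<tau>) (conjugate i) = \<sigma> (\<tau> (conjugate i))" for \<sigma> \<tau> i
      using L_conj by (simp add: galois_group_def compose_def)
    have "\<tau> \<in> range (\<lambda>n::int. g [^]\<^bsub>galois_group L F\<^esub> n)" if t: "\<tau> \<in> carrier (galois_group L F)" for \<tau>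
    proof -
      note T = galois_groupD[OF t F(1) L_field]
      obtain p where "poly_over F p \<and> (\<forall>x. poly p x = 0 \<longleftrightarrow> x \<in> range conjugate)"
        using conj_roots by (rule exE)
      then have p: "poly_over F p" "\<And>x. poly p x = 0 \<longleftrightarrow> x \<in> range conjugate" by simp_all
      have "\<tau> \<alpha> \<in> range conjugate"
        using T(11)[OF \<alpha>(1) p(1)] T(7) p(2)[of \<alpha>] p(2)[of "\<tau> \<alpha>"] \<alpha>_conj by simp
      then obtain j where j: "\<tau> (conjugate k) = conjugate j" using k by auto
      have eq: "\<tau> = \<upsilon>" if u: "\<upsilon> \<in> carrier (galois_group L F)" "\<upsilon> (conjugate k) = conjugate j" for \<upsilon>
      proof (rule extensionalityI[of _ L])
        note U = galois_groupD[OF u(1) F(1) L_field]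
        show "\<tau> \<in> extensional L" "\<upsilon> \<in> extensional L" by (rule T(1), rule U(1))
        fix x assume "x \<in> L"
        then obtain p where "poly_over F p" "x = poly p \<alpha>" using L_eq by blast
        then show "\<tau> x = \<upsilon> x" using T(11)[OF \<alpha>(1)] U(11)[OF \<alpha>(1)] j u(2) k by simp
      qed
      \<comment> \<open>\<open>\<tau>\<close> is determined by the image of \<alpha>, and the powers
        of \<open>g\<close> realize all three possible images.\<close>
      have "j = k \<or> j = cyc3 k \<or> j = cyc3 (cyc3 k)" using exhaust_3[of k] exhaust_3[of j] by auto
      then show ?thesis
      proof (elim disjE)
        assume "j = k"
        moreover have "\<one>\<^bsub>galois_group L F\<^esub> (conjugate k) = conjugate k" using L_conj by (simp add: galois_group_def)
        ultimately have "\<tau> = g [^]\<^bsub>galois_group L F\<^esub> (0::int)" using eq[OF G.one_closed] by simp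
        then show ?thesis by blast
      next
        assume "j = cyc3 k"
        then have "\<tau> = g [^]\<^bsub>galois_group L F\<^esub> (1::int)" using eq[OF g] gi g by simp
        then show ?thesis by blast
      next
        assume "j = cyc3 (cyc3 k)"
        then have "\<tau> = g \<otimes>\<^bsub>galois_group L F\<^esub> g" using eq[OF G.m_closed[OF g g]] gi mult by simp
        also have "\<dots> = g [^]\<^bsub>galois_group L F\<^esub> (2::int)"
          using g G.int_pow_mult[OF g, of 1 1] by simp
        finally show ?thesis by blast
      qed
    qed
    then have "carrier (galois_group L F) = range (\<lambda>n::int. g [^]\<^bsub>galois_group L F\<^esub> n)"
      using G.int_pow_closed[OF g] by blast
    then show ?thesis unfolding cyclic_extension_def G.cyclic_group using normal g by blast
  qed
  then obtain \<sigma> where s: "\<sigma> \<in> ?Gal" "perm \<sigma> \<notin> {id, cyc3, cyc3 \<circ> cyc3}" using nc by blast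
  have "p \<in> perm ` ?Gal"
    by (rule transitive_perms_all[OF galois_perms imageI[OF s(1)] s(2) p])
  then show ?thesis by (rule imageE) (rule that, assumption, rule sym)
qed

section \<open>The normal closure and its Galois group\<close>

abbreviation K :: "qbar set" where "K \<equiv> normal_closure F L"

lemma normal_closure_normal: "normal_extension F K" "L \<subseteq> K"
proof -
  have "subfield (UNIV :: qbar set) QBar" unfolding subfield_QBar_iff by simp
  then have U: "normal_extension F UNIV"
    using F(1) galoisD(1) by (auto simp: normal_extension_def bij_is_surj)
  show "L \<subseteq> K" unfolding normal_closure_def by blast
  have "subfield K QBar"
    unfolding subfield_QBar_iff normal_closure_def
    by (auto simp: normal_extension_def subfieldD)
  moreover have "F \<subseteq> K" using L_field(2) \<open>L \<subseteq> K\<close> by blast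
  moreover have "\<sigma> ` K = K" if s: "\<sigma> \<in> carrier (galois_group UNIV F)" for \<sigma>
  proof -
    have sub: "\<tau> x \<in> K" if t: "\<tau> \<in> carrier (galois_group UNIV F)" and x: "x \<in> K" for \<tau> x
      unfolding normal_closure_def
    proof (rule InterI)
      fix M assume "M \<in> {M. normal_extension F M \<and> L \<subseteq> M}"
      moreover from this have "x \<in> M" using x unfolding normal_closure_def by blast
      ultimately show "\<tau> x \<in> M" using t unfolding normal_extension_def by blast
    qed
    show ?thesis
    proof (intro equalityI subsetI)
      fix x assume "x \<in> K"
      then show "x \<in> \<sigma> ` K"
        using sub[OF galois_inverse(1)[OF s]] by (intro image_eqI[of _ _ "the_inv \<sigma> x"]) (auto simp: galois_inverse(2)[OF s])
    qed (use sub[OF s] in auto)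
  qed
  ultimately show "normal_extension F K" using F(1) by (simp add: normal_extension_def)
qed

lemma K_field: "subfield K QBar" "F \<subseteq> K"
  using normal_closure_normal(1) by (auto simp: normal_extension_def)

lemma conj_K: "conjugate i \<in> K"
  using normal_closure_normal \<alpha>(1) h[of i] unfolding conjugate_def normal_extension_def by blast

text \<open>The field \<open>N\<close> generated over \<open>F\<close> by the conjugates is stable
  under automorphisms, because its preimage is a field containing the same generators. So
  \<open>N\<close> is normal and contains \<open>L\<close>, hence the normal closure.\<close>

lemma normal_closure_minimal:
  assumes M: "subfield M QBar" "F \<subseteq> M" "range conjugate \<subseteq> M"
  shows "K \<subseteq> M"
proof -
  define N where "N = \<Inter>{N. subfield N QBar \<and> F \<subseteq> N \<and> range conjugate \<subseteq> N}"
  have N: "subfield N QBar" unfolding subfield_QBar_iff N_def by (auto simp: subfieldD)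
  have FN: "F \<subseteq> N" "range conjugate \<subseteq> N" unfolding N_def by blast+
  have sub: "\<tau> x \<in> N" if t: "\<tau> \<in> carrier (galois_group UNIV F)" and x: "x \<in> N" for \<tau> x
  proof -
    have "subfield {x. \<tau> x \<in> N} QBar" using galois_preimage_subfield[OF t N] .
    moreover have "F \<subseteq> {x. \<tau> x \<in> N}" using FN(1) galoisD(4)[OF t] by auto
    moreover have "range conjugate \<subseteq> {x. \<tau> x \<in> N}" using FN(2) galois_conj(1)[OF t] by auto
    ultimately show ?thesis using x unfolding N_def by blast
  qed
  have "\<sigma> ` N = N" if s: "\<sigma> \<in> carrier (galois_group UNIV F)" for \<sigma>
  proof (intro equalityI subsetI)
    fix x assume "x \<in> N"
    then show "x \<in> \<sigma> ` N"
      using sub[OF galois_inverse(1)[OF s]] by (intro image_eqI[of _ _ "the_inv \<sigma> x"]) (auto simp: galois_inverse(2)[OF s])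
  qed (use sub[OF s] in auto)
  then have "normal_extension F N" using F(1) N FN(1) by (simp add: normal_extension_def)
  moreover have "L \<subseteq> N"
  proof
    fix x assume "x \<in> L"
    then obtain p where p: "poly_over F p" "x = poly p \<alpha>" using L_eq by blast
    then have "poly_over N p" using FN(1) by blast
    then show "x \<in> N"
      using poly_over_eval[OF subfield_subring_of(1)[OF N]] \<alpha>_conj FN(2) p(2) by blast
  qed
  ultimately have "K \<subseteq> N" unfolding normal_closure_def by blast
  also have "N \<subseteq> M" using M unfolding N_def by blast
  finally show ?thesis .
qed

lemma galois_K_conj:
  assumes t: "\<tau> \<in> carrier (galois_group K F)"
  shows "\<tau> (conjugate i) \<in> range conjugate" "bij (perm \<tau>)"
proof -
  note T = galois_groupD[OF t F(1) K_field]
  obtain p where "poly_over F p \<and> (\<forall>x. poly p x = 0 \<longleftrightarrow> x \<in> range conjugate)"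
    using conj_roots by (rule exE)
  then have p: "poly_over F p" "\<And>x. poly p x = 0 \<longleftrightarrow> x \<in> range conjugate" by simp_all
  have *: "\<tau> (conjugate i) \<in> range conjugate" for i
    using T(11)[OF conj_K[of i] p(1)] T(7) p(2)[of "conjugate i"] p(2)[of "\<tau> (conjugate i)"] by simp
  then show "\<tau> (conjugate i) \<in> range conjugate" .
  show "bij (perm \<tau>)"
    by (rule bij_perm[where \<sigma> = \<tau>, OF *]) (use T(2) conj_K in \<open>auto simp: bij_betw_def inj_on_def\<close>)
qed

lemma perm_restrict: "perm (restrict \<sigma> K) = perm \<sigma>"
  by (rule perm_cong) (simp add: conj_K)

text \<open>Injectivity holds because the conjugates generate the normal closure, surjectivity
  because every permutation comes from an automorphism of the algebraic closure, which
  restricts.\<close>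

theorem normal_closure_S3:
  assumes nc: "\<not> cyclic_extension F L"
  shows "S3_group (galois_group K F) perm"
proof (rule S3_group.intro)
  let ?G = "galois_group K F"
  show "group ?G" using galois_group_is_group[OF F(1) K_field] .
  show "perm (\<sigma> \<otimes>\<^bsub>?G\<^esub> \<tau>) = perm \<sigma> \<circ> perm \<tau>" if s: "\<sigma> \<in> carrier ?G" and t: "\<tau> \<in> carrier ?G" for \<sigma> \<tau>
  proof -
    have "perm (\<sigma> \<otimes>\<^bsub>?G\<^esub> \<tau>) = perm (\<sigma> \<circ> \<tau>)"
      by (rule perm_cong) (simp add: galois_group_def compose_def conj_K)
    moreover have "perm (\<sigma> \<circ> \<tau>) i = perm \<sigma> (perm \<tau> i)" for i
      by (rule perm_compose[where \<sigma> = \<sigma> and \<tau> = \<tau>]) (rule galois_K_conj(1)[OF t], rule galois_K_conj(1)[OF s])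
    ultimately show ?thesis by (simp add: fun_eq_iff)
  qed
  have "inj_on perm (carrier ?G)"
  proof (rule inj_onI)
    fix \<sigma> \<tau> assume s: "\<sigma> \<in> carrier ?G" and t: "\<tau> \<in> carrier ?G" and eq: "perm \<sigma> = perm \<tau>"
    note S = galois_groupD[OF s F(1) K_field]
    note T = galois_groupD[OF t F(1) K_field]
    have sub: "subfield {x \<in> K. \<sigma> x = \<tau> x} QBar"
      unfolding subfield_QBar_iff using subfieldD[OF K_field(1)] by (auto simp: S T)
    have "\<sigma> (conjugate i) = \<tau> (conjugate i)" for i
      using conj_perm[where \<sigma> = \<sigma>, OF galois_K_conj(1)[OF s]] conj_perm[where \<sigma> = \<tau>, OF galois_K_conj(1)[OF t]] eq
      by simp
    then have "K \<subseteq> {x \<in> K. \<sigma> x = \<tau> x}"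
      using K_field(2) S(6) T(6) conj_K by (intro normal_closure_minimal[OF sub]) auto
    then show "\<sigma> = \<tau>" by (intro extensionalityI[OF S(1) T(1)]) auto
  qed
  moreover have "perm ` carrier ?G = {p. bij p}"
  proof (intro equalityI subsetI)
    fix p :: "3 \<Rightarrow> 3" assume "p \<in> {p. bij p}"
    then obtain \<sigma> where s: "\<sigma> \<in> carrier (galois_group UNIV F)" "perm \<sigma> = p"
      using all_perms_occur[OF nc] by blast
    have "restrict \<sigma> K \<in> carrier ?G"
      using galois_restrict[OF s(1) K_field] normal_closure_normal(1) s(1) by (auto simp: normal_extension_def)
    then show "p \<in> perm ` carrier ?G" using s(2) perm_restrict by (intro image_eqI) simp_all
  qed (use galois_K_conj(2) in auto)
  ultimately show "bij_betw perm (carrier ?G) {p. bij p}" by (simp add: bij_betw_def)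
qed

text \<open>The Vandermonde product of the conjugates, a square root of the discriminant; odd
  permutations change its sign.\<close>

definition disc_root :: qbar where
  "disc_root = (conjugate 1 - conjugate 2) * (conjugate 1 - conjugate 3) * (conjugate 2 - conjugate 3)"

lemma disc_root_neq_0: "disc_root \<noteq> 0"
  by (simp add: disc_root_def conj_eq three_neq)

lemma galois_disc_root:
  assumes s: "\<sigma> \<in> carrier (galois_group UNIV F)"
  shows "\<sigma> disc_root = (if perm \<sigma> \<in> {id, cyc3, cyc3 \<circ> cyc3} then disc_root else - disc_root)"
proof -
  let ?p = "perm \<sigma>"
  have "\<sigma> disc_root = (conjugate (?p 1) - conjugate (?p 2)) * (conjugate (?p 1) - conjugate (?p 3)) * (conjugate (?p 2) - conjugate (?p 3))"
    by (simp add: disc_root_def galoisD[OF s] galois_conj(2)[OF s])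
  then show ?thesis
    using perm3_words[OF galois_conj(3)[OF s]]
    by (elim insertE) (simp_all add: disc_root_def fun3_eq_iff swap12_def three_neq algebra_simps)
qed

lemma disc_root_square: "disc_root * disc_root \<in> F"
proof (rule galois_fixed_field[OF F])
  fix \<sigma> assume "\<sigma> \<in> carrier (galois_group UNIV F)"
  then show "\<sigma> (disc_root * disc_root) = disc_root * disc_root"
    using galois_disc_root[of \<sigma>] by (simp add: galoisD split: if_splits)
qed

lemma disc_root_notin:
  assumes "\<sigma> \<in> carrier (galois_group UNIV F)" "perm \<sigma> \<notin> {id, cyc3, cyc3 \<circ> cyc3}"
  shows "disc_root \<notin> F"
proof
  assume "disc_root \<in> F"
  then have "- disc_root = disc_root"
    using galoisD(4)[OF assms(1)] galois_disc_root[OF assms(1)] assms(2) by simp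
  then show False using disc_root_neq_0 by simp
qed

end

section \<open>The topology of the Weil group\<close>

text \<open>A basis of \<open>M\<close> over \<open>F\<close> consists of algebraic elements and can
  be adjoined to \<open>E\<close>. The resulting field defines the smaller neighbourhoods needed to
  restrict the Weil topology to \<open>E\<close>.\<close>

lemma finite_compositum:
  assumes E: "finite_extension F E" and M: "finite_extension F M"
  obtains N where "finite_extension E N" "M \<subseteq> N"
proof -
  interpret Q: Ring.field QBar by (rule QBar_field)
  obtain m where m: "subfield F QBar" "subfield M QBar" "F \<subseteq> M" "Q.dimension m F M"
    using M by (auto simp: finite_extension_def extension_of_degree_def)
  have e: "subfield E QBar" "F \<subseteq> E"
    using E by (auto simp: finite_extension_def extension_of_degree_def)
  obtain Us where Us: "set Us \<subseteq> carrier QBar" "Q.independent F Us" "length Us = m" "Q.Span F Us = M"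
    using Q.exists_base[OF m(1,4)] by blast
  have "set Us \<subseteq> M" using Q.Span_base_incl[OF m(1) Us(1)] Us(4) by blast
  then have alg: "(Q.algebraic over E) x" if "x \<in> set Us" for x
    using Q.algebraic_mono[OF e(2)] Q.finite_dimension_imp_algebraic[OF m(1) subfieldE(1)[OF m(2)] Q.finite_dimensionI[OF m(4)]] that
    by blast
  define N where "N = Q.finite_extension E Us"
  have N: "subfield N QBar" "Q.finite_dimension E N"
    unfolding N_def using Q.finite_extension_is_subfield[OF e(1) Us(1) alg]
      Q.finite_extension_finite_dimension(1)[OF e(1) Us(1) alg] by blast+
  have EN: "E \<subseteq> N" "set Us \<subseteq> N"
    unfolding N_def using Q.finite_extension_incl[OF subfieldE(3)[OF e(1)] Us(1)]
      Q.finite_extension_mem[OF subfieldE(1)[OF e(1)] Us(1)] by blast+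
  have "M \<subseteq> N"
    using subfield_subalgebra[OF m(1) N(1)] EN e(2) Us(4) unfolding Q.Span_subalgebra_minimal[OF m(1) Us(1)]
    by blast
  moreover have "finite_extension E N"
    using N e(1) EN(1) unfolding finite_extension_def extension_of_degree_def by blast
  ultimately show ?thesis using that by blast
qed

context weil_setting
begin

lemma weil_basis_subset:
  assumes "\<sigma> \<in> carrier (weil_group F)" "\<tau> \<in> inertia F"
  shows "\<sigma> \<circ> \<tau> \<in> carrier (weil_group F)"
  using weil_compose[OF assms(1) inertia_weil[OF assms(2)]] .

lemma id_inertia: "id \<in> inertia F"
  by (simp add: inertia_iff galois_id)

lemma openin_weil_coset:
  assumes "\<sigma> \<in> carrier (weil_group F)" "finite_extension F M"
  shows "openin (weil_topology F) {\<sigma> \<circ> \<tau> |\<tau>. \<tau> \<in> inertia F \<and> (\<forall>x\<in>M. \<tau> x = x)}"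
  unfolding weil_topology_def
  by (rule topology_generated_by_Basis) (use assms in \<open>auto simp: weil_ops\<close>)

lemma topspace_weil: "topspace (weil_topology F) = carrier (weil_group F)"
proof (intro equalityI subsetI)
  fix \<sigma> assume "\<sigma> \<in> topspace (weil_topology F)"
  then show "\<sigma> \<in> carrier (weil_group F)"
    unfolding weil_topology_def topology_generated_by_topspace using weil_basis_subset by (auto simp: weil_ops)
next
  fix \<sigma> assume s: "\<sigma> \<in> carrier (weil_group F)"
  have fin: "finite_extension F F"
    using extension_of_degree_1[OF F(1)] unfolding finite_extension_def by blast
  have "\<sigma> \<in> {\<sigma> \<circ> \<tau> |\<tau>. \<tau> \<in> inertia F \<and> (\<forall>x\<in>F. \<tau> x = x)}"
    using id_inertia by (intro CollectI exI[of _ id]) simp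
  then show "\<sigma> \<in> topspace (weil_topology F)"
    using openin_subset[OF openin_weil_coset[OF s fin]] by blast
qed

text \<open>The inertia group of \<open>E\<close> is the part of that of \<open>F\<close> fixing
  \<open>E\<close>. So around each point the preimage of a basic open set given by \<open>M\<close>
  contains one given by a field \<open>N\<close> that is finite over \<open>E\<close> and contains
  \<open>M\<close>.\<close>

lemma weil_topology_inclusion:
  assumes E: "finite_extension F E"
  shows "continuous_map (weil_topology E) (weil_topology F) (\<lambda>\<sigma>. \<sigma>)"
proof -
  have e: "subfield E QBar" "F \<subseteq> E"
    using E by (auto simp: finite_extension_def extension_of_degree_def)
  interpret E: weil_setting E by (rule weil_setting.intro) (use F e in auto)
  have gal: "\<tau> \<in> inertia E \<longleftrightarrow> \<tau> \<in> inertia F \<and> (\<forall>x\<in>E. \<tau> x = x)" for \<tau>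
    unfolding inertia_iff E.inertia_iff galois_group_UNIV using e(2) by blast
  have W: "carrier (weil_group E) = {\<sigma> \<in> carrier (weil_group F). \<forall>x\<in>E. \<sigma> x = x}"
    using weil_group_extension[OF F e] .
  show ?thesis
    unfolding weil_topology_def[of F]
  proof (rule continuous_on_generated_topo)
    fix U assume "U \<in> {U. \<exists>\<sigma> M. \<sigma> \<in> carrier (weil_group F) \<and> finite_extension F M \<and>
        U = {\<sigma> \<otimes>\<^bsub>weil_group F\<^esub> \<tau> | \<tau>. \<tau> \<in> inertia F \<and> (\<forall>x\<in>M. \<tau> x = x)}}"
    then obtain \<sigma> M where s: "\<sigma> \<in> carrier (weil_group F)" and M: "finite_extension F M"
      and U: "U = {\<sigma> \<circ> \<tau> | \<tau>. \<tau> \<in> inertia F \<and> (\<forall>x\<in>M. \<tau> x = x)}"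
      by (auto simp: weil_ops)
    obtain N where N: "finite_extension E N" "M \<subseteq> N" using finite_compositum[OF E M] .
    show "openin (weil_topology E) ((\<lambda>\<sigma>. \<sigma>) -` U \<inter> topspace (weil_topology E))"
      unfolding openin_subopen[of _ "_ \<inter> _"]
    proof
      fix \<rho> assume "\<rho> \<in> (\<lambda>\<sigma>. \<sigma>) -` U \<inter> topspace (weil_topology E)"
      then have r: "\<rho> \<in> carrier (weil_group E)" "\<rho> \<in> U" by (auto simp: E.topspace_weil)
      obtain \<tau> where t: "\<rho> = \<sigma> \<circ> \<tau>" "\<tau> \<in> inertia F" "\<forall>x\<in>M. \<tau> x = x" using r(2) U by blast
      let ?V = "{\<rho> \<circ> \<tau> |\<tau>. \<tau> \<in> inertia E \<and> (\<forall>x\<in>N. \<tau> x = x)}"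
      have "openin (weil_topology E) ?V" using E.openin_weil_coset[OF r(1) N(1)] .
      moreover have "\<rho> \<in> ?V" using E.id_inertia by (intro CollectI exI[of _ id]) simp
      moreover have "?V \<subseteq> (\<lambda>\<sigma>. \<sigma>) -` U \<inter> topspace (weil_topology E)"
      proof
        fix \<upsilon> assume "\<upsilon> \<in> ?V"
        then obtain \<tau>' where t': "\<upsilon> = \<rho> \<circ> \<tau>'" "\<tau>' \<in> inertia E" "\<forall>x\<in>N. \<tau>' x = x" by blast
        have "\<upsilon> \<in> carrier (weil_group E)" using E.weil_basis_subset[OF r(1) t'(2)] t'(1) by simp
        moreover have "\<upsilon> \<in> U"
        proof -
          have i: "\<tau>' \<in> inertia F" using t'(2) gal by blast
          have G: "\<tau> \<in> carrier (galois_group UNIV F)" "\<tau>' \<in> carrier (galois_group UNIV F)"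
            using i t(2) by (auto simp: inertia_iff)
          have "\<tau> \<circ> \<tau>' \<in> inertia F"
            using galois_compose[OF G] i t(2) integers_galois[OF G(2) F(2)] by (simp add: inertia_iff)
          moreover have "\<forall>x\<in>M. (\<tau> \<circ> \<tau>') x = x" using t(3) t'(3) N(2) by auto
          ultimately show ?thesis unfolding U using t(1) t'(1)
            by (intro CollectI exI[of _ "\<tau> \<circ> \<tau>'"]) (simp add: comp_assoc)
        qed
        ultimately show "\<upsilon> \<in> (\<lambda>\<sigma>. \<sigma>) -` U \<inter> topspace (weil_topology E)"
          by (simp add: E.topspace_weil)
      qed
      ultimately show "\<exists>V. openin (weil_topology E) V \<and> \<rho> \<in> V \<and> V \<subseteq> (\<lambda>\<sigma>. \<sigma>) -` U \<inter> topspace (weil_topology E)"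
        by blast
    qed
  next
    have "(\<lambda>\<sigma>. \<sigma>) ` topspace (weil_topology E) \<subseteq> topspace (weil_topology F)"
      by (auto simp: topspace_weil E.topspace_weil W)
    then show "(\<lambda>\<sigma>. \<sigma>) ` topspace (weil_topology E) \<subseteq> \<Union> {U. \<exists>\<sigma> M. \<sigma> \<in> carrier (weil_group F) \<and> finite_extension F M \<and>
        U = {\<sigma> \<otimes>\<^bsub>weil_group F\<^esub> \<tau> | \<tau>. \<tau> \<in> inertia F \<and> (\<forall>x\<in>M. \<tau> x = x)}}"
      unfolding weil_topology_def topology_generated_by_topspace .
  qed
qed

lemma quasicharacter_iff:
  "quasicharacter F \<eta> \<longleftrightarrow> (\<forall>\<sigma>\<in>carrier (weil_group F). \<eta> \<sigma> \<noteq> 0) \<and>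
     (\<forall>\<sigma>\<in>carrier (weil_group F). \<forall>\<tau>\<in>carrier (weil_group F). \<eta> (\<sigma> \<circ> \<tau>) = \<eta> \<sigma> * \<eta> \<tau>) \<and>
     continuous_map (weil_topology F) euclidean \<eta>"
proof -
  have "carrier (units_of (ring_of_type_algebra :: complex ring)) = {x. x \<noteq> 0}"
    by (auto simp: units_of_def Units_def ring_of_type_algebra_def)
      (metis left_inverse right_inverse)
  moreover have "mult (units_of (ring_of_type_algebra :: complex ring)) = (*)"
    by (simp add: units_of_def ring_of_type_algebra_def)
  ultimately show ?thesis unfolding quasicharacter_def hom_def weil_ops by auto
qed

end

section \<open>Continuity of matrix expressions\<close>

text \<open>The set \<open>S\<close> accommodates expressions that are continuous only where a
  matrix is invertible.\<close>

lemma continuous_map_compose_continuous_on: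
  assumes "continuous_map T euclidean f" "\<And>x. x \<in> topspace T \<Longrightarrow> f x \<in> S" "continuous_on S \<Phi>"
  shows "continuous_map T euclidean (\<lambda>x. \<Phi> (f x))"
proof -
  have "continuous_map T (top_of_set S) f"
    using assms(1,2) by (intro continuous_map_into_subtopology) auto
  then show ?thesis
    using continuous_map_compose[of T "top_of_set S" f euclidean \<Phi>] assms(3) by (simp add: o_def)
qed

lemma continuous_on_matrixI:
  fixes f :: "'a::topological_space \<Rightarrow> complex ^ 'n ^ 'm"
  assumes "\<And>i j. continuous_on S (\<lambda>x. f x $ i $ j)"
  shows "continuous_on S f"
proof -
  have "continuous_on S (\<lambda>x. \<chi> i j. f x $ i $ j)" by (intro continuous_on_vec_lambda assms)
  then show ?thesis by simp
qed

lemma continuous_on_matrix_mult: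
  fixes f :: "'a::topological_space \<Rightarrow> complex ^ 'n ^ 'm" and g :: "'a \<Rightarrow> complex ^ 'k ^ 'n"
  assumes "continuous_on S f" "continuous_on S g"
  shows "continuous_on S (\<lambda>x. f x ** g x)"
  by (rule continuous_on_matrixI) (simp add: matrix_matrix_mult_def, intro continuous_intros assms)

text \<open>The inverse is replaced by the adjugate divided by the determinant, both polynomial in
  the entries.\<close>

lemma continuous_on_Ad0:
  fixes f :: "'a::topological_space \<Rightarrow> complex ^ 2 ^ 2"
  assumes f: "continuous_on S f" and inv: "\<And>x. x \<in> S \<Longrightarrow> invertible (f x)"
  shows "continuous_on S (Ad0 f)"
proof (rule continuous_on_matrixI)
  fix i j :: 3
  have adj: "continuous_on S (\<lambda>x. adj2 (f x))"
  proof (rule continuous_on_matrixI)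
    fix k l :: 2
    show "continuous_on S (\<lambda>x. adj2 (f x) $ k $ l)"
      using exhaust_2[of k] exhaust_2[of l]
      by (elim disjE; simp only: adj2_def vector_2) (intro continuous_intros f)+
  qed
  have d: "continuous_on S (\<lambda>x. det (f x))" unfolding det_2 by (intro continuous_intros f)
  have d0: "det (f x) \<noteq> 0" if "x \<in> S" for x using inv[OF that] by (simp add: invertible_det_nz)
  have c: "continuous_on S (\<lambda>x. (f x ** M ** adj2 (f x)) $ k $ l / det (f x))" for M :: "complex ^ 2 ^ 2" and k l
    by (intro continuous_intros continuous_on_matrix_mult f adj d) (use d0 in auto)
  have eq: "(f x ** M ** adj2 (f x)) $ k $ l / det (f x) = (f x ** M ** matrix_inv (f x)) $ k $ l"
    if "x \<in> S" for M :: "complex ^ 2 ^ 2" and k l x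
  proof -
    have "f x ** M ** adj2 (f x) = f x ** M ** mat (det (f x)) ** matrix_inv (f x)"
      unfolding adj2_eq_matrix_inv[OF inv[OF that]] by (simp only: matrix_mul_assoc)
    also have "\<dots> = mat (det (f x)) ** (f x ** M ** matrix_inv (f x))"
      unfolding mat_mult_commute by (simp only: matrix_mul_assoc)
    finally have "f x ** M ** adj2 (f x) = mat (det (f x)) ** (f x ** M ** matrix_inv (f x))" .
    then show ?thesis using d0[OF that] by simp
  qed
  have "continuous_on S (\<lambda>x. (f x ** M ** matrix_inv (f x)) $ k $ l)" for M :: "complex ^ 2 ^ 2" and k l
    by (rule continuous_on_cong[THEN iffD1, OF refl _ c[of M k l]]) (rule eq)
  then show "continuous_on S (\<lambda>x. Ad0 f x $ i $ j)"
    using exhaust_3[of i] by (auto simp: Ad0_def matrix_def sl2_coords_def)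
qed

section \<open>The twisting character\<close>

text \<open>Conjugating \<open>S g\<close> by \<open>P\<close> and removing \<open>Ad0 R g\<close>
  leaves the scalar matrix of \<kappa>; its size three explains the factor in the trace formula.
  Multiplicativity is inherited from \<open>S\<close> and \<open>Ad0 R\<close>.\<close>

lemma twist_character:
  fixes G (structure) and R :: "'g \<Rightarrow> complex ^ 2 ^ 2" and S :: "'g \<Rightarrow> complex ^ 3 ^ 3"
  assumes G: "group G" and R: "R \<in> hom G GL" and S: "S \<in> hom G GL" and P: "invertible P"
    and PS: "\<And>g. g \<in> carrier G \<Longrightarrow> P ** S g = mat (\<kappa> g) ** Ad0 R g ** P"
    and g: "g \<in> carrier G"
  shows "h \<in> carrier G \<Longrightarrow> \<kappa> (g \<otimes> h) = \<kappa> g * \<kappa> h"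
    "3 * \<kappa> g = trace (P ** S g ** matrix_inv P ** Ad0 R (inv g))"
proof -
  interpret group G by (rule G)
  note Pi = matrix_inv_mult[OF P]
  have conj: "P ** S g ** matrix_inv P = mat (\<kappa> g) ** Ad0 R g" if "g \<in> carrier G" for g
    using PS[OF that] Pi(1) by (simp add: matrix_mul_assoc[symmetric])
  have scalar: "a = b" if "mat a = (mat b :: complex ^ 3 ^ 3)" for a b
    using arg_cong[OF that, of "\<lambda>A :: complex ^ 3 ^ 3. A $ 1 $ 1"] by (simp add: mat_def)
  show "\<kappa> (g \<otimes> h) = \<kappa> g * \<kappa> h" if h: "h \<in> carrier G"
  proof (rule scalar)
    have "mat (\<kappa> (g \<otimes> h)) ** Ad0 R (g \<otimes> h) = P ** S (g \<otimes> h) ** matrix_inv P"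
      using conj[of "g \<otimes> h"] g h by simp
    also have "\<dots> = P ** S g ** matrix_inv P ** (P ** S h ** matrix_inv P)"
    proof -
      have "P ** S g ** (matrix_inv P ** P) ** S h ** matrix_inv P = P ** S g ** S h ** matrix_inv P"
        by (simp add: Pi)
      then show ?thesis using hom_GL(2)[OF G S g h] by (simp add: matrix_mul_assoc)
    qed
    also have "\<dots> = mat (\<kappa> g) ** (Ad0 R g ** mat (\<kappa> h)) ** Ad0 R h"
      by (simp add: conj g h matrix_mul_assoc)
    also have "\<dots> = mat (\<kappa> g * \<kappa> h) ** Ad0 R (g \<otimes> h)"
      unfolding mat_mult_commute by (simp add: Ad0_group(1)[OF G R g h] matrix_mul_assoc mat_mult_mat)
    finally have "mat (\<kappa> (g \<otimes> h)) ** (Ad0 R (g \<otimes> h) ** Ad0 R (inv (g \<otimes> h))) = mat (\<kappa> g * \<kappa> h) ** (Ad0 R (g \<otimes> h) ** Ad0 R (inv (g \<otimes> h)))"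
      by (simp add: matrix_mul_assoc)
    then show "mat (\<kappa> (g \<otimes> h)) = (mat (\<kappa> g * \<kappa> h) :: complex ^ 3 ^ 3)"
      using Ad0_group(2)[OF G R, of "g \<otimes> h"] g h by simp
  qed
  have "P ** S g ** matrix_inv P ** Ad0 R (inv g) = mat (\<kappa> g) ** (Ad0 R g ** Ad0 R (inv g))"
    by (simp add: conj[OF g] matrix_mul_assoc)
  then have "P ** S g ** matrix_inv P ** Ad0 R (inv g) = mat (\<kappa> g)"
    using Ad0_group(2)[OF G R g] by simp
  then show "3 * \<kappa> g = trace (P ** S g ** matrix_inv P ** Ad0 R (inv g))"
    by (simp add: trace_def mat_def)
qed

text \<open>The trace formula contains \<open>Ad0 R (inv g)\<close>. Self-duality expresses this
  through the transpose of \<open>Ad0 R g\<close>, so \<kappa> becomes a continuous function of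
  \<open>R g\<close> and \<open>S g\<close>, and continuity of inversion in the group does not
  enter.\<close>

lemma twist_character_continuous:
  fixes G (structure) and R :: "'g \<Rightarrow> complex ^ 2 ^ 2" and S :: "'g \<Rightarrow> complex ^ 3 ^ 3"
  assumes G: "group G" and R: "R \<in> hom G GL" and S: "S \<in> hom G GL" and P: "invertible P"
    and PS: "\<And>g. g \<in> carrier G \<Longrightarrow> P ** S g = mat (\<kappa> g) ** Ad0 R g ** P"
    and T: "topspace T = carrier G" "continuous_map T euclidean R" "continuous_map T euclidean S"
  shows "continuous_map T euclidean \<kappa>"
proof -
  obtain J :: "complex ^ 3 ^ 3" where J: "invertible J"
    "\<And>g. g \<in> carrier G \<Longrightarrow> transpose (Ad0 R (inv g)) ** J = J ** Ad0 R g"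
    using Ad0_self_dual[OF G R] by blast
  have inv: "Ad0 R (inv g) = transpose (J ** Ad0 R g ** matrix_inv J)" if "g \<in> carrier G" for g
  proof -
    have "J ** Ad0 R g ** matrix_inv J = transpose (Ad0 R (inv g)) ** (J ** matrix_inv J)"
      using J(2)[OF that] by (simp add: matrix_mul_assoc)
    then show ?thesis using matrix_inv_mult(1)[OF J(1)] by simp
  qed
  define U :: "((complex ^ 2 ^ 2) \<times> (complex ^ 3 ^ 3)) set" where "U = {z. invertible (fst z)}"
  define \<Phi> where "\<Phi> z = trace (P ** snd z ** matrix_inv P ** transpose (J ** Ad0 fst z ** matrix_inv J)) / 3"
    for z :: "(complex ^ 2 ^ 2) \<times> (complex ^ 3 ^ 3)"
  have A: "continuous_on U (Ad0 fst)"
    by (rule continuous_on_Ad0) (auto simp: U_def intro: continuous_intros)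
  have t: "continuous_on U (\<lambda>z. transpose (f z))" if "continuous_on U f"
    for f :: "(complex ^ 2 ^ 2) \<times> (complex ^ 3 ^ 3) \<Rightarrow> complex ^ 3 ^ 3"
    by (rule continuous_on_matrixI) (simp add: transpose_def, intro continuous_intros that)
  have "continuous_on U \<Phi>"
    unfolding \<Phi>_def trace_def
    by (intro continuous_intros continuous_on_matrix_mult t A) simp
  moreover have "continuous_map T euclidean (\<lambda>g. (R g, S g))"
    using continuous_map_pairedI[OF T(2,3)] by (simp add: euclidean_product_topology)
  moreover have "(R g, S g) \<in> U" if "g \<in> topspace T" for g
    using hom_GL(1)[OF G R] that T(1) by (simp add: U_def)
  ultimately have "continuous_map T euclidean (\<lambda>g. \<Phi> (R g, S g))"
    using continuous_map_compose_continuous_on[of T "\<lambda>g. (R g, S g)" U \<Phi>] by blast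
  then show ?thesis
  proof (rule continuous_map_eq)
    fix g assume "g \<in> topspace T"
    then have g: "g \<in> carrier G" using T(1) by simp
    have "Ad0 fst (R g, S g) = Ad0 R g" by (simp add: Ad0_def)
    then show "\<Phi> (R g, S g) = \<kappa> g"
      using twist_character(2)[OF G R S P PS g] inv[OF g] by (simp add: \<Phi>_def mult.commute)
  qed
qed

section \<open>Subgroups of index two\<close>

text \<open>Clifford's argument: an element outside the subgroup maps the stable line to a second one.\<close>

lemma induced_from_index_2:
  fixes G (structure) and R :: "'g \<Rightarrow> complex ^ 2 ^ 2"
  assumes G: "group G" and irr: "irreducible_rep G R" and H: "subgroup (carrier H) G"
    and idx: "\<And>g g'. g \<in> carrier G \<Longrightarrow> g' \<in> carrier G \<Longrightarrow> g \<notin> carrier H \<Longrightarrow> g' \<notin> carrier H \<Longrightarrow> g \<otimes> g' \<in> carrier H"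
    and t: "t \<in> carrier G" "t \<notin> carrier H"
    and v: "v \<noteq> 0" "\<And>k. k \<in> carrier H \<Longrightarrow> \<exists>c. R k *v v = c *s v"
  obtains \<theta> and l :: "complex ^ 2"
  where "iso_to_induced G H \<theta> R" "\<And>k. \<theta> k = (\<Sum>i\<in>UNIV. l $ i * (R k *v v) $ i)"
    "\<And>k. k \<in> carrier H \<Longrightarrow> R k *v v = \<theta> k *s v"
proof -
  interpret group G by (rule G)
  note HD = subgroup.mem_carrier[OF H] subgroup.m_closed[OF H] subgroup.m_inv_closed[OF H]
  have R: "R \<in> hom G GL" and irrD: "\<And>U. vec.subspace U \<Longrightarrow> (\<And>g u. g \<in> carrier G \<Longrightarrow> u \<in> U \<Longrightarrow> R g *v u \<in> U) \<Longrightarrow> U = {0} \<or> U = UNIV"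
    using irr unfolding irreducible_rep_def by blast+
  note RG = hom_GL[OF G R]
  have act: "R (g \<otimes> k) *v u = R g *v (R k *v u)" if "g \<in> carrier G" "k \<in> carrier G" for g k u
    using RG(2)[OF that] by (simp add: matrix_vector_mul_assoc)
  have factor: "g \<otimes> inv t \<in> carrier H" "g \<otimes> t \<in> carrier H" if "g \<in> carrier G" "g \<notin> carrier H" for g
    using idx[OF that(1) t(1) that(2) t(2)] idx[OF that(1) inv_closed[OF t(1)] that(2)] HD(3)[of "inv t"] t by auto
  define w where "w = R t *v v"
  have "w \<noteq> c *s v" for c
  proof
    assume w: "w = c *s v"
    have line: "R g *v v \<in> {c *s v |c. True}" if g: "g \<in> carrier G" for g
    proof (cases "g \<in> carrier H")
      case False
      have "g = (g \<otimes> inv t) \<otimes> t" using g t by (simp add: m_assoc)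
      then have "R g *v v = R (g \<otimes> inv t) *v w" using act[of "g \<otimes> inv t" t v] g t by (simp add: w_def)
      moreover obtain d where "R (g \<otimes> inv t) *v v = d *s v" using v(2) factor(1)[OF g False] by blast
      ultimately have "R g *v v = (c * d) *s v" by (simp add: w vec.scale)
      then show ?thesis by blast
    qed (use v(2) in blast)
    then have inv: "R g *v u \<in> {c *s v |c. True}" if gu: "g \<in> carrier G" "u \<in> {c *s v |c. True}" for g u
    proof -
      obtain d where d: "u = d *s v" using gu(2) by blast
      obtain e where "R g *v v = e *s v" using line[OF gu(1)] by blast
      then have "R g *v u = (d * e) *s v" by (simp add: d vec.scale)
      then show ?thesis by blast
    qed
    show False using irrD[OF subspace_line inv] line_neq_UNIV line_eq_0 v(1) by blast
  qed
  then have "det (vector [v, w] :: complex ^ 2 ^ 2) \<noteq> 0" using two_dim_line_independent[OF v(1)] by blast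
  moreover define D where "D = v $ 1 * w $ 2 - v $ 2 * w $ 1"
  ultimately have D: "D \<noteq> 0" by (simp add: det_2)
  \<comment> \<open>Cramer's rule: \<open>l\<close> is the functional with value 1 on
    \<open>v\<close> and 0 on \<open>w\<close>.\<close>
  define l :: "complex ^ 2" where "l = vector [w $ 2 / D, - w $ 1 / D]"
  define f where "f u = (\<Sum>i\<in>UNIV. l $ i * u $ i)" for u :: "complex ^ 2"
  have f_lin: "f (x + y) = f x + f y" "f (c *s x) = c * f x" for x y c
    by (simp_all add: f_def sum_2 algebra_simps)
  have f_v: "f v = 1" and f_w: "f w = 0"
    using D by (simp_all add: f_def sum_2 l_def divide_simps) (simp add: D_def algebra_simps)
  have decomp: "\<exists>c. u = f u *s v + c *s w" for u
  proof -
    have "u = f u *s v + ((v $ 1 * u $ 2 - v $ 2 * u $ 1) / D) *s w"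
      using D unfolding vec_eq_iff forall_2
      by (simp add: f_def sum_2 l_def divide_simps) (simp add: D_def algebra_simps)
    then show ?thesis by blast
  qed
  define \<theta> where "\<theta> k = f (R k *v v)" for k
  have eig: "R k *v v = \<theta> k *s v" if "k \<in> carrier H" for k
    using v(2)[OF that] f_v by (auto simp: \<theta>_def f_lin)
  have eig_w: "\<exists>c. R k *v w = c *s w" if k: "k \<in> carrier H" for k
  proof -
    have kG: "k \<in> carrier G" using HD(1) k .
    have "inv t \<otimes> k \<notin> carrier H"
    proof
      assume "inv t \<otimes> k \<in> carrier H"
      then have "inv (inv t \<otimes> k \<otimes> inv k) \<in> carrier H" using HD k by blast
      then show False using t kG by (simp add: m_assoc)
    qed
    then have c: "inv t \<otimes> k \<otimes> t \<in> carrier H" using factor(2) t kG by simp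
    have "k \<otimes> t = t \<otimes> (inv t \<otimes> k \<otimes> t)" using t kG by (simp flip: m_assoc)
    then have "R k *v w = R t *v (R (inv t \<otimes> k \<otimes> t) *v v)"
      using act[OF kG t(1)] act[OF t(1) HD(1)[OF c]] by (simp add: w_def)
    then have "R k *v w = \<theta> (inv t \<otimes> k \<otimes> t) *s w" by (simp add: eig[OF c] w_def vec.scale)
    then show ?thesis by blast
  qed
  have f_R: "f (R k *v u) = \<theta> k * f u" if k: "k \<in> carrier H" for k u
  proof -
    obtain c where c: "u = f u *s v + c *s w" using decomp by blast
    obtain d where d: "R k *v w = d *s w" using eig_w[OF k] by blast
    have "f (R k *v (f u *s v + c *s w)) = \<theta> k * f u"
      by (simp add: vec.add vec.scale eig[OF k] d f_lin f_v f_w)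
    then show ?thesis using c by metis
  qed
  \<comment> \<open>Frobenius reciprocity for the functional \<open>f\<close>, which transforms
    under \<open>H\<close> by \<theta>.\<close>
  define T where "T u g = (if g \<in> carrier G then f (R g *v u) else 0)" for u g
  have T_in: "T u \<in> induced_space G H \<theta>" for u
    using HD(1) by (auto simp: induced_space_def T_def act f_R)
  have ti: "R (inv t) *v w = v"
    using RG(3) act[of "inv t" t v] t(1) by (simp add: w_def l_inv)
  have tv: "f (R (inv t) *v v) = 0"
  proof -
    have "inv t \<notin> carrier H" using HD(3)[of "inv t"] t by auto
    then have tt: "inv t \<otimes> inv t \<in> carrier H" using idx t by simp
    have "inv t = t \<otimes> (inv t \<otimes> inv t)" using t by (simp flip: m_assoc)
    then have "R (inv t) *v v = R t *v (R (inv t \<otimes> inv t) *v v)" using act[of t "inv t \<otimes> inv t" v] t by simp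
    then have "R (inv t) *v v = \<theta> (inv t \<otimes> inv t) *s w" by (simp add: eig[OF tt] w_def vec.scale)
    then show ?thesis by (simp add: f_lin f_w)
  qed
  \<comment> \<open>Evaluation at the two coset representatives, the identity and
    \<open>inv t\<close>, recovers the coordinates along \<open>v\<close> and
    \<open>w\<close>.\<close>
  have T_one: "T u \<one> = f u" for u using RG(3)[of \<one>] by (simp add: T_def)
  have T_t: "T (a *s v + b *s w) (inv t) = b" for a b
    using t by (simp add: T_def vec.add vec.scale f_lin ti tv f_v)
  have "inj T"
  proof (rule injI)
    fix x y assume eq: "T x = T y"
    obtain c d where c: "x = f x *s v + c *s w" and d: "y = f y *s v + d *s w" using decomp by metis
    have "T x (inv t) = c" using T_t[of "f x" c] by (simp flip: c)
    moreover have "T y (inv t) = d" using T_t[of "f y" d] by (simp flip: d)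
    ultimately have "c = d" using eq by simp
    moreover have "f x = f y" using T_one eq by metis
    ultimately show "x = y" using c d by simp
  qed
  moreover have "\<phi> \<in> range T" if p: "\<phi> \<in> induced_space G H \<theta>" for \<phi>
  proof -
    have p0: "\<phi> g = 0" if "g \<notin> carrier G" for g
      using p that unfolding induced_space_def by blast
    have p1: "\<phi> (k \<otimes> g) = \<theta> k * \<phi> g" if "k \<in> carrier H" "g \<in> carrier G" for k g
      using p that unfolding induced_space_def by blast
    define u where "u = \<phi> \<one> *s v + \<phi> (inv t) *s w"
    have T1: "T u (k \<otimes> g) = \<theta> k * T u g" if "k \<in> carrier H" "g \<in> carrier G" for k g
      using T_in[of u] that unfolding induced_space_def by blast
    have "T u g = \<phi> g" for g
    proof (cases "g \<in> carrier G")
      case g: True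
      show ?thesis
      proof (cases "g \<in> carrier H")
        case True
        have "T u \<one> = \<phi> \<one>" unfolding T_one by (simp add: u_def f_lin f_v f_w)
        then show ?thesis using T1[OF True one_closed] p1[OF True one_closed] g by simp
      next
        case False
        have "T u (inv t) = \<phi> (inv t)" unfolding u_def by (rule T_t)
        moreover have "g = (g \<otimes> t) \<otimes> inv t" using g t by (simp add: m_assoc)
        ultimately show ?thesis
          using T1[OF factor(2)[OF g False] inv_closed[OF t(1)]] p1[OF factor(2)[OF g False] inv_closed[OF t(1)]] by simp
      qed
    qed (simp add: T_def p0)
    then have "T u = \<phi>" by blast
    then show ?thesis by blast
  qed
  ultimately have "bij_betw T UNIV (induced_space G H \<theta>)"
    using T_in by (auto simp: bij_betw_def)
  then have "iso_to_induced G H \<theta> R"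
    unfolding iso_to_induced_def
    by (intro exI[of _ T]) (auto simp: T_def vec.add vec.scale f_lin act)
  then show ?thesis using that eig unfolding \<theta>_def f_def by blast
qed

section \<open>Reducibility of the tensor product\<close>

lemma (in weil_setting) weil_extension_subgroup:
  assumes E: "subfield E QBar" "F \<subseteq> E"
  shows "subgroup (carrier (weil_group E)) (weil_group F)"
proof -
  interpret group "weil_group F" by (rule weil_group)
  note W = weil_group_extension[OF F E]
  show ?thesis
  proof (rule subgroupI)
    show "carrier (weil_group E) \<subseteq> carrier (weil_group F)" using W by blast
    show "carrier (weil_group E) \<noteq> {}"
      using W one_closed by (auto simp: weil_ops)
    fix \<sigma> assume s: "\<sigma> \<in> carrier (weil_group E)"
    then have s': "\<sigma> \<in> carrier (weil_group F)" "\<forall>x\<in>E. \<sigma> x = x" using W by auto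
    have "\<forall>x\<in>E. the_inv \<sigma> x = x"
      using galois_inverse(3)[OF weil_galois[OF s'(1)]] s'(2) by metis
    then show "inv\<^bsub>weil_group F\<^esub> \<sigma> \<in> carrier (weil_group E)"
      using W weil_inverse[OF s'(1)] by (simp add: weil_inv[OF s'(1)])
    fix \<tau> assume "\<tau> \<in> carrier (weil_group E)"
    then show "\<sigma> \<otimes>\<^bsub>weil_group F\<^esub> \<tau> \<in> carrier (weil_group E)"
      using W s' weil_compose by (simp add: weil_ops)
  qed
qed

context cubic_setting
begin

text \<open>By Clifford's argument a stable line would make the representation induced from the
  quadratic extension generated by the square root of the discriminant.\<close>

lemma primitive_irreducible_even:
  assumes r: "weil_rep F R" "irreducible_rep (weil_group F) R" "primitive_rep F R"
    and U: "vec.subspace U" "\<And>\<sigma> v. \<sigma> \<in> carrier (weil_group F) \<Longrightarrow> perm \<sigma> \<in> {id, cyc3, cyc3 \<circ> cyc3} \<Longrightarrow> v \<in> U \<Longrightarrow> R \<sigma> *v v \<in> U"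
  shows "U = {0} \<or> U = UNIV"
proof (rule ccontr)
  assume "\<not> (U = {0} \<or> U = UNIV)"
  then have U': "U \<noteq> {0}" "U \<noteq> UNIV" by auto
  obtain v where v: "v \<noteq> 0" "U = {c *s v |c. True}" using line_or_trivial[OF U(1) U'] .
  have irrD: "V = {0} \<or> V = UNIV" if "vec.subspace V" "\<And>\<sigma> v. \<sigma> \<in> carrier (weil_group F) \<Longrightarrow> v \<in> V \<Longrightarrow> R \<sigma> *v v \<in> V" for V
    using r(2) that unfolding irreducible_rep_def by blast
  have "\<exists>t. t \<in> carrier (weil_group F) \<and> perm t \<notin> {id, cyc3, cyc3 \<circ> cyc3}"
  proof (rule ccontr)
    assume "\<nexists>t. t \<in> carrier (weil_group F) \<and> perm t \<notin> {id, cyc3, cyc3 \<circ> cyc3}"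
    then have "R \<sigma> *v u \<in> U" if "\<sigma> \<in> carrier (weil_group F)" "u \<in> U" for \<sigma> u
      using U(2) that by blast
    then show False using irrD[OF U(1)] U' by blast
  qed
  then obtain t where t: "t \<in> carrier (weil_group F)" "perm t \<notin> {id, cyc3, cyc3 \<circ> cyc3}" by (elim exE conjE)
  define E where "E = {a + b * disc_root |a b. a \<in> F \<and> b \<in> F}"
  have deg: "extension_of_degree 2 F E" and dE: "disc_root \<in> E"
    unfolding E_def using quadratic_extension[OF F(1) disc_root_square disc_root_notin[OF weil_galois[OF t(1)] t(2)]] by blast+
  have E: "subfield E QBar" "F \<subseteq> E" "finite_extension F E"
    using deg by (auto simp: extension_of_degree_def finite_extension_def)
  interpret E: weil_setting E by (rule weil_setting.intro) (use F E in auto)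
  have neg: "- disc_root \<noteq> disc_root" using disc_root_neq_0 by simp
  have W: "carrier (weil_group E) = {\<sigma> \<in> carrier (weil_group F). \<sigma> disc_root = disc_root}"
  proof -
    have "\<sigma> x = x" if s: "\<sigma> \<in> carrier (weil_group F)" "\<sigma> disc_root = disc_root" and x: "x \<in> E" for \<sigma> x
    proof -
      obtain a b where ab: "x = a + b * disc_root" "a \<in> F" "b \<in> F" using x unfolding E_def by blast
      note G = galoisD[OF weil_galois[OF s(1)]]
      show ?thesis by (simp add: ab(1) G(2,3) G(4)[OF ab(2)] G(4)[OF ab(3)] s(2))
    qed
    then show ?thesis unfolding weil_group_extension[OF F E(1,2)] using dE by blast
  qed
  have disc: "\<sigma> disc_root = (if perm \<sigma> \<in> {id, cyc3, cyc3 \<circ> cyc3} then disc_root else - disc_root)"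
    if "\<sigma> \<in> carrier (weil_group F)" for \<sigma>
    using galois_disc_root[OF weil_galois[OF that]] .
  have W_even: "perm \<sigma> \<in> {id, cyc3, cyc3 \<circ> cyc3}" if "\<sigma> \<in> carrier (weil_group E)" for \<sigma>
    using that disc[of \<sigma>] neg W by (metis (lifting) mem_Collect_eq)
  have odd: "\<sigma> disc_root = - disc_root" if "\<sigma> \<in> carrier (weil_group F)" "\<sigma> \<notin> carrier (weil_group E)" for \<sigma>
    using that disc[of \<sigma>] W by (metis (lifting) mem_Collect_eq)
  have R: "R \<in> hom (weil_group F) GL" using r(1) by (simp add: weil_rep_def)
  obtain \<theta> l where ind: "iso_to_induced (weil_group F) (weil_group E) \<theta> R"
    and \<theta>: "\<And>k. \<theta> k = (\<Sum>i\<in>UNIV. l $ i * (R k *v v) $ i)"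
    and eig: "\<And>k. k \<in> carrier (weil_group E) \<Longrightarrow> R k *v v = \<theta> k *s v"
  proof (rule induced_from_index_2[OF weil_group r(2) weil_extension_subgroup[OF E(1,2)] _ t(1) _ v(1)])
    show "t \<notin> carrier (weil_group E)" using t(2) W_even by blast
    show "\<sigma> \<otimes>\<^bsub>weil_group F\<^esub> \<tau> \<in> carrier (weil_group E)"
      if st: "\<sigma> \<in> carrier (weil_group F)" "\<tau> \<in> carrier (weil_group F)" "\<sigma> \<notin> carrier (weil_group E)" "\<tau> \<notin> carrier (weil_group E)" for \<sigma> \<tau>
      using odd[OF st(1,3)] odd[OF st(2,4)] weil_compose[OF st(1,2)] galoisD(7)[OF weil_galois[OF st(1)]]
      by (simp add: W weil_ops)
    show "\<exists>c. R k *v v = c *s v" if k: "k \<in> carrier (weil_group E)" for k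
    proof -
      have "v = 1 *s v" by simp
      then have "v \<in> U" unfolding v(2) by blast
      then have "R k *v v \<in> U" using U(2)[of k v] W_even[OF k] k W by blast
      then show ?thesis unfolding v(2) by blast
    qed
    fix \<theta> and l :: "complex ^ 2"
    assume a: "iso_to_induced (weil_group F) (weil_group E) \<theta> R"
      "\<And>k. \<theta> k = (\<Sum>i\<in>UNIV. l $ i * (R k *v v) $ i)"
      "\<And>k. k \<in> carrier (weil_group E) \<Longrightarrow> R k *v v = \<theta> k *s v"
    show thesis by (rule that[OF a])
  qed
  have "quasicharacter E \<theta>"
    unfolding E.quasicharacter_iff
  proof (intro conjI ballI)
    have sub: "\<sigma> \<in> carrier (weil_group F)" if "\<sigma> \<in> carrier (weil_group E)" for \<sigma> using that W by blast
    have line: "a = b" if "a *s v = b *s v" for a b using that v(1) vec.scale_right_imp_eq by blast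
    fix \<sigma> assume s: "\<sigma> \<in> carrier (weil_group E)"
    show "\<theta> \<sigma> \<noteq> 0"
    proof
      assume "\<theta> \<sigma> = 0"
      then have "R \<sigma> *v v = 0" using eig[OF s] by simp
      then have "matrix_inv (R \<sigma>) ** R \<sigma> *v v = 0" by (simp flip: matrix_vector_mul_assoc)
      then show False using matrix_inv_mult(2)[OF hom_GL(1)[OF weil_group R sub[OF s]]] v(1) by simp
    qed
    fix \<tau> assume t: "\<tau> \<in> carrier (weil_group E)"
    have "R (\<sigma> \<circ> \<tau>) *v v = R \<sigma> *v (R \<tau> *v v)"
      using hom_GL(2)[OF weil_group R sub[OF s] sub[OF t]] by (simp add: weil_ops matrix_vector_mul_assoc)
    then have "\<theta> (\<sigma> \<circ> \<tau>) *s v = (\<theta> \<sigma> * \<theta> \<tau>) *s v"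
      using eig[OF E.weil_compose[OF s t]] by (simp add: eig[OF s] eig[OF t] vec.scale mult.commute)
    then show "\<theta> (\<sigma> \<circ> \<tau>) = \<theta> \<sigma> * \<theta> \<tau>" by (rule line)
  next
    have "continuous_map (weil_topology E) euclidean (R \<circ> (\<lambda>\<sigma>. \<sigma>))"
      by (rule continuous_map_compose[OF weil_topology_inclusion[OF E(3)]]) (use r(1) in \<open>simp add: weil_rep_def\<close>)
    then have c: "continuous_map (weil_topology E) euclidean R" by (simp add: o_def)
    \<comment> \<open>\<theta> is a fixed linear functional of the matrix, so it inherits continuity
      from the restriction of \<open>R\<close>.\<close>
    have "continuous_on UNIV (\<lambda>A :: complex ^ 2 ^ 2. \<Sum>i\<in>UNIV. l $ i * (A *v v) $ i)"
      unfolding matrix_vector_mult_def by (simp, intro continuous_intros)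
    then have "continuous_map (weil_topology E) euclidean (\<lambda>\<sigma>. \<Sum>i\<in>UNIV. l $ i * (R \<sigma> *v v) $ i)"
      by (rule continuous_map_compose_continuous_on[OF c UNIV_I])
    then show "continuous_map (weil_topology E) euclidean \<theta>" using \<theta> by presburger
  qed
  then show False using r(3) ind deg unfolding primitive_rep_def by blast
qed

lemma perm_compose_weil:
  assumes "\<sigma> \<in> carrier (weil_group F)" "\<tau> \<in> carrier (weil_group F)"
  shows "perm (\<sigma> \<otimes>\<^bsub>weil_group F\<^esub> \<tau>) = perm \<sigma> \<circ> perm \<tau>"
  using galois_perm_compose[OF weil_galois[OF assms(1)] weil_galois[OF assms(2)]] by (simp add: weil_ops)

text \<open>The elements \<open>h i\<close> represent the cosets of the Weil group of \<open>L\<close>, and the rows of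
  \<open>lam\<close> are the functionals evaluating an induced function at \<open>(h i)\<inverse>\<close>.\<close>

lemma monomial_pair:
  assumes hW: "\<And>i. h i \<in> carrier (weil_group F)"
    and r1: "weil_rep F R" "irreducible_rep (weil_group F) R" "primitive_rep F R"
    and r2: "irreducible_rep (weil_group F) S" and lam: "invertible lam"
    and mono: "\<And>s i j. s \<in> carrier (weil_group F) \<Longrightarrow> the_inv (h j) \<circ> s \<circ> h i \<in> carrier (weil_group L) \<Longrightarrow> \<exists>c. lam $ j v* S s = c *s lam $ i"
  shows "monomial_pair (weil_group F) R S lam perm"
proof (rule monomial_pair.intro[OF weil_group r1(2) r2 lam])
  let ?G = "carrier (weil_group F)"
  show bij: "bij (perm \<sigma>)" if "\<sigma> \<in> ?G" for \<sigma> using galois_conj(3)[OF weil_galois[OF that]] .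
  show "\<exists>c. lam $ perm \<sigma> i v* S \<sigma> = c *s lam $ i" if s: "\<sigma> \<in> ?G" for \<sigma> i
  proof (rule mono[OF s])
    have "the_inv (h (perm \<sigma> i)) \<circ> \<sigma> \<circ> h i \<in> ?G"
      by (intro weil_compose weil_inverse hW s)
    moreover have "\<sigma> (h i \<alpha>) = h (perm \<sigma> i) \<alpha>"
      using galois_conj(2)[OF weil_galois[OF s], of i] by (simp add: conjugate_def)
    ultimately show "the_inv (h (perm \<sigma> i)) \<circ> \<sigma> \<circ> h i \<in> carrier (weil_group L)"
      unfolding weil_L by (simp add: galois_inverse(3)[OF h])
  qed
  show trans: "\<exists>\<sigma>\<in>?G. perm \<sigma> i = j" for i j
  proof (rule bexI)
    show "h j \<circ> the_inv (h i) \<in> ?G" by (intro weil_compose weil_inverse hW)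
    show "perm (h j \<circ> the_inv (h i)) i = j"
      by (rule perm_eqI) (simp add: conjugate_def galois_inverse(3)[OF h])
  qed
  have R: "R \<in> hom (weil_group F) GL" using r1(1) by (simp add: weil_rep_def)
  have "cyc3 \<in> perm ` ?G"
  proof (rule transitive_perms_cyc3)
    fix p assume "p \<in> perm ` ?G"
    then obtain \<sigma> where s: "p = perm \<sigma>" "\<sigma> \<in> ?G" by (rule imageE)
    then show "bij p" using bij by simp
    fix q assume "q \<in> perm ` ?G"
    then obtain \<tau> where t: "q = perm \<tau>" "\<tau> \<in> ?G" by (rule imageE)
    show "p \<circ> q \<in> perm ` ?G"
      using perm_compose_weil[OF s(2) t(2)] weil_compose[OF s(2) t(2)] s(1) t(1)
      by (intro image_eqI[of _ _ "\<sigma> \<circ> \<tau>"]) (simp_all add: weil_ops)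
  next
    show "\<exists>p\<in>perm ` ?G. p i = j" for i j using trans[of i j] by (elim bexE) (rule bexI[OF _ imageI])
  qed
  then obtain c where c: "c \<in> ?G" "perm c = cyc3" by (metis imageE)
  show "U = {0} \<or> U = UNIV" if U: "vec.subspace U" "\<And>\<sigma> v. \<sigma> \<in> ?G \<Longrightarrow> perm \<sigma> = id \<Longrightarrow> v \<in> U \<Longrightarrow> R \<sigma> *v v \<in> U" for U
  proof (rule irreducible_on_index_3[where \<pi> = perm, OF weil_group R perm_compose_weil c _ U(1)])
    show "V = {0} \<or> V = UNIV" if V: "vec.subspace V" "\<And>\<sigma> v. \<sigma> \<in> ?G \<Longrightarrow> perm \<sigma> \<in> {id, cyc3, cyc3 \<circ> cyc3} \<Longrightarrow> v \<in> V \<Longrightarrow> R \<sigma> *v v \<in> V" for V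
      using V by (rule primitive_irreducible_even[OF r1])
  qed (assumption, assumption, rule U(2))
qed

end

lemma rep_iso_twist:
  fixes S :: "'g \<Rightarrow> complex ^ 'n ^ 'n"
  shows "rep_iso G S (twist \<eta> A) \<longleftrightarrow>
    (\<exists>P. invertible P \<and> (\<forall>g\<in>carrier G. P ** S g = mat (\<eta> g) ** A g ** P))"
  unfolding rep_iso_def twist_eq invertible_def by blast

text \<open>The witness \<open>\<phi>\<close> is the standard representation on the sum-zero plane,
  pulled back through the action on the conjugates. It is fixed before \<eta> and serves every
  \<eta>.\<close>

theorem theorem1:
  fixes F L :: "qbar set"
    and \<rho>1 :: "(qbar \<Rightarrow> qbar) \<Rightarrow> complex ^ 2 ^ 2"
    and \<rho>2 :: "(qbar \<Rightarrow> qbar) \<Rightarrow> complex ^ 3 ^ 3"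
    and \<theta> :: "(qbar \<Rightarrow> qbar) \<Rightarrow> complex"
  assumes F: "finite_extension Q2 F"
    and rho1: "weil_rep F \<rho>1" "irreducible_rep (weil_group F) \<rho>1" "primitive_rep F \<rho>1"
    and rho2: "weil_rep F \<rho>2" "irreducible_rep (weil_group F) \<rho>2"
    and L: "extension_of_degree 3 F L" "\<not> cyclic_extension F L"
    and theta: "quasicharacter L \<theta>"
    and induced: "iso_to_induced (weil_group F) (weil_group L) \<theta> \<rho>2"
    and untwisted: "\<And>\<eta>. \<lbrakk>quasicharacter F \<eta>; unramified F \<eta>; \<exists>\<sigma> \<in> carrier (weil_group F). \<eta> \<sigma> \<noteq> 1\<rbrakk>
      \<Longrightarrow> \<not> rep_iso (weil_group F) \<rho>2 (twist \<eta> \<rho>2)"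
  shows "(reducible_rep (weil_group F) (tensor_rep \<rho>1 \<rho>2) \<longleftrightarrow>
      (\<exists>\<eta>. quasicharacter F \<eta> \<and> rep_iso (weil_group F) \<rho>2 (twist \<eta> (Ad0 \<rho>1)))) \<and>
    galois_group (normal_closure F L) F \<cong> sym_group 3 \<and>
      (\<exists>\<phi> :: (qbar \<Rightarrow> qbar) \<Rightarrow> complex ^ 2 ^ 2.
        irreducible_rep (galois_group (normal_closure F L) F) \<phi> \<and>
        (\<forall>\<phi>' :: (qbar \<Rightarrow> qbar) \<Rightarrow> complex ^ 2 ^ 2.
           irreducible_rep (galois_group (normal_closure F L) F) \<phi>' \<longrightarrow>
           rep_iso (galois_group (normal_closure F L) F) \<phi>' \<phi>) \<and>
        (\<forall>\<eta>. quasicharacter F \<eta> \<and> rep_iso (weil_group F) \<rho>2 (twist \<eta> (Ad0 \<rho>1)) \<longrightarrow>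
           rep_iso (weil_group F) (tensor_rep \<rho>1 \<rho>2)
             (sum_rep (twist \<eta> \<rho>1)
               (tensor_rep (twist \<eta> \<rho>1) (inflate (normal_closure F L) \<phi>)))))"
proof -
  let ?W = "weil_group F"
  interpret weil_setting F by (rule weil_setting.intro[OF finite_extension_subfields[OF F]])
  note Ff = weil_setting.F[OF weil_setting_axioms]
  interpret W: group ?W by (rule weil_group)
  have L': "subfield L QBar" "F \<subseteq> L" using L(1) by (auto simp: extension_of_degree_def)
  interpret L: weil_setting L by (rule weil_setting.intro) (use Ff L' in auto)
  have "L \<noteq> F" using extension_of_degree_unique[OF L(1)] extension_of_degree_1[OF Ff(1)] by force
  then obtain \<alpha> where \<alpha>: "\<alpha> \<in> L" "\<alpha> \<notin> F" using L'(2) by blast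
  obtain r :: "3 \<Rightarrow> qbar \<Rightarrow> qbar" and lam :: "complex ^ 3 ^ 3" where
    r: "\<And>i. r i \<in> carrier ?W" and r_inj: "\<And>i j. r i \<otimes>\<^bsub>?W\<^esub> inv\<^bsub>?W\<^esub> (r j) \<in> carrier (weil_group L) \<Longrightarrow> i = j"
    and lam: "invertible lam"
    and mono: "\<And>s i j. s \<in> carrier ?W \<Longrightarrow> r j \<otimes>\<^bsub>?W\<^esub> s \<otimes>\<^bsub>?W\<^esub> inv\<^bsub>?W\<^esub> (r i) \<in> carrier (weil_group L)
      \<Longrightarrow> \<exists>c. lam $ j v* \<rho>2 s = c *s lam $ i"
  proof (rule induced_cosets[OF weil_group weil_extension_subgroup[OF L'] _ _ induced])
    show "\<theta> k \<noteq> 0" if "k \<in> carrier (weil_group L)" for k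
      using theta that unfolding L.quasicharacter_iff by blast
    show "\<theta> (k \<otimes>\<^bsub>?W\<^esub> k') = \<theta> k * \<theta> k'" if "k \<in> carrier (weil_group L)" "k' \<in> carrier (weil_group L)" for k k'
      using theta that unfolding L.quasicharacter_iff weil_ops by blast
    fix r :: "3 \<Rightarrow> qbar \<Rightarrow> qbar" and lam :: "complex ^ 3 ^ 3"
    assume a: "\<And>i. r i \<in> carrier ?W"
      "\<And>i j. r i \<otimes>\<^bsub>?W\<^esub> inv\<^bsub>?W\<^esub> (r j) \<in> carrier (weil_group L) \<Longrightarrow> i = j" "invertible lam"
      "\<And>s i j. s \<in> carrier ?W \<Longrightarrow> r j \<otimes>\<^bsub>?W\<^esub> s \<otimes>\<^bsub>?W\<^esub> inv\<^bsub>?W\<^esub> (r i) \<in> carrier (weil_group L)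
        \<Longrightarrow> \<exists>c. lam $ j v* \<rho>2 s = c *s lam $ i"
    show thesis by (rule that[OF a])
  qed
  \<comment> \<open>The \<open>r i\<close> represent right cosets of the Weil group of
    \<open>L\<close>; their inverses represent left cosets, on each of which the image of \<alpha>
    is constant.\<close>
  define h where "h i = the_inv (r i)" for i
  have hW: "h i \<in> carrier ?W" "h i \<in> carrier (galois_group UNIV F)" for i
    using weil_inverse[OF r] weil_galois unfolding h_def by blast+
  have hh: "the_inv (h i) = r i" for i
    using galois_inverse(2,3)[OF weil_galois[OF r]] galois_inverse(2)[OF hW(2), of i]
    unfolding h_def by (metis ext)
  have inv_r: "inv\<^bsub>?W\<^esub> (r i) = h i" for i using weil_inv[OF r] by (simp add: h_def)
  have rh: "r i (h i x) = x" for i x using galois_inverse(2)[OF weil_galois[OF r]] by (simp add: h_def)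
  have L_gen: "L = {poly p \<alpha> |p. poly_over F p}" using cubic_generated(1)[OF Ff L(1) \<alpha>] .
  note noncyclic = L(2)
  interpret cubic_setting F L \<alpha> h
  proof
    \<comment> \<open>If two conjugates agree, \<open>r i \<circ> h j\<close> fixes \<alpha>, hence
      all of \<open>L\<close>, and so lies in the Weil group of \<open>L\<close>.\<close>
    show "i = j" if eq: "h i \<alpha> = h j \<alpha>" for i j
    proof (rule r_inj)
      have W: "r i \<circ> h j \<in> carrier ?W" using weil_compose[OF r hW(1)] .
      have "(r i \<circ> h j) x = x" if "x \<in> L" for x
      proof -
        obtain p where p: "poly_over F p" "x = poly p \<alpha>" using \<open>x \<in> L\<close> L_gen by blast
        then show ?thesis using galois_poly[OF weil_galois[OF W] p(1), of \<alpha>] rh by (simp flip: eq)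
      qed
      then show "r i \<otimes>\<^bsub>?W\<^esub> inv\<^bsub>?W\<^esub> (r j) \<in> carrier (weil_group L)"
        unfolding weil_group_extension[OF Ff L'] using W by (simp add: inv_r weil_ops)
    qed
  qed (use L(1) \<alpha> hW(2) in auto)
  have mono': "\<exists>c. lam $ j v* \<rho>2 s = c *s lam $ i"
    if "s \<in> carrier ?W" "the_inv (h j) \<circ> s \<circ> h i \<in> carrier (weil_group L)" for s i j
    using mono[OF that(1), of j i] that(2) by (simp add: hh inv_r weil_ops)
  interpret M: monomial_pair ?W \<rho>1 \<rho>2 lam perm
    by (rule monomial_pair[OF hW(1) rho1 rho2(2) lam mono'])
  interpret S3: S3_group "galois_group K F" perm by (rule normal_closure_S3[OF noncyclic])
  define \<phi> where "\<phi> \<tau> = std_rep (perm \<tau>)" for \<tau>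
  have hom: "tensor_rep \<rho>1 \<rho>2 \<in> hom ?W GL" using tensor_rep_hom[OF weil_group M.hom] .
  have decomp: "rep_iso ?W (tensor_rep \<rho>1 \<rho>2) (sum_rep (twist \<eta> \<rho>1) (tensor_rep (twist \<eta> \<rho>1) (inflate K \<phi>)))"
    if \<eta>: "quasicharacter F \<eta>" "rep_iso ?W \<rho>2 (twist \<eta> (Ad0 \<rho>1))" for \<eta>
  proof -
    obtain P where P: "invertible P" "\<And>g. g \<in> carrier ?W \<Longrightarrow> P ** \<rho>2 g = mat (\<eta> g) ** Ad0 \<rho>1 g ** P"
      using \<eta>(2) unfolding rep_iso_twist by blast
    show ?thesis
    proof (rule M.tensor_decomposition[OF P])
      show "\<eta> g \<noteq> 0" if "g \<in> carrier ?W" for g using \<eta>(1) that unfolding quasicharacter_iff by blast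
      show "inflate K \<phi> g = std_rep (perm g)" for g by (simp add: inflate_def \<phi>_def perm_restrict)
    qed
  qed
  have "\<exists>\<eta>. quasicharacter F \<eta> \<and> rep_iso ?W \<rho>2 (twist \<eta> (Ad0 \<rho>1))" if red: "reducible_rep ?W (tensor_rep \<rho>1 \<rho>2)"
  proof -
    obtain Y where Y: "vec.subspace Y" "Y \<noteq> {0}" "Y \<noteq> UNIV"
      "\<And>g x. g \<in> carrier ?W \<Longrightarrow> x \<in> Y \<Longrightarrow> tensor_rep \<rho>1 \<rho>2 g *v x \<in> Y"
      using red hom unfolding reducible_rep_def irreducible_rep_def by blast
    obtain P \<kappa> where P: "invertible P" and k: "\<And>g. g \<in> carrier ?W \<Longrightarrow> P ** \<rho>2 g = mat (\<kappa> g) ** Ad0 \<rho>1 g ** P"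
      "\<And>g. g \<in> carrier ?W \<Longrightarrow> \<kappa> g \<noteq> 0"
      using M.reducible_imp_twist_equivalent[OF Y] unfolding twist_equivalent_def by blast
    have c: "continuous_map (weil_topology F) euclidean \<rho>1" "continuous_map (weil_topology F) euclidean \<rho>2"
      using rho1(1) rho2(1) by (simp_all add: weil_rep_def)
    have "\<kappa> (\<sigma> \<circ> \<tau>) = \<kappa> \<sigma> * \<kappa> \<tau>" if "\<sigma> \<in> carrier ?W" "\<tau> \<in> carrier ?W" for \<sigma> \<tau>
      using twist_character(1)[OF weil_group M.hom P k(1) that] by (simp add: weil_ops)
    moreover have "continuous_map (weil_topology F) euclidean \<kappa>"
      by (rule twist_character_continuous[OF weil_group M.hom P k(1) topspace_weil c])
    ultimately have "quasicharacter F \<kappa>" unfolding quasicharacter_iff using k(2) by blast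
    moreover have "rep_iso ?W \<rho>2 (twist \<kappa> (Ad0 \<rho>1))" unfolding rep_iso_twist using P k(1) by blast
    ultimately show ?thesis by blast
  qed
  moreover have "reducible_rep ?W (tensor_rep \<rho>1 \<rho>2)"
    if "\<exists>\<eta>. quasicharacter F \<eta> \<and> rep_iso ?W \<rho>2 (twist \<eta> (Ad0 \<rho>1))"
    using sum_rep_reducible[OF hom] decomp that by blast
  moreover have "irreducible_rep (galois_group K F) \<phi>"
    unfolding \<phi>_def by (rule S3.std_rep_irreducible)
  ultimately show ?thesis
    using S3.iso_sym_group S3.two_dim_irreducible_unique decomp by blast
qed

end
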